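(* Let $f=\sum_{n=0}^\infty a_nY_n$ on $\mathbb{S}^2$, where $Y_n(\theta,\phi)=\sqrt{2n+1}\,P_n(\cos\theta)$ are the zonal harmonics. Suppose that for some $1<p<2$ and some constant $C$, $$|a_n|\le \frac{C}{n^p},\qquad |a_n-a_{n-1}|\le\frac{C}{n^{p+1}}\qquad\text{for all } n\ge1.$$ Let $u$ be the solution of $iu_t+\Delta_{\mathbb{S}^2}u=0$, $u(\cdot,0)=f$. Then for almost every $t$, $u(\cdot,t)\in C^{\gamma'}(\mathbb{S}^2)$ for every $0<\gamma'<p-1$, and hence $\dim_t(f)\le 4-p$. If, in addition, $f\notin H^{p-\frac12+\epsilon}(\mathbb{S}^2)$ for every $\epsilon>0$, then for almost every $t$, $\dim_t(f)\ge\max\left(\frac72-p,\,2\right)$.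
   Context: $\theta\in[0,\pi]$ is the angle from the north pole, $\phi\in[0,2\pi)$ the other spherical coordinate, $P_n$ is the Legendre polynomial of degree $n$. $\Delta_{\mathbb S^2}$ is the Laplace–Beltrami operator, so $\Delta_{\mathbb S^2} Y_n=-n(n+1)Y_n$. $H^r(\mathbb{S}^2)$ has norm $\big(\sum_n\langle n\rangle^{2r}\|\mathrm{proj}_nf\|_{L^2}^2\big)^{1/2}$ with $\mathrm{proj}_n$ the projection onto spherical harmonics of degree $n$ and $\langle n\rangle=(1+n^2)^{1/2}$. The fractal (upper Minkowski) dimension of a bounded set $E$ is $\limsup_{\epsilon\to0}\frac{\log\mathcal N(E,\epsilon)}{\log(1/\epsilon)}$, where $\mathcal N(E,\epsilon)$ is the minimum number of boxes of sidelength $\epsilon$ needed to cover $E$. $\dim_t(f)$ denotes the maximum of the fractal dimensions of the graphs of the real and imaginary parts of $u(\cdot,t)$. $C^{\gamma'}$ is the Hölder space. *)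

theory Defs
  imports "HOL-Analysis.Analysis" "HOL-Computational_Algebra.Polynomial"
begin

text \<open>
  The sphere is \<open>sphere 0 1\<close> in \<open>real^3\<close>, with the polar axis along the third coordinate, so that
  \<open>cos \<theta> = x $ 3\<close>.  Functions on the sphere are functions on \<open>real^3\<close> of which only the values on
  the sphere matter; elements of \<open>L\<^sup>2\<close> are given by Borel representatives.
\<close>

abbreviation S2 :: "(real^3) set" where
  "S2 \<equiv> sphere 0 1"

definition spherical_coords :: "real \<times> real \<Rightarrow> real^3" where
  "spherical_coords = (\<lambda>(\<theta>, \<phi>). vector [sin \<theta> * cos \<phi>, sin \<theta> * sin \<phi>, cos \<theta>])"

text \<open>Surface measure: the image of \<open>sin \<theta> d\<theta> d\<phi>\<close> (total mass \<open>4 * pi\<close>).\<close>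

definition sphere_measure :: "(real^3) measure" where
  "sphere_measure =
     distr
       (density (restrict_space lborel ({0..pi} \<times> {0..<2 * pi})) (\<lambda>(\<theta>, \<phi>). ennreal (sin \<theta>)))
       (restrict_space borel S2)
       spherical_coords"

definition L2_sphere :: "(real^3 \<Rightarrow> complex) set" where
  "L2_sphere = {f. f \<in> borel_measurable sphere_measure \<and>
                   integrable sphere_measure (\<lambda>x. (norm (f x))\<^sup>2)}"

definition L2_norm :: "(real^3 \<Rightarrow> complex) \<Rightarrow> real" where
  "L2_norm f = sqrt (integral\<^sup>L sphere_measure (\<lambda>x. (norm (f x))\<^sup>2))"

text \<open>Rodrigues' formula.\<close>

definition legendre_poly :: "nat \<Rightarrow> real poly" where
  "legendre_poly n = smult (1 / (2 ^ n * fact n)) ((pderiv ^^ n) ([:-1, 0, 1:] ^ n))"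

definition zonal_harmonic :: "nat \<Rightarrow> real^3 \<Rightarrow> complex" where
  "zonal_harmonic n x = complex_of_real (sqrt (2 * real n + 1) * poly (legendre_poly n) (x $ 3))"

text \<open>\<open>f = (\<Sum>n. a n * Y n)\<close> with convergence in \<open>L\<^sup>2\<close>.\<close>

definition zonal_expansion :: "(nat \<Rightarrow> complex) \<Rightarrow> (real^3 \<Rightarrow> complex) \<Rightarrow> bool" where
  "zonal_expansion a f \<longleftrightarrow> f \<in> L2_sphere \<and>
     (\<lambda>N. L2_norm (\<lambda>x. f x - (\<Sum>n<N. a n * zonal_harmonic n x))) \<longlonglongrightarrow> 0"

definition laplacian :: "('a::euclidean_space \<Rightarrow> 'b::real_normed_vector) \<Rightarrow> 'a \<Rightarrow> 'b" where
  "laplacian F x =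
     (\<Sum>b\<in>Basis. frechet_derivative (\<lambda>y. frechet_derivative F (at y) b) (at x) b)"

text \<open>\<open>k\<close> times continuously differentiable on an open set \<open>U\<close>.\<close>

primrec Ck_on :: "nat \<Rightarrow> 'a set \<Rightarrow> ('a::euclidean_space \<Rightarrow> 'b::real_normed_vector) \<Rightarrow> bool" where
  "Ck_on 0 U F \<longleftrightarrow> continuous_on U F"
| "Ck_on (Suc k) U F \<longleftrightarrow> (\<forall>x\<in>U. F differentiable (at x)) \<and>
     (\<forall>b\<in>Basis. Ck_on k U (\<lambda>x. frechet_derivative F (at x) b))"

definition radial_extension :: "(real^3 \<Rightarrow> 'b) \<Rightarrow> real^3 \<Rightarrow> 'b" where
  "radial_extension \<psi> y = \<psi> (y /\<^sub>R norm y)"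

definition smooth_sphere :: "(real^3 \<Rightarrow> complex) \<Rightarrow> bool" where
  "smooth_sphere \<psi> \<longleftrightarrow> (\<forall>k. Ck_on k (UNIV - {0}) (radial_extension \<psi>))"

text \<open>
  In polar coordinates the Euclidean Laplacian is
  \<open>\<partial>\<^sub>r\<^sub>r + (2 / r) \<partial>\<^sub>r + (1 / r\<^sup>2) \<Delta>\<close> with \<open>\<Delta>\<close> the Laplace--Beltrami operator of the unit sphere; so on
  the sphere it agrees with \<open>\<Delta> \<psi>\<close> when applied to the extension of \<open>\<psi>\<close> that is constant along rays.
\<close>

definition laplace_beltrami :: "(real^3 \<Rightarrow> complex) \<Rightarrow> real^3 \<Rightarrow> complex" where
  "laplace_beltrami \<psi> = laplacian (radial_extension \<psi>)"

text \<open>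
  \<open>u\<close> is a solution in \<open>C(\<real>; L\<^sup>2)\<close> of \<open>i u\<^sub>t + \<Delta> u = 0\<close>, \<open>u(0) = f\<close>.  The data considered need not
  lie in the domain of \<open>\<Delta>\<close>, so the equation is understood in the distributional sense:
  \<open>d/dt (\<integral> u(t) \<psi>) = i (\<integral> u(t) \<Delta>\<psi>)\<close> for all smooth \<open>\<psi>\<close>.
\<close>

definition schrodinger_solution ::
    "(real^3 \<Rightarrow> complex) \<Rightarrow> (real \<Rightarrow> real^3 \<Rightarrow> complex) \<Rightarrow> bool" where
  "schrodinger_solution f u \<longleftrightarrow>
     (\<forall>t. u t \<in> L2_sphere) \<and>
     (\<forall>t. ((\<lambda>s. L2_norm (\<lambda>x. u s x - u t x)) \<longlongrightarrow> 0) (at t)) \<and>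
     (AE x in sphere_measure. u 0 x = f x) \<and>
     (\<forall>\<psi>. smooth_sphere \<psi> \<longrightarrow>
        (\<forall>t. ((\<lambda>s. integral\<^sup>L sphere_measure (\<lambda>x. u s x * \<psi> x)) has_vector_derivative
               \<i> * integral\<^sup>L sphere_measure (\<lambda>x. u t x * laplace_beltrami \<psi> x)) (at t)))"

text \<open>
  Spherical harmonics of degree \<open>n\<close>, represented by the homogeneous harmonic polynomials whose
  restrictions to the sphere they are.
\<close>

definition spherical_harmonics :: "nat \<Rightarrow> (real^3 \<Rightarrow> complex) set" where
  "spherical_harmonics n = {h. polynomial_function h \<and>
     (\<forall>r x. h (r *\<^sub>R x) = r ^ n *\<^sub>R h x) \<and> (\<forall>x. laplacian h x = 0)}"

definition harmonic_proj :: "nat \<Rightarrow> (real^3 \<Rightarrow> complex) \<Rightarrow> real^3 \<Rightarrow> complex" where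
  "harmonic_proj n f = (SOME g. g \<in> spherical_harmonics n \<and>
     (\<forall>h\<in>spherical_harmonics n. integral\<^sup>L sphere_measure (\<lambda>x. (f x - g x) * cnj (h x)) = 0))"

text \<open>The Sobolev space of order \<open>r\<close>; only meant for \<open>r \<ge> 0\<close>, where it is a subspace of \<open>L\<^sup>2\<close>.\<close>

definition sobolev_sphere :: "real \<Rightarrow> (real^3 \<Rightarrow> complex) set" where
  "sobolev_sphere r = {f. f \<in> L2_sphere \<and>
     summable (\<lambda>n. sqrt (1 + (real n)\<^sup>2) powr (2 * r) * (L2_norm (harmonic_proj n f))\<^sup>2)}"

definition continuous_version :: "(real^3 \<Rightarrow> complex) \<Rightarrow> (real^3 \<Rightarrow> complex) \<Rightarrow> bool" where
  "continuous_version v g \<longleftrightarrow> continuous_on S2 g \<and> (AE x in sphere_measure. v x = g x)"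

text \<open>For \<open>0 < \<gamma> < 1\<close>; the chordal distance is comparable to the geodesic one.\<close>

definition holder_sphere :: "real \<Rightarrow> (real^3 \<Rightarrow> complex) set" where
  "holder_sphere \<gamma> = {g. \<exists>M. \<forall>x\<in>S2. \<forall>y\<in>S2. norm (g x - g y) \<le> M * dist x y powr \<gamma>}"

text \<open>A set \<open>K\<close> of corners stands for the boxes \<open>cbox c (c + \<epsilon> *\<^sub>R One)\<close> of side length \<open>\<epsilon>\<close>.\<close>

definition box_number :: "'a::euclidean_space set \<Rightarrow> real \<Rightarrow> nat" where
  "box_number E \<epsilon> =
     (LEAST k. \<exists>K. finite K \<and> card K = k \<and> E \<subseteq> (\<Union>c\<in>K. cbox c (c + \<epsilon> *\<^sub>R One)))"

definition fractal_dim :: "'a::euclidean_space set \<Rightarrow> ereal" where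
  "fractal_dim E = Limsup (at_right 0) (\<lambda>\<epsilon>. ereal (ln (real (box_number E \<epsilon>)) / ln (1 / \<epsilon>)))"

definition graph_S2 :: "(real^3 \<Rightarrow> real) \<Rightarrow> ((real^3) \<times> real) set" where
  "graph_S2 h = (\<lambda>x. (x, h x)) ` S2"

definition graph_dim :: "(real^3 \<Rightarrow> complex) \<Rightarrow> ereal" where
  "graph_dim g = max (fractal_dim (graph_S2 (\<lambda>x. Re (g x)))) (fractal_dim (graph_S2 (\<lambda>x. Im (g x))))"

end

theory Submission
  imports Defs
begin

text \<open>
  For almost every \<open>t\<close> the Weyl sums with phase \<open>t * n * (n + 1) + \<alpha> * n\<close> have square root cancellation
  up to \<open>\<epsilon>\<close>-losses, uniformly in \<open>\<alpha>\<close>.  Inserting this into integral representations of \<open>P\<^sub>n\<close> and summing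
  by parts, the dyadic block of the solution at frequency \<open>N\<close> is
  \<open>O (N powr (1 - p + \<epsilon>) * min 1 ((N * sin \<theta>) powr (- 1/2)))\<close>, and its \<open>\<theta>\<close>-derivative is larger by at most
  a factor \<open>N\<close>.  Hence the solution is a zonal function \<open>G \<theta>\<close> which is Hoelder continuous of every order
  below \<open>p - 1\<close>, and of every order below \<open>p - 1/2\<close> with constant \<open>O ((sin \<theta>) powr (- 1/2))\<close>; the first
  property bounds the dimension of the graphs from above.

  For the lower bound, the assumption on \<open>f\<close> provides blocks \<open>B\<close> with squared norm at least
  \<open>N powr (1 - 2 * p - \<epsilon>)\<close>.  This squared norm is the integral of \<open>G * cnj B * sin \<theta>\<close>, and \<open>cnj B * sin \<theta>\<close>
  is a derivative \<open>H'\<close> with \<open>H = O (N powr (- 1/2 - p + \<epsilon>) * sqrt (sin \<theta>))\<close>, so it is at most the sum over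
  rings of width \<open>pi / N\<close> of the oscillation of \<open>G\<close> times the size of \<open>H\<close>.  Since \<open>G\<close> does not depend on
  the longitude, a cover of the graphs by boxes of side \<open>pi / N\<close> bounds the sum of the oscillations by
  \<open>N powr (d - 2 + \<epsilon>)\<close>, up to the rings near the poles, when \<open>d\<close> exceeds the dimensions of the graphs.
  Comparing exponents gives \<open>d \<ge> 7/2 - p\<close>.
\<close>

section \<open>Legendre polynomials\<close>

text \<open>No asymptotic expansion of P_n is used. Both integral representations write P_n (cos
  \<theta>) as a superposition of powers z^n with |z| \<le> 1. The angle of z is a linear phase,
  harmless because the Weyl bound is uniform in \<alpha>; the modulus is a monotone weight, harmless
  for summation by parts. Laplace's integral gives bounds up to the poles, the ray integral adds the
  decay away from them.

  The obstacle in the lower bound is the poles. At distance \<epsilon> only about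
  \<open>sin \<theta> / \<epsilon>\<close> meridians can be told apart, so boxes see little of the
  oscillation there. Rings with \<open>sin \<theta>\<close> below
  \<open>N powr (-5 * \<eta>)\<close> are left to the weighted modulus of continuity: they are few
  enough to gain 5\<eta> in the exponent, more than the 2\<eta> lost in the estimates. For p \<ge>
  3/2 the claim reduces to the bound 2, valid for every continuous function.

  The solution is only assumed to satisfy the weak equation. Its moments against polynomials solve
  linear differential equations, which determine it almost everywhere; that it is zonal is a
  consequence.\<close>

lemma real_poly_eqI: "(\<And>x. poly p x = poly q x) \<Longrightarrow> p = (q :: real poly)"
  by (simp add: poly_eq_poly_eq_iff[symmetric] ext)

text \<open>Leibniz' rule for a product with the linear factor \<open>[:0, 1:]\<close> stops after
  two terms. The form with \<open>Suc n\<close> avoids a truncated index in the lower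
  derivative.\<close>

lemma pderiv_funpow_mult_X:
  "(pderiv ^^ Suc n) ([:0, 1:] * (p :: real poly)) =
     [:0, 1:] * (pderiv ^^ Suc n) p + smult (real (Suc n)) ((pderiv ^^ n) p)"
proof (induction n)
  case 0
  show ?case by (simp add: pderiv_mult pderiv_pCons)
next
  case (Suc n)
  have "(pderiv ^^ Suc (Suc n)) ([:0, 1:] * p) = pderiv ((pderiv ^^ Suc n) ([:0, 1:] * p))"
    by simp
  also have "\<dots> = pderiv ([:0, 1:] * (pderiv ^^ Suc n) p + smult (real (Suc n)) ((pderiv ^^ n) p))"
    by (simp only: Suc.IH)
  also have "\<dots> = [:0, 1:] * (pderiv ^^ Suc (Suc n)) p + smult (real (Suc (Suc n))) ((pderiv ^^ Suc n) p)"
    by (rule real_poly_eqI)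
      (simp add: pderiv_add pderiv_mult pderiv_smult pderiv_pCons algebra_simps del: mult_pCons_left)
  finally show ?case .
qed

abbreviation quadX :: "real poly" where "quadX \<equiv> [:-1, 0, 1:]"

lemma pderiv_quadX_power: "pderiv (quadX ^ Suc n) = smult (2 * real (Suc n)) ([:0, 1:] * quadX ^ n)"
proof -
  have "pderiv quadX = smult 2 [:0, 1:]" by (simp add: pderiv_pCons)
  then show ?thesis
    by (simp only: pderiv_power_Suc, intro real_poly_eqI) (simp add: algebra_simps)
qed

text \<open>Rodrigues' formula with one derivative fewer, hence an antiderivative of the Legendre
  polynomial when \<open>n \<ge> 1\<close>. It is the quantity eliminated between the two
  expressions for \<open>legendre_poly (Suc n)\<close> below.\<close>

definition legendre_primitive :: "nat \<Rightarrow> real poly" where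
  "legendre_primitive n = smult (1 / (2 ^ n * fact n)) ((pderiv ^^ (n - 1)) (quadX ^ n))"

text \<open>One derivative of \<open>quadX ^ Suc n\<close> produces a factor
  \<open>[:0, 1:]\<close>, and Leibniz' rule moves the remaining \<open>n\<close> derivatives past
  it.\<close>

lemma legendre_Suc_eq1:
  assumes "n \<ge> 1"
  shows "legendre_poly (Suc n) = [:0, 1:] * legendre_poly n + smult (real n) (legendre_primitive n)"
proof -
  obtain m where m: "n = Suc m" using assms by (cases n) auto
  have "(pderiv ^^ Suc n) (quadX ^ Suc n) = (pderiv ^^ n) (pderiv (quadX ^ Suc n))"
    by (simp only: funpow_Suc_right o_apply)
  also have "\<dots> = smult (2 * real (Suc n)) ((pderiv ^^ n) ([:0, 1:] * quadX ^ n))"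
    by (simp only: pderiv_quadX_power higher_pderiv_smult)
  also have "(pderiv ^^ n) ([:0, 1:] * quadX ^ n) =
      [:0, 1:] * (pderiv ^^ n) (quadX ^ n) + smult (real n) ((pderiv ^^ (n - 1)) (quadX ^ n))"
    unfolding m by (simp only: pderiv_funpow_mult_X diff_Suc_1)
  finally have "legendre_poly (Suc n) = smult (2 * real (Suc n) / (2 ^ Suc n * fact (Suc n)))
      ([:0, 1:] * (pderiv ^^ n) (quadX ^ n) + smult (real n) ((pderiv ^^ (n - 1)) (quadX ^ n)))"
    by (simp only: legendre_poly_def smult_smult) (simp del: mult_pCons_left power_Suc fact_Suc)
  moreover have "2 * real (Suc n) / (2 ^ Suc n * fact (Suc n)) = 1 / (2 ^ n * fact n)"
    by (simp add: field_simps del: of_nat_Suc)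
  ultimately show ?thesis
    unfolding legendre_poly_def[of n] legendre_primitive_def
    by (intro real_poly_eqI) (simp add: algebra_simps del: mult_pCons_left power_Suc fact_Suc)
qed

lemma pderiv2_quadX_power:
  assumes "n \<ge> 1"
  shows "pderiv (pderiv (quadX ^ Suc n)) =
    smult (2 * real (Suc n)) (smult (2 * real n + 1) (quadX ^ n) + smult (2 * real n) (quadX ^ (n - 1)))"
proof -
  obtain m where m: "n = Suc m" using assms by (cases n) auto
  have X2: "[:0, 1:] * [:0, 1:] = quadX + [:1:]" by simp
  have "pderiv ([:0, 1:] * quadX ^ n) = quadX ^ n + [:0,1:] * smult (2 * real n) ([:0, 1:] * quadX ^ m)"
    unfolding m by (simp only: pderiv_mult pderiv_quadX_power) (simp add: pderiv_pCons del: mult_pCons_left power_Suc)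
  also have "\<dots> = quadX ^ n + smult (2 * real n) (([:0, 1:] * [:0,1:]) * quadX ^ m)"
    by (simp only: mult_smult_right mult.assoc)
  also have "\<dots> = smult (2 * real n + 1) (quadX ^ n) + smult (2 * real n) (quadX ^ (n - 1))"
    unfolding X2 m by (intro real_poly_eqI) (simp add: algebra_simps)
  finally show ?thesis
    by (simp only: pderiv_quadX_power pderiv_smult)
qed

text \<open>Here two derivatives are taken at once; the square of \<open>[:0, 1:]\<close> that
  appears is rewritten as \<open>quadX + [:1:]\<close>, so that only powers of \<open>quadX\<close>
  are left.\<close>

lemma legendre_Suc_eq2:
  assumes "n \<ge> 1"
  shows "legendre_poly (Suc n) = smult (2 * real n + 1) (legendre_primitive n) + legendre_poly (n - 1)"
proof -
  obtain m where m: "n = Suc m" using assms by (cases n) auto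
  have "(pderiv ^^ Suc n) (quadX ^ Suc n) = (pderiv ^^ m) (pderiv (pderiv (quadX ^ Suc n)))"
    unfolding m by (simp only: funpow_Suc_right o_apply)
  also have "\<dots> = smult (2 * real (Suc n)) (smult (2 * real n + 1) ((pderiv ^^ m) (quadX ^ n))
                    + smult (2 * real n) ((pderiv ^^ m) (quadX ^ m)))"
    using pderiv2_quadX_power[OF assms] m
    by (simp only: higher_pderiv_smult higher_pderiv_add) (simp del: power_Suc of_nat_Suc)
  finally have "legendre_poly (Suc n) = smult (2 * real (Suc n) / (2 ^ Suc n * fact (Suc n)))
      (smult (2 * real n + 1) ((pderiv ^^ m) (quadX ^ n)) + smult (2 * real n) ((pderiv ^^ m) (quadX ^ m)))"
    by (simp only: legendre_poly_def smult_smult) (simp del: power_Suc fact_Suc of_nat_Suc)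
  moreover have k: "2 * real (Suc n) / (2 ^ Suc n * fact (Suc n)) = 1 / (2 ^ n * fact n)"
    by (simp add: field_simps del: of_nat_Suc)
  ultimately have "legendre_poly (Suc n) =
      smult (2 * real n + 1) (smult (1 / (2 ^ n * fact n)) ((pderiv ^^ m) (quadX ^ n)))
      + smult (2 * real n / (2 ^ n * fact n)) ((pderiv ^^ m) (quadX ^ m))"
    by (simp add: smult_add_right del: power_Suc fact_Suc of_nat_Suc)
  also have "2 * real n / (2 ^ n * fact n) = 1 / (2 ^ m * fact m)"
    unfolding m by (simp add: field_simps del: of_nat_Suc)
  finally show ?thesis
    unfolding legendre_poly_def[of "n - 1"] legendre_primitive_def using m
    by (simp del: power_Suc fact_Suc smult_smult)
qed

lemma legendre_primitive_pderiv:
  assumes "n \<ge> 1"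
  shows "pderiv (legendre_primitive n) = legendre_poly n"
proof -
  obtain m where m: "n = Suc m" using assms by (cases n) auto
  show ?thesis unfolding legendre_primitive_def legendre_poly_def m
    by (simp add: pderiv_smult del: power_Suc fact_Suc)
qed

lemma legendre_0 [simp]: "legendre_poly 0 = 1"
  by (simp add: legendre_poly_def)

lemma legendre_1 [simp]: "legendre_poly (Suc 0) = [:0, 1:]"
  by (simp add: legendre_poly_def pderiv_pCons)

abbreviation leg :: "nat \<Rightarrow> real \<Rightarrow> real" where "leg n x \<equiv> poly (legendre_poly n) x"

text \<open>Obtained by eliminating \<open>legendre_primitive\<close> between
  \<open>legendre_Suc_eq1\<close> and \<open>legendre_Suc_eq2\<close>.\<close>

lemma bonnet:
  assumes "n \<ge> 1"
  shows "real (Suc n) * leg (Suc n) x = (2 * real n + 1) * x * leg n x - real n * leg (n - 1) x"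
proof -
  have 1: "leg (Suc n) x = x * leg n x + real n * poly (legendre_primitive n) x"
    using legendre_Suc_eq1[OF assms] by simp
  have 2: "leg (Suc n) x = (2 * real n + 1) * poly (legendre_primitive n) x + leg (n - 1) x"
    using legendre_Suc_eq2[OF assms] by simp
  have "(2 * real n + 1) * leg (Suc n) x - (2 * real n + 1) * x * leg n x
     = real n * ((2 * real n + 1) * poly (legendre_primitive n) x)"
    unfolding 1 by (simp add: algebra_simps)
  also have "\<dots> = real n * (leg (Suc n) x - leg (n - 1) x)" using 2 by simp
  finally show ?thesis by (simp add: algebra_simps)
qed

abbreviation dleg :: "nat \<Rightarrow> real \<Rightarrow> real" where "dleg n x \<equiv> poly (pderiv (legendre_poly n)) x"

lemma dleg_Suc: "dleg (Suc n) x = x * dleg n x + real (Suc n) * leg n x"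
proof (cases "n = 0")
  case True
  then show ?thesis by (simp add: pderiv_pCons)
next
  case False
  then show ?thesis
    using legendre_Suc_eq1[of n] legendre_primitive_pderiv[of n]
    by (simp add: pderiv_add pderiv_mult pderiv_smult pderiv_pCons algebra_simps del: mult_pCons_left)
qed

lemma dleg_pred:
  assumes "n \<ge> 1"
  shows "dleg (n - 1) x = x * dleg n x - real n * leg n x"
proof -
  have "dleg (Suc n) x = (2 * real n + 1) * leg n x + dleg (n - 1) x"
    using legendre_Suc_eq2[OF assms] legendre_primitive_pderiv[OF assms]
    by (simp add: pderiv_add pderiv_smult)
  then show ?thesis using dleg_Suc[of n x] by (simp add: algebra_simps)
qed

text \<open>\<open>dleg_Suc\<close> and \<open>dleg_pred\<close> are two linear relations between
  consecutive derivatives; eliminating \<open>dleg (n - 1)\<close> leaves this one.\<close>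

lemma legendre_derivative:
  assumes "n \<ge> 1"
  shows "(1 - x\<^sup>2) * dleg n x = real n * (leg (n - 1) x - x * leg n x)"
proof -
  obtain m where m: "n = Suc m" using assms by (cases n) auto
  have 1: "dleg n x = x * dleg m x + real n * leg m x" using dleg_Suc[of m x] m by simp
  have 2: "dleg m x = x * dleg n x - real n * leg n x" using dleg_pred[OF assms] m by simp
  have "dleg n x = x * (x * dleg n x - real n * leg n x) + real n * leg m x"
    using 1 by (simp add: 2)
  then show ?thesis using m by (simp add: algebra_simps power2_eq_square)
qed

text \<open>The derivative of \<open>legendre_derivative\<close>, read as an identity of
  polynomials, with \<open>dleg (n - 1)\<close> removed by \<open>dleg_pred\<close>.\<close>

lemma legendre_ode:
  "(1 - x\<^sup>2) * poly (pderiv (pderiv (legendre_poly n))) x - 2 * x * dleg n x = - real n * (real n + 1) * leg n x"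
proof (cases "n = 0")
  case False
  then have n: "n \<ge> 1" by simp
  define p where "p = [:1, 0, -1:] * pderiv (legendre_poly n)"
  define q where "q = smult (real n) (legendre_poly (n - 1) - [:0, 1:] * legendre_poly n)"
  have "poly p y = poly q y" for y
    using legendre_derivative[OF n, of y] by (simp add: p_def q_def algebra_simps power2_eq_square)
  then have "p = q" by (simp add: poly_eq_poly_eq_iff[symmetric] ext)
  then have "poly (pderiv p) x = poly (pderiv q) x" by simp
  moreover have "poly (pderiv p) x = (1 - x\<^sup>2) * poly (pderiv (pderiv (legendre_poly n))) x - 2 * x * dleg n x"
    unfolding p_def pderiv_mult by (simp add: pderiv_pCons algebra_simps power2_eq_square)
  moreover have "poly (pderiv q) x = real n * (dleg (n - 1) x - leg n x - x * dleg n x)"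
    unfolding q_def pderiv_mult pderiv_smult pderiv_diff by (simp add: pderiv_pCons algebra_simps)
  ultimately have "(1 - x\<^sup>2) * poly (pderiv (pderiv (legendre_poly n))) x - 2 * x * dleg n x =
      real n * (dleg (n - 1) x - leg n x - x * dleg n x)" by simp
  then show ?thesis unfolding dleg_pred[OF n, of x] by (simp add: algebra_simps)
qed (simp add: pderiv_1)

text \<open>The three-term recurrence and its first step fix a sequence up to the factor
  \<open>v 0\<close>. Both integral representations are identified by this criterion; the sequences
  are complex because the integrals are.\<close>

lemma bonnet_unique:
  fixes v :: "nat \<Rightarrow> complex"
  assumes "v 1 = of_real x * v 0"
    and "\<And>n. n \<ge> 1 \<Longrightarrow>
      of_nat (Suc n) * v (Suc n) = of_real ((2 * real n + 1) * x) * v n - of_nat n * v (n - 1)"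
  shows "v n = of_real (leg n x) * v 0"
proof (induction n rule: less_induct)
  case (less n)
  consider "n = 0" | "n = 1" | m where "n = Suc m" "m \<ge> 1"
    by (cases n; force)
  then show ?case
  proof cases
    case 3
    have "of_nat (Suc m) * v (Suc m) = of_real ((2 * real m + 1) * x) * (of_real (leg m x) * v 0)
        - of_nat m * (of_real (leg (m - 1) x) * v 0)"
      using assms(2)[OF 3(2)] less[of m] less[of "m - 1"] 3 by simp
    also have "\<dots> = of_real ((2 * real m + 1) * x * leg m x - real m * leg (m - 1) x) * v 0"
      by (simp add: algebra_simps)
    also have "\<dots> = of_nat (Suc m) * (of_real (leg (Suc m) x) * v 0)"
      unfolding bonnet[OF 3(2), symmetric] by simp
    finally show ?thesis using 3(1) by (simp del: of_nat_Suc)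
  qed (use assms(1) in auto)
qed

section \<open>Integral representations of Legendre polynomials\<close>

text \<open>The base of the powers in Laplace's first integral: P_n (cos \<theta>) is the mean of
  \<open>lapz \<theta> \<phi> ^ n\<close> over \<open>\<phi> \<in> {0..pi}\<close>.\<close>

definition lapz :: "real \<Rightarrow> real \<Rightarrow> complex" where
  "lapz \<theta> \<phi> = of_real (cos \<theta>) + \<i> * of_real (sin \<theta>) * of_real (cos \<phi>)"

lemma norm_lapz_le_1: "norm (lapz \<theta> \<phi>) \<le> 1"
proof -
  have "(norm (lapz \<theta> \<phi>))\<^sup>2 = (cos \<theta>)\<^sup>2 + (sin \<theta> * cos \<phi>)\<^sup>2"
    by (simp add: lapz_def cmod_power2)
  also have "\<dots> \<le> (cos \<theta>)\<^sup>2 + (sin \<theta>)\<^sup>2"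
    unfolding power_mult_distrib
    by (intro add_left_mono mult_left_le) (auto simp: abs_square_le_1)
  finally have "(norm (lapz \<theta> \<phi>))\<^sup>2 \<le> 1" by simp
  then show ?thesis by (simp add: power2_le_iff_abs_le abs_square_le_1)
qed

lemma continuous_on_lapz [continuous_intros]: "continuous_on A (lapz \<theta>)"
  unfolding lapz_def by (intro continuous_intros)

definition laplace_int :: "real \<Rightarrow> nat \<Rightarrow> complex" where
  "laplace_int \<theta> n = integral {0..pi} (\<lambda>\<phi>. lapz \<theta> \<phi> ^ n)"

text \<open>The combination of integrands in Bonnet's recurrence is the exact derivative of
  \<open>b * sin \<phi> * lapz \<theta> \<phi> ^ n\<close>, which vanishes at both end
  points.\<close>

lemma laplace_int_recurrence:
  assumes "n \<ge> 1"
  shows "of_nat (Suc n) * laplace_int \<theta> (Suc n) =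
    of_real ((2 * real n + 1) * cos \<theta>) * laplace_int \<theta> n - of_nat n * laplace_int \<theta> (n - 1)"
proof -
  define c where "c = complex_of_real (cos \<theta>)"
  define b where "b = \<i> * complex_of_real (sin \<theta>)"
  have cb: "c\<^sup>2 - b\<^sup>2 = 1"
    by (simp add: c_def b_def power_mult_distrib flip: of_real_power of_real_add)
  let ?F = "\<lambda>w. b * sin w * (c + b * cos w) ^ n"
  let ?f = "\<lambda>\<phi>. of_nat (Suc n) * lapz \<theta> \<phi> ^ Suc n - (2 * of_nat n + 1) * c * lapz \<theta> \<phi> ^ n
                + of_nat n * lapz \<theta> \<phi> ^ (n - 1)"
  have "((\<lambda>\<phi>. ?F (of_real \<phi>)) has_vector_derivative ?f \<phi>) (at \<phi> within {0..pi})" for \<phi>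
  proof (rule has_vector_derivative_real_field)
    let ?w = "complex_of_real \<phi>"
    obtain m where m: "n = Suc m" using assms by (cases n) auto
    have z: "lapz \<theta> \<phi> = c + b * cos ?w"
      by (simp add: lapz_def c_def b_def cos_of_real)
    have 1: "(?F has_field_derivative
        (b * cos ?w * (c + b * cos ?w) ^ n + b * sin ?w * (of_nat n * (c + b * cos ?w) ^ (n - 1) * (b * - sin ?w)))) (at ?w)"
      by (auto intro!: derivative_eq_intros simp: algebra_simps)
    have 2: "b * cos ?w * (c + b * cos ?w) ^ n + b * sin ?w * (of_nat n * (c + b * cos ?w) ^ (n - 1) * (b * - sin ?w)) = ?f \<phi>"
    proof -
      define C S where "C = cos ?w" and "S = sin ?w"
      define Z where "Z = c + b * C"
      have "S\<^sup>2 + C\<^sup>2 = 1" by (simp add: C_def S_def)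
      then have S: "S * S = 1 - C * C" by (simp add: power2_eq_square algebra_simps)
      have b: "b * b = c * c - 1" using cb by (simp add: power2_eq_square algebra_simps)
      have bC: "b * C = Z - c" by (simp add: Z_def)
      \<comment> \<open>Since \<open>b\<^sup>2 = c\<^sup>2 - 1\<close>, the square of
        \<open>b * S\<close> is a polynomial in \<open>Z\<close> and \<open>c\<close> alone; it
        supplies the terms of the recurrence.\<close>
      have "b * S * (b * S) = (b * b) * (S * S)" by simp
      also have "\<dots> = b * b - (b * C) * (b * C)" unfolding S by (simp add: algebra_simps)
      finally have bS: "b * S * (b * S) = 2 * c * Z - Z * Z - 1"
        unfolding bC b by (simp add: algebra_simps)
      have "b * C * Z ^ n + b * S * (of_nat n * Z ^ (n - 1) * (b * - S)) =
         b * C * Z ^ n - of_nat n * Z ^ (n - 1) * (b * S * (b * S))"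
        by (simp add: algebra_simps)
      also have "\<dots> = of_nat (Suc n) * Z ^ Suc n - (2 * of_nat n + 1) * c * Z ^ n + of_nat n * Z ^ (n - 1)"
        unfolding bC bS by (simp add: m algebra_simps)
      finally show ?thesis by (simp only: z C_def S_def Z_def)
    qed
    show "(?F has_field_derivative ?f \<phi>) (at ?w)"
      using 1 unfolding 2 .
  qed
  then have "(?f has_integral (?F (of_real pi) - ?F (of_real 0))) {0..pi}"
    by (intro fundamental_theorem_of_calculus) auto
  then have "(?f has_integral 0) {0..pi}"
    by (simp flip: sin_of_real)
  moreover have "(?f has_integral (of_nat (Suc n) * laplace_int \<theta> (Suc n)
      - (2 * of_nat n + 1) * c * laplace_int \<theta> n + of_nat n * laplace_int \<theta> (n - 1))) {0..pi}"
    unfolding laplace_int_def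
    by (intro has_integral_add has_integral_diff has_integral_mult_right integrable_integral
        integrable_continuous_real continuous_intros)
  ultimately have "of_nat (Suc n) * laplace_int \<theta> (Suc n)
      - (2 * of_nat n + 1) * c * laplace_int \<theta> n + of_nat n * laplace_int \<theta> (n - 1) = 0"
    by (blast intro: has_integral_unique)
  then show ?thesis by (simp add: c_def algebra_simps)
qed

lemma laplace_formula: "laplace_int \<theta> n = of_real (leg n (cos \<theta>)) * of_real pi"
proof -
  have 0: "laplace_int \<theta> 0 = of_real pi"
    unfolding laplace_int_def using has_integral_const_real[of "1::complex" 0 pi]
    by (simp add: integral_unique scaleR_conv_of_real)
  have "((\<lambda>\<phi>. lapz \<theta> \<phi>) has_integral
      (of_real (cos \<theta>) * of_real pi + \<i> * of_real (sin \<theta>) * of_real (sin pi - sin 0))) {0..pi}"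
  proof -
    have "(cos has_integral sin pi - sin 0) {0..pi}"
      by (intro fundamental_theorem_of_calculus)
        (auto intro!: derivative_eq_intros simp flip: has_real_derivative_iff_has_vector_derivative)
    from has_integral_mult_right[OF has_integral_of_real[OF this], of "\<i> * of_real (sin \<theta>)"]
    have "((\<lambda>\<phi>. \<i> * of_real (sin \<theta>) * complex_of_real (cos \<phi>)) has_integral \<i> * of_real (sin \<theta>) * of_real (sin pi - sin 0)) {0..pi}" .
    moreover have "((\<lambda>\<phi>. complex_of_real (cos \<theta>)) has_integral of_real (cos \<theta>) * of_real pi) {0..pi}"
      using has_integral_const_real[of "complex_of_real (cos \<theta>)" 0 pi]
      by (simp add: scaleR_conv_of_real mult.commute)
    ultimately show ?thesis unfolding lapz_def by (intro has_integral_add)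
  qed
  then have 1: "laplace_int \<theta> 1 = of_real (cos \<theta>) * laplace_int \<theta> 0"
    unfolding 0 by (simp add: laplace_int_def integral_unique)
  show ?thesis
    using bonnet_unique[OF 1 laplace_int_recurrence] 0 by simp
qed

text \<open>
  The second integral representation runs along the ray from \<open>cis \<theta>\<close> to the origin:
  \<open>leg n (cos \<theta>)\<close> is \<open>2 / pi\<close> times the imaginary part of \<open>ray_int \<theta> n\<close>.  The oscillation in \<open>n\<close> is
  the pure phase \<open>cis (n * \<theta>)\<close>, and the factor \<open>(1 - s\<^sup>2) ^ n\<close> produces the decay
  \<open>(n * sin \<theta>) powr (-1/2)\<close> away from the poles.
\<close>

definition ray_D :: "real \<Rightarrow> real \<Rightarrow> complex" where
  "ray_D \<theta> s = csqrt (1 - (1 - (of_real s)\<^sup>2) * (cis \<theta>)\<^sup>2)"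

text \<open>The substitution in the integral of
  \<open>u ^ n / sqrt (1 - 2 * u * cos \<theta> + u\<^sup>2)\<close> from 0 to
  \<open>cis \<theta>\<close>. The radicand becomes the square of
  \<open>s * ray_D \<theta> s\<close>, so the singularity of the integrand at
  \<open>u = cis \<theta>\<close> is removed.\<close>

definition ray_u :: "real \<Rightarrow> real \<Rightarrow> complex" where
  "ray_u \<theta> s = of_real (1 - s\<^sup>2) * cis \<theta>"

definition ray_int :: "real \<Rightarrow> nat \<Rightarrow> complex" where
  "ray_int \<theta> n = integral {0..1} (\<lambda>s. ray_u \<theta> s ^ n * (2 * cis \<theta> / ray_D \<theta> s))"

lemma Re_cis_squared: "Re ((cis \<theta>)\<^sup>2) = cos (2 * \<theta>)"
  and Im_cis_squared: "Im ((cis \<theta>)\<^sup>2) = sin (2 * \<theta>)"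
  by (simp_all add: power2_eq_square cos_double sin_double)

text \<open>The law of cosines for \<open>1 - r * cis (2 * \<theta>)\<close> with
  \<open>r = 1 - s\<^sup>2\<close>: the squared modulus is
  \<open>(1 - r)\<^sup>2 + 4 * r * (sin \<theta>)\<^sup>2\<close>.\<close>

lemma ray_arg_norm:
  assumes "0 \<le> s" "s \<le> 1"
  shows "(norm (1 - (1 - (of_real s)\<^sup>2) * (cis \<theta>)\<^sup>2))\<^sup>2 = s ^ 4 + 4 * (1 - s\<^sup>2) * (sin \<theta>)\<^sup>2"
proof -
  have *: "(1 - (1 - (of_real s)\<^sup>2) * (cis \<theta>)\<^sup>2) = Complex (1 - (1 - s\<^sup>2) * cos (2 * \<theta>)) (- (1 - s\<^sup>2) * sin (2 * \<theta>))"
    unfolding complex_eq_iff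
    by (simp add: Re_cis_squared Im_cis_squared flip: of_real_power of_real_diff) (simp add: algebra_simps)
  define r where "r = 1 - s\<^sup>2"
  have "(norm (1 - (1 - (of_real s)\<^sup>2) * (cis \<theta>)\<^sup>2))\<^sup>2 = (1 - r * cos (2 * \<theta>))\<^sup>2 + (- r * sin (2 * \<theta>))\<^sup>2"
    unfolding * r_def by (simp add: cmod_power2)
  also have "\<dots> = 1 - 2 * r * cos (2 * \<theta>) + r\<^sup>2 * ((cos (2*\<theta>))\<^sup>2 + (sin (2 * \<theta>))\<^sup>2)"
    unfolding distrib_left by (simp add: power2_diff power_mult_distrib)
  also have "\<dots> = 1 - 2 * r * cos (2 * \<theta>) + r\<^sup>2"
    by (simp only: sin_cos_squared_add2 mult_1_right)
  also have "\<dots> = (1 - r)\<^sup>2 + 4 * r * (sin \<theta>)\<^sup>2"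
    unfolding cos_double_sin by (simp add: power2_diff algebra_simps)
  finally show ?thesis by (simp add: r_def)
qed

text \<open>The real part \<open>1 - (1 - s\<^sup>2) * cos (2 * \<theta>)\<close> is positive, so
  the principal square root is analytic along the whole ray.\<close>

lemma ray_arg_notin:
  assumes "0 \<le> s" "s \<le> 1" "0 < \<theta>" "\<theta> < pi"
  shows "1 - (1 - (of_real s)\<^sup>2) * (cis \<theta>)\<^sup>2 \<notin> \<real>\<^sub>\<le>\<^sub>0"
proof -
  have "Re (1 - (1 - (of_real s)\<^sup>2) * (cis \<theta>)\<^sup>2) = 1 - (1 - s\<^sup>2) * cos (2 * \<theta>)"
    by (simp add: Re_cis_squared flip: of_real_power)
  moreover have "sin \<theta> > 0" using assms sin_gt_zero by blast
  then have c: "cos (2 * \<theta>) < 1" by (simp add: cos_double_sin)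
  have "(1 - s\<^sup>2) * cos (2 * \<theta>) < 1"
  proof (cases "cos (2 * \<theta>) \<le> 0")
    case True
    have "(1 - s\<^sup>2) * cos (2 * \<theta>) \<le> 0"
      using assms by (intro mult_nonneg_nonpos True) (simp add: power2_le_iff_abs_le abs_square_le_1)
    then show ?thesis by simp
  next
    case False
    then have "(1 - s\<^sup>2) * cos (2 * \<theta>) \<le> 1 * cos (2 * \<theta>)" by (intro mult_right_mono) auto
    then show ?thesis using c by simp
  qed
  ultimately show ?thesis by (auto simp: complex_nonpos_Reals_iff)
qed

lemma norm_ray_D_squared: "(norm (ray_D \<theta> s))\<^sup>2 = norm (1 - (1 - (of_real s)\<^sup>2) * (cis \<theta>)\<^sup>2)"
  unfolding ray_D_def norm_power[symmetric] power2_csqrt ..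

text \<open>Both bounds come from \<open>ray_arg_norm\<close>. For the first only
  \<open>s ^ 4\<close> is kept. For the second, \<open>s ^ 4\<close> is multiplied by
  \<open>(sin \<theta>)\<^sup>2 \<le> 1\<close>, and
  \<open>s ^ 4 + 4 * (1 - s\<^sup>2) = (2 - s\<^sup>2)\<^sup>2\<close> is at least 1.\<close>

lemma norm_ray_D_ge:
  assumes "0 \<le> s" "s \<le> 1"
  shows "norm (ray_D \<theta> s) \<ge> s" "sin \<theta> \<ge> 0 \<Longrightarrow> norm (ray_D \<theta> s) \<ge> sqrt (sin \<theta>)"
proof -
  have s1: "s\<^sup>2 \<le> 1" using assms by (simp add: abs_square_le_1)
  have sn: "(sin \<theta>)\<^sup>2 \<le> 1" by (simp add: abs_square_le_1)
  have n: "(norm (ray_D \<theta> s) ^ 2)\<^sup>2 = s ^ 4 + 4 * (1 - s\<^sup>2) * (sin \<theta>)\<^sup>2"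
    unfolding norm_ray_D_squared ray_arg_norm[OF assms] ..
  have "(s\<^sup>2)\<^sup>2 \<le> (norm (ray_D \<theta> s) ^ 2)\<^sup>2"
    unfolding n using s1 by simp
  then have "s\<^sup>2 \<le> (norm (ray_D \<theta> s))\<^sup>2"
    by (rule power2_le_imp_le) simp
  then show "norm (ray_D \<theta> s) \<ge> s" by (rule power2_le_imp_le) simp
  assume sin: "sin \<theta> \<ge> 0"
  have "(sin \<theta>)\<^sup>2 \<le> (2 - s\<^sup>2)\<^sup>2 * (sin \<theta>)\<^sup>2"
    using s1 by (simp add: mult_le_cancel_right1 one_le_power)
  also have "\<dots> = s ^ 4 * (sin \<theta>)\<^sup>2 + 4 * (1 - s\<^sup>2) * (sin \<theta>)\<^sup>2"
    by (simp add: algebra_simps power2_eq_square power4_eq_xxxx)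
  also have "\<dots> \<le> s ^ 4 + 4 * (1 - s\<^sup>2) * (sin \<theta>)\<^sup>2"
    using sn by (simp add: mult_left_le)
  finally have "(sin \<theta>)\<^sup>2 \<le> (norm (ray_D \<theta> s) ^ 2)\<^sup>2" unfolding n .
  then have "sin \<theta> \<le> (norm (ray_D \<theta> s))\<^sup>2" by (rule power2_le_imp_le) simp
  then show "norm (ray_D \<theta> s) \<ge> sqrt (sin \<theta>)" by (simp add: real_le_lsqrt)
qed

lemma ray_D_nonzero:
  assumes "0 \<le> s" "s \<le> 1" "0 < \<theta>" "\<theta> < pi"
  shows "ray_D \<theta> s \<noteq> 0"
  using ray_arg_notin[OF assms] by (auto simp: ray_D_def)

lemma continuous_on_ray_D:
  assumes "0 < \<theta>" "\<theta> < pi"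
  shows "continuous_on {0..1} (ray_D \<theta>)"
  unfolding ray_D_def
proof (rule continuous_on_compose2[where g = csqrt and t = "- \<real>\<^sub>\<le>\<^sub>0"])
  show "continuous_on (- \<real>\<^sub>\<le>\<^sub>0) csqrt"
    by (intro continuous_at_imp_continuous_on ballI continuous_at_csqrt) simp
  show "continuous_on {0..1} (\<lambda>s. 1 - (1 - (complex_of_real s)\<^sup>2) * (cis \<theta>)\<^sup>2)"
    by (intro continuous_intros)
  show "(\<lambda>s. 1 - (1 - (complex_of_real s)\<^sup>2) * (cis \<theta>)\<^sup>2) ` {0..1} \<subseteq> - \<real>\<^sub>\<le>\<^sub>0"
  proof (rule image_subsetI)
    fix s :: real assume "s \<in> {0..1}"
    then show "1 - (1 - (complex_of_real s)\<^sup>2) * (cis \<theta>)\<^sup>2 \<in> - \<real>\<^sub>\<le>\<^sub>0"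
      using ray_arg_notin[of s \<theta>] assms by (simp only: atLeastAtMost_iff Compl_iff simp_thms)
  qed
qed

lemma continuous_on_ray_u: "continuous_on A (ray_u \<theta>)"
  unfolding ray_u_def by (intro continuous_intros)

lemma two_cos_cis: "2 * of_real (cos \<theta>) * cis \<theta> = (cis \<theta>)\<^sup>2 + 1"
  unfolding complex_eq_iff
  by (simp add: Re_cis_squared Im_cis_squared cos_double_cos sin_double power2_eq_square[of "cos _"])

text \<open>In the variable \<open>u\<close> the differentiated function is
  \<open>u ^ n * sqrt (1 - 2 * u * cos \<theta> + u\<^sup>2)\<close>. Its derivative is the
  combination from Bonnet's recurrence divided by the root, and
  \<open>- (2 * cis \<theta> / D)\<close> is \<open>du / ds\<close> divided by the root.\<close>

lemma ray_derivative:
  fixes s \<theta> :: real and n :: nat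
  assumes "0 \<le> s" "s \<le> 1" "0 < \<theta>" "\<theta> < pi"
  defines "D \<equiv> ray_D \<theta> s" and "u \<equiv> ray_u \<theta> s"
  shows "((\<lambda>s. ray_u \<theta> s ^ n * (of_real s * ray_D \<theta> s)) has_vector_derivative
    - (2 * cis \<theta> / D) * (of_nat (Suc n) * u ^ Suc n - of_real ((2 * real n + 1) * cos \<theta>) * u ^ n
       + of_nat n * u ^ (n - 1))) (at s within {0..1})"
proof -
  define E where "E = cis \<theta>"
  define w where "w = complex_of_real s"
  have E: "2 * of_real (cos \<theta>) * E = E\<^sup>2 + 1"
    unfolding E_def by (rule two_cos_cis)
  have nz: "D \<noteq> 0" using ray_D_nonzero[OF assms(1-4)] by (simp add: D_def)
  have Dw: "D = csqrt (1 - (1 - w\<^sup>2) * E\<^sup>2)" by (simp add: D_def ray_D_def w_def E_def)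
  have uw: "u = (1 - w\<^sup>2) * E" by (simp add: u_def ray_u_def w_def E_def)
  have D2: "D\<^sup>2 = 1 - (1 - w\<^sup>2) * E\<^sup>2" unfolding Dw by simp
  have ni: "1 - (1 - w\<^sup>2) * E\<^sup>2 \<notin> \<real>\<^sub>\<le>\<^sub>0"
    using ray_arg_notin[OF assms(1-4)] by (simp add: w_def E_def)
  let ?F = "\<lambda>w. ((1 - w\<^sup>2) * E) ^ n * (w * csqrt (1 - (1 - w\<^sup>2) * E\<^sup>2))"
  have d1: "((\<lambda>w. (1 - w\<^sup>2) * E) has_field_derivative - 2 * w * E) (at w)"
    by (auto intro!: derivative_eq_intros)
  have d2: "((\<lambda>w. 1 - (1 - w\<^sup>2) * E\<^sup>2) has_field_derivative 2 * w * E\<^sup>2) (at w)"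
    by (auto intro!: derivative_eq_intros)
  have d3: "((\<lambda>w. csqrt (1 - (1 - w\<^sup>2) * E\<^sup>2)) has_field_derivative inverse (2 * D) * (2 * w * E\<^sup>2)) (at w)"
    unfolding Dw by (rule DERIV_chain2[OF has_field_derivative_csqrt[OF ni] d2])
  have "(?F has_field_derivative
    (of_nat n * u ^ (n - 1) * (- 2 * w * E) * (w * D) + u ^ n * (D + w * (inverse (2 * D) * (2 * w * E\<^sup>2))))) (at w)"
    by (rule DERIV_cong[OF DERIV_mult[OF DERIV_power[OF d1, of n] DERIV_mult[OF DERIV_ident d3]]])
      (simp add: uw Dw mult_ac add_ac)
  also have "(of_nat n * u ^ (n - 1) * (- 2 * w * E) * (w * D) + u ^ n * (D + w * (inverse (2 * D) * (2 * w * E\<^sup>2))))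
    = - (2 * E / D) * (of_nat (Suc n) * u ^ Suc n - of_real ((2 * real n + 1) * cos \<theta>) * u ^ n
       + of_nat n * u ^ (n - 1))" (is "?L = ?R")
  proof -
    \<comment> \<open>After multiplication by \<open>D\<close> only \<open>D\<^sup>2\<close>
      remains, which is a polynomial in \<open>w\<close> and \<open>E\<close>, and the claim becomes
      a polynomial identity.\<close>
    have "?L * D = of_nat n * u ^ (n - 1) * (- 2 * E * w\<^sup>2) * D\<^sup>2 + u ^ n * (D\<^sup>2 + w\<^sup>2 * E\<^sup>2)"
    proof -
      have "(inverse (2 * D) * (2 * w * E\<^sup>2)) * D = w * E\<^sup>2" using nz by simp
      then have "w * (inverse (2 * D) * (2 * w * E\<^sup>2)) * D = w\<^sup>2 * E\<^sup>2"
        by (simp only: mult.assoc power2_eq_square)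
      then show ?thesis by (simp only: distrib_right mult.assoc distrib_left power2_eq_square) (simp add: mult_ac)
    qed
    also have "\<dots> = - 2 * E * of_nat (Suc n) * u ^ Suc n + (2 * of_nat n + 1) * (E\<^sup>2 + 1) * u ^ n
       - 2 * E * of_nat n * u ^ (n - 1)"
    proof -
      define r where "r = 1 - w\<^sup>2"
      have w2: "w\<^sup>2 = 1 - r" and u: "u = r * E" and D2': "D\<^sup>2 = 1 - r * E\<^sup>2"
        by (simp_all add: r_def uw D2)
      show ?thesis
      proof (cases n)
        case 0
        then show ?thesis unfolding D2' u w2 by (simp add: algebra_simps power2_eq_square)
      next
        case (Suc m)
        have "k * (- 2 * E * w\<^sup>2) * D\<^sup>2 + u * (D\<^sup>2 + w\<^sup>2 * E\<^sup>2) =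
          - 2 * E * (k + 1) * u\<^sup>2 + (2 * k + 1) * (E\<^sup>2 + 1) * u - 2 * E * k" for k :: complex
          unfolding D2' u w2 by (simp add: algebra_simps power2_eq_square)
        note core = this[of "of_nat n"]
        have "of_nat n * u ^ (n - 1) * (- 2 * E * w\<^sup>2) * D\<^sup>2 + u ^ n * (D\<^sup>2 + w\<^sup>2 * E\<^sup>2)
          = u ^ m * (of_nat n * (- 2 * E * w\<^sup>2) * D\<^sup>2 + u * (D\<^sup>2 + w\<^sup>2 * E\<^sup>2))"
          by (simp only: Suc power_Suc diff_Suc_1 distrib_left mult_ac)
        also have "\<dots> = u ^ m * (- 2 * E * (of_nat n + 1) * u\<^sup>2 + (2 * of_nat n + 1) * (E\<^sup>2 + 1) * u - 2 * E * of_nat n)"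
          unfolding core ..
        also have "\<dots> = - 2 * E * of_nat (Suc n) * u ^ Suc n + (2 * of_nat n + 1) * (E\<^sup>2 + 1) * u ^ n
           - 2 * E * of_nat n * u ^ (n - 1)"
          by (simp only: Suc power_Suc diff_Suc_1 distrib_left right_diff_distrib mult_ac power2_eq_square of_nat_Suc add_ac)
        finally show ?thesis .
      qed
    qed
    also have "\<dots> = ?R * D"
    proof -
      have "?R * D = - 2 * E * (of_nat (Suc n) * u ^ Suc n - of_real ((2 * real n + 1) * cos \<theta>) * u ^ n
          + of_nat n * u ^ (n - 1))" using nz by simp
      also have "\<dots> = - 2 * E * of_nat (Suc n) * u ^ Suc n
          + (2 * of_nat n + 1) * (2 * of_real (cos \<theta>) * E) * u ^ n - 2 * E * of_nat n * u ^ (n - 1)"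
        by (simp add: algebra_simps del: power_Suc)
      finally show ?thesis unfolding E ..
    qed
    finally show ?thesis using nz by (metis mult_right_cancel)
  qed
  finally have "(?F has_field_derivative ?R) (at w)" .
  from has_vector_derivative_real_field[OF this[unfolded w_def]]
  show ?thesis by (simp add: E_def ray_u_def ray_D_def)
qed

lemma continuous_on_ray_integrand:
  assumes "0 < \<theta>" "\<theta> < pi" "continuous_on {0..1} g"
  shows "continuous_on {0..1} (\<lambda>s. g s * (2 * cis \<theta> / ray_D \<theta> s))"
  using ray_D_nonzero[OF _ _ assms(1,2)] assms(3)
  by (intro continuous_intros continuous_on_ray_D[OF assms(1,2)]) auto

text \<open>The boundary term at \<open>s = 0\<close> vanishes, and the one at \<open>s = 1\<close>
  is present only for \<open>n = 0\<close>, where it is real. The imaginary parts therefore satisfy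
  Bonnet's recurrence from the first step on.\<close>

lemma ray_int_relation:
  assumes "0 < \<theta>" "\<theta> < pi"
  shows "of_nat (Suc n) * ray_int \<theta> (Suc n) - of_real ((2 * real n + 1) * cos \<theta>) * ray_int \<theta> n
     + of_nat n * ray_int \<theta> (n - 1) = (if n = 0 then -1 else 0)"
proof -
  let ?F = "\<lambda>s. ray_u \<theta> s ^ n * (of_real s * ray_D \<theta> s)"
  let ?q = "\<lambda>s. 2 * cis \<theta> / ray_D \<theta> s"
  let ?f = "\<lambda>s. - (?q s) * (of_nat (Suc n) * ray_u \<theta> s ^ Suc n
       - of_real ((2 * real n + 1) * cos \<theta>) * ray_u \<theta> s ^ n + of_nat n * ray_u \<theta> s ^ (n - 1))"
  have "(?f has_integral (?F 1 - ?F 0)) {0..1}"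
    by (intro fundamental_theorem_of_calculus ray_derivative assms) auto
  then have neg: "((\<lambda>s. - ?f s) has_integral - (?F 1 - ?F 0)) {0..1}"
    by (rule has_integral_neg)
  have ends: "- (?F 1 - ?F 0) = (if n = 0 then -1 else 0)"
    by (simp add: ray_u_def ray_D_def)
  let ?g = "\<lambda>s. of_nat (Suc n) * (ray_u \<theta> s ^ Suc n * ?q s)
       - of_real ((2 * real n + 1) * cos \<theta>) * (ray_u \<theta> s ^ n * ?q s) + of_nat n * (ray_u \<theta> s ^ (n - 1) * ?q s)"
  have alg: "- (- q * (a * x - b * y + c * z)) = a * (x * q) - b * (y * q) + c * (z * q)"
    for a b c x y z q :: complex
    by (simp add: algebra_simps)
  have g: "- ?f s = ?g s" for s
    by (rule alg)
  have "(?g has_integral (of_nat (Suc n) * ray_int \<theta> (Suc n) - of_real ((2 * real n + 1) * cos \<theta>) * ray_int \<theta> n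
     + of_nat n * ray_int \<theta> (n - 1))) {0..1}"
    unfolding ray_int_def
    by (intro has_integral_add has_integral_diff has_integral_mult_right integrable_integral
        integrable_continuous_real continuous_on_ray_integrand assms continuous_intros continuous_on_ray_u)
  from has_integral_unique[OF this neg[unfolded g]] show ?thesis
    unfolding ends .
qed

text \<open>An antiderivative of \<open>1 / sqrt (1 - 2 * u * cos \<theta> + u\<^sup>2)\<close> is
  the logarithm of \<open>u - cos \<theta>\<close> plus the root, called \<open>Z\<close> below. At
  \<open>s = 0\<close> it equals \<open>\<i> * sin \<theta>\<close>, of argument
  \<open>pi / 2\<close>, and at \<open>s = 1\<close> a positive real number.\<close>

lemma Im_ray_int_0:
  assumes "0 < \<theta>" "\<theta> < pi"
  shows "Im (ray_int \<theta> 0) = pi / 2"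
proof -
  define c where "c = complex_of_real (cos \<theta>)"
  define Z where "Z s = ray_u \<theta> s - c + of_real s * ray_D \<theta> s" for s
  have sin: "sin \<theta> > 0" using assms sin_gt_zero by blast
  \<comment> \<open>The conjugate expression \<open>U - V\<close> has product
    \<open>- (sin \<theta>)\<^sup>2\<close> with \<open>Z s\<close>. If \<open>Z s\<close> were a
    nonpositive real number, it would be nonzero and \<open>U - V\<close>, hence \<open>U\<close>,
    would be real; this forces \<open>s = 1\<close>, where \<open>Z s\<close> is positive.\<close>
  have notin: "Z s \<notin> \<real>\<^sub>\<le>\<^sub>0" if s: "0 \<le> s" "s \<le> 1" for s
  proof
    assume Zn: "Z s \<in> \<real>\<^sub>\<le>\<^sub>0"
    define U where "U = ray_u \<theta> s - c"
    define V where "V = of_real s * ray_D \<theta> s"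
    have "V\<^sup>2 = (of_real s)\<^sup>2 * (1 - (1 - (of_real s)\<^sup>2) * (cis \<theta>)\<^sup>2)"
      unfolding V_def ray_D_def by (simp add: power_mult_distrib)
    also have "\<dots> = (ray_u \<theta> s)\<^sup>2 - 2 * c * ray_u \<theta> s + 1"
    proof -
      define E w where "E = cis \<theta>" and "w = complex_of_real s"
      have "2 * c * E = E\<^sup>2 + 1"
        unfolding c_def E_def by (rule two_cos_cis)
      moreover have "2 * c * ray_u \<theta> s = (1 - w\<^sup>2) * (2 * c * E)"
        by (simp add: ray_u_def E_def w_def)
      ultimately have "2 * c * ray_u \<theta> s = (1 - w\<^sup>2) * (E\<^sup>2 + 1)"
        by (simp only:)
      moreover have u: "ray_u \<theta> s = (1 - w\<^sup>2) * E"
        by (simp add: ray_u_def E_def w_def)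
      moreover have "((1 - w\<^sup>2) * E)\<^sup>2 - (1 - w\<^sup>2) * (E\<^sup>2 + 1) + 1 = w\<^sup>2 * (1 - (1 - w\<^sup>2) * E\<^sup>2)"
        by (simp only: power2_eq_square) (simp add: algebra_simps)
      ultimately have "w\<^sup>2 * (1 - (1 - w\<^sup>2) * E\<^sup>2) = (ray_u \<theta> s)\<^sup>2 - 2 * c * ray_u \<theta> s + 1"
        by metis
      then show ?thesis unfolding E_def w_def .
    qed
    finally have V2: "V\<^sup>2 = (ray_u \<theta> s)\<^sup>2 - 2 * c * ray_u \<theta> s + 1" .
    have "(U + V) * (U - V) = U\<^sup>2 - V\<^sup>2"
      by (simp add: power2_eq_square algebra_simps)
    also have "\<dots> = c\<^sup>2 - 1"
      unfolding V2 U_def power2_diff by simp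
    also have "\<dots> = of_real (- (sin \<theta>)\<^sup>2)"
      unfolding c_def by (simp add: sin_squared_eq)
    finally have prod: "Z s * (U - V) = of_real (- (sin \<theta>)\<^sup>2)"
      unfolding Z_def U_def V_def .
    from Zn obtain x where x: "Z s = of_real x" "x \<le> 0"
      by (auto elim!: nonpos_Reals_cases)
    have "x \<noteq> 0" using prod sin x by auto
    moreover have "of_real x * (U - V) = of_real (- (sin \<theta>)\<^sup>2)"
      using prod unfolding x(1) .
    ultimately have "U - V = of_real (- (sin \<theta>)\<^sup>2) / of_real x"
      by (metis nonzero_mult_div_cancel_left of_real_eq_0_iff)
    then have "U - V = of_real (- (sin \<theta>)\<^sup>2 / x)"
      by simp
    moreover have "U + V = of_real x" using x by (simp add: Z_def U_def V_def)
    ultimately have "Im (U + V + (U - V)) = 0" by simp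
    then have "Im U = 0" by simp
    then have "(1 - s\<^sup>2) * sin \<theta> = 0" by (simp add: U_def c_def ray_u_def)
    then have "s\<^sup>2 = 1" using sin by simp
    then have s1: "s = 1" using s by (simp add: power2_eq_1_iff)
    have "complex_of_real x = of_real (1 - cos \<theta>)" using x(1) unfolding Z_def s1
      by (simp add: ray_u_def ray_D_def c_def)
    then have "x = 1 - cos \<theta>" by (simp only: of_real_eq_iff)
    moreover have "cos \<theta> < 1" using cos_monotone_0_pi[of 0 \<theta>] assms by simp
    ultimately show False using x(2) by simp
  qed
  have "((\<lambda>s. - Ln (Z s)) has_vector_derivative (2 * cis \<theta> / ray_D \<theta> s)) (at s within {0..1})"
    if s: "0 \<le> s" "s \<le> 1" for s
  proof -
    have nz: "ray_D \<theta> s \<noteq> 0" using ray_D_nonzero s assms by blast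
    have "((\<lambda>s. of_real s * ray_D \<theta> s) has_vector_derivative
       - (2 * cis \<theta> / ray_D \<theta> s) * (ray_u \<theta> s - c)) (at s within {0..1})"
      using ray_derivative[OF s assms, of 0] by (simp add: c_def)
    moreover have "(ray_u \<theta> has_vector_derivative - 2 * of_real s * cis \<theta>) (at s within {0..1})"
    proof -
      have "((\<lambda>w. (1 - w\<^sup>2) * cis \<theta>) has_field_derivative - 2 * of_real s * cis \<theta>) (at (of_real s))"
        by (auto intro!: derivative_eq_intros)
      from has_vector_derivative_real_field[OF this] show ?thesis
        by (simp add: ray_u_def[abs_def])
    qed
    ultimately have "(Z has_vector_derivative - 2 * of_real s * cis \<theta> - 0
        + - (2 * cis \<theta> / ray_D \<theta> s) * (ray_u \<theta> s - c)) (at s within {0..1})"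
      unfolding Z_def[abs_def]
      by (intro has_vector_derivative_add has_vector_derivative_diff has_vector_derivative_const)
    also have "- 2 * of_real s * cis \<theta> - 0 + - (2 * cis \<theta> / ray_D \<theta> s) * (ray_u \<theta> s - c)
       = - (2 * cis \<theta> / ray_D \<theta> s) * Z s"
      using nz by (simp add: Z_def field_simps)
    finally have dZ: "(Z has_vector_derivative - (2 * cis \<theta> / ray_D \<theta> s) * Z s) (at s within {0..1})" .
    have "((\<lambda>z. - Ln z) has_field_derivative - inverse (Z s)) (at (Z s) within Z ` {0..1})"
      using notin[OF s] by (auto intro!: derivative_eq_intros simp: divide_inverse)
    from field_vector_diff_chain_within[OF dZ this]
    have "((\<lambda>z. - Ln z) \<circ> Z has_vector_derivative - (2 * cis \<theta> / ray_D \<theta> s) * Z s * - inverse (Z s)) (at s within {0..1})" .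
    moreover have "Z s \<noteq> 0" using notin[OF s] by auto
    then have "- (2 * cis \<theta> / ray_D \<theta> s) * Z s * - inverse (Z s) = 2 * cis \<theta> / ray_D \<theta> s"
      by (simp add: mult.assoc)
    ultimately show ?thesis by (simp only: o_def)
  qed
  then have "((\<lambda>s. 2 * cis \<theta> / ray_D \<theta> s) has_integral (- Ln (Z 1) - (- Ln (Z 0)))) {0..1}"
    by (intro fundamental_theorem_of_calculus) auto
  then have "ray_int \<theta> 0 = Ln (Z 0) - Ln (Z 1)"
    by (simp add: ray_int_def integral_unique)
  moreover have "Z 0 = \<i> * of_real (sin \<theta>)"
    by (simp add: Z_def ray_u_def c_def complex_eq_iff)
  moreover have "Z 1 = of_real (1 - cos \<theta>)"
    by (simp add: Z_def ray_u_def c_def ray_D_def)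
  moreover have "Im (Ln (of_real (1 - cos \<theta>))) = 0"
  proof -
    have "cos \<theta> < 1" using cos_monotone_0_pi[of 0 \<theta>] assms by simp
    then show ?thesis by (subst Ln_of_real) auto
  qed
  moreover have "Im (Ln (\<i> * of_real (sin \<theta>))) = pi / 2"
    using sin Ln_times_of_real[of "sin \<theta>" \<i>] by (simp add: mult.commute)
  ultimately show ?thesis by simp
qed

lemma ray_formula:
  assumes "0 < \<theta>" "\<theta> < pi"
  shows "leg n (cos \<theta>) = (2 / pi) * Im (ray_int \<theta> n)"
proof -
  let ?v = "\<lambda>n. complex_of_real (Im (ray_int \<theta> n))"
  have rel: "Im (of_nat (Suc n) * ray_int \<theta> (Suc n) - of_real ((2 * real n + 1) * cos \<theta>) * ray_int \<theta> n
     + of_nat n * ray_int \<theta> (n - 1)) = 0" for n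
    unfolding ray_int_relation[OF assms] by simp
  then have rel: "real (Suc n) * Im (ray_int \<theta> (Suc n)) =
     (2 * real n + 1) * cos \<theta> * Im (ray_int \<theta> n) - real n * Im (ray_int \<theta> (n - 1))" for n
    using rel[of n] by (simp add: algebra_simps)
  have 1: "?v 1 = of_real (cos \<theta>) * ?v 0"
    using rel[of 0] by simp
  have "of_nat (Suc n) * ?v (Suc n) = of_real ((2 * real n + 1) * cos \<theta>) * ?v n - of_nat n * ?v (n - 1)" for n
    using arg_cong[OF rel[of n], of complex_of_real] by simp
  from bonnet_unique[OF 1 this, of n]
  have "Im (ray_int \<theta> n) = leg n (cos \<theta>) * Im (ray_int \<theta> 0)"
    by (simp flip: of_real_mult)
  then show ?thesis by (simp add: Im_ray_int_0[OF assms] field_simps)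
qed

section \<open>Quadratic Weyl sums\<close>

lemma cis_diff_norm: "norm (1 - cis x) = 2 * \<bar>sin (x / 2)\<bar>"
proof -
  have "(norm (1 - cis x))\<^sup>2 = (2 * sin (x / 2))\<^sup>2"
  proof -
    have "(norm (1 - cis x))\<^sup>2 = (1 - cos x)\<^sup>2 + (sin x)\<^sup>2" by (simp add: cmod_power2)
    also have "\<dots> = 2 - 2 * cos (2 * (x / 2))"
      by (simp add: power2_diff sin_squared_eq)
    also have "\<dots> = (2 * sin (x / 2))\<^sup>2" unfolding cos_double_sin by simp
    finally show ?thesis .
  qed
  then show ?thesis
    by (metis abs_mult abs_norm_cancel abs_numeral power2_eq_iff_nonneg power2_abs abs_ge_zero norm_ge_zero)
qed

lemma norm_geometric_cis_le:
  "norm (\<Sum>m<M. cis (x * real m)) * \<bar>sin (x / 2)\<bar> \<le> 1"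
proof -
  have "(\<Sum>m<M. cis (x * real m)) * (1 - cis x) = 1 - cis x ^ M"
  proof -
    have "cis (x * real m) = cis x ^ m" for m by (simp add: Complex.DeMoivre mult.commute)
    then show ?thesis using one_diff_power_eq[of "cis x" M] by (simp only: mult.commute)
  qed
  then have "norm (\<Sum>m<M. cis (x * real m)) * (2 * \<bar>sin (x / 2)\<bar>) = norm (1 - cis x ^ M)"
    by (metis norm_mult cis_diff_norm)
  also have "\<dots> \<le> norm (1 :: complex) + norm (cis x ^ M)" by (rule norm_triangle_ineq4)
  also have "\<dots> = 2" by (simp add: norm_power)
  finally show ?thesis by simp
qed

text \<open>Weyl differencing as an identity: the square is expanded and the pairs of terms are
  grouped by their distance \<open>h\<close>.\<close>

lemma norm_sum_squared_differencing:
  fixes x :: "nat \<Rightarrow> complex"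
  assumes "\<And>n. norm (x n) = 1"
  shows "(norm (\<Sum>n<L. x n))\<^sup>2 = real L + 2 * Re (\<Sum>h=1..<L. \<Sum>m<L-h. x (m + h) * cnj (x m))"
proof (induction L)
  case (Suc L)
  have "(norm (\<Sum>n<Suc L. x n))\<^sup>2 = (norm (\<Sum>n<L. x n))\<^sup>2 + (norm (x L))\<^sup>2 + 2 * Re (x L * cnj (\<Sum>n<L. x n))"
  proof -
    have "(norm (a + b))\<^sup>2 = (norm a)\<^sup>2 + (norm b)\<^sup>2 + 2 * Re (b * cnj a)" for a b :: complex
      unfolding cmod_power2 by (simp add: power2_eq_square algebra_simps)
    then show ?thesis by (simp only: sum.lessThan_Suc)
  qed
  also have "(norm (x L))\<^sup>2 = 1" by (simp add: assms)
  also have "x L * cnj (\<Sum>n<L. x n) = (\<Sum>h=1..<Suc L. x L * cnj (x (L - h)))"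
  proof -
    have "(\<Sum>n<L. x L * cnj (x n)) = (\<Sum>h=1..<Suc L. x L * cnj (x (L - h)))"
      by (rule sum.reindex_bij_witness[of _ "\<lambda>h. L - h" "\<lambda>n. L - n"]) auto
    then show ?thesis by (simp add: sum_distrib_left)
  qed
  also have "(norm (\<Sum>n<L. x n))\<^sup>2 + 1 + 2 * Re (\<Sum>h=1..<Suc L. x L * cnj (x (L - h))) =
     real (Suc L) + 2 * Re (\<Sum>h=1..<Suc L. \<Sum>m<Suc L-h. x (m + h) * cnj (x m))"
  proof -
    have "(\<Sum>h=1..<Suc L. \<Sum>m<Suc L-h. x (m + h) * cnj (x m)) =
       (\<Sum>h=1..<Suc L. (\<Sum>m<L-h. x (m + h) * cnj (x m)) + x L * cnj (x (L - h)))"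
      by (intro sum.cong refl) (auto simp: Suc_diff_le)
    also have "\<dots> = (\<Sum>h=1..<Suc L. \<Sum>m<L-h. x (m + h) * cnj (x m)) + (\<Sum>h=1..<Suc L. x L * cnj (x (L - h)))"
      by (rule sum.distrib)
    also have "(\<Sum>h=1..<Suc L. \<Sum>m<L-h. x (m + h) * cnj (x m)) = (\<Sum>h=1..<L. \<Sum>m<L-h. x (m + h) * cnj (x m))"
      by (cases "L = 0") (auto simp: sum.atLeastLessThan_Suc)
    finally show ?thesis unfolding Suc by simp
  qed
  finally show ?case .
qed simp

text \<open>The time factor of a harmonic of degree \<open>n\<close>, on which the Laplacian acts as
  \<open>- n * (n + 1)\<close>.\<close>

definition schr_phase :: "real \<Rightarrow> nat \<Rightarrow> complex" where
  "schr_phase t n = cis (- t * real n * (real n + 1))"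

lemma norm_schr_phase [simp]: "norm (schr_phase t n) = 1"
  by (simp add: schr_phase_def)

text \<open>Differencing turns the quadratic phase into a linear one of frequency
  \<open>- 2 * t * h\<close>. The shift \<open>A\<close> and the linear phase \<alpha> survive only
  in a factor of modulus one, which makes the bound uniform in both.\<close>

lemma weyl_inequality:
  "(norm (\<Sum>n<L. schr_phase t (A + n) * cis (\<alpha> * real (A + n))))\<^sup>2 \<le>
     real L + 2 * (\<Sum>h=1..<L. if sin (t * real h) = 0 then real L else min (real L) (1 / \<bar>sin (t * real h)\<bar>))"
proof -
  define x where "x n = schr_phase t (A + n) * cis (\<alpha> * real (A + n))" for n
  have "(norm (\<Sum>n<L. x n))\<^sup>2 = real L + 2 * Re (\<Sum>h=1..<L. \<Sum>m<L-h. x (m + h) * cnj (x m))"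
    by (rule norm_sum_squared_differencing) (simp add: x_def norm_mult)
  moreover have "Re (\<Sum>h=1..<L. \<Sum>m<L-h. x (m + h) * cnj (x m)) \<le>
     (\<Sum>h=1..<L. if sin (t * real h) = 0 then real L else min (real L) (1 / \<bar>sin (t * real h)\<bar>))"
    apply (subst Re_sum)
  proof (rule sum_mono)
    fix h assume h: "h \<in> {1..<L}"
    define y where "y = - 2 * t * real h"
    define c where "c = cis (\<alpha> * real h - t * real h * (2 * real A + real h + 1))"
    have xx: "x (m + h) * cnj (x m) = c * cis (y * real m)" for m
      unfolding x_def schr_phase_def c_def y_def cis_cnj cis_mult complex_cnj_mult
      by (rule arg_cong[where f = cis]) (simp add: algebra_simps)
    have eq: "norm (\<Sum>m<L-h. x (m + h) * cnj (x m)) = norm (\<Sum>m<L-h. cis (y * real m))"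
      unfolding xx sum_distrib_left[symmetric] norm_mult by (simp add: c_def)
    have 1: "norm (\<Sum>m<L-h. cis (y * real m)) \<le> real L"
      by (rule order_trans[OF norm_sum]) simp
    have 2: "norm (\<Sum>m<L-h. cis (y * real m)) \<le> 1 / \<bar>sin (t * real h)\<bar>" if "sin (t * real h) \<noteq> 0"
      using norm_geometric_cis_le[of y "L-h"] that by (simp add: y_def field_simps)
    show "(Re (\<Sum>m<L-h. x (m + h) * cnj (x m))) \<le>
       (if sin (t * real h) = 0 then real L else min (real L) (1 / \<bar>sin (t * real h)\<bar>))"
      using 1 2 complex_Re_le_cmod[of "\<Sum>m<L-h. x (m + h) * cnj (x m)"] unfolding eq by auto
  qed
  ultimately show ?thesis unfolding x_def by linarith
qed

text \<open>
  Interpolation between the two bounds for a geometric sum, \<open>L\<close> and \<open>1 / \<bar>sin t\<bar>\<close>, leaves a pole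
  that is integrable over a period.
\<close>

definition sin_pole :: "real \<Rightarrow> real \<Rightarrow> real" where
  "sin_pole e t = \<bar>sin t\<bar> powr (e - 1)"

section \<open>Integrability of the pole, and summability over the frequencies for almost every
  time\<close>

lemma sin_pole_measurable [measurable]: "sin_pole e \<in> borel_measurable borel"
  unfolding sin_pole_def by measurable

text \<open>Concavity: on \<open>{0..pi/2}\<close> the sine lies above its chord.\<close>

lemma jordan_sin:
  assumes "0 \<le> x" "x \<le> pi / 2"
  shows "2 / pi * x \<le> sin x"
proof -
  have "concave_on {0..pi/2} sin"
    unfolding concave_on_def
  proof (rule convex_on_realI[where f' = "\<lambda>x. - cos x"])
    show "\<And>x. x \<in> {0..pi/2} \<Longrightarrow> ((\<lambda>x. - sin x) has_real_derivative - cos x) (at x)"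
      by (auto intro!: derivative_eq_intros)
    show "- cos x \<le> - cos y" if "x \<in> {0..pi/2}" "y \<in> {0..pi/2}" "x \<le> y" for x y
      using cos_monotone_0_pi_le[of x y] that by auto
  qed auto
  from concave_onD[OF this, of "2 / pi * x" 0 "pi / 2"]
  show ?thesis using assms by (simp add: field_simps)
qed

lemma nn_integral_sin_pole_half:
  assumes "0 < e" "e < 1"
  shows "(\<integral>\<^sup>+ t. ennreal (sin_pole e t) * indicator {0..pi/2} t \<partial>lborel) < \<infinity>"
proof -
  have I: "((\<lambda>x. (2 / pi) powr (e - 1) * x powr (e - 1)) has_integral
      (2 / pi) powr (e - 1) * ((pi/2) powr e / e)) {0..pi/2}"
    using has_integral_powr_from_0[of "e - 1" "pi/2"] assms by (intro has_integral_mult_right) simp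
  have "(\<integral>\<^sup>+ t. ennreal (sin_pole e t) * indicator {0..pi/2} t \<partial>lborel) \<le>
     (\<integral>\<^sup>+ t. ennreal (indicator {0..pi/2} t * ((2 / pi) powr (e - 1) * t powr (e - 1))) \<partial>lborel)"
  proof (intro nn_integral_mono)
    fix t :: real
    show "ennreal (sin_pole e t) * indicator {0..pi/2} t \<le>
       ennreal (indicator {0..pi/2} t * ((2 / pi) powr (e - 1) * t powr (e - 1)))"
    proof (cases "t \<in> {0<..pi/2}")
      case True
      then have "2 / pi * t \<le> sin t" "2 / pi * t > 0" using jordan_sin[of t] by auto
      then have "sin_pole e t \<le> (2 / pi * t) powr (e - 1)"
        unfolding sin_pole_def using assms by (intro powr_mono2') auto
      also have "(2 / pi * t) powr (e - 1) = (2 / pi) powr (e - 1) * t powr (e - 1)"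
        by (rule powr_mult)
      finally show ?thesis using True by (simp add: ennreal_leI)
    next
      case False
      then have "t \<notin> {0..pi/2} \<or> t = 0" by auto
      then show ?thesis by (auto simp: sin_pole_def)
    qed
  qed
  also have "\<dots> = ennreal ((2 / pi) powr (e - 1) * ((pi/2) powr e / e))"
    by (rule nn_integral_has_integral_lebesgue[OF _ I]) simp
  finally show ?thesis by (rule le_less_trans) simp
qed

lemma sin_pole_periodic: "sin_pole e (t + real k * pi) = sin_pole e t"
  "sin_pole e (pi - t) = sin_pole e t"
proof -
  have "\<bar>sin (t + real k * pi)\<bar> = \<bar>sin t\<bar>"
    by (induction k) (auto simp: algebra_simps sin_add cos_add abs_mult simp flip: add.assoc)
  then show "sin_pole e (t + real k * pi) = sin_pole e t" by (simp add: sin_pole_def)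
qed (simp add: sin_pole_def)

lemma nn_integral_sin_pole_period:
  "(\<integral>\<^sup>+ t. ennreal (sin_pole e t) * indicator {0..<real k * pi} t \<partial>lborel) =
     of_nat k * (\<integral>\<^sup>+ t. ennreal (sin_pole e t) * indicator {0..<pi} t \<partial>lborel)"
proof (induction k)
  case (Suc k)
  let ?f = "\<lambda>t. ennreal (sin_pole e t)"
  have "(\<integral>\<^sup>+ t. ?f t * indicator {0..<real (Suc k) * pi} t \<partial>lborel) =
     (\<integral>\<^sup>+ t. ?f t * indicator {0..<real k * pi} t + ?f t * indicator {real k * pi..<real (Suc k) * pi} t \<partial>lborel)"
  proof (intro nn_integral_cong)
    fix t
    have "{0..<real (Suc k) * pi} = {0..<real k * pi} \<union> {real k * pi..<real (Suc k) * pi}"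
      by (subst ivl_disj_un) (auto simp: algebra_simps)
    then show "?f t * indicator {0..<real (Suc k) * pi} t =
        ?f t * indicator {0..<real k * pi} t + ?f t * indicator {real k * pi..<real (Suc k) * pi} t"
      by (auto simp: indicator_def)
  qed
  also have "\<dots> = (\<integral>\<^sup>+ t. ?f t * indicator {0..<real k * pi} t \<partial>lborel)
      + (\<integral>\<^sup>+ t. ?f t * indicator {real k * pi..<real (Suc k) * pi} t \<partial>lborel)"
    by (intro nn_integral_add) measurable
  also have "(\<integral>\<^sup>+ t. ?f t * indicator {real k * pi..<real (Suc k) * pi} t \<partial>lborel) =
      (\<integral>\<^sup>+ t. ?f (real k * pi + 1 * t) * indicator {real k * pi..<real (Suc k) * pi} (real k * pi + 1 * t) \<partial>lborel)"
    by (subst nn_integral_real_affine[where c = 1 and t = "real k * pi"]) auto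
  also have "\<dots> = (\<integral>\<^sup>+ t. ?f t * indicator {0..<pi} t \<partial>lborel)"
  proof (intro nn_integral_cong)
    fix t
    have "sin_pole e (real k * pi + 1 * t) = sin_pole e t"
      using sin_pole_periodic(1)[of e t k] by (simp add: add.commute)
    then show "?f (real k * pi + 1 * t) * indicator {real k * pi..<real (Suc k) * pi} (real k * pi + 1 * t)
       = ?f t * indicator {0..<pi} t"
      by (auto simp: indicator_def algebra_simps)
  qed
  finally show ?case unfolding Suc by (simp add: algebra_simps)
qed simp

lemma nn_integral_sin_pole:
  assumes "0 < e" "e < 1"
  shows "(\<integral>\<^sup>+ t. ennreal (sin_pole e t) * indicator {0..<pi} t \<partial>lborel) < \<infinity>"
proof -
  let ?f = "\<lambda>t. ennreal (sin_pole e t)"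
  have "(\<integral>\<^sup>+ t. ?f t * indicator {0..<pi} t \<partial>lborel) \<le>
    (\<integral>\<^sup>+ t. ?f t * indicator {0..pi/2} t + ?f t * indicator {pi/2..pi} t \<partial>lborel)"
    by (intro nn_integral_mono) (auto simp: indicator_def)
  also have "\<dots> = (\<integral>\<^sup>+ t. ?f t * indicator {0..pi/2} t \<partial>lborel) + (\<integral>\<^sup>+ t. ?f t * indicator {pi/2..pi} t \<partial>lborel)"
    by (intro nn_integral_add) measurable
  also have "(\<integral>\<^sup>+ t. ?f t * indicator {pi/2..pi} t \<partial>lborel) =
     (\<integral>\<^sup>+ t. ?f (pi + (-1) * t) * indicator {pi/2..pi} (pi + (-1) * t) \<partial>lborel)"
    by (subst nn_integral_real_affine[where c = "-1" and t = pi]) auto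
  also have "\<dots> = (\<integral>\<^sup>+ t. ?f t * indicator {0..pi/2} t \<partial>lborel)"
    using sin_pole_periodic(2)[of e] by (intro nn_integral_cong) (auto simp: indicator_def field_simps)
  also have "(\<integral>\<^sup>+ t. ?f t * indicator {0..pi/2} t \<partial>lborel) + (\<integral>\<^sup>+ t. ?f t * indicator {0..pi/2} t \<partial>lborel) < \<infinity>"
    using nn_integral_sin_pole_half[OF assms] by simp
  finally show ?thesis .
qed

text \<open>Dilation by \<open>h\<close> compresses \<open>h * k\<close> periods into an interval of
  \<open>k\<close> periods, so the integral does not depend on \<open>h\<close>.\<close>

lemma nn_integral_sin_pole_scaled:
  assumes "h \<ge> 1"
  shows "(\<integral>\<^sup>+ t. ennreal (sin_pole e (t * real h)) * indicator {0..<real k * pi} t \<partial>lborel) =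
     of_nat k * (\<integral>\<^sup>+ t. ennreal (sin_pole e t) * indicator {0..<pi} t \<partial>lborel)"
proof -
  let ?c = "(\<integral>\<^sup>+ t. ennreal (sin_pole e t) * indicator {0..<pi} t \<partial>lborel)"
  have "of_nat (h * k) * ?c =
     (\<integral>\<^sup>+ t. ennreal (sin_pole e t) * indicator {0..<real (h * k) * pi} t \<partial>lborel)"
    unfolding nn_integral_sin_pole_period ..
  also have "\<dots> = ennreal \<bar>real h\<bar> * (\<integral>\<^sup>+ t. ennreal (sin_pole e (0 + real h * t)) *
       indicator {0..<real (h * k) * pi} (0 + real h * t) \<partial>lborel)"
    using assms by (subst nn_integral_real_affine[where c = "real h" and t = 0]) auto
  also have "(\<integral>\<^sup>+ t. ennreal (sin_pole e (0 + real h * t)) * indicator {0..<real (h * k) * pi} (0 + real h * t) \<partial>lborel)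
     = (\<integral>\<^sup>+ t. ennreal (sin_pole e (t * real h)) * indicator {0..<real k * pi} t \<partial>lborel)"
    using assms
    by (intro nn_integral_cong) (auto simp: indicator_def mult_ac zero_le_mult_iff)
  finally have "of_nat h * (of_nat k * ?c) =
     of_nat h * (\<integral>\<^sup>+ t. ennreal (sin_pole e (t * real h)) * indicator {0..<real k * pi} t \<partial>lborel)"
    by (simp only: mult.assoc of_nat_mult ennreal_of_nat_eq_real_of_nat[symmetric] abs_of_nat)
  then show ?thesis
    using assms by (subst (asm) ennreal_mult_cancel_left) (auto simp: ennreal_of_nat_eq_real_of_nat)
qed

text \<open>The integral of the whole series over the interval is a constant times the sum of
  \<open>h powr (- 1 - e)\<close>, hence finite, and so the series is finite almost everywhere. The
  index is shifted so that the frequencies start at 1.\<close>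

lemma AE_sin_pole_summable_interval:
  assumes "0 < e" "e < 1"
  shows "AE t in lborel. t \<in> {0..<real k * pi} \<longrightarrow>
    summable (\<lambda>h. real (Suc h) powr (- 1 - e) * sin_pole e (t * real (Suc h)))"
proof -
  let ?g = "\<lambda>h t. real (Suc h) powr (- 1 - e) * sin_pole e (t * real (Suc h))"
  let ?I = "\<lambda>t. indicator {0..<real k * pi} t :: ennreal"
  let ?c = "(\<integral>\<^sup>+ t. ennreal (sin_pole e t) * indicator {0..<pi} t \<partial>lborel)"
  have nn: "?g h t \<ge> 0" for h t by (simp add: sin_pole_def)
  have sm: "summable (\<lambda>h. real (Suc h) powr (- 1 - e))"
    using assms by (subst summable_Suc_iff) (simp add: summable_real_powr_iff)
  have "(\<integral>\<^sup>+ t. (\<Sum>h. ennreal (?g h t) * ?I t) \<partial>lborel) = (\<Sum>h. \<integral>\<^sup>+ t. ennreal (?g h t) * ?I t \<partial>lborel)"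
    by (intro nn_integral_suminf) measurable
  also have "\<dots> = (\<Sum>h. ennreal (real (Suc h) powr (- 1 - e)) * (of_nat k * ?c))"
  proof (intro suminf_cong)
    fix h
    have "(\<integral>\<^sup>+ t. ennreal (?g h t) * ?I t \<partial>lborel) =
       (\<integral>\<^sup>+ t. ennreal (real (Suc h) powr (- 1 - e)) * (ennreal (sin_pole e (t * real (Suc h))) * ?I t) \<partial>lborel)"
      by (intro nn_integral_cong) (simp add: ennreal_mult' mult.assoc)
    also have "\<dots> = ennreal (real (Suc h) powr (- 1 - e)) * (\<integral>\<^sup>+ t. ennreal (sin_pole e (t * real (Suc h))) * ?I t \<partial>lborel)"
      by (intro nn_integral_cmult) measurable
    finally show "(\<integral>\<^sup>+ t. ennreal (?g h t) * ?I t \<partial>lborel) = ennreal (real (Suc h) powr (- 1 - e)) * (of_nat k * ?c)"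
      using nn_integral_sin_pole_scaled[of "Suc h" e k] by simp
  qed
  also have "\<dots> = ennreal (\<Sum>h. real (Suc h) powr (- 1 - e)) * (of_nat k * ?c)"
    using sm by (simp add: ennreal_suminf_multc suminf_ennreal2)
  also have "\<dots> < \<infinity>"
    using nn_integral_sin_pole[OF assms] by (simp add: ennreal_mult_less_top ennreal_of_nat_eq_real_of_nat)
  finally have "AE t in lborel. (\<Sum>h. ennreal (?g h t) * ?I t) \<noteq> \<infinity>"
    by (intro nn_integral_PInf_AE) (auto simp: less_top)
  then show ?thesis
  proof eventually_elim
    case (elim t)
    show ?case
    proof
      assume "t \<in> {0..<real k * pi}"
      then have "(\<Sum>h. ennreal (?g h t)) \<noteq> \<infinity>" using elim by simp
      then show "summable (\<lambda>h. ?g h t)"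
        using nn by (intro summable_suminf_not_top) auto
    qed
  qed
qed

text \<open>The intervals exhaust the nonnegative half-line; negative times follow because the
  summands are even in \<open>t\<close>.\<close>

lemma AE_sin_pole_summable:
  assumes "0 < e" "e < 1"
  shows "AE t in lborel. summable (\<lambda>h. real (Suc h) powr (- 1 - e) * sin_pole e (t * real (Suc h)))"
proof -
  let ?S = "\<lambda>t. summable (\<lambda>h. real (Suc h) powr (- 1 - e) * sin_pole e (t * real (Suc h)))"
  have even: "?S (- t) = ?S t" for t by (simp add: sin_pole_def)
  have A: "AE t in lborel. \<forall>k. t \<in> {0..<real k * pi} \<longrightarrow> ?S t"
    unfolding AE_all_countable using AE_sin_pole_summable_interval[OF assms] by blast
  then have B: "AE t in lborel. \<forall>k. - t \<in> {0..<real k * pi} \<longrightarrow> ?S (- t)"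
    by (intro AE_distrD[of uminus lborel borel]) (simp_all only: lborel_distr_uminus, simp)
  from A B show ?thesis
  proof eventually_elim
    case (elim t)
    obtain k where "\<bar>t\<bar> / pi < real k" using reals_Archimedean2 by blast
    then have "\<bar>t\<bar> < real k * pi" by (simp add: field_simps)
    then show ?case using elim even[of t] by (cases "t \<ge> 0") (auto simp: abs_if)
  qed
qed

text \<open>
  Square root cancellation, uniformly in the linear phase \<open>\<alpha>\<close>, which absorbs the oscillation of the
  Legendre polynomials.
\<close>

definition weyl_bounded :: "real \<Rightarrow> real \<Rightarrow> real \<Rightarrow> bool" where
  "weyl_bounded t e K \<longleftrightarrow> (\<forall>L A \<alpha>.
     norm (\<Sum>n<L. schr_phase t (A + n) * cis (\<alpha> * real (A + n))) \<le> K * real L powr (1/2 + e))"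

text \<open>Interpolation gives \<open>min L (1 / x) \<le> L powr e * x powr (e - 1)\<close> for
  \<open>x = \<bar>sin (t * h)\<bar>\<close>. Since \<open>h < L\<close>, the factor
  \<open>L powr e\<close> is at most \<open>L powr (1 + 2 * e) * h powr (- 1 - e)\<close>, so the
  sum in Weyl's inequality is at most \<open>L powr (1 + 2 * e)\<close> times a convergent
  series.\<close>

lemma weyl_boundedI:
  assumes e: "0 < e" "e < 1"
    and S: "summable (\<lambda>h. real (Suc h) powr (- 1 - e) * sin_pole e (t * real (Suc h)))"
    and t: "\<And>h. h \<ge> 1 \<Longrightarrow> sin (t * real h) \<noteq> 0"
  shows "\<exists>K. weyl_bounded t e K"
proof -
  define S where "S = (\<Sum>h. real (Suc h) powr (- 1 - e) * sin_pole e (t * real (Suc h)))"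
  have S0: "S \<ge> 0" unfolding S_def by (intro suminf_nonneg assms) (simp add: sin_pole_def)
  have "norm (\<Sum>n<L. schr_phase t (A + n) * cis (\<alpha> * real (A + n))) \<le> sqrt (1 + 2 * S) * real L powr (1/2 + e)" for L A \<alpha>
  proof (cases "L = 0")
    case False
    then have L: "real L \<ge> 1" by simp
    have "(\<Sum>h=1..<L. if sin (t * real h) = 0 then real L else min (real L) (1 / \<bar>sin (t * real h)\<bar>)) \<le>
       (\<Sum>h=1..<L. real L powr (1 + 2 * e) * (real h powr (- 1 - e) * sin_pole e (t * real h)))"
    proof (rule sum_mono)
      fix h assume h: "h \<in> {1..<L}"
      define x where "x = \<bar>sin (t * real h)\<bar>"
      define m where "m = min (real L) (1 / x)"
      have x: "x > 0" using t[of h] h by (simp add: x_def)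
      have m0: "m > 0" using x L by (simp add: m_def)
      have "m = m powr e * m powr (1 - e)" using m0 by (simp flip: powr_add)
      also have "\<dots> \<le> real L powr e * (1 / x) powr (1 - e)"
        using e m0 by (intro mult_mono powr_mono2) (auto simp: m_def)
      also have "(1 / x) powr (1 - e) = x powr (e - 1)"
        using x by (simp add: powr_divide flip: powr_minus_divide)
      also have "real L powr e = real L powr (1 + 2 * e) * real L powr (- 1 - e)"
        using L by (simp flip: powr_add)
      also have "real L powr (1 + 2 * e) * real L powr (- 1 - e) * x powr (e - 1) \<le>
         real L powr (1 + 2 * e) * real h powr (- 1 - e) * x powr (e - 1)"
        using h e by (intro mult_right_mono mult_left_mono powr_mono2') auto
      finally show "(if sin (t * real h) = 0 then real L else min (real L) (1 / \<bar>sin (t * real h)\<bar>)) \<le>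
         real L powr (1 + 2 * e) * (real h powr (- 1 - e) * sin_pole e (t * real h))"
        using x by (simp add: m_def x_def sin_pole_def mult.assoc)
    qed
    also have "\<dots> = real L powr (1 + 2 * e) * (\<Sum>h<L-1. real (Suc h) powr (- 1 - e) * sin_pole e (t * real (Suc h)))"
      unfolding sum_distrib_left
      by (rule sum.reindex_bij_witness[of _ Suc "\<lambda>h. h - 1"]) (use False in auto)
    also have "\<dots> \<le> real L powr (1 + 2 * e) * S"
      unfolding S_def by (intro mult_left_mono sum_le_suminf S) (auto simp: sin_pole_def)
    finally have "(norm (\<Sum>n<L. schr_phase t (A + n) * cis (\<alpha> * real (A + n))))\<^sup>2 \<le> real L + 2 * (real L powr (1 + 2 * e) * S)"
      using weyl_inequality[of t A \<alpha> L] by linarith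
    also have "\<dots> \<le> real L powr (1 + 2 * e) + 2 * (real L powr (1 + 2 * e) * S)"
      using L e powr_mono[of 1 "1 + 2 * e" "real L"] by simp
    also have "\<dots> = (1 + 2 * S) * (real L powr (1/2 + e) * real L powr (1/2 + e))"
      by (simp add: algebra_simps flip: powr_add)
    also have "\<dots> = (sqrt (1 + 2 * S) * real L powr (1/2 + e))\<^sup>2"
      using S0 by (simp add: power2_eq_square power_mult_distrib)
    finally show ?thesis by (rule power2_le_imp_le) (use S0 in simp)
  qed simp
  then show ?thesis unfolding weyl_bounded_def by blast
qed

lemma weyl_bounded_mono:
  assumes "weyl_bounded t e K" "e \<le> e'"
  shows "weyl_bounded t e' \<bar>K\<bar>"
  unfolding weyl_bounded_def
proof (intro allI)
  fix L A :: nat and \<alpha> :: real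
  have "K * real L powr (1/2 + e) \<le> \<bar>K\<bar> * real L powr (1/2 + e')"
  proof (cases "L = 0")
    case False
    then show ?thesis using assms by (intro mult_mono powr_mono) auto
  qed simp
  then show "norm (\<Sum>n<L. schr_phase t (A + n) * cis (\<alpha> * real (A + n))) \<le> \<bar>K\<bar> * real L powr (1/2 + e')"
    using assms(1) unfolding weyl_bounded_def by (meson order_trans)
qed

text \<open>Outside a countable set of rational multiples of \<open>pi\<close> all
  \<open>sin (t * h)\<close> with \<open>h \<ge> 1\<close> are nonzero. The exponents
  \<open>1 / (k + 2)\<close> lie strictly between 0 and 1 and suffice by
  \<open>weyl_bounded_mono\<close>, so only countably many null sets are excluded.\<close>

theorem AE_weyl_bounded: "AE t in lborel. \<forall>e>0. \<exists>K. weyl_bounded t e K"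
proof -
  have "countable (\<Union>h\<in>{1..}. \<Union>i::int. {of_int i * pi / real (h::nat)})"
    by (intro countable_UN) auto
  then have "AE t in lborel. t \<notin> (\<Union>h\<in>{1..}. \<Union>i::int. {of_int i * pi / real (h::nat)})"
    by (intro AE_not_in countable_imp_null_set_lborel)
  moreover have "AE t in lborel. \<forall>k. summable (\<lambda>h. real (Suc h) powr (- 1 - 1 / real (k + 2)) *
      sin_pole (1 / real (k + 2)) (t * real (Suc h)))"
    unfolding AE_all_countable by (intro allI AE_sin_pole_summable) auto
  ultimately show ?thesis
  proof eventually_elim
    case (elim t)
    have nz: "sin (t * real h) \<noteq> 0" if h: "h \<ge> 1" for h
    proof
      assume "sin (t * real h) = 0"
      then obtain i :: int where "t * real h = of_int i * pi" unfolding sin_zero_iff_int2 by blast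
      then have "t = of_int i * pi / real h" using h by (simp add: field_simps)
      then show False using elim(1) h by blast
    qed
    show ?case
    proof (intro allI impI)
      fix e :: real assume "e > 0"
      then obtain k where k: "1 / real (Suc k) < e" using nat_approx_posE by blast
      have "1 / real (k + 2) \<le> 1 / real (Suc k)" by (simp add: field_simps)
      then have "1 / real (k + 2) \<le> e" using k by simp
      moreover obtain K where "weyl_bounded t (1 / real (k + 2)) K"
        using weyl_boundedI[of "1 / real (k + 2)" t] elim(2) nz by auto
      ultimately show "\<exists>K. weyl_bounded t e K" using weyl_bounded_mono by blast
    qed
  qed
qed

section \<open>Dyadic blocks of Legendre series\<close>

lemma summation_by_parts:
  fixes c x :: "nat \<Rightarrow> complex"
  assumes "N < M"
  shows "(\<Sum>n\<in>{N..<M}. c n * x n) =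
    c (M - 1) * (\<Sum>n\<in>{N..<M}. x n) - (\<Sum>n\<in>{N<..<M}. (c n - c (n - 1)) * (\<Sum>m\<in>{N..<n}. x m))"
proof -
  have "(\<Sum>n\<in>{N..<Suc M}. c n * x n) =
    c M * (\<Sum>n\<in>{N..<Suc M}. x n) - (\<Sum>n\<in>{N<..<Suc M}. (c n - c (n - 1)) * (\<Sum>m\<in>{N..<n}. x m))"
    if "N \<le> M" for M
    using that
  proof (induction M rule: dec_induct)
    case base
    show ?case by simp
  next
    case (step M)
    have "{N<..<Suc (Suc M)} = insert (Suc M) {N<..<Suc M}" using step by auto
    then show ?case using step by (simp add: algebra_simps)
  qed
  from this[of "M - 1"] show ?thesis using assms by simp
qed

lemma norm_summation_by_parts_le:
  fixes c x :: "nat \<Rightarrow> complex"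
  assumes "\<And>k. N \<le> k \<Longrightarrow> k \<le> M \<Longrightarrow> norm (\<Sum>n\<in>{N..<k}. x n) \<le> W" and "N < M"
  shows "norm (\<Sum>n\<in>{N..<M}. c n * x n) \<le> (norm (c (M - 1)) + (\<Sum>n\<in>{N<..<M}. norm (c n - c (n - 1)))) * W"
proof -
  have "norm (\<Sum>n\<in>{N..<M}. c n * x n) \<le> norm (c (M - 1) * (\<Sum>n\<in>{N..<M}. x n))
     + norm (\<Sum>n\<in>{N<..<M}. (c n - c (n - 1)) * (\<Sum>m\<in>{N..<n}. x m))"
    unfolding summation_by_parts[OF assms(2)] by (rule norm_triangle_ineq4)
  also have "\<dots> \<le> norm (c (M - 1)) * W + (\<Sum>n\<in>{N<..<M}. norm (c n - c (n - 1)) * W)"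
    using assms by (intro add_mono order_trans[OF norm_sum] sum_mono)
      (auto simp: norm_mult intro!: mult_left_mono)
  finally show ?thesis by (simp add: sum_distrib_right distrib_right)
qed

lemma sum_telescope_pred:
  fixes g :: "nat \<Rightarrow> real"
  assumes "N < M"
  shows "(\<Sum>n\<in>{N<..<M}. g (n - 1) - g n) = g N - g (M - 1)"
proof -
  have "(\<Sum>n\<in>{N<..<Suc M}. g (n - 1) - g n) = g N - g M" if "N \<le> M" for M
    using that
  proof (induction M rule: dec_induct)
    case (step M)
    have "{N<..<Suc (Suc M)} = insert (Suc M) {N<..<Suc M}" using step by auto
    then show ?case using step by simp
  next
    case base
    have "{N<..<Suc N} = {}" by auto
    then show ?case by simp
  qed
  from this[of "M - 1"] show ?thesis using assms by simp
qed

text \<open>The weights decrease, so their variation telescopes and the bound carries the first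
  weight only. The offset \<open>d\<close> is 0 for the blocks and 1 for their derivatives, where
  the exponent is \<open>n - 1\<close>.\<close>

lemma norm_sum_power_weight_le:
  fixes x :: "nat \<Rightarrow> complex" and r :: real
  assumes "\<And>k. N \<le> k \<Longrightarrow> k \<le> M \<Longrightarrow> norm (\<Sum>n\<in>{N..<k}. x n) \<le> W"
    and r: "0 \<le> r" "r \<le> 1" and "d \<le> N" "W \<ge> 0"
  shows "norm (\<Sum>n\<in>{N..<M}. of_real (r ^ (n - d)) * x n) \<le> r ^ (N - d) * W"
proof (cases "N < M")
  case True
  have eq: "(\<Sum>n\<in>{N<..<M}. r ^ (n - 1 - d) - r ^ (n - d)) = r ^ (N - d) - r ^ (M - 1 - d)"
    using sum_telescope_pred[OF True, of "\<lambda>n. r ^ (n - d)"] by simp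
  have "norm (\<Sum>n\<in>{N..<M}. of_real (r ^ (n - d)) * x n) \<le>
    (norm (complex_of_real (r ^ (M - 1 - d))) + (\<Sum>n\<in>{N<..<M}. norm (complex_of_real (r ^ (n - d)) - of_real (r ^ (n - 1 - d))))) * W"
    by (rule norm_summation_by_parts_le[OF assms(1) True])
  also have "(\<Sum>n\<in>{N<..<M}. norm (complex_of_real (r ^ (n - d)) - of_real (r ^ (n - 1 - d)))) =
     (\<Sum>n\<in>{N<..<M}. r ^ (n - 1 - d) - r ^ (n - d))"
  proof (intro sum.cong refl)
    fix n
    have "r ^ (n - d) \<le> r ^ (n - 1 - d)" using r by (intro power_decreasing) auto
    then show "norm (complex_of_real (r ^ (n - d)) - of_real (r ^ (n - 1 - d))) = r ^ (n - 1 - d) - r ^ (n - d)"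
      unfolding of_real_diff[symmetric] norm_of_real by simp
  qed
  finally show ?thesis unfolding eq using r by (simp add: norm_power)
qed (use assms in simp)

section \<open>Coefficients of bounded variation on a dyadic block\<close>

text \<open>The total variation over the block is at most \<open>A\<close>, so summation by parts
  against such coefficients costs a factor \<open>2 * A\<close>.\<close>

definition slowly_varying :: "nat \<Rightarrow> real \<Rightarrow> (nat \<Rightarrow> complex) \<Rightarrow> bool" where
  "slowly_varying N A c \<longleftrightarrow> A \<ge> 0 \<and> (\<forall>n\<in>{N..<2*N}. norm (c n) \<le> A) \<and>
     (\<forall>n\<in>{N<..<2*N}. norm (c n - c (n - 1)) \<le> A / real N)"

lemma slowly_varying_mult:
  assumes "slowly_varying N A c" "slowly_varying N B d"
  shows "slowly_varying N (2 * A * B) (\<lambda>n. c n * d n)"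
proof -
  have AB: "A \<ge> 0" "B \<ge> 0" using assms by (auto simp: slowly_varying_def)
  have "norm (c n * d n) \<le> 2 * A * B" if "n \<in> {N..<2*N}" for n
  proof -
    have "norm (c n * d n) \<le> A * B" unfolding norm_mult
      using assms that AB by (intro mult_mono) (auto simp: slowly_varying_def)
    moreover have "0 \<le> A * B" using AB by simp
    ultimately show ?thesis unfolding mult.assoc by linarith
  qed
  moreover have "norm (c n * d n - c (n - 1) * d (n - 1)) \<le> 2 * A * B / real N" if n: "n \<in> {N<..<2*N}" for n
  proof -
    have "c n * d n - c (n - 1) * d (n - 1) = (c n - c (n - 1)) * d n + c (n - 1) * (d n - d (n - 1))"
      by (simp add: algebra_simps)
    also have "norm \<dots> \<le> norm (c n - c (n - 1)) * norm (d n) + norm (c (n - 1)) * norm (d n - d (n - 1))"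
      by (rule order_trans[OF norm_triangle_ineq]) (simp add: norm_mult)
    also have "\<dots> \<le> A / real N * B + A * (B / real N)"
    proof -
      have "n - 1 \<in> {N..<2*N}" "n \<in> {N..<2*N}" using n by auto
      then show ?thesis
        using assms n AB unfolding slowly_varying_def by (intro add_mono mult_mono) auto
    qed
    finally show ?thesis by simp
  qed
  ultimately show ?thesis using AB unfolding slowly_varying_def by simp
qed

lemma slowly_varying_of_nat: "slowly_varying N (2 * real N) (\<lambda>n. of_nat n)"
proof -
  have "norm (complex_of_nat n - of_nat (n - 1)) \<le> 2 * real N / real N" if "n \<in> {N<..<2*N}" for n
    using that by (cases n) auto
  then show ?thesis by (auto simp: slowly_varying_def)
qed

lemma weyl_bounded_ge_1:
  assumes "weyl_bounded t e K"
  shows "K \<ge> 1"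
  using assms[unfolded weyl_bounded_def, rule_format, of 0 0 "Suc 0"] by (simp add: norm_mult)

text \<open>Write \<open>z = r * cis \<alpha>\<close>. The angle is absorbed by the linear phase in
  \<open>weyl_bounded\<close>, the powers of \<open>r\<close> by
  \<open>norm_sum_power_weight_le\<close>, and \<open>c\<close> by a second summation by parts. The
  bounds on the blocks below integrate this estimate.\<close>

lemma norm_weighted_weyl_sum_le:
  fixes z :: complex
  assumes W: "weyl_bounded t e K" and c: "slowly_varying N A c" and z: "norm z \<le> 1"
    and N: "N \<ge> 1" and d: "d \<le> N" and e: "e > 0"
  shows "norm (\<Sum>n\<in>{N..<2*N}. c n * schr_phase t n * z ^ (n - d)) \<le>
     2 * A * K * real N powr (1/2 + e) * norm z ^ (N - d)"
proof -
  define r where "r = norm z"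
  define \<alpha> where "\<alpha> = Arg z"
  define B where "B = K * real N powr (1/2 + e)"
  have K: "K \<ge> 1" by (rule weyl_bounded_ge_1[OF W])
  have B: "B \<ge> 0" using K by (simp add: B_def)
  have z_eq: "z = of_real r * cis \<alpha>"
    unfolding r_def \<alpha>_def by (metis rcis_cmod_Arg rcis_def)
  have r: "0 \<le> r" "r \<le> 1" using z by (auto simp: r_def)
  define x where "x n = schr_phase t n * cis (\<alpha> * real n)" for n
  have "norm (\<Sum>n\<in>{N..<k}. x n) \<le> B" if "N \<le> k" "k \<le> 2 * N" for k
  proof -
    have "(\<Sum>n\<in>{N..<k}. x n) = (\<Sum>n<k - N. x (N + n))"
      by (rule sum.reindex_bij_witness[of _ "\<lambda>n. N + n" "\<lambda>n. n - N"]) auto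
    also have "norm \<dots> \<le> K * real (k - N) powr (1/2 + e)"
      using W unfolding weyl_bounded_def x_def by blast
    also have "\<dots> \<le> B" unfolding B_def using that e K
      by (intro mult_left_mono powr_mono2) auto
    finally show ?thesis .
  qed
  then have 1: "norm (\<Sum>n\<in>{N..<k}. of_real (r ^ (n - d)) * x n) \<le> r ^ (N - d) * B" if "k \<le> 2 * N" for k
    using that r d B by (intro norm_sum_power_weight_le) auto
  have "norm (\<Sum>n\<in>{N..<2*N}. c n * (of_real (r ^ (n - d)) * x n)) \<le>
     (norm (c (2 * N - 1)) + (\<Sum>n\<in>{N<..<2*N}. norm (c n - c (n - 1)))) * (r ^ (N - d) * B)"
    using N 1 by (intro norm_summation_by_parts_le) auto
  also have "\<dots> \<le> (A + (\<Sum>n\<in>{N<..<2*N}. A / real N)) * (r ^ (N - d) * B)"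
    using c N r B by (intro mult_right_mono add_mono sum_mono) (auto simp: slowly_varying_def)
  also have "\<dots> \<le> (2 * A) * (r ^ (N - d) * B)"
  proof (rule mult_right_mono)
    have "A \<ge> 0" using c by (simp add: slowly_varying_def)
    then show "A + (\<Sum>n\<in>{N<..<2*N}. A / real N) \<le> 2 * A"
      using N by (simp add: field_simps mult_left_mono of_nat_diff)
  qed (use r B in simp)
  \<comment> \<open>The linear phase runs with \<open>n\<close> but the power of \<open>z\<close>
    with \<open>n - d\<close>; the difference is a common factor of modulus one.\<close>
  also have "(\<Sum>n\<in>{N..<2*N}. c n * (of_real (r ^ (n - d)) * x n)) =
      cis (\<alpha> * real d) * (\<Sum>n\<in>{N..<2*N}. c n * schr_phase t n * z ^ (n - d))"
    unfolding sum_distrib_left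
  proof (rule sum.cong[OF refl])
    fix n assume n: "n \<in> {N..<2*N}"
    have "z ^ (n - d) = of_real (r ^ (n - d)) * cis (\<alpha> * real (n - d))"
      unfolding z_eq by (simp add: power_mult_distrib Complex.DeMoivre mult.commute)
    moreover have "cis (\<alpha> * real n) = cis (\<alpha> * real d) * cis (\<alpha> * real (n - d))"
      using n d by (simp add: cis_mult of_nat_diff algebra_simps)
    ultimately show "c n * (of_real (r ^ (n - d)) * x n) = cis (\<alpha> * real d) * (c n * schr_phase t n * z ^ (n - d))"
      by (simp add: x_def)
  qed
  finally show ?thesis by (simp add: norm_mult r_def B_def mult_ac)
qed

text \<open>The value is at most \<open>(pi / 2) / sqrt N\<close>; this is the gain of half a power
  of \<open>N\<close> away from the poles.\<close>

lemma has_integral_bound_kernel: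
  assumes "N \<ge> 1"
  shows "((\<lambda>s. 1 / (1 + real N * s\<^sup>2)) has_integral (arctan (sqrt (real N)) / sqrt (real N))) {0..1}"
proof -
  have "((\<lambda>s. arctan (sqrt (real N) * s) / sqrt (real N)) has_vector_derivative 1 / (1 + real N * s\<^sup>2)) (at s within {0..1})" for s
    unfolding has_real_derivative_iff_has_vector_derivative[symmetric]
    using assms by (auto intro!: derivative_eq_intros simp: power_mult_distrib divide_inverse)
  then have "((\<lambda>s. 1 / (1 + real N * s\<^sup>2)) has_integral
      (arctan (sqrt (real N) * 1) / sqrt (real N) - arctan (sqrt (real N) * 0) / sqrt (real N))) {0..1}"
    by (intro fundamental_theorem_of_calculus) auto
  then show ?thesis by simp
qed

text \<open>Bernoulli's inequality bounds \<open>(1 + s\<^sup>2) ^ N\<close> from below, and its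
  product with \<open>(1 - s\<^sup>2) ^ N\<close> is at most 1.\<close>

lemma power_one_minus_sq_le:
  assumes "0 \<le> s" "s \<le> (1::real)"
  shows "(1 - s\<^sup>2) ^ N \<le> 1 / (1 + real N * s\<^sup>2)"
proof -
  have s: "s\<^sup>2 \<le> 1" using assms by (simp add: abs_square_le_1)
  have "1 + real N * s\<^sup>2 \<le> (1 + s\<^sup>2) ^ N"
    by (rule Bernoulli_inequality) (simp add: order_trans[of _ 0])
  then have "(1 - s\<^sup>2) ^ N * (1 + real N * s\<^sup>2) \<le> (1 - s\<^sup>2) ^ N * (1 + s\<^sup>2) ^ N"
    using s by (intro mult_left_mono) auto
  also have "\<dots> = (1 - s ^ 4) ^ N"
    by (simp add: power_mult_distrib[symmetric] algebra_simps power4_eq_xxxx power2_eq_square)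
  also have "\<dots> \<le> 1"
    using assms by (intro power_le_one) (auto simp: power_le_one)
  finally show ?thesis
    by (subst pos_le_divide_eq) (auto intro!: add_pos_nonneg)
qed

lemma power_pred_one_minus_sq_le:
  assumes "0 \<le> s" "s \<le> (1::real)" "N \<ge> 1"
  shows "(1 - s\<^sup>2) ^ (N - 1) \<le> 2 * (1 / (1 + real N * s\<^sup>2))"
proof -
  have s: "s\<^sup>2 \<le> 1" using assms by (simp add: abs_square_le_1)
  have "(1 - s\<^sup>2) ^ (N - 1) * (1 + real N * s\<^sup>2) =
     (1 - s\<^sup>2) ^ (N - 1) * (1 + real (N - 1) * s\<^sup>2) + (1 - s\<^sup>2) ^ (N - 1) * s\<^sup>2"
    using assms(3) by (simp add: of_nat_diff algebra_simps)
  also have "\<dots> \<le> 1 + 1"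
  proof (rule add_mono)
    have "0 < 1 + real (N - 1) * s\<^sup>2" by (auto intro!: add_pos_nonneg)
    then show "(1 - s\<^sup>2) ^ (N - 1) * (1 + real (N - 1) * s\<^sup>2) \<le> 1"
      using power_one_minus_sq_le[OF assms(1,2), of "N - 1"] by (simp add: pos_le_divide_eq)
    show "(1 - s\<^sup>2) ^ (N - 1) * s\<^sup>2 \<le> 1"
      using s power_le_one[of "1 - s\<^sup>2" "N - 1"] by (intro mult_le_one) auto
  qed
  finally have "(1 - s\<^sup>2) ^ (N - 1) * (1 + real N * s\<^sup>2) \<le> 2" by simp
  then have "(1 - s\<^sup>2) ^ (N - 1) \<le> 2 / (1 + real N * s\<^sup>2)"
    by (subst pos_le_divide_eq) (auto intro!: add_pos_nonneg)
  then show ?thesis by simp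
qed

lemma has_integral_cnj_I:
  assumes "f integrable_on A"
  shows "((\<lambda>x. cnj (f x)) has_integral cnj (integral A f)) A"
  using has_integral_linear[OF integrable_integral[OF assms] bounded_linear_cnj] by (simp add: o_def)

text \<open>The weights \<open>w n\<close> are complex, so the imaginary part cannot be taken after
  the summation. It is written as \<open>(z - cnj z) / (2 * \<i>)\<close>, which is why the sums
  with the integrands and with their conjugates are both bounded.\<close>

lemma norm_sum_Im_integral_le:
  fixes w :: "nat \<Rightarrow> complex" and f :: "nat \<Rightarrow> real \<Rightarrow> complex"
  assumes cont: "\<And>n. n \<in> I \<Longrightarrow> continuous_on {0..1} (f n)" and "finite I"
    and g: "(g has_integral G) {0..1}"
    and b1: "\<And>s. 0 \<le> s \<Longrightarrow> s \<le> 1 \<Longrightarrow> norm (\<Sum>n\<in>I. w n * f n s) \<le> g s"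
    and b2: "\<And>s. 0 \<le> s \<Longrightarrow> s \<le> 1 \<Longrightarrow> norm (\<Sum>n\<in>I. w n * cnj (f n s)) \<le> g s"
  shows "norm (\<Sum>n\<in>I. w n * of_real (Im (integral {0..1} (f n)))) \<le> G"
proof -
  have int: "f n integrable_on {0..1}" if "n \<in> I" for n
    using cont[OF that] by (rule integrable_continuous_real)
  have h1: "((\<lambda>s. \<Sum>n\<in>I. w n * f n s) has_integral (\<Sum>n\<in>I. w n * integral {0..1} (f n))) {0..1}"
    using int assms(2) by (intro has_integral_sum has_integral_mult_right integrable_integral) auto
  have h2: "((\<lambda>s. \<Sum>n\<in>I. w n * cnj (f n s)) has_integral (\<Sum>n\<in>I. w n * cnj (integral {0..1} (f n)))) {0..1}"
    using int assms(2) by (intro has_integral_sum has_integral_mult_right) (auto intro!: has_integral_cnj_I)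
  have n1: "norm (\<Sum>n\<in>I. w n * integral {0..1} (f n)) \<le> G"
    using Henstock_Kurzweil_Integration.integral_norm_bound_integral[OF has_integral_integrable[OF h1] has_integral_integrable[OF g]] b1
      integral_unique[OF h1] integral_unique[OF g] by auto
  have n2: "norm (\<Sum>n\<in>I. w n * cnj (integral {0..1} (f n))) \<le> G"
    using Henstock_Kurzweil_Integration.integral_norm_bound_integral[OF has_integral_integrable[OF h2] has_integral_integrable[OF g]] b2
      integral_unique[OF h2] integral_unique[OF g] by auto
  have "of_real (Im z) = (z - cnj z) / (2 * \<i>)" for z
    by (simp add: complex_eq_iff)
  then have "(\<Sum>n\<in>I. w n * of_real (Im (integral {0..1} (f n)))) =
     ((\<Sum>n\<in>I. w n * integral {0..1} (f n)) - (\<Sum>n\<in>I. w n * cnj (integral {0..1} (f n)))) / (2 * \<i>)"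
    by (simp add: sum_subtractf[symmetric] sum_divide_distrib algebra_simps)
  also have "norm \<dots> \<le> (G + G) / 2"
    unfolding norm_divide norm_mult
    by (simp, rule order_trans[OF norm_triangle_ineq4]) (use n1 n2 in linarith)
  finally show ?thesis by simp
qed

section \<open>Bounds on a block and on its derivative\<close>

definition leg_block :: "real \<Rightarrow> (nat \<Rightarrow> complex) \<Rightarrow> nat \<Rightarrow> real \<Rightarrow> complex" where
  "leg_block t c N \<theta> = (\<Sum>n\<in>{N..<2*N}. c n * schr_phase t n * of_real (leg n (cos \<theta>)))"

definition leg_block_deriv :: "real \<Rightarrow> (nat \<Rightarrow> complex) \<Rightarrow> nat \<Rightarrow> real \<Rightarrow> complex" where
  "leg_block_deriv t c N \<theta> = (\<Sum>n\<in>{N..<2*N}. c n * schr_phase t n * of_real (- sin \<theta> * dleg n (cos \<theta>)))"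

lemma leg_block_has_vector_derivative:
  "(leg_block t c N has_vector_derivative leg_block_deriv t c N \<theta>) (at \<theta> within S)"
proof -
  have "((\<lambda>\<theta>. leg n (cos \<theta>)) has_real_derivative - sin \<theta> * dleg n (cos \<theta>)) (at \<theta> within S)" for n
    using DERIV_chain2[OF poly_DERIV, of cos "- sin \<theta>" \<theta> S "legendre_poly n"]
    by (simp add: has_field_derivative_at_within mult.commute)
  then have "((\<lambda>\<theta>. complex_of_real (leg n (cos \<theta>))) has_vector_derivative of_real (- sin \<theta> * dleg n (cos \<theta>))) (at \<theta> within S)" for n
    by (intro has_vector_derivative_of_real) (simp add: has_real_derivative_iff_has_vector_derivative)
  then show ?thesis unfolding leg_block_def[abs_def] leg_block_deriv_def
    by (intro has_vector_derivative_sum has_vector_derivative_mult_right)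
qed

text \<open>For each \<open>\<phi>\<close> the base \<open>lapz \<theta> \<phi>\<close> lies in the
  unit disc, so the weighted Weyl bound applies under the integral. The factor \<open>g\<close> is 1
  for the block and the \<theta>-derivative of \<open>lapz\<close> for the derivative of the
  block.\<close>

lemma norm_sum_lapz_le:
  assumes c: "slowly_varying N A c" and W: "weyl_bounded t e K" and e: "e > 0" and N: "N \<ge> 1" and d: "d \<le> N"
    and g: "continuous_on {0..pi} g" "\<And>\<phi>. \<phi> \<in> {0..pi} \<Longrightarrow> norm (g \<phi>) \<le> 1"
  shows "norm (\<Sum>n\<in>{N..<2*N}. c n * schr_phase t n * integral {0..pi} (\<lambda>\<phi>. lapz \<theta> \<phi> ^ (n - d) * g \<phi>))
     \<le> pi * (2 * A * K * real N powr (1/2 + e))"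
proof -
  define B where "B = 2 * A * K * real N powr (1/2 + e)"
  have B: "B \<ge> 0" using weyl_bounded_ge_1[OF W] c by (simp add: B_def slowly_varying_def)
  define F where "F \<phi> = (\<Sum>n\<in>{N..<2*N}. c n * schr_phase t n * (lapz \<theta> \<phi> ^ (n - d) * g \<phi>))" for \<phi>
  have h: "(F has_integral (\<Sum>n\<in>{N..<2*N}. c n * schr_phase t n * integral {0..pi} (\<lambda>\<phi>. lapz \<theta> \<phi> ^ (n - d) * g \<phi>))) {0..pi}"
    unfolding F_def
    by (intro has_integral_sum has_integral_mult_right integrable_integral integrable_continuous_real
        continuous_intros g) auto
  have "norm (F \<phi>) \<le> B" if "\<phi> \<in> {0..pi}" for \<phi>
  proof -
    have "F \<phi> = (\<Sum>n\<in>{N..<2*N}. c n * schr_phase t n * lapz \<theta> \<phi> ^ (n - d)) * g \<phi>"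
      by (simp add: F_def sum_distrib_right mult.assoc)
    also have "norm \<dots> \<le> B * 1"
      unfolding norm_mult
    proof (rule mult_mono)
      have "norm (\<Sum>n\<in>{N..<2*N}. c n * schr_phase t n * lapz \<theta> \<phi> ^ (n - d)) \<le> B * norm (lapz \<theta> \<phi>) ^ (N - d)"
        unfolding B_def by (rule norm_weighted_weyl_sum_le[OF W c norm_lapz_le_1 N d e])
      also have "\<dots> \<le> B * 1"
        by (intro mult_left_mono power_le_one norm_lapz_le_1 B) auto
      finally show "norm (\<Sum>n\<in>{N..<2*N}. c n * schr_phase t n * lapz \<theta> \<phi> ^ (n - d)) \<le> B" by simp
    qed (use g(2) that B in auto)
    finally show ?thesis by simp
  qed
  moreover have "(\<lambda>_. B) integrable_on {0..pi}"
    by (rule integrable_const_ivl)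
  ultimately have "norm (integral {0..pi} F) \<le> integral {0..pi} (\<lambda>_. B)"
    by (intro Henstock_Kurzweil_Integration.integral_norm_bound_integral has_integral_integrable[OF h]) auto
  also have "integral {0..pi} (\<lambda>_. B) = pi * B"
    using has_integral_const_real[of B 0 pi] by (simp add: integral_unique)
  finally show ?thesis unfolding integral_unique[OF h] B_def .
qed

lemma norm_leg_block_le:
  assumes "slowly_varying N A c" "weyl_bounded t e K" "e > 0" "N \<ge> 1"
  shows "norm (leg_block t c N \<theta>) \<le> 2 * A * K * real N powr (1/2 + e)"
proof -
  have "of_real pi * leg_block t c N \<theta> =
    (\<Sum>n\<in>{N..<2*N}. c n * schr_phase t n * integral {0..pi} (\<lambda>\<phi>. lapz \<theta> \<phi> ^ (n - 0) * 1))"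
    unfolding leg_block_def sum_distrib_left
    by (intro sum.cong refl) (simp add: laplace_formula flip: laplace_int_def)
  then have "norm (of_real pi * leg_block t c N \<theta>) \<le> pi * (2 * A * K * real N powr (1/2 + e))"
    using norm_sum_lapz_le[OF assms, of 0 "\<lambda>_. 1" \<theta>] by simp
  then have "pi * norm (leg_block t c N \<theta>) \<le> pi * (2 * A * K * real N powr (1/2 + e))"
    by (simp only: norm_mult norm_of_real abs_of_pos[OF pi_gt_zero])
  then show ?thesis by (simp only: mult_le_cancel_left_pos[OF pi_gt_zero])
qed

text \<open>Formally Laplace's integral is differentiated under the integral sign, and
  \<open>?g\<close> is the \<theta>-derivative of \<open>lapz \<theta> \<phi>\<close>. The resulting
  formula is proved algebraically: after multiplication by \<open>sin \<theta>\<close> it reduces to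
  \<open>legendre_derivative\<close>.\<close>

lemma norm_leg_block_deriv_le:
  assumes c: "slowly_varying N A c" and W: "weyl_bounded t e K" and "e > 0" and N: "N \<ge> 1"
  shows "norm (leg_block_deriv t c N \<theta>) \<le> 8 * A * K * real N powr (3/2 + e)"
proof (cases "sin \<theta> = 0")
  case True
  have "A * K \<ge> 0" using weyl_bounded_ge_1[OF W] c by (simp add: slowly_varying_def)
  then show ?thesis using True by (simp add: leg_block_deriv_def)
next
  case False
  let ?g = "\<lambda>\<phi>. - of_real (sin \<theta>) + \<i> * of_real (cos \<theta>) * complex_of_real (cos \<phi>)"
  define \<sigma> where "\<sigma> = complex_of_real (sin \<theta>)"
  have sv: "slowly_varying N (4 * A * real N) (\<lambda>n. c n * of_nat n)"
    using slowly_varying_mult[OF c slowly_varying_of_nat] by (simp add: mult_ac)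
  have key: "of_real pi * of_real (- sin \<theta> * dleg n (cos \<theta>)) =
     of_nat n * integral {0..pi} (\<lambda>\<phi>. lapz \<theta> \<phi> ^ (n - 1) * ?g \<phi>)" if n: "n \<ge> 1" for n
  proof -
    define J where "J = integral {0..pi} (\<lambda>\<phi>. lapz \<theta> \<phi> ^ (n - 1) * ?g \<phi>)"
    have int: "(\<lambda>\<phi>. lapz \<theta> \<phi> ^ k) integrable_on {0..pi}" for k
      by (intro integrable_continuous_real continuous_intros)
    have "\<sigma> * (lapz \<theta> \<phi> ^ (n - 1) * ?g \<phi>) = of_real (cos \<theta>) * lapz \<theta> \<phi> ^ n - lapz \<theta> \<phi> ^ (n - 1)" for \<phi>
    proof -
      have "(complex_of_real (cos \<theta>))\<^sup>2 + \<sigma>\<^sup>2 = 1" by (simp add: \<sigma>_def flip: of_real_power of_real_add)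
      then have "\<sigma> * ?g \<phi> = of_real (cos \<theta>) * lapz \<theta> \<phi> - 1"
        unfolding lapz_def \<sigma>_def[symmetric] by (simp add: algebra_simps power2_eq_square)
      moreover have "lapz \<theta> \<phi> ^ n = lapz \<theta> \<phi> ^ (n - 1) * lapz \<theta> \<phi>"
        using n by (cases n) auto
      moreover have "\<sigma> * (lapz \<theta> \<phi> ^ (n - 1) * ?g \<phi>) = lapz \<theta> \<phi> ^ (n - 1) * (\<sigma> * ?g \<phi>)"
        by (simp only: mult.left_commute)
      moreover have "Z * (k * z - 1) = k * (Z * z) - Z" for Z k z :: complex
        by (simp add: algebra_simps)
      ultimately show ?thesis by (simp only:)
    qed
    then have "\<sigma> * integral {0..pi} (\<lambda>\<phi>. lapz \<theta> \<phi> ^ (n - 1) * ?g \<phi>) =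
       integral {0..pi} (\<lambda>\<phi>. of_real (cos \<theta>) * lapz \<theta> \<phi> ^ n - lapz \<theta> \<phi> ^ (n - 1))"
      by (simp only: integral_mult_right[symmetric])
    also have "\<dots> = of_real (cos \<theta>) * laplace_int \<theta> n - laplace_int \<theta> (n - 1)"
      unfolding laplace_int_def
      by (subst integral_diff) (auto intro!: int integrable_on_cmult_left simp: integral_mult_right)
    also have "\<dots> = of_real pi * of_real (cos \<theta> * leg n (cos \<theta>) - leg (n - 1) (cos \<theta>))"
      by (simp add: laplace_formula algebra_simps)
    finally have J: "\<sigma> * J = of_real pi * of_real (cos \<theta> * leg n (cos \<theta>) - leg (n - 1) (cos \<theta>))"
      unfolding J_def .
    have "\<sigma> * (of_nat n * J) = of_nat n * (of_real pi * of_real (cos \<theta> * leg n (cos \<theta>) - leg (n - 1) (cos \<theta>)))"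
      unfolding J[symmetric] by (rule mult.left_commute)
    also have "\<dots> = of_real pi * of_real (- (real n * (leg (n - 1) (cos \<theta>) - cos \<theta> * leg n (cos \<theta>))))"
      by (simp add: algebra_simps)
    also have "\<dots> = \<sigma> * (of_real pi * of_real (- sin \<theta> * dleg n (cos \<theta>)))"
    proof -
      have "1 - (cos \<theta>)\<^sup>2 = sin \<theta> * sin \<theta>"
        by (simp add: sin_squared_eq flip: power2_eq_square)
      then show ?thesis unfolding legendre_derivative[OF n, symmetric] \<sigma>_def by simp
    qed
    finally have eq: "\<sigma> * (of_nat n * J) = \<sigma> * (of_real pi * of_real (- sin \<theta> * dleg n (cos \<theta>)))" .
    have nz: "\<sigma> \<noteq> 0" using False by (simp add: \<sigma>_def)
    show ?thesis using eq unfolding mult_left_cancel[OF nz] J_def by (rule sym)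
  qed
  have "of_real pi * leg_block_deriv t c N \<theta> =
    (\<Sum>n\<in>{N..<2*N}. c n * of_nat n * schr_phase t n * integral {0..pi} (\<lambda>\<phi>. lapz \<theta> \<phi> ^ (n - 1) * ?g \<phi>))"
    unfolding leg_block_deriv_def sum_distrib_left
  proof (intro sum.cong refl)
    fix n assume "n \<in> {N..<2*N}"
    then have "n \<ge> 1" using N by auto
    note key = key[OF this]
    have "of_real pi * (c n * schr_phase t n * of_real (- sin \<theta> * dleg n (cos \<theta>))) =
        c n * schr_phase t n * (of_real pi * of_real (- sin \<theta> * dleg n (cos \<theta>)))"
      by (simp only: mult_ac)
    then show "of_real pi * (c n * schr_phase t n * of_real (- sin \<theta> * dleg n (cos \<theta>))) =
       c n * of_nat n * schr_phase t n * integral {0..pi} (\<lambda>\<phi>. lapz \<theta> \<phi> ^ (n - 1) * ?g \<phi>)"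
      unfolding key by (simp only: mult_ac)
  qed
  moreover have "norm (\<Sum>n\<in>{N..<2*N}. c n * of_nat n * schr_phase t n * integral {0..pi} (\<lambda>\<phi>. lapz \<theta> \<phi> ^ (n - 1) * ?g \<phi>))
     \<le> pi * (2 * (4 * A * real N) * K * real N powr (1/2 + e))"
  proof (rule norm_sum_lapz_le[OF sv W \<open>e > 0\<close> N N])
    fix \<phi> :: real
    have "(norm (?g \<phi>))\<^sup>2 = (sin \<theta>)\<^sup>2 + (cos \<theta>)\<^sup>2 * (cos \<phi>)\<^sup>2"
      by (simp add: cmod_power2 power_mult_distrib)
    also have "\<dots> \<le> (sin \<theta>)\<^sup>2 + (cos \<theta>)\<^sup>2"
      by (intro add_left_mono mult_left_le) (auto simp: abs_square_le_1)
    finally have "(norm (?g \<phi>))\<^sup>2 \<le> 1" by simp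
    then show "norm (?g \<phi>) \<le> 1" by (simp add: power2_le_iff_abs_le abs_square_le_1)
  qed (intro continuous_intros)
  ultimately have "norm (of_real pi * leg_block_deriv t c N \<theta>) \<le> pi * (8 * A * K * (real N * real N powr (1/2 + e)))"
    by (simp add: mult_ac)
  then have "pi * norm (leg_block_deriv t c N \<theta>) \<le> pi * (8 * A * K * (real N * real N powr (1/2 + e)))"
    by (simp add: norm_mult)
  then have "norm (leg_block_deriv t c N \<theta>) \<le> 8 * A * K * (real N * real N powr (1/2 + e))"
    by (simp only: mult_le_cancel_left_pos[OF pi_gt_zero])
  also have "real N * real N powr (1/2 + e) = real N powr (3/2 + e)"
  proof -
    have "real N * real N powr (1/2 + e) = real N powr 1 * real N powr (1/2 + e)" using N by simp
    also have "\<dots> = real N powr (3/2 + e)" by (subst powr_add[symmetric]) (simp add: add.commute)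
    finally show ?thesis .
  qed
  finally show ?thesis .
qed

lemma norm_ray_u: "0 \<le> s \<Longrightarrow> s \<le> 1 \<Longrightarrow> norm (ray_u \<theta> s) = 1 - s\<^sup>2"
  by (simp add: ray_u_def norm_mult abs_square_le_1 del: of_real_diff)

lemma norm_ray_D_pos:
  assumes "0 \<le> s" "s \<le> 1" "sin \<theta> > 0"
  shows "norm (ray_D \<theta> s) > 0"
  using norm_ray_D_ge(2)[OF assms(1,2), of \<theta>] assms(3)
  by (meson less_eq_real_def less_le_trans real_sqrt_gt_zero)

lemma sqrt_N_powr:
  assumes "N \<ge> 1"
  shows "real N powr (1/2 + e) / sqrt (real N) = real N powr e"
  using assms by (simp add: powr_add powr_half_sqrt)

text \<open>On the ray the Weyl bound decays like \<open>(1 - s\<^sup>2) ^ N\<close>, whose integral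
  over \<open>s\<close> gains \<open>N powr (-1/2)\<close>. The denominator \<open>ray_D\<close>, of
  modulus at least \<open>sqrt (sin \<theta>)\<close>, accounts for the weight.\<close>

lemma norm_leg_block_sqrt_le:
  assumes c: "slowly_varying N A c" and W: "weyl_bounded t e K" and e: "e > 0" and N: "N \<ge> 1"
    and \<theta>: "0 < \<theta>" "\<theta> < pi"
  shows "norm (leg_block t c N \<theta>) * sqrt (sin \<theta>) \<le> 4 * A * K * real N powr e"
proof -
  define B where "B = 2 * A * K * real N powr (1/2 + e)"
  have B: "B \<ge> 0" using weyl_bounded_ge_1[OF W] c by (simp add: B_def slowly_varying_def)
  have \<sigma>: "sin \<theta> > 0" using \<theta> sin_gt_zero by blast
  let ?f = "\<lambda>n s. ray_u \<theta> s ^ n * (2 * cis \<theta> / ray_D \<theta> s)"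
  define g where "g s = 2 * B / sqrt (sin \<theta>) * (1 / (1 + real N * s\<^sup>2))" for s
  define G where "G = 2 * B / sqrt (sin \<theta>) * (arctan (sqrt (real N)) / sqrt (real N))"
  have gG: "(g has_integral G) {0..1}"
    unfolding g_def G_def by (intro has_integral_mult_right has_integral_bound_kernel N)
  have bound: "norm (\<Sum>n\<in>{N..<2*N}. c n * schr_phase t n * (z ^ n * q)) \<le> g s"
    if s: "0 \<le> s" "s \<le> 1" and z: "norm z = 1 - s\<^sup>2" and q: "norm q = 2 / norm (ray_D \<theta> s)" for z q s
  proof -
    have s1: "s\<^sup>2 \<le> 1" using s by (simp add: abs_square_le_1)
    have "(\<Sum>n\<in>{N..<2*N}. c n * schr_phase t n * (z ^ n * q)) = (\<Sum>n\<in>{N..<2*N}. c n * schr_phase t n * z ^ (n - 0)) * q"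
      by (simp add: sum_distrib_right mult.assoc)
    also have "norm \<dots> \<le> (B * (1 - s\<^sup>2) ^ N) * (2 / sqrt (sin \<theta>))"
      unfolding norm_mult
    proof (rule mult_mono)
      have "norm z \<le> 1" using z by simp
      from norm_weighted_weyl_sum_le[OF W c this N _ e, of 0]
      show "norm (\<Sum>n\<in>{N..<2*N}. c n * schr_phase t n * z ^ (n - 0)) \<le> B * (1 - s\<^sup>2) ^ N"
        using z by (simp add: B_def)
      show "norm q \<le> 2 / sqrt (sin \<theta>)"
        unfolding q using norm_ray_D_ge(2)[OF s, of \<theta>] \<sigma> norm_ray_D_pos[OF s \<sigma>]
        by (intro divide_left_mono) auto
    qed (use B s1 in auto)
    also have "\<dots> \<le> (B * (1 / (1 + real N * s\<^sup>2))) * (2 / sqrt (sin \<theta>))"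
      using power_one_minus_sq_le[OF s] B \<sigma> by (intro mult_right_mono mult_left_mono) auto
    finally show ?thesis by (simp add: g_def mult_ac)
  qed
  have "norm (\<Sum>n\<in>{N..<2*N}. (c n * schr_phase t n) * of_real (Im (integral {0..1} (?f n)))) \<le> G"
  proof (rule norm_sum_Im_integral_le[OF _ _ gG])
    show "continuous_on {0..1} (?f n)" for n
      by (intro continuous_on_ray_integrand \<theta> continuous_intros continuous_on_ray_u)
    show "norm (\<Sum>n\<in>{N..<2*N}. c n * schr_phase t n * ?f n s) \<le> g s" if "0 \<le> s" "s \<le> 1" for s
      using that by (intro bound) (auto simp: norm_ray_u norm_divide norm_mult)
    show "norm (\<Sum>n\<in>{N..<2*N}. c n * schr_phase t n * cnj (?f n s)) \<le> g s" if "0 \<le> s" "s \<le> 1" for s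
      unfolding complex_cnj_mult complex_cnj_power
      using that by (intro bound) (auto simp: norm_ray_u norm_divide norm_mult)
  qed simp
  also have "(\<Sum>n\<in>{N..<2*N}. (c n * schr_phase t n) * of_real (Im (integral {0..1} (?f n)))) = of_real (pi / 2) * leg_block t c N \<theta>"
    unfolding leg_block_def sum_distrib_left
    by (intro sum.cong refl) (simp add: ray_formula[OF \<theta>] ray_int_def)
  finally have "pi / 2 * norm (leg_block t c N \<theta>) \<le> G" by (simp add: norm_mult)
  also have "G \<le> 2 * B / sqrt (sin \<theta>) * ((pi / 2) / sqrt (real N))"
    unfolding G_def using B \<sigma> arctan_ubound[of "sqrt (real N)"]
    by (intro mult_left_mono divide_right_mono) auto
  also have "\<dots> = pi / 2 * (2 * B / sqrt (real N) / sqrt (sin \<theta>))" by (simp add: mult_ac)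
  finally have "norm (leg_block t c N \<theta>) \<le> 2 * B / sqrt (real N) / sqrt (sin \<theta>)"
    by (simp only: mult_le_cancel_left_pos[OF pi_half_gt_zero])
  also have "2 * B / sqrt (real N) = 4 * A * K * (real N powr (1/2 + e) / sqrt (real N))"
    by (simp add: B_def)
  finally show ?thesis unfolding sqrt_N_powr[OF N] using \<sigma> by (simp add: field_simps)
qed

text \<open>This factor appears in the ray integrand of \<open>cos \<theta> * leg n (cos \<theta>) -
  leg (n - 1) (cos \<theta>)\<close>. At \<open>s = 0\<close> it has modulus
  \<open>sin \<theta>\<close>, because \<open>cos \<theta> * cis \<theta> - 1 = \<i> * sin \<theta>
  * cis \<theta>\<close>.\<close>

lemma norm_one_minus_cos_ray_u:
  assumes s: "0 \<le> s" "s \<le> 1" and "sin \<theta> \<ge> 0"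
  shows "norm (of_real (cos \<theta>) * ray_u \<theta> s - 1) \<le> s\<^sup>2 + sin \<theta>"
proof -
  have s1: "s\<^sup>2 \<le> 1" using s by (simp add: abs_square_le_1)
  have c: "of_real (cos \<theta>) * cis \<theta> - 1 = \<i> * of_real (sin \<theta>) * cis \<theta>"
    using sin_cos_squared_add3[of \<theta>] unfolding complex_eq_iff
    by (simp del: sin_cos_squared_add3)
  have "of_real (cos \<theta>) * ray_u \<theta> s - 1 =
      of_real (1 - s\<^sup>2) * (of_real (cos \<theta>) * cis \<theta> - 1) - of_real (s\<^sup>2)"
    by (simp add: ray_u_def algebra_simps)
  also have "norm \<dots> \<le> norm (of_real (1 - s\<^sup>2) * (of_real (cos \<theta>) * cis \<theta> - 1)) + norm (complex_of_real (s\<^sup>2))"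
    by (rule norm_triangle_ineq4)
  also have "\<dots> = (1 - s\<^sup>2) * sin \<theta> + s\<^sup>2"
    unfolding c norm_mult norm_of_real using s1 assms by simp
  also have "\<dots> \<le> 1 * sin \<theta> + s\<^sup>2"
    using assms by (intro add_right_mono mult_right_mono) auto
  finally show ?thesis by simp
qed

lemma has_integral_s_power:
  assumes "N \<ge> 1"
  shows "((\<lambda>s. 2 * s * (1 - s\<^sup>2) ^ (N - 1)) has_integral (1 / real N)) {0..(1::real)}"
proof -
  have "((\<lambda>s. - ((1 - s\<^sup>2) ^ N) / real N) has_vector_derivative 2 * s * (1 - s\<^sup>2) ^ (N - 1)) (at s within {0..1})" for s :: real
    unfolding has_real_derivative_iff_has_vector_derivative[symmetric]
    using assms by (auto intro!: derivative_eq_intros)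
  then have "((\<lambda>s. 2 * s * (1 - s\<^sup>2) ^ (N - 1)) has_integral
     (- ((1 - 1\<^sup>2) ^ N) / real N - (- ((1 - 0\<^sup>2) ^ N) / real N))) {0..(1::real)}"
    by (intro fundamental_theorem_of_calculus) auto
  then show ?thesis using assms by (simp add: zero_power)
qed

text \<open>By \<open>legendre_derivative\<close>,
  \<open>(sin \<theta>)\<^sup>2 * dleg n (cos \<theta>)\<close> is \<open>n\<close> times a
  difference whose ray integrand carries the factor
  \<open>cos \<theta> * ray_u \<theta> s - 1\<close>. The part \<open>s\<^sup>2\<close> of its bound
  integrates to order \<open>1 / N\<close>, the part \<open>sin \<theta>\<close> to order
  \<open>sqrt (sin \<theta>) / sqrt N\<close>.\<close>

lemma norm_leg_block_deriv_times_sin_le: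
  assumes c: "slowly_varying N A c" and W: "weyl_bounded t e K" and e: "e > 0" and N: "N \<ge> 1"
    and \<theta>: "0 < \<theta>" "\<theta> < pi"
  shows "norm (leg_block_deriv t c N \<theta>) * sin \<theta> \<le>
    16 / pi * A * K * real N powr (3/2 + e) * (1 / real N + 2 * pi * sqrt (sin \<theta>) / sqrt (real N))"
proof -
  define B where "B = 8 * A * K * real N powr (3/2 + e)"
  have B: "B \<ge> 0" using weyl_bounded_ge_1[OF W] c by (simp add: B_def slowly_varying_def)
  have sv: "slowly_varying N (4 * A * real N) (\<lambda>n. c n * of_nat n)"
    using slowly_varying_mult[OF c slowly_varying_of_nat] by (simp add: mult_ac)
  have B_eq: "2 * (4 * A * real N) * K * real N powr (1/2 + e) = B"
  proof -
    have "real N * real N powr (1/2 + e) = real N powr 1 * real N powr (1/2 + e)" using N by simp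
    also have "\<dots> = real N powr (3/2 + e)" by (subst powr_add[symmetric]) (simp add: add.commute)
    finally show ?thesis unfolding B_def by (simp add: mult_ac)
  qed
  have \<sigma>: "sin \<theta> > 0" using \<theta> sin_gt_zero by blast
  let ?q = "\<lambda>s. 2 * cis \<theta> / ray_D \<theta> s"
  let ?f = "\<lambda>n s. ray_u \<theta> s ^ (n - 1) * (of_real (cos \<theta>) * ray_u \<theta> s - 1) * ?q s"
  define g where "g s = B * (2 * s * (1 - s\<^sup>2) ^ (N - 1)) + 4 * B * sqrt (sin \<theta>) * (1 / (1 + real N * s\<^sup>2))" for s
  define G where "G = B * (1 / real N) + 4 * B * sqrt (sin \<theta>) * (arctan (sqrt (real N)) / sqrt (real N))"
  have gG: "(g has_integral G) {0..1}"
    unfolding g_def G_def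
    by (intro has_integral_add has_integral_mult_right has_integral_bound_kernel has_integral_s_power N)
  have bound: "norm (\<Sum>n\<in>{N..<2*N}. c n * of_nat n * schr_phase t n * (z ^ (n - 1) * v * q)) \<le> g s"
    if s: "0 \<le> s" "s \<le> 1" and z: "norm z = 1 - s\<^sup>2" and v: "norm v \<le> s\<^sup>2 + sin \<theta>"
      and q: "norm q = 2 / norm (ray_D \<theta> s)" for z v q s
  proof -
    have s1: "s\<^sup>2 \<le> 1" using s by (simp add: abs_square_le_1)
    have "(\<Sum>n\<in>{N..<2*N}. c n * of_nat n * schr_phase t n * (z ^ (n - 1) * v * q)) =
        (\<Sum>n\<in>{N..<2*N}. c n * of_nat n * schr_phase t n * z ^ (n - 1)) * (v * q)"
      by (simp add: sum_distrib_right mult.assoc)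
    also have "norm \<dots> \<le> (B * (1 - s\<^sup>2) ^ (N - 1)) * (2 * s + 2 * sqrt (sin \<theta>))"
      unfolding norm_mult[of "sum _ _"]
    proof (rule mult_mono)
      have "norm z \<le> 1" using z by simp
      from norm_weighted_weyl_sum_le[OF W sv this N _ e, of 1]
      show "norm (\<Sum>n\<in>{N..<2*N}. c n * of_nat n * schr_phase t n * z ^ (n - 1)) \<le> B * (1 - s\<^sup>2) ^ (N - 1)"
        using z N unfolding B_eq by simp
      \<comment> \<open>Each part of the numerator meets the lower bound of the denominator that
        suits it: \<open>s\<^sup>2\<close> is divided by \<open>s\<close>, and
        \<open>sin \<theta>\<close> by \<open>sqrt (sin \<theta>)\<close>.\<close>
      define D where "D = norm (ray_D \<theta> s)"
      have D: "D > 0" "s \<le> D" "sqrt (sin \<theta>) \<le> D"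
        using norm_ray_D_pos[OF s \<sigma>] norm_ray_D_ge[OF s] \<sigma> by (auto simp: D_def)
      have "s\<^sup>2 \<le> s * D" unfolding power2_eq_square using s D by (intro mult_left_mono) auto
      moreover have "sin \<theta> \<le> sqrt (sin \<theta>) * D"
      proof -
        have "sin \<theta> = sqrt (sin \<theta>) * sqrt (sin \<theta>)" using \<sigma> by simp
        also have "\<dots> \<le> sqrt (sin \<theta>) * D" using \<sigma> D by (intro mult_left_mono) auto
        finally show ?thesis .
      qed
      ultimately have "norm v \<le> (s + sqrt (sin \<theta>)) * D"
        using v by (simp add: algebra_simps)
      then have "norm v * (2 / D) \<le> (s + sqrt (sin \<theta>)) * D * (2 / D)"
        using D by (intro mult_right_mono) auto
      also have "\<dots> = 2 * s + 2 * sqrt (sin \<theta>)" using D by simp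
      finally show "norm (v * q) \<le> 2 * s + 2 * sqrt (sin \<theta>)"
        unfolding norm_mult q D_def .
    qed (use B s1 in auto)
    also have "\<dots> = B * (2 * s * (1 - s\<^sup>2) ^ (N - 1)) + 2 * B * sqrt (sin \<theta>) * (1 - s\<^sup>2) ^ (N - 1)"
      by (simp add: algebra_simps)
    also have "\<dots> \<le> B * (2 * s * (1 - s\<^sup>2) ^ (N - 1)) + 2 * B * sqrt (sin \<theta>) * (2 * (1 / (1 + real N * s\<^sup>2)))"
      using power_pred_one_minus_sq_le[OF s N] B \<sigma> by (intro add_left_mono mult_left_mono) auto
    finally show ?thesis by (simp add: g_def mult_ac)
  qed
  have "norm (\<Sum>n\<in>{N..<2*N}. (c n * of_nat n * schr_phase t n) * of_real (Im (integral {0..1} (?f n)))) \<le> G"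
  proof (rule norm_sum_Im_integral_le[OF _ _ gG])
    show "continuous_on {0..1} (?f n)" for n
      by (intro continuous_on_ray_integrand \<theta> continuous_intros continuous_on_ray_u)
    show "norm (\<Sum>n\<in>{N..<2*N}. c n * of_nat n * schr_phase t n * ?f n s) \<le> g s" if "0 \<le> s" "s \<le> 1" for s
      using that \<sigma> norm_one_minus_cos_ray_u[of s \<theta>]
      by (intro bound) (auto simp: norm_ray_u norm_divide norm_mult)
    show "norm (\<Sum>n\<in>{N..<2*N}. c n * of_nat n * schr_phase t n * cnj (?f n s)) \<le> g s" if "0 \<le> s" "s \<le> 1" for s
    proof -
      have "norm (cnj (of_real (cos \<theta>) * ray_u \<theta> s - 1)) \<le> s\<^sup>2 + sin \<theta>"
        unfolding complex_mod_cnj using that \<sigma> norm_one_minus_cos_ray_u[of s \<theta>] by simp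
      moreover have "norm (cnj (?q s)) = 2 / norm (ray_D \<theta> s)"
        by (simp add: norm_divide norm_mult)
      ultimately show ?thesis
        unfolding complex_cnj_mult[of "_ * _" "?q s"] complex_cnj_mult[of "_ ^ _"] complex_cnj_power
        using that by (intro bound) (auto simp: norm_ray_u)
    qed
  qed simp
  also have "(\<Sum>n\<in>{N..<2*N}. (c n * of_nat n * schr_phase t n) * of_real (Im (integral {0..1} (?f n)))) =
      of_real (pi / 2 * sin \<theta>) * leg_block_deriv t c N \<theta>"
    unfolding leg_block_deriv_def sum_distrib_left
  proof (intro sum.cong refl)
    fix n assume "n \<in> {N..<2*N}"
    then have n: "n \<ge> 1" using N by auto
    have int: "(\<lambda>s. ray_u \<theta> s ^ k * ?q s) integrable_on {0..1}" for k
      by (intro integrable_continuous_real continuous_on_ray_integrand \<theta> continuous_intros continuous_on_ray_u)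
    have "?f n = (\<lambda>s. of_real (cos \<theta>) * (ray_u \<theta> s ^ n * ?q s) - ray_u \<theta> s ^ (n - 1) * ?q s)"
    proof
      fix s
      have "ray_u \<theta> s ^ n = ray_u \<theta> s ^ (n - 1) * ray_u \<theta> s" using n by (cases n) auto
      then show "?f n s = of_real (cos \<theta>) * (ray_u \<theta> s ^ n * ?q s) - ray_u \<theta> s ^ (n - 1) * ?q s"
        by (simp only: left_diff_distrib right_diff_distrib mult_1_right mult_1_left mult_ac)
    qed
    then have "integral {0..1} (?f n) = of_real (cos \<theta>) * ray_int \<theta> n - ray_int \<theta> (n - 1)"
      unfolding ray_int_def using int
      by (simp only: integral_diff integrable_on_cmult_left integral_mult_right)
    then have "Im (integral {0..1} (?f n)) = cos \<theta> * Im (ray_int \<theta> n) - Im (ray_int \<theta> (n - 1))"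
      by simp
    also have "\<dots> = pi / 2 * (cos \<theta> * leg n (cos \<theta>) - leg (n - 1) (cos \<theta>))"
      unfolding ray_formula[OF \<theta>] by (simp add: algebra_simps)
    finally have Y: "Im (integral {0..1} (?f n)) = pi / 2 * (cos \<theta> * leg n (cos \<theta>) - leg (n - 1) (cos \<theta>))" .
    have "real n * Im (integral {0..1} (?f n)) =
        - (pi / 2) * (real n * (leg (n - 1) (cos \<theta>) - cos \<theta> * leg n (cos \<theta>)))"
      unfolding Y by (simp add: algebra_simps)
    also have "\<dots> = pi / 2 * sin \<theta> * (- sin \<theta> * dleg n (cos \<theta>))"
      unfolding legendre_derivative[OF n, symmetric] sin_squared_eq[symmetric]
      by (simp add: power2_eq_square)
    finally have *: "real n * Im (integral {0..1} (?f n)) = pi / 2 * sin \<theta> * (- sin \<theta> * dleg n (cos \<theta>))" .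
    have "c n * of_nat n * schr_phase t n * of_real (Im (integral {0..1} (?f n))) =
        c n * schr_phase t n * of_real (real n * Im (integral {0..1} (?f n)))"
      by (simp only: of_real_mult of_real_of_nat_eq mult_ac)
    then show "c n * of_nat n * schr_phase t n * of_real (Im (integral {0..1} (?f n))) =
       of_real (pi / 2 * sin \<theta>) * (c n * schr_phase t n * of_real (- sin \<theta> * dleg n (cos \<theta>)))"
      unfolding * of_real_mult by (simp only: mult_ac)
  qed
  finally have "pi / 2 * (norm (leg_block_deriv t c N \<theta>) * sin \<theta>) \<le> G"
    using \<sigma> by (simp add: norm_mult mult_ac)
  also have "G \<le> B * (1 / real N) + 4 * B * sqrt (sin \<theta>) * ((pi / 2) / sqrt (real N))"
    unfolding G_def using B \<sigma> arctan_ubound[of "sqrt (real N)"]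
    by (intro add_left_mono mult_left_mono divide_right_mono) auto
  also have "\<dots> = pi / 2 * (2 * B / pi * (1 / real N + 2 * pi * sqrt (sin \<theta>) / sqrt (real N)))"
    by (simp add: algebra_simps)
  finally have "norm (leg_block_deriv t c N \<theta>) * sin \<theta> \<le> 2 * B / pi * (1 / real N + 2 * pi * sqrt (sin \<theta>) / sqrt (real N))"
    by (simp only: mult_le_cancel_left_pos[OF pi_half_gt_zero])
  also have "2 * B / pi = 16 / pi * A * K * real N powr (3/2 + e)" by (simp add: B_def)
  finally show ?thesis .
qed

text \<open>For \<open>N * sin \<theta> \<le> 1\<close> the bound valid up to the poles is enough.
  Beyond, the term with \<open>1 / N\<close> in the previous lemma is dominated by the other one.
  The constant is \<open>6 + 32\<close>, with \<open>16 / pi \<le> 6\<close>.\<close>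

lemma norm_leg_block_deriv_sqrt_le:
  assumes c: "slowly_varying N A c" and W: "weyl_bounded t e K" and e: "e > 0" and N: "N \<ge> 1"
    and \<theta>: "0 < \<theta>" "\<theta> < pi"
  shows "norm (leg_block_deriv t c N \<theta>) * sqrt (sin \<theta>) \<le> 38 * A * K * real N powr (1 + e)"
proof -
  define x where "x = norm (leg_block_deriv t c N \<theta>)"
  define \<sigma> where "\<sigma> = sqrt (sin \<theta>)"
  define r where "r = sqrt (real N)"
  define B where "B = A * K * real N powr (1 + e)"
  have B: "B \<ge> 0" using weyl_bounded_ge_1[OF W] c by (simp add: B_def slowly_varying_def)
  have sin: "sin \<theta> > 0" using \<theta> sin_gt_zero by blast
  have \<sigma>: "\<sigma> > 0" "sin \<theta> = \<sigma> * \<sigma>" using sin by (auto simp: \<sigma>_def)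
  have r: "r > 0" "real N = r * r" using N by (auto simp: r_def)
  have Br: "A * K * real N powr (3/2 + e) = B * r"
  proof -
    have "real N powr (3/2 + e) = real N powr (1 + e) * real N powr (1/2)"
      by (subst powr_add[symmetric]) (simp add: add.commute)
    then show ?thesis using N by (simp add: B_def r_def powr_half_sqrt)
  qed
  have 1: "x \<le> 8 * B * r"
    using norm_leg_block_deriv_le[OF c W e N, of \<theta>] Br by (simp add: x_def mult.assoc)
  have "x * (\<sigma> * \<sigma>) \<le> 16 / pi * (B * r) * (1 / (r * r) + 2 * pi * \<sigma> / r)"
  proof -
    have "x * sin \<theta> \<le> 16 / pi * (A * K * real N powr (3/2 + e)) * (1 / real N + 2 * pi * \<sigma> / r)"
      using norm_leg_block_deriv_times_sin_le[OF c W e N \<theta>]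
      unfolding x_def[symmetric] \<sigma>_def[symmetric] r_def[symmetric] by (simp only: mult.assoc)
    from this[unfolded Br] show ?thesis by (simp only: \<sigma>(2) r(2))
  qed
  also have "\<dots> = 16 / pi * B * (1 / r) + 32 * B * \<sigma>"
    using r by (simp add: field_simps)
  finally have 2: "x * (\<sigma> * \<sigma>) \<le> 16 / pi * B * (1 / r) + 32 * B * \<sigma>" .
  have "x * \<sigma> \<le> 38 * B"
  proof (cases "r * \<sigma> \<le> 1")
    case True
    have "x * \<sigma> \<le> 8 * B * r * \<sigma>" using 1 \<sigma> by (intro mult_right_mono) auto
    also have "\<dots> = 8 * B * (r * \<sigma>)" by simp
    also have "\<dots> \<le> 8 * B * 1" using True B by (intro mult_left_mono) auto
    finally show ?thesis using B by simp
  next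
    case False
    then have "1 / r \<le> \<sigma>" using r by (simp add: field_simps)
    then have "16 / pi * B * (1 / r) \<le> 16 / pi * B * \<sigma>" using B by (intro mult_left_mono) auto
    also have "\<dots> \<le> 6 * B * \<sigma>"
      using B \<sigma> pi_gt3 by (intro mult_right_mono) (auto simp: field_simps)
    finally have "(x * \<sigma>) * \<sigma> \<le> (38 * B) * \<sigma>" using 2 by (simp add: algebra_simps)
    then show ?thesis using \<sigma> by (simp only: mult_le_cancel_right_pos)
  qed
  then show ?thesis by (simp add: x_def \<sigma>_def B_def mult.assoc)
qed

section \<open>The profile of the solution\<close>

lemma norm_diff_le_deriv_bound:
  fixes f :: "real \<Rightarrow> complex"
  assumes "\<And>x. (f has_vector_derivative f' x) (at x)"
    and "\<And>x. min a b < x \<Longrightarrow> x < max a b \<Longrightarrow> norm (f' x) \<le> B"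
  shows "norm (f a - f b) \<le> \<bar>a - b\<bar> * B"
proof -
  have main: "norm (f d - f c) \<le> \<bar>d - c\<bar> * B" if cd: "c < d" and B: "\<And>x. c < x \<Longrightarrow> x < d \<Longrightarrow> norm (f' x) \<le> B" for c d
  proof -
    have "continuous_on {c..d} f"
      by (intro continuous_at_imp_continuous_on ballI) (use assms(1) has_vector_derivative_continuous in blast)
    from mvt_general[OF cd this, of "\<lambda>x h. h *\<^sub>R f' x"] assms(1)
    obtain x where x: "x \<in> {c<..<d}" "norm (f d - f c) \<le> norm ((d - c) *\<^sub>R f' x)"
      unfolding has_vector_derivative_def by blast
    have "norm ((d - c) *\<^sub>R f' x) = \<bar>d - c\<bar> * norm (f' x)" by simp
    also have "\<dots> \<le> \<bar>d - c\<bar> * B" using B x by (intro mult_left_mono) auto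
    finally show ?thesis using x(2) by linarith
  qed
  show ?thesis
  proof (cases a b rule: linorder_cases)
    case less
    then show ?thesis using main[of a b] assms(2) by (simp add: norm_minus_commute abs_minus_commute)
  next
    case greater
    then show ?thesis using main[of b a] assms(2) by simp
  qed simp
qed

text \<open>The core is \<open>min 1 x \<le> x powr \<gamma>\<close> for exponents between 0 and
  1.\<close>

lemma min_le_powr_interpolation:
  fixes x P \<tau> M :: real
  assumes "x \<le> P" "x \<le> P * (\<tau> * M)" "0 \<le> \<gamma>" "\<gamma> \<le> 1" "\<tau> \<ge> 0" "M > 0" "P \<ge> 0"
  shows "x \<le> P * (\<tau> powr \<gamma> * M powr \<gamma>)"
proof (cases "\<tau> = 0")
  case True
  then show ?thesis using assms by auto
next
  case False
  then have "\<tau> > 0" using assms by simp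
  have eq: "\<tau> powr \<gamma> * M powr \<gamma> = (\<tau> * M) powr \<gamma>"
    using assms by (simp add: powr_mult)
  have "min 1 (\<tau> * M) \<le> (\<tau> * M) powr \<gamma>"
  proof (cases "\<tau> * M \<le> 1")
    case True
    then have "(\<tau> * M) powr 1 \<le> (\<tau> * M) powr \<gamma>"
      using assms by (intro powr_mono') auto
    then show ?thesis using True assms \<open>\<tau> > 0\<close> by simp
  next
    case False
    then show ?thesis using assms ge_one_powr_ge_zero[of "\<tau> * M" \<gamma>] by simp
  qed
  then have "P * min 1 (\<tau> * M) \<le> P * (\<tau> powr \<gamma> * M powr \<gamma>)"
    unfolding eq using assms by (intro mult_left_mono) auto
  moreover have "x \<le> P * min 1 (\<tau> * M)"
    using assms by (simp add: min_def)
  ultimately show ?thesis by linarith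
qed

lemma self_le_twice: "(x::real) \<ge> 0 \<Longrightarrow> x \<le> 2 * x"
  by simp

lemma two_power_powr: "(2 ^ i :: real) powr x = (2 powr x) ^ i"
  by (simp add: powr_realpow[symmetric] powr_powr powr_power mult.commute)

lemma summable_two_power_powr:
  assumes "x < 0"
  shows "summable (\<lambda>i. (2 ^ i :: real) powr x)"
proof -
  have "2 powr x < (1 :: real)" using assms by (simp add: powr_less_one)
  then show ?thesis unfolding two_power_powr by (intro summable_geometric) auto
qed

text \<open>Each dyadic difference is bounded by its size and by its derivative times \<tau>.
  Interpolation with exponent \<gamma> leads to a geometric series of ratio
  \<open>2 powr (\<beta> + \<gamma>)\<close>, and its convergence limits \<gamma>.\<close>

lemma norm_suminf_diff_le_interpolation:
  fixes u v :: "nat \<Rightarrow> complex"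
  assumes u: "summable u" and v: "summable v"
    and 1: "\<And>i. norm (u i - v i) \<le> P * (2 ^ i) powr \<beta>"
    and 2: "\<And>i. norm (u i - v i) \<le> P * \<tau> * (2 ^ i) powr (\<beta> + 1)"
    and g: "0 \<le> \<gamma>" "\<gamma> \<le> 1" "\<beta> + \<gamma> < 0" "\<tau> \<ge> 0" "P \<ge> 0"
  shows "norm (suminf u - suminf v) \<le> P * (\<Sum>i. (2 ^ i) powr (\<beta> + \<gamma>)) * \<tau> powr \<gamma>"
proof -
  have b: "norm (u i - v i) \<le> P * \<tau> powr \<gamma> * (2 ^ i) powr (\<beta> + \<gamma>)" for i
  proof -
    have "norm (u i - v i) \<le> (P * (2 ^ i) powr \<beta>) * (\<tau> powr \<gamma> * (2 ^ i) powr \<gamma>)"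
      using 1[of i] 2[of i] g
      by (intro min_le_powr_interpolation) (auto simp: powr_add algebra_simps)
    then show ?thesis by (simp add: powr_add algebra_simps)
  qed
  have s: "summable (\<lambda>i. P * \<tau> powr \<gamma> * (2 ^ i) powr (\<beta> + \<gamma>))"
    by (intro summable_mult summable_two_power_powr g)
  have "suminf u - suminf v = (\<Sum>i. u i - v i)"
    by (rule suminf_diff[OF u v])
  also have "norm \<dots> \<le> (\<Sum>i. P * \<tau> powr \<gamma> * (2 ^ i) powr (\<beta> + \<gamma>))"
    by (rule norm_suminf_le[OF b s])
  also have "\<dots> = P * \<tau> powr \<gamma> * (\<Sum>i. (2 ^ i) powr (\<beta> + \<gamma>))"
    by (intro suminf_mult summable_two_power_powr g)
  finally show ?thesis by (simp add: mult_ac)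
qed

section \<open>Size and variation of the coefficients\<close>

locale zonal_coeffs =
  fixes a :: "nat \<Rightarrow> complex" and p C :: real
  assumes p1: "1 < p" and p2: "p < 2"
    and a_bound: "\<And>n. n \<ge> 1 \<Longrightarrow> norm (a n) \<le> C / real n powr p"
    and a_diff: "\<And>n. n \<ge> 1 \<Longrightarrow> norm (a n - a (n - 1)) \<le> C / real n powr (p + 1)"
begin

lemma C_nonneg: "C \<ge> 0"
  using a_bound[of 1] norm_ge_zero[of "a 1"] by (simp del: norm_ge_zero)

text \<open>The coefficients with respect to the unnormalised polynomials \<open>leg n\<close>; the
  normalising factor turns the decay \<open>n powr (- p)\<close> into
  \<open>n powr (1/2 - p)\<close>.\<close>

definition b :: "nat \<Rightarrow> complex" where
  "b n = a n * of_real (sqrt (2 * real n + 1))"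

lemma slowly_varying_a:
  assumes N: "N \<ge> 1"
  shows "slowly_varying N (C * real N powr (- p)) a"
proof -
  have "norm (a n) \<le> C * real N powr (- p)" if n: "n \<in> {N..<2*N}" for n
  proof -
    have "norm (a n) \<le> C * real n powr (- p)"
      using a_bound[of n] n N by (simp add: powr_minus divide_inverse)
    also have "\<dots> \<le> C * real N powr (- p)"
      using n N p1 C_nonneg by (intro mult_left_mono powr_mono2') auto
    finally show ?thesis .
  qed
  moreover have "norm (a n - a (n - 1)) \<le> C * real N powr (- p) / real N" if n: "n \<in> {N<..<2*N}" for n
  proof -
    have "norm (a n - a (n - 1)) \<le> C * real n powr (- p - 1)"
      using a_diff[of n] n N by (simp add: powr_minus[symmetric] divide_inverse)
    also have "\<dots> \<le> C * real N powr (- p - 1)"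
      using n N p1 C_nonneg by (intro mult_left_mono powr_mono2') auto
    also have "\<dots> = C * real N powr (- p) / real N"
      using N by (simp add: powr_diff)
    finally show ?thesis .
  qed
  ultimately show ?thesis using C_nonneg by (simp add: slowly_varying_def)
qed

text \<open>The squares of consecutive values differ by 2, so the values differ by 2 over their
  sum.\<close>

lemma slowly_varying_sqrt:
  assumes N: "N \<ge> 1"
  shows "slowly_varying N (3 * sqrt (real N)) (\<lambda>n. of_real (sqrt (2 * real n + 1)))"
proof -
  have "sqrt (2 * real n + 1) \<le> 3 * sqrt (real N)" if "n \<in> {N..<2*N}" for n
  proof -
    have "2 * real n + 1 \<le> 3\<^sup>2 * real N" using that by auto
    then have "sqrt (2 * real n + 1) \<le> sqrt (3\<^sup>2 * real N)" by (rule real_sqrt_le_mono)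
    then show ?thesis by (simp add: real_sqrt_mult)
  qed
  moreover have "norm (complex_of_real (sqrt (2 * real n + 1)) - of_real (sqrt (2 * real (n - 1) + 1))) \<le> 3 * sqrt (real N) / real N"
    if n: "n \<in> {N<..<2*N}" for n
  proof -
    define x where "x = sqrt (2 * real n + 1)"
    define y where "y = sqrt (2 * real (n - 1) + 1)"
    have xy: "x\<^sup>2 - y\<^sup>2 = 2" using n by (simp add: x_def y_def of_nat_diff)
    have xN: "sqrt (real N) \<le> x" unfolding x_def using n by (intro real_sqrt_le_mono) auto
    have y0: "y \<ge> 0" by (simp add: y_def)
    have r: "sqrt (real N) > 0" using N by simp
    have yx: "y \<le> x" unfolding x_def y_def by (intro real_sqrt_le_mono) auto
    have "(x - y) * sqrt (real N) \<le> (x - y) * (x + y)"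
      using xN y0 yx by (intro mult_left_mono) auto
    also have "\<dots> = 2" using xy by (simp add: power2_eq_square algebra_simps)
    finally have "x - y \<le> 2 / sqrt (real N)" using r by (simp add: field_simps)
    also have "\<dots> \<le> 3 / sqrt (real N)" using r by (intro divide_right_mono) auto
    also have "\<dots> = 3 * sqrt (real N) / real N" using N by (simp add: real_div_sqrt field_simps)
    finally show ?thesis
      unfolding x_def[symmetric] y_def[symmetric] of_real_diff[symmetric] norm_of_real using yx by simp
  qed
  ultimately show ?thesis by (simp add: slowly_varying_def)
qed

lemma slowly_varying_b:
  assumes N: "N \<ge> 1"
  shows "slowly_varying N (6 * C * real N powr (1/2 - p)) b"
proof -
  have "2 * (C * real N powr (- p)) * (3 * sqrt (real N)) = 6 * C * real N powr (1/2 - p)"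
    using N by (simp add: powr_half_sqrt[symmetric] powr_add[symmetric] mult_ac)
  with slowly_varying_mult[OF slowly_varying_a[OF N] slowly_varying_sqrt[OF N]]
  show ?thesis by (simp add: b_def[abs_def])
qed

lemma slowly_varying_inverse_eigenvalue:
  assumes N: "N \<ge> 1"
  shows "slowly_varying N (2 / (real N)\<^sup>2) (\<lambda>n. of_real (1 / (real n * (real n + 1))))"
proof -
  have "1 / (real n * (real n + 1)) \<le> 2 / (real N)\<^sup>2" if n: "n \<in> {N..<2*N}" for n
  proof -
    have "(real N)\<^sup>2 \<le> real n * (real n + 1)"
      unfolding power2_eq_square using n by (intro mult_mono) auto
    then have "1 / (real n * (real n + 1)) \<le> 1 / (real N)\<^sup>2"
      using N n by (intro divide_left_mono mult_pos_pos) auto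
    also have "\<dots> \<le> 2 / (real N)\<^sup>2" by (intro divide_right_mono) auto
    finally show ?thesis .
  qed
  moreover have "norm (complex_of_real (1 / (real n * (real n + 1))) - of_real (1 / (real (n - 1) * (real (n - 1) + 1)))) \<le> 2 / (real N)\<^sup>2 / real N"
    if n: "n \<in> {N<..<2*N}" for n
  proof -
    define x where "x = real (n - 1)"
    have x: "real n = x + 1" "x \<ge> real N" "x > 0" using n N by (auto simp: x_def of_nat_diff)
    have "1 / (x * (x + 1)) - 1 / ((x + 1) * (x + 1 + 1)) = 2 / (x * (x + 1) * (x + 2))"
      using x(3) by (simp add: divide_simps add_pos_pos)
    moreover have "\<dots> \<le> 2 / (real N * real N * real N)"
      using x N by (intro divide_left_mono mult_mono) auto
    moreover have "2 / (x * (x + 1) * (x + 2)) \<ge> 0" using x by simp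
    ultimately have "\<bar>1 / ((x + 1) * (x + 1 + 1)) - 1 / (x * (x + 1))\<bar> \<le> 2 / (real N * real N * real N)"
      by linarith
    then show ?thesis
      unfolding of_real_diff[symmetric] norm_of_real x_def[symmetric] x(1) by (simp add: power2_eq_square)
  qed
  ultimately show ?thesis unfolding slowly_varying_def norm_of_real by simp
qed

text \<open>Division by the eigenvalue gains two powers of \<open>N\<close>. These are the
  coefficients of the function \<open>H\<close> in the lower bound.\<close>

lemma slowly_varying_b_over_eigenvalue:
  assumes N: "N \<ge> 1"
  shows "slowly_varying N (24 * C * real N powr (- 3/2 - p)) (\<lambda>n. b n * of_real (1 / (real n * (real n + 1))))"
proof -
  have "real N powr (- 2) = 1 / (real N)\<^sup>2"
    unfolding powr_minus_divide using N by simp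
  then have "2 * (6 * C * real N powr (1/2 - p)) * (2 / (real N)\<^sup>2) = 24 * C * (real N powr (1/2 - p) * real N powr (- 2))"
    by simp
  also have "real N powr (1/2 - p) * real N powr (- 2) = real N powr (- 3/2 - p)"
    by (subst powr_add[symmetric]) (simp add: algebra_simps)
  finally show ?thesis
    using slowly_varying_mult[OF slowly_varying_b[OF N] slowly_varying_inverse_eigenvalue[OF N]] by simp
qed

end

section \<open>The profile at a good time: its blocks, its sum and its moduli of continuity\<close>

locale zonal_time = zonal_coeffs +
  fixes t :: real
  assumes weyl: "\<And>e. e > 0 \<Longrightarrow> \<exists>K. weyl_bounded t e K"
begin

definition T :: "nat \<Rightarrow> real \<Rightarrow> complex" where "T i = leg_block t b (2 ^ i)"
definition T' :: "nat \<Rightarrow> real \<Rightarrow> complex" where "T' i = leg_block_deriv t b (2 ^ i)"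

lemma T_deriv: "(T i has_vector_derivative T' i \<theta>) (at \<theta> within S)"
  unfolding T_def T'_def by (rule leg_block_has_vector_derivative)

lemma continuous_on_T: "continuous_on S (T i)"
  using has_vector_derivative_continuous[OF T_deriv] continuous_on_eq_continuous_within by blast

lemma T_bounds:
  assumes e: "e > 0"
  obtains D where "D \<ge> 0"
    "\<And>i \<theta>. norm (T i \<theta>) \<le> D * (2 ^ i) powr (1 - p + e)"
    "\<And>i \<theta>. norm (T' i \<theta>) \<le> D * (2 ^ i) powr (2 - p + e)"
    "\<And>i \<theta>. 0 < \<theta> \<Longrightarrow> \<theta> < pi \<Longrightarrow> norm (T i \<theta>) * sqrt (sin \<theta>) \<le> D * (2 ^ i) powr (1/2 - p + e)"
    "\<And>i \<theta>. 0 < \<theta> \<Longrightarrow> \<theta> < pi \<Longrightarrow> norm (T' i \<theta>) * sqrt (sin \<theta>) \<le> D * (2 ^ i) powr (3/2 - p + e)"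
proof -
  obtain K where K: "weyl_bounded t e K" using weyl[OF e] by blast
  have K1: "K \<ge> 1" by (rule weyl_bounded_ge_1[OF K])
  have CK: "C * K \<ge> 0" using C_nonneg K1 by simp
  have N: "(2 ^ i :: nat) \<ge> 1" for i by simp
  have mono: "c * C * K * x \<le> 228 * C * K * x" if "c \<le> 228" "x \<ge> 0" for c x :: real
  proof -
    have "c * (C * K * x) \<le> 228 * (C * K * x)"
      using that CK by (intro mult_right_mono) auto
    then show ?thesis by (simp add: mult.assoc)
  qed
  have comb: "k * (6 * C * (real (2 ^ i)) powr (1/2 - p)) * K * (real (2 ^ i)) powr y = (6 * k) * C * K * (2 ^ i) powr (1/2 - p + y)" for k y i
    by (simp add: powr_add mult_ac)
  show thesis
  proof
    \<comment> \<open>The four block estimates have the constants 2, 8, 4 and 38 and the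
      coefficients contribute 6; the largest product \<open>228 = 6 * 38\<close> serves for
      all.\<close>
    show "228 * C * K \<ge> 0" using CK by simp
    show "norm (T i \<theta>) \<le> 228 * C * K * (2 ^ i) powr (1 - p + e)" for i \<theta>
    proof -
      have "norm (T i \<theta>) \<le> 12 * C * K * (2 ^ i) powr (1/2 - p + (1/2 + e))"
        using norm_leg_block_le[OF slowly_varying_b[OF N] K e N, of i \<theta>] unfolding T_def comb by simp
      also have "\<dots> \<le> 228 * C * K * (2 ^ i) powr (1/2 - p + (1/2 + e))" by (rule mono) auto
      finally show ?thesis by (simp add: algebra_simps)
    qed
    show "norm (T' i \<theta>) \<le> 228 * C * K * (2 ^ i) powr (2 - p + e)" for i \<theta>
    proof -
      have "norm (T' i \<theta>) \<le> 48 * C * K * (2 ^ i) powr (1/2 - p + (3/2 + e))"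
        using norm_leg_block_deriv_le[OF slowly_varying_b[OF N] K e N, of i \<theta>] unfolding T'_def comb by simp
      also have "\<dots> \<le> 228 * C * K * (2 ^ i) powr (1/2 - p + (3/2 + e))" by (rule mono) auto
      finally show ?thesis by (simp add: algebra_simps)
    qed
    show "norm (T i \<theta>) * sqrt (sin \<theta>) \<le> 228 * C * K * (2 ^ i) powr (1/2 - p + e)" if "0 < \<theta>" "\<theta> < pi" for i \<theta>
    proof -
      have "norm (T i \<theta>) * sqrt (sin \<theta>) \<le> 24 * C * K * (2 ^ i) powr (1/2 - p + e)"
        using norm_leg_block_sqrt_le[OF slowly_varying_b[OF N] K e N that, of i] unfolding T_def comb by simp
      also have "\<dots> \<le> 228 * C * K * (2 ^ i) powr (1/2 - p + e)" by (rule mono) auto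
      finally show ?thesis .
    qed
    show "norm (T' i \<theta>) * sqrt (sin \<theta>) \<le> 228 * C * K * (2 ^ i) powr (3/2 - p + e)" if "0 < \<theta>" "\<theta> < pi" for i \<theta>
    proof -
      have "norm (T' i \<theta>) * sqrt (sin \<theta>) \<le> 228 * C * K * (2 ^ i) powr (1/2 - p + (1 + e))"
        using norm_leg_block_deriv_sqrt_le[OF slowly_varying_b[OF N] K e N that, of i] unfolding T'_def comb by simp
      then show ?thesis by (simp add: algebra_simps)
    qed
  qed
qed

text \<open>The dyadic blocks begin with degree 1. Degree 0 has phase 1 at all times and enters as
  the constant \<open>b 0\<close>.\<close>

definition G :: "real \<Rightarrow> complex" where "G \<theta> = b 0 + (\<Sum>i. T i \<theta>)"

lemma T_summable: "summable (\<lambda>i. T i \<theta>)"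
  and G_uniform_limit: "uniform_limit UNIV (\<lambda>k \<theta>. b 0 + (\<Sum>i<k. T i \<theta>)) G sequentially"
proof -
  define e where "e = (p - 1) / 2"
  have e: "e > 0" "1 - p + e < 0" using p1 by (auto simp: e_def field_simps)
  obtain D where D: "\<And>i \<theta>. norm (T i \<theta>) \<le> D * (2 ^ i) powr (1 - p + e)"
    using T_bounds[OF e(1)] by metis
  have s: "summable (\<lambda>i. D * (2 ^ i) powr (1 - p + e))"
    by (intro summable_mult summable_two_power_powr e)
  show "summable (\<lambda>i. T i \<theta>)" by (rule summable_comparison_test'[OF s, of 0]) (use D in auto)
  have "uniform_limit UNIV (\<lambda>k \<theta>. \<Sum>i<k. T i \<theta>) (\<lambda>\<theta>. \<Sum>i. T i \<theta>) sequentially"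
    by (rule Weierstrass_m_test[OF _ s]) (use D in auto)
  then show "uniform_limit UNIV (\<lambda>k \<theta>. b 0 + (\<Sum>i<k. T i \<theta>)) G sequentially"
    unfolding G_def by (intro uniform_limit_intros)
qed

lemma G_diff: "G \<theta> - G \<theta>' = (\<Sum>i. T i \<theta>) - (\<Sum>i. T i \<theta>')"
  by (simp add: G_def)

lemma G_holder:
  assumes \<gamma>: "0 < \<gamma>" "\<gamma> < p - 1"
  obtains M where "M \<ge> 0" "\<And>\<theta> \<theta>'. norm (G \<theta> - G \<theta>') \<le> M * \<bar>\<theta> - \<theta>'\<bar> powr \<gamma>"
proof -
  \<comment> \<open>Half of the slack in \<gamma> pays for the loss in the Weyl bound; the other
    half keeps the geometric series convergent.\<close>
  define e where "e = (p - 1 - \<gamma>) / 2"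
  have e: "e > 0" "1 - p + e + \<gamma> < 0" using \<gamma> by (auto simp: e_def field_simps)
  obtain D where D: "D \<ge> 0" "\<And>i \<theta>. norm (T i \<theta>) \<le> D * (2 ^ i) powr (1 - p + e)"
    "\<And>i \<theta>. norm (T' i \<theta>) \<le> D * (2 ^ i) powr (2 - p + e)"
    using T_bounds[OF e(1)] by metis
  have "norm (G \<theta> - G \<theta>') \<le> 2 * D * (\<Sum>i. (2 ^ i) powr (1 - p + e + \<gamma>)) * \<bar>\<theta> - \<theta>'\<bar> powr \<gamma>" for \<theta> \<theta>'
    unfolding G_diff
  proof (rule norm_suminf_diff_le_interpolation[OF T_summable T_summable])
    fix i
    have "norm (T i \<theta> - T i \<theta>') \<le> norm (T i \<theta>) + norm (T i \<theta>')" by (rule norm_triangle_ineq4)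
    then show "norm (T i \<theta> - T i \<theta>') \<le> 2 * D * (2 ^ i) powr (1 - p + e)"
      using D(2)[of i \<theta>] D(2)[of i \<theta>'] by linarith
    have "norm (T i \<theta> - T i \<theta>') \<le> \<bar>\<theta> - \<theta>'\<bar> * (D * (2 ^ i) powr (2 - p + e))"
      by (rule norm_diff_le_deriv_bound[OF T_deriv D(3)])
    also have "\<dots> \<le> 2 * (\<bar>\<theta> - \<theta>'\<bar> * (D * (2 ^ i) powr (2 - p + e)))"
      using D(1) by simp
    finally show "norm (T i \<theta> - T i \<theta>') \<le> 2 * D * \<bar>\<theta> - \<theta>'\<bar> * (2 ^ i) powr (1 - p + e + 1)"
      by (simp add: algebra_simps)
  qed (use \<gamma> e D p2 in auto)
  moreover have "2 * D * (\<Sum>i. (2 ^ i) powr (1 - p + e + \<gamma>)) \<ge> 0"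
    using D(1) by (intro mult_nonneg_nonneg suminf_nonneg summable_two_power_powr e) auto
  ultimately show thesis using that by blast
qed

text \<open>The blocks and their derivatives gain half a power of the frequency at the price of
  \<open>1 / sqrt (sin \<theta>)\<close>, which is at most \<open>1 / sqrt s\<close> on the segment.
  The sine is bounded below on the whole segment between the two points because the derivative is
  estimated there.\<close>

lemma G_weighted_modulus:
  assumes \<gamma>: "0 \<le> \<gamma>" "\<gamma> < p - 1/2" "\<gamma> \<le> 1"
  obtains M where "M \<ge> 0" "\<And>\<theta> \<theta>' s. s > 0 \<Longrightarrow>
     (\<And>x. min \<theta> \<theta>' \<le> x \<Longrightarrow> x \<le> max \<theta> \<theta>' \<Longrightarrow> 0 < x \<and> x < pi \<and> sin x \<ge> s) \<Longrightarrow>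
     norm (G \<theta> - G \<theta>') \<le> M / sqrt s * \<bar>\<theta> - \<theta>'\<bar> powr \<gamma>"
proof -
  define e where "e = (p - 1/2 - \<gamma>) / 2"
  have e: "e > 0" "1/2 - p + e + \<gamma> < 0" using \<gamma> by (auto simp: e_def field_simps)
  obtain D where D: "D \<ge> 0"
    "\<And>i \<theta>. 0 < \<theta> \<Longrightarrow> \<theta> < pi \<Longrightarrow> norm (T i \<theta>) * sqrt (sin \<theta>) \<le> D * (2 ^ i) powr (1/2 - p + e)"
    "\<And>i \<theta>. 0 < \<theta> \<Longrightarrow> \<theta> < pi \<Longrightarrow> norm (T' i \<theta>) * sqrt (sin \<theta>) \<le> D * (2 ^ i) powr (3/2 - p + e)"
    using T_bounds[OF e(1)] by metis
  define S where "S = (\<Sum>i. (2 ^ i :: real) powr (1/2 - p + e + \<gamma>))"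
  have div: "y \<le> X / sqrt s" if "y * sqrt (sin x) \<le> X" "sin x \<ge> s" "s > 0" "y \<ge> 0" for y x X s :: real
  proof -
    have "y * sqrt s \<le> y * sqrt (sin x)" using that by (intro mult_left_mono real_sqrt_le_mono) auto
    then have "y * sqrt s \<le> X" using that by linarith
    then show ?thesis using that by (simp add: field_simps)
  qed
  have "norm (G \<theta> - G \<theta>') \<le> (2 * D * S) / sqrt s * \<bar>\<theta> - \<theta>'\<bar> powr \<gamma>"
    if s: "s > 0" and x: "\<And>x. min \<theta> \<theta>' \<le> x \<Longrightarrow> x \<le> max \<theta> \<theta>' \<Longrightarrow> 0 < x \<and> x < pi \<and> sin x \<ge> s" for \<theta> \<theta>' s
  proof -
    have "norm (G \<theta> - G \<theta>') \<le> (2 * D / sqrt s) * (\<Sum>i. (2 ^ i) powr (1/2 - p + e + \<gamma>)) * \<bar>\<theta> - \<theta>'\<bar> powr \<gamma>"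
      unfolding G_diff
    proof (rule norm_suminf_diff_le_interpolation[OF T_summable T_summable])
      fix i
      have t: "norm (T i y) \<le> D * (2 ^ i) powr (1/2 - p + e) / sqrt s" if "min \<theta> \<theta>' \<le> y" "y \<le> max \<theta> \<theta>'" for y
        using D(2)[of y i] x[OF that] s by (intro div) auto
      have "norm (T i \<theta> - T i \<theta>') \<le> norm (T i \<theta>) + norm (T i \<theta>')" by (rule norm_triangle_ineq4)
      then show "norm (T i \<theta> - T i \<theta>') \<le> 2 * D / sqrt s * (2 ^ i) powr (1/2 - p + e)"
        using t[of \<theta>] t[of \<theta>'] by simp
      have "norm (T i \<theta> - T i \<theta>') \<le> \<bar>\<theta> - \<theta>'\<bar> * (D * (2 ^ i) powr (3/2 - p + e) / sqrt s)"
      proof (rule norm_diff_le_deriv_bound[OF T_deriv])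
        fix y assume "min \<theta> \<theta>' < y" "y < max \<theta> \<theta>'"
        then show "norm (T' i y) \<le> D * (2 ^ i) powr (3/2 - p + e) / sqrt s"
          using D(3)[of y i] x[of y] s by (intro div) auto
      qed
      also have "\<dots> \<le> 2 * (\<bar>\<theta> - \<theta>'\<bar> * (D * (2 ^ i) powr (3/2 - p + e) / sqrt s))"
        by (rule self_le_twice) (use D(1) s in simp)
      finally show "norm (T i \<theta> - T i \<theta>') \<le> 2 * D / sqrt s * \<bar>\<theta> - \<theta>'\<bar> * (2 ^ i) powr (1/2 - p + e + 1)"
        by (simp add: algebra_simps)
    qed (use \<gamma> e D s in auto)
    then show ?thesis by (simp add: S_def)
  qed
  moreover have "2 * D * S \<ge> 0"
    unfolding S_def using D(1) by (intro mult_nonneg_nonneg suminf_nonneg summable_two_power_powr e) auto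
  ultimately show thesis using that by blast
qed

lemma continuous_on_G: "continuous_on S G"
proof -
  have "continuous_on UNIV G"
    by (rule uniform_limit_theorem[OF _ G_uniform_limit])
      (auto intro!: always_eventually continuous_intros continuous_on_T)
  then show ?thesis by (rule continuous_on_subset) simp
qed

end

section \<open>Surface measure and square integrable functions\<close>

lemma spherical_coords_nth [simp]:
  "spherical_coords (\<theta>, \<phi>) $ 1 = sin \<theta> * cos \<phi>"
  "spherical_coords (\<theta>, \<phi>) $ 2 = sin \<theta> * sin \<phi>"
  "spherical_coords (\<theta>, \<phi>) $ 3 = cos \<theta>"
  by (simp_all add: spherical_coords_def vector_3)

lemma norm_vec3: "norm (x :: real^3) = sqrt ((x $ 1)\<^sup>2 + (x $ 2)\<^sup>2 + (x $ 3)\<^sup>2)"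
  by (simp add: norm_vec_def L2_set_def sum_3)

lemma S2_iff: "x \<in> S2 \<longleftrightarrow> (x $ 1)\<^sup>2 + (x $ 2)\<^sup>2 + (x $ 3)\<^sup>2 = (1::real)"
  by (simp add: norm_vec3 dist_norm)

lemma spherical_coords_in_S2: "spherical_coords p \<in> S2"
proof (cases p)
  case (Pair \<theta> \<phi>)
  have "(sin \<theta> * cos \<phi>)\<^sup>2 + (sin \<theta> * sin \<phi>)\<^sup>2 = (sin \<theta>)\<^sup>2 * ((cos \<phi>)\<^sup>2 + (sin \<phi>)\<^sup>2)"
    by (simp only: power_mult_distrib distrib_left)
  then show ?thesis unfolding Pair S2_iff by simp
qed

lemma norm_spherical_coords [simp]: "norm (spherical_coords p) = 1"
  using spherical_coords_in_S2[of p] by simp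

lemma spherical_coords_exists:
  assumes "x \<in> S2"
  obtains \<phi> where "0 \<le> \<phi>" "\<phi> < 2 * pi" "x = spherical_coords (arccos (x $ 3), \<phi>)"
proof -
  define \<theta> where "\<theta> = arccos (x $ 3)"
  have eq: "(x $ 1)\<^sup>2 + (x $ 2)\<^sup>2 + (x $ 3)\<^sup>2 = 1" using assms by (simp only: S2_iff)
  then have "(x $ 3)\<^sup>2 \<le> 1"
    using zero_le_power2[of "x $ 1"] zero_le_power2[of "x $ 2"] by linarith
  then have x3: "-1 \<le> x $ 3" "x $ 3 \<le> 1" by (simp_all add: abs_square_le_1 abs_le_iff)
  have c: "cos \<theta> = x $ 3" using x3 by (simp add: \<theta>_def)
  have s: "sin \<theta> \<ge> 0" unfolding \<theta>_def using arccos_bounded[OF x3] by (intro sin_ge_zero) auto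
  have s2: "(sin \<theta>)\<^sup>2 = (x $ 1)\<^sup>2 + (x $ 2)\<^sup>2" using eq by (simp add: sin_squared_eq c)
  obtain \<phi> where \<phi>: "0 \<le> \<phi>" "\<phi> < 2 * pi" "x $ 1 = sin \<theta> * cos \<phi>" "x $ 2 = sin \<theta> * sin \<phi>"
  proof (cases "sin \<theta> = 0")
    case True
    then have "x $ 1 = 0" "x $ 2 = 0" using s2 by (simp_all add: sum_power2_eq_zero_iff)
    then show thesis using that[of 0] True by simp
  next
    case False
    have "(x $ 1 / sin \<theta>)\<^sup>2 + (x $ 2 / sin \<theta>)\<^sup>2 = ((x $ 1)\<^sup>2 + (x $ 2)\<^sup>2) / (sin \<theta>)\<^sup>2"
      by (simp add: power_divide add_divide_distrib)
    also have "\<dots> = 1" unfolding s2[symmetric] using False by simp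
    finally obtain \<phi> where "0 \<le> \<phi>" "\<phi> < 2 * pi" "x $ 1 / sin \<theta> = cos \<phi>" "x $ 2 / sin \<theta> = sin \<phi>"
      by (rule sincos_total_2pi)
    then show thesis using that[of \<phi>] False by (simp add: field_simps)
  qed
  have "x = spherical_coords (\<theta>, \<phi>)"
    using \<phi> c by (simp add: vec_eq_iff forall_3)
  then show thesis unfolding \<theta>_def by (rule that[OF \<phi>(1,2)])
qed

abbreviation coord_region :: "(real \<times> real) set" where
  "coord_region \<equiv> {0..pi} \<times> {0..<2 * pi}"

lemma continuous_on_spherical_coords: "continuous_on A spherical_coords"
proof -
  have c: "(\<lambda>p. spherical_coords p $ 1) = (\<lambda>p. sin (fst p) * cos (snd p))"
    "(\<lambda>p. spherical_coords p $ 2) = (\<lambda>p. sin (fst p) * sin (snd p))"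
    "(\<lambda>p. spherical_coords p $ 3) = (\<lambda>p. cos (fst p))"
    by (auto simp: fun_eq_iff)
  have "continuous_on A (\<lambda>p. spherical_coords p $ 1)" "continuous_on A (\<lambda>p. spherical_coords p $ 2)"
    "continuous_on A (\<lambda>p. spherical_coords p $ 3)"
    unfolding c by (intro continuous_intros)+
  then have "continuous_on A (\<lambda>p. spherical_coords p $ i)" for i
    using exhaust_3[of i] by blast
  then have "continuous_on A (\<lambda>p. \<chi> i. spherical_coords p $ i)"
    by (intro continuous_on_vec_lambda)
  then show ?thesis by simp
qed

lemma borel_coord_region [measurable]: "coord_region \<in> sets borel"
  by (simp add: borel_Times)

lemma measurable_spherical_coords [measurable]:
  "spherical_coords \<in> restrict_space lborel coord_region \<rightarrow>\<^sub>M restrict_space borel S2"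
proof (rule measurable_restrict_space2)
  show "spherical_coords \<in> restrict_space lborel coord_region \<rightarrow>\<^sub>M borel"
    by (intro measurable_restrict_space1)
      (simp add: borel_measurable_continuous_onI continuous_on_spherical_coords)
qed (use spherical_coords_in_S2 in auto)

lemma space_sphere_measure [simp]: "space sphere_measure = S2"
  by (simp add: sphere_measure_def space_restrict_space)

lemma sets_sphere_measure: "sets sphere_measure = sets (restrict_space borel S2)"
  by (simp add: sphere_measure_def)

lemma borel_measurable_sphere_cong:
  "borel_measurable sphere_measure = borel_measurable (restrict_space borel S2)"
  by (intro measurable_cong_sets sets_sphere_measure refl)

lemma borel_measurable_sphere_continuous:
  fixes f :: "real^3 \<Rightarrow> 'b::topological_space"
  assumes "continuous_on S2 f"
  shows "f \<in> borel_measurable sphere_measure"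
  unfolding borel_measurable_sphere_cong by (rule borel_measurable_continuous_on_restrict[OF assms])

lemma measurable_sin_density [measurable]:
  "(\<lambda>(\<theta>, \<phi>). ennreal (sin \<theta>)) \<in> borel_measurable (restrict_space lborel coord_region)"
  unfolding case_prod_beta
  by (intro measurable_restrict_space1 measurable_compose[OF _ measurable_ennreal])
    (simp add: borel_measurable_continuous_onI continuous_intros)

lemma finite_sphere_measure: "finite_measure sphere_measure"
proof
  let ?R = "restrict_space lborel coord_region"
  have "emeasure sphere_measure (space sphere_measure) =
     emeasure (density ?R (\<lambda>(\<theta>, \<phi>). ennreal (sin \<theta>))) (space ?R)"
  proof -
    have "S2 \<in> sets (restrict_space borel S2)"
      using sets.top[of "restrict_space borel S2"] by (simp add: space_restrict_space)
    moreover have "spherical_coords -` S2 \<inter> space ?R = space ?R" by auto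
    ultimately show ?thesis
      unfolding space_sphere_measure unfolding sphere_measure_def
      by (subst emeasure_distr) simp_all
  qed
  also have "\<dots> = (\<integral>\<^sup>+ p. (\<lambda>(\<theta>, \<phi>). ennreal (sin \<theta>)) p \<partial>?R)"
    by (subst emeasure_density[OF measurable_sin_density sets.top])
      (auto intro!: nn_integral_cong simp: indicator_def)
  also have "\<dots> \<le> (\<integral>\<^sup>+ p. 1 \<partial>?R)"
    by (intro nn_integral_mono) (auto simp: ennreal_le_1)
  also have "\<dots> = emeasure lborel coord_region"
    by (simp add: emeasure_restrict_space space_restrict_space)
  also have "\<dots> \<le> emeasure lborel (cbox (0, 0) (pi, 2 * pi))"
  proof (rule emeasure_mono)
    show "coord_region \<subseteq> cbox (0, 0) (pi, 2 * pi)" by (auto simp: cbox_Pair_eq)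
  qed simp
  also have "\<dots> < \<infinity>" using emeasure_lborel_cbox_finite[of "(0, 0)" "(pi, 2 * pi)"] by (simp only: infinity_ennreal_def)
  finally show "emeasure sphere_measure (space sphere_measure) \<noteq> \<infinity>" by simp
qed

interpretation sphere: finite_measure sphere_measure by (rule finite_sphere_measure)

lemma integrable_sphere_continuous:
  fixes f :: "real^3 \<Rightarrow> 'b::{banach, second_countable_topology}"
  assumes "continuous_on S2 f"
  shows "integrable sphere_measure f"
proof -
  have "compact (f ` S2)" by (intro compact_continuous_image assms compact_sphere)
  then obtain B where "\<forall>x\<in>S2. norm (f x) \<le> B"
    using compact_imp_bounded bounded_iff by (metis imageI)
  then show ?thesis
    by (intro sphere.integrable_const_bound[of _ B] borel_measurable_sphere_continuous assms) auto
qed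

section \<open>Integration in spherical coordinates\<close>

lemma integral_sphere_measure:
  fixes f :: "real^3 \<Rightarrow> 'b::{banach, second_countable_topology}"
  assumes "f \<in> borel_measurable sphere_measure"
  shows "integral\<^sup>L sphere_measure f =
    (\<integral>p. indicator coord_region p *\<^sub>R (sin (fst p) *\<^sub>R f (spherical_coords p)) \<partial>lborel)"
proof -
  let ?R = "restrict_space lborel coord_region"
  have f: "f \<in> borel_measurable (restrict_space borel S2)"
    using assms unfolding borel_measurable_sphere_cong .
  have fs [measurable]: "(\<lambda>p. f (spherical_coords p)) \<in> borel_measurable ?R"
    by (rule measurable_compose[OF measurable_spherical_coords f])
  have "integral\<^sup>L sphere_measure f = (\<integral>p. f (spherical_coords p) \<partial>density ?R (\<lambda>(\<theta>, \<phi>). ennreal (sin \<theta>)))"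
    unfolding sphere_measure_def by (rule integral_distr) (use f in auto)
  also have "(\<lambda>(\<theta>, \<phi>). ennreal (sin \<theta>)) = (\<lambda>p :: real \<times> real. ennreal (sin (fst p)))"
    by (rule ext) (simp add: case_prod_beta)
  also have "(\<integral>p. f (spherical_coords p) \<partial>density ?R (\<lambda>p. ennreal (sin (fst p)))) =
      (\<integral>p. sin (fst p) *\<^sub>R f (spherical_coords p) \<partial>?R)"
  proof (rule integral_density[OF fs])
    show "(\<lambda>p. sin (fst p)) \<in> borel_measurable ?R"
      by (intro measurable_restrict_space1) (simp add: borel_measurable_continuous_onI continuous_intros)
    show "AE p in ?R. 0 \<le> sin (fst p)"
      by (rule AE_I2) (auto simp: space_restrict_space intro!: sin_ge_zero)
  qed
  also have "\<dots> = (\<integral>p. indicator coord_region p *\<^sub>R (sin (fst p) *\<^sub>R f (spherical_coords p)) \<partial>lborel)"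
    by (rule integral_restrict_space) simp
  finally show ?thesis .
qed

text \<open>Fubini for a function that separates in the two angles; the density
  \<open>sin \<theta>\<close> goes with the factor in \<theta>.\<close>

lemma integral_sphere_product:
  fixes F :: "real^3 \<Rightarrow> complex" and f g :: "real \<Rightarrow> complex"
  assumes F: "F \<in> borel_measurable sphere_measure"
    and f: "continuous_on UNIV f" and g: "continuous_on UNIV g"
    and eq: "\<And>\<theta> \<phi>. 0 \<le> \<theta> \<Longrightarrow> \<theta> \<le> pi \<Longrightarrow> F (spherical_coords (\<theta>, \<phi>)) = f \<theta> * g \<phi>"
  shows "integral\<^sup>L sphere_measure F =
    integral {0..pi} (\<lambda>\<theta>. of_real (sin \<theta>) * f \<theta>) * integral {0..2*pi} g"
proof -
  define u where "u \<theta> = indicator {0..pi} \<theta> *\<^sub>R (of_real (sin \<theta>) * f \<theta>)" for \<theta>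
  define v where "v \<phi> = indicator {0..<2*pi} \<phi> *\<^sub>R g \<phi>" for \<phi> :: real
  have u_int: "integrable lborel u" unfolding u_def
    by (intro borel_integrable_compact continuous_intros compact_Icc continuous_on_subset[OF f]) auto
  have v0: "integrable lborel (\<lambda>\<phi>. indicator {0..2*pi} \<phi> *\<^sub>R g \<phi>)"
    by (intro borel_integrable_compact compact_Icc continuous_on_subset[OF g]) auto
  have [measurable]: "g \<in> borel_measurable borel" "f \<in> borel_measurable borel"
    using f g by (auto intro: borel_measurable_continuous_onI)
  have vm [measurable]: "v \<in> borel_measurable borel" unfolding v_def by measurable
  have um [measurable]: "u \<in> borel_measurable borel" unfolding u_def by measurable
  \<comment> \<open>The longitude runs over a half-open interval in the definition of the measure;
    the missing end point is a null set.\<close>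
  have v_ae: "AE \<phi> in lborel. v \<phi> = indicator {0..2*pi} \<phi> *\<^sub>R g \<phi>"
    by (rule AE_I'[of "{2*pi}"]) (auto simp: v_def indicator_def)
  have v_int: "integrable lborel v"
    using v0 v_ae by (subst integrable_cong_AE[OF _ _ v_ae]) auto
  have "integral\<^sup>L sphere_measure F = (\<integral>p. u (fst p) * v (snd p) \<partial>lborel)"
    unfolding integral_sphere_measure[OF F]
  proof (rule Bochner_Integration.integral_cong[OF refl])
    fix p :: "real \<times> real"
    show "indicator coord_region p *\<^sub>R (sin (fst p) *\<^sub>R F (spherical_coords p)) = u (fst p) * v (snd p)"
      by (cases p) (auto simp: u_def v_def indicator_def eq scaleR_conv_of_real)
  qed
  also have "\<dots> = (\<integral>p. u (fst p) * v (snd p) \<partial>(lborel \<Otimes>\<^sub>M lborel))"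
    by (simp add: lborel_prod)
  also have "\<dots> = (\<integral>\<theta>. (\<integral>\<phi>. u \<theta> * v \<phi> \<partial>lborel) \<partial>lborel)"
  proof -
    have "integrable (lborel \<Otimes>\<^sub>M lborel) (\<lambda>p. u (fst p) * v (snd p))"
    proof (rule lborel_pair.Fubini_integrable)
      show "(\<lambda>p. u (fst p) * v (snd p)) \<in> borel_measurable (lborel \<Otimes>\<^sub>M lborel)" by measurable
      have "integrable lborel (\<lambda>x. norm (u x) * (\<integral>y. norm (v y) \<partial>lborel))"
        using u_int by (intro integrable_mult_left integrable_norm) auto
      then show "integrable lborel (\<lambda>x. \<integral>y. norm (u (fst (x, y)) * v (snd (x, y))) \<partial>lborel)"
        by (simp add: norm_mult)
      show "AE x in lborel. integrable lborel (\<lambda>y. u (fst (x, y)) * v (snd (x, y)))"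
        using v_int by simp
    qed
    from lborel_pair.integral_fst'[OF this] show ?thesis by simp
  qed
  also have "\<dots> = (\<integral>\<theta>. u \<theta> \<partial>lborel) * (\<integral>\<phi>. v \<phi> \<partial>lborel)"
    by simp
  also have "(\<integral>\<theta>. u \<theta> \<partial>lborel) = integral {0..pi} (\<lambda>\<theta>. of_real (sin \<theta>) * f \<theta>)"
    using set_borel_integral_eq_integral(2)[of "{0..pi}" "\<lambda>\<theta>. of_real (sin \<theta>) * f \<theta>"] u_int
    unfolding set_integrable_def set_lebesgue_integral_def u_def by simp
  also have "(\<integral>\<phi>. v \<phi> \<partial>lborel) = (\<integral>\<phi>. indicator {0..2*pi} \<phi> *\<^sub>R g \<phi> \<partial>lborel)"
    by (intro integral_cong_AE v_ae) auto
  also have "\<dots> = integral {0..2*pi} g"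
    using set_borel_integral_eq_integral(2)[of "{0..2*pi}" g] v0
    unfolding set_integrable_def set_lebesgue_integral_def by simp
  finally show ?thesis .
qed

section \<open>Square integrable functions and their moments\<close>

text \<open>The inequality \<open>2 * r \<le> d + r\<^sup>2 / d\<close> takes the place of Cauchy's
  inequality, with \<open>d\<close> equal to the norm of \<open>w\<close>. If that norm is zero,
  \<open>d\<close> is made arbitrarily small instead.\<close>

lemma integral_norm_le_L2_norm:
  assumes "w \<in> L2_sphere"
  shows "integrable sphere_measure w"
    and "integral\<^sup>L sphere_measure (\<lambda>x. norm (w x)) \<le> (measure sphere_measure S2 + 1) / 2 * L2_norm w"
proof -
  have m: "w \<in> borel_measurable sphere_measure" and i: "integrable sphere_measure (\<lambda>x. (norm (w x))\<^sup>2)"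
    using assms by (auto simp: L2_sphere_def)
  have amgm: "norm (w x) \<le> (d + (norm (w x))\<^sup>2 / d) / 2" if "d > 0" for d x
  proof -
    have "0 \<le> (norm (w x) - d)\<^sup>2" by simp
    then have "2 * d * norm (w x) \<le> d\<^sup>2 + (norm (w x))\<^sup>2" by (simp add: power2_diff algebra_simps)
    then show ?thesis using that by (simp add: field_simps power2_eq_square)
  qed
  have dom: "integrable sphere_measure (\<lambda>x. (d + (norm (w x))\<^sup>2 / d) / 2)" for d
    using i by auto
  show int: "integrable sphere_measure w"
    by (rule Bochner_Integration.integrable_bound[OF dom[of 1] m]) (use amgm[of 1] in force)
  define I where "I = integral\<^sup>L sphere_measure (\<lambda>x. (norm (w x))\<^sup>2)"
  define N where "N = L2_norm w"
  have I0: "I \<ge> 0" unfolding I_def by simp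
  have N: "N \<ge> 0" "N * N = I" using I0 unfolding N_def L2_norm_def I_def by auto
  have bound: "integral\<^sup>L sphere_measure (\<lambda>x. norm (w x)) \<le> (d * measure sphere_measure S2 + I / d) / 2" if "d > 0" for d
  proof -
    have "integral\<^sup>L sphere_measure (\<lambda>x. norm (w x)) \<le> integral\<^sup>L sphere_measure (\<lambda>x. (d + (norm (w x))\<^sup>2 / d) / 2)"
      using int dom amgm[OF that] by (intro integral_mono) auto
    also have "\<dots> = (d * measure sphere_measure S2 + I / d) / 2"
      using i by (simp add: I_def mult.commute)
    finally show ?thesis .
  qed
  show "integral\<^sup>L sphere_measure (\<lambda>x. norm (w x)) \<le> (measure sphere_measure S2 + 1) / 2 * N"
  proof (cases "N = 0")
    case True
    then have "I = 0" using N by simp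
    have "integral\<^sup>L sphere_measure (\<lambda>x. norm (w x)) \<le> 0 + e" if "e > 0" for e
    proof -
      define d where "d = 2 * e / (measure sphere_measure S2 + 1)"
      have "measure sphere_measure S2 \<ge> 0" by simp
      then have "measure sphere_measure S2 + 1 > 0" by linarith
      then have "d > 0" "d * (measure sphere_measure S2 + 1) = 2 * e" using that by (auto simp: d_def)
      moreover have "d * measure sphere_measure S2 \<le> d * (measure sphere_measure S2 + 1)"
        using \<open>d > 0\<close> by simp
      ultimately show ?thesis using bound[of d] \<open>I = 0\<close> by simp
    qed
    then have "integral\<^sup>L sphere_measure (\<lambda>x. norm (w x)) \<le> 0" by (rule field_le_epsilon)
    then show ?thesis using True by simp
  next
    case False
    then have "N > 0" using N by simp
    moreover have "I / N = N" using \<open>N > 0\<close> N(2) by (simp add: field_simps)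
    ultimately show ?thesis using bound[of N] by (simp add: algebra_simps add_divide_distrib)
  qed
qed

lemma L2_sphere_continuous: "continuous_on S2 g \<Longrightarrow> g \<in> L2_sphere"
  unfolding L2_sphere_def
  by (auto intro!: borel_measurable_sphere_continuous integrable_sphere_continuous continuous_intros)

lemma L2_sphere_diff:
  assumes "f \<in> L2_sphere" "g \<in> L2_sphere"
  shows "(\<lambda>x. f x - g x) \<in> L2_sphere"
proof -
  have m: "f \<in> borel_measurable sphere_measure" "g \<in> borel_measurable sphere_measure"
    using assms by (auto simp: L2_sphere_def)
  have i: "integrable sphere_measure (\<lambda>x. 2 * (norm (f x))\<^sup>2 + 2 * (norm (g x))\<^sup>2)"
    using assms by (auto simp: L2_sphere_def)
  have "(norm (f x - g x))\<^sup>2 \<le> 2 * (norm (f x))\<^sup>2 + 2 * (norm (g x))\<^sup>2" for x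
  proof -
    have "(norm (f x - g x))\<^sup>2 \<le> (norm (f x) + norm (g x))\<^sup>2"
      by (intro power_mono norm_triangle_ineq4) auto
    also have "\<dots> \<le> 2 * (norm (f x))\<^sup>2 + 2 * (norm (g x))\<^sup>2"
      using sum_squares_bound[of "norm (f x)" "norm (g x)"] by (simp add: power2_sum)
    finally show ?thesis .
  qed
  then have "integrable sphere_measure (\<lambda>x. (norm (f x - g x))\<^sup>2)"
    using m by (intro Bochner_Integration.integrable_bound[OF i]) auto
  then show ?thesis using m by (auto simp: L2_sphere_def)
qed

lemma L2_sphere_mult_bounded:
  assumes f: "f \<in> L2_sphere" and h: "h \<in> borel_measurable sphere_measure" "\<And>x. x \<in> S2 \<Longrightarrow> norm (h x) \<le> B"
  shows "(\<lambda>x. f x * h x) \<in> L2_sphere"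
proof -
  have m: "f \<in> borel_measurable sphere_measure" using f by (auto simp: L2_sphere_def)
  have i: "integrable sphere_measure (\<lambda>x. B\<^sup>2 * (norm (f x))\<^sup>2)"
    using f by (auto simp: L2_sphere_def)
  have "AE x in sphere_measure. norm ((norm (f x * h x))\<^sup>2) \<le> norm (B\<^sup>2 * (norm (f x))\<^sup>2)"
  proof (rule AE_I2)
    fix x assume "x \<in> space sphere_measure"
    then have "(norm (h x))\<^sup>2 \<le> B\<^sup>2" using h(2)[of x] by (intro power_mono) auto
    then have "(norm (h x))\<^sup>2 * (norm (f x))\<^sup>2 \<le> B\<^sup>2 * (norm (f x))\<^sup>2" by (rule mult_right_mono) simp
    then show "norm ((norm (f x * h x))\<^sup>2) \<le> norm (B\<^sup>2 * (norm (f x))\<^sup>2)"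
      by (simp add: norm_mult power_mult_distrib mult.commute)
  qed
  then have "integrable sphere_measure (\<lambda>x. (norm (f x * h x))\<^sup>2)"
    using m h by (intro Bochner_Integration.integrable_bound[OF i]) auto
  then show ?thesis using m h by (auto simp: L2_sphere_def)
qed

lemma continuous_S2_bounded:
  fixes h :: "real^3 \<Rightarrow> complex"
  assumes "continuous_on S2 h"
  obtains B where "B \<ge> 0" "\<And>x. x \<in> S2 \<Longrightarrow> norm (h x) \<le> B"
proof -
  have "compact (h ` S2)" by (intro compact_continuous_image assms compact_sphere)
  then obtain B where B: "\<forall>x\<in>S2. norm (h x) \<le> B"
    using compact_imp_bounded bounded_iff by (metis imageI)
  show thesis by (rule that[of "max B 0"]) (use B in \<open>auto simp: le_max_iff_disj\<close>)
qed

lemma integrable_L2_mult_continuous: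
  assumes "f \<in> L2_sphere" "continuous_on S2 h"
  shows "integrable sphere_measure (\<lambda>x. f x * h x)"
proof -
  obtain B where "B \<ge> 0" "\<And>x. x \<in> S2 \<Longrightarrow> norm (h x) \<le> B" using continuous_S2_bounded[OF assms(2)] by blast
  then show ?thesis
    using L2_sphere_mult_bounded[OF assms(1) borel_measurable_sphere_continuous[OF assms(2)]]
    by (intro integral_norm_le_L2_norm(1)) blast
qed

text \<open>Mean square convergence tested against a bounded function; it carries the expansion of
  \<open>f\<close> over to its moments.\<close>

lemma L2_limit_integral:
  fixes h :: "real^3 \<Rightarrow> complex"
  assumes f: "f \<in> L2_sphere" and g: "\<And>N. continuous_on S2 (g N)"
    and lim: "(\<lambda>N. L2_norm (\<lambda>x. f x - g N x)) \<longlonglongrightarrow> 0" and h: "continuous_on S2 h"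
  shows "(\<lambda>N. integral\<^sup>L sphere_measure (\<lambda>x. g N x * h x)) \<longlonglongrightarrow> integral\<^sup>L sphere_measure (\<lambda>x. f x * h x)"
proof -
  obtain B where B: "B \<ge> 0" "\<And>x. x \<in> S2 \<Longrightarrow> norm (h x) \<le> B" using continuous_S2_bounded[OF h] by blast
  let ?c = "(measure sphere_measure S2 + 1) / 2"
  have "norm (integral\<^sup>L sphere_measure (\<lambda>x. g N x * h x) - integral\<^sup>L sphere_measure (\<lambda>x. f x * h x))
      \<le> B * (?c * L2_norm (\<lambda>x. f x - g N x))" for N
  proof -
    have w: "(\<lambda>x. f x - g N x) \<in> L2_sphere" by (intro L2_sphere_diff f L2_sphere_continuous g)
    have "integral\<^sup>L sphere_measure (\<lambda>x. f x * h x) - integral\<^sup>L sphere_measure (\<lambda>x. g N x * h x) =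
        integral\<^sup>L sphere_measure (\<lambda>x. f x * h x - g N x * h x)"
      by (intro Bochner_Integration.integral_diff[symmetric] integrable_L2_mult_continuous f h L2_sphere_continuous g)
    also have "norm \<dots> \<le> integral\<^sup>L sphere_measure (\<lambda>x. norm (f x * h x - g N x * h x))"
      by (rule integral_norm_bound)
    also have "\<dots> \<le> integral\<^sup>L sphere_measure (\<lambda>x. B * norm (f x - g N x))"
    proof (rule integral_mono)
      show "integrable sphere_measure (\<lambda>x. norm (f x * h x - g N x * h x))"
        by (intro integrable_norm Bochner_Integration.integrable_diff integrable_L2_mult_continuous f h L2_sphere_continuous g)
      show "integrable sphere_measure (\<lambda>x. B * norm (f x - g N x))"
        using integral_norm_le_L2_norm(1)[OF w] by auto
      fix x assume "x \<in> space sphere_measure"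
      then have "norm (f x - g N x) * norm (h x) \<le> norm (f x - g N x) * B"
        using B by (intro mult_left_mono) auto
      then show "norm (f x * h x - g N x * h x) \<le> B * norm (f x - g N x)"
        unfolding left_diff_distrib[symmetric] norm_mult by (simp only: mult.commute)
    qed
    also have "\<dots> = B * integral\<^sup>L sphere_measure (\<lambda>x. norm (f x - g N x))" by simp
    also have "\<dots> \<le> B * (?c * L2_norm (\<lambda>x. f x - g N x))"
      by (intro mult_left_mono integral_norm_le_L2_norm(2)[OF w] B)
    finally show ?thesis by (simp add: norm_minus_commute)
  qed
  then have ev: "\<forall>\<^sub>F N in sequentially. norm (integral\<^sup>L sphere_measure (\<lambda>x. g N x * h x)
      - integral\<^sup>L sphere_measure (\<lambda>x. f x * h x)) \<le> B * (?c * L2_norm (\<lambda>x. f x - g N x))"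
    by (intro always_eventually allI)
  have "(\<lambda>N. B * (?c * L2_norm (\<lambda>x. f x - g N x))) \<longlonglongrightarrow> B * (?c * 0)"
    by (intro tendsto_mult_left lim)
  then have "(\<lambda>N. B * (?c * L2_norm (\<lambda>x. f x - g N x))) \<longlonglongrightarrow> 0"
    by (simp only: mult_zero_right)
  from Lim_null_comparison[OF ev this]
  have "(\<lambda>N. integral\<^sup>L sphere_measure (\<lambda>x. g N x * h x) - integral\<^sup>L sphere_measure (\<lambda>x. f x * h x)) \<longlonglongrightarrow> 0" .
  then show ?thesis by (simp add: LIM_zero_iff)
qed

section \<open>The Laplace--Beltrami operator on polynomials\<close>

text \<open>A derivative stored through its three partial derivatives, which are complex although
  the directions are real.\<close>

definition grad_form :: "(3 \<Rightarrow> complex) \<Rightarrow> real^3 \<Rightarrow> complex" where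
  "grad_form v = (\<lambda>h. \<Sum>i\<in>UNIV. of_real (h $ i) * v i)"

lemma has_derivative_grad_coord:
  "((\<lambda>y. complex_of_real (y $ k)) has_derivative grad_form (\<lambda>i. if i = k then 1 else 0)) (at y)"
proof -
  have "bounded_linear (\<lambda>y :: real^3. complex_of_real (y $ k))"
    by (intro bounded_linear_compose[OF bounded_linear_of_real] bounded_linear_vec_nth)
  then have "((\<lambda>y. complex_of_real (y $ k)) has_derivative (\<lambda>y. complex_of_real (y $ k))) (at y)"
    by (rule bounded_linear_imp_has_derivative)
  moreover have "grad_form (\<lambda>i. if i = k then 1 else 0) = (\<lambda>y. complex_of_real (y $ k))"
    by (auto simp: grad_form_def fun_eq_iff if_distrib cong: if_cong)
  ultimately show ?thesis by simp
qed

lemma has_derivative_grad_inverse_norm: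
  assumes "y \<noteq> 0"
  shows "((\<lambda>y. complex_of_real (inverse (norm y))) has_derivative
    grad_form (\<lambda>i. - of_real (y $ i) * of_real (inverse (norm y)) ^ 3)) (at y)"
proof -
  have "norm y \<noteq> 0" using assms by simp
  from Deriv.has_derivative_inverse[OF this has_derivative_norm[OF assms]]
  have "((\<lambda>y. inverse (norm y)) has_derivative (\<lambda>h. - (inverse (norm y) * (h \<bullet> sgn y) * inverse (norm y)))) (at y)"
    by simp
  from has_derivative_of_real[OF this]
  have "((\<lambda>y. complex_of_real (inverse (norm y))) has_derivative
     (\<lambda>h. of_real (- (inverse (norm y) * (h \<bullet> sgn y) * inverse (norm y))))) (at y)" .
  moreover have "grad_form (\<lambda>i. - of_real (y $ i) * of_real (inverse (norm y)) ^ 3) =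
      (\<lambda>h. complex_of_real (- (inverse (norm y) * (h \<bullet> sgn y) * inverse (norm y))))"
    by (auto simp: grad_form_def fun_eq_iff sgn_div_norm inner_vec_def sum_3 power3_eq_cube algebra_simps divide_inverse)
  ultimately show ?thesis by simp
qed

lemma has_derivative_grad_add:
  assumes "(F has_derivative grad_form d) (at y)" "(G has_derivative grad_form e) (at y)"
  shows "((\<lambda>y. F y + G y) has_derivative grad_form (\<lambda>i. d i + e i)) (at y)"
proof -
  have "grad_form (\<lambda>i. d i + e i) = (\<lambda>h. grad_form d h + grad_form e h)"
    by (simp add: grad_form_def fun_eq_iff distrib_left sum.distrib)
  then show ?thesis using has_derivative_add[OF assms] by simp
qed

lemma has_derivative_grad_mult:
  assumes "(F has_derivative grad_form d) (at y)" "(G has_derivative grad_form e) (at y)"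
  shows "((\<lambda>y. F y * G y) has_derivative grad_form (\<lambda>i. d i * G y + F y * e i)) (at y)"
proof -
  have "grad_form (\<lambda>i. d i * G y + F y * e i) = (\<lambda>h. F y * grad_form e h + grad_form d h * G y)"
    by (simp add: grad_form_def fun_eq_iff sum_3 algebra_simps)
  then show ?thesis using has_derivative_mult[OF assms] by simp
qed

lemma grad_form_0 [simp]: "grad_form (\<lambda>i. 0) = (\<lambda>h. 0)"
  by (simp add: grad_form_def)

lemma has_derivative_grad_const: "((\<lambda>y. c) has_derivative grad_form (\<lambda>i. 0)) (at y)"
  by (simp add: grad_form_def)

text \<open>The complex polynomials in the coordinates as an inductive class, so that facts about
  them can be proved by induction; \<open>polynomial_function_poly3\<close> connects it with the
  library notion.\<close>

inductive poly3 :: "(real^3 \<Rightarrow> complex) \<Rightarrow> bool" where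
  const: "poly3 (\<lambda>y. c)"
| coord: "poly3 (\<lambda>y. of_real (y $ i))"
| add: "poly3 F \<Longrightarrow> poly3 G \<Longrightarrow> poly3 (\<lambda>y. F y + G y)"
| mult: "poly3 F \<Longrightarrow> poly3 G \<Longrightarrow> poly3 (\<lambda>y. F y * G y)"

text \<open>
  Closed under partial derivatives away from the origin, and containing the radial extensions of
  polynomials; hence the restrictions of polynomials to the sphere are smooth.
\<close>

inductive rat_fun :: "(real^3 \<Rightarrow> complex) \<Rightarrow> bool" where
  const: "rat_fun (\<lambda>y. c)"
| coord: "rat_fun (\<lambda>y. of_real (y $ i))"
| inverse_norm: "rat_fun (\<lambda>y. of_real (inverse (norm y)))"
| add: "rat_fun F \<Longrightarrow> rat_fun G \<Longrightarrow> rat_fun (\<lambda>y. F y + G y)"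
| mult: "rat_fun F \<Longrightarrow> rat_fun G \<Longrightarrow> rat_fun (\<lambda>y. F y * G y)"

lemma poly3_gradient:
  assumes "poly3 F"
  shows "\<exists>D. (\<forall>i. poly3 (D i)) \<and> (\<forall>y. (F has_derivative grad_form (\<lambda>i. D i y)) (at y))"
  using assms
proof induction
  case (const c)
  show ?case by (rule exI[of _ "\<lambda>i y. 0"]) (auto intro: poly3.const)
next
  case (coord k)
  show ?case
    by (rule exI[of _ "\<lambda>i y. if i = k then 1 else 0"]) (use has_derivative_grad_coord in \<open>auto intro: poly3.const\<close>)
next
  case (add F G)
  then obtain D E where "\<forall>i. poly3 (D i)" "\<forall>i. poly3 (E i)" "\<forall>y. (F has_derivative grad_form (\<lambda>i. D i y)) (at y)"
    "\<forall>y. (G has_derivative grad_form (\<lambda>i. E i y)) (at y)" by blast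
  then show ?case
    by (intro exI[of _ "\<lambda>i y. D i y + E i y"]) (intro conjI allI poly3.add has_derivative_grad_add; simp)
next
  case (mult F G)
  then obtain D E where "\<forall>i. poly3 (D i)" "\<forall>i. poly3 (E i)" "\<forall>y. (F has_derivative grad_form (\<lambda>i. D i y)) (at y)"
    "\<forall>y. (G has_derivative grad_form (\<lambda>i. E i y)) (at y)" by blast
  then show ?case using mult.hyps
    by (intro exI[of _ "\<lambda>i y. D i y * G y + F y * E i y"]) (intro conjI allI poly3.add poly3.mult has_derivative_grad_mult; simp)
qed

lemma rat_fun_minus: "rat_fun F \<Longrightarrow> rat_fun (\<lambda>y. - F y)"
  using rat_fun.mult[OF rat_fun.const[of "-1"]] by simp

lemma rat_fun_power: "rat_fun F \<Longrightarrow> rat_fun (\<lambda>y. F y ^ n)"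
  by (induction n) (auto intro: rat_fun.const[of 1, simplified] rat_fun.mult)

lemma rat_fun_gradient:
  assumes "rat_fun F"
  shows "\<exists>D. (\<forall>i. rat_fun (D i)) \<and> (\<forall>y. y \<noteq> 0 \<longrightarrow> (F has_derivative grad_form (\<lambda>i. D i y)) (at y))"
  using assms
proof induction
  case (const c)
  show ?case by (rule exI[of _ "\<lambda>i y. 0"]) (auto intro: rat_fun.const)
next
  case (coord k)
  show ?case
    by (rule exI[of _ "\<lambda>i y. if i = k then 1 else 0"]) (use has_derivative_grad_coord in \<open>auto intro: rat_fun.const\<close>)
next
  case inverse_norm
  show ?case
    by (rule exI[of _ "\<lambda>i y. - of_real (y $ i) * of_real (inverse (norm y)) ^ 3"])
      (use has_derivative_grad_inverse_norm in \<open>auto intro!: rat_fun.mult rat_fun_minus rat_fun_power rat_fun.coord rat_fun.inverse_norm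
         simp del: of_real_inverse\<close>)
next
  case (add F G)
  then obtain D E where "\<forall>i. rat_fun (D i)" "\<forall>i. rat_fun (E i)" "\<forall>y. y \<noteq> 0 \<longrightarrow> (F has_derivative grad_form (\<lambda>i. D i y)) (at y)"
    "\<forall>y. y \<noteq> 0 \<longrightarrow> (G has_derivative grad_form (\<lambda>i. E i y)) (at y)" by blast
  then show ?case
    by (intro exI[of _ "\<lambda>i y. D i y + E i y"]) (intro conjI allI impI rat_fun.add has_derivative_grad_add; simp)
next
  case (mult F G)
  then obtain D E where "\<forall>i. rat_fun (D i)" "\<forall>i. rat_fun (E i)" "\<forall>y. y \<noteq> 0 \<longrightarrow> (F has_derivative grad_form (\<lambda>i. D i y)) (at y)"
    "\<forall>y. y \<noteq> 0 \<longrightarrow> (G has_derivative grad_form (\<lambda>i. E i y)) (at y)" by blast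
  then show ?case using mult.hyps
    by (intro exI[of _ "\<lambda>i y. D i y * G y + F y * E i y"]) (intro conjI allI impI rat_fun.add rat_fun.mult has_derivative_grad_mult; simp)
qed

lemma frechet_derivative_grad:
  assumes "(F has_derivative grad_form d) (at y)"
  shows "frechet_derivative F (at y) = grad_form d"
  using frechet_derivative_at[OF assms] by simp

lemma grad_form_axis: "grad_form d (axis i 1) = d i"
proof -
  have "grad_form d (axis i 1) = (\<Sum>j\<in>UNIV. if j = i then d j else 0)"
    unfolding grad_form_def by (intro sum.cong) (auto simp: axis_def)
  then show ?thesis by simp
qed

lemma Basis_real3: "(Basis :: (real^3) set) = range (\<lambda>i. axis i 1)"
  by (auto simp: Basis_vec_def)

text \<open>\<open>F'\<close> has to agree with \<open>F\<close> only off the origin, because in the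
  induction step the Frechet derivatives are identified with members of \<open>rat_fun\<close> only
  there.\<close>

lemma rat_fun_Ck:
  assumes "rat_fun F" "\<And>y. y \<noteq> 0 \<Longrightarrow> F' y = F y"
  shows "Ck_on k (UNIV - {0}) F'"
  using assms
proof (induction k arbitrary: F F')
  case 0
  obtain D where D: "\<forall>y. y \<noteq> 0 \<longrightarrow> (F has_derivative grad_form (\<lambda>i. D i y)) (at y)" using rat_fun_gradient[OF 0(1)] by blast
  have "continuous_on (UNIV - {0}) F"
    using D has_derivative_continuous by (intro continuous_at_imp_continuous_on) blast
  also have "?this \<longleftrightarrow> continuous_on (UNIV - {0}) F'" using 0(2) by (intro continuous_on_cong) auto
  finally show ?case by simp
next
  case (Suc k)
  obtain D where D: "\<And>i. rat_fun (D i)" "\<And>y. y \<noteq> 0 \<Longrightarrow> (F has_derivative grad_form (\<lambda>i. D i y)) (at y)"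
    using rat_fun_gradient[OF Suc(2)] by blast
  have D': "(F' has_derivative grad_form (\<lambda>i. D i y)) (at y)" if "y \<noteq> 0" for y
    using has_derivative_transform_within_open[OF D(2)[OF that], of "UNIV - {0}" F'] that Suc(3) by auto
  have "Ck_on k (UNIV - {0}) (\<lambda>x. frechet_derivative F' (at x) b)" if "b \<in> Basis" for b
  proof -
    obtain i where "b = axis i 1" using \<open>b \<in> Basis\<close> unfolding Basis_real3 by (elim imageE)
    then have "frechet_derivative F' (at y) b = D i y" if "y \<noteq> 0" for y
      using frechet_derivative_grad[OF D'[OF that]] by (simp add: grad_form_axis)
    then show ?thesis by (rule Suc.IH[OF D(1)])
  qed
  then show ?case using D' by (auto simp: differentiable_def)
qed

text \<open>
  On \<open>U\<close>, the functions \<open>D i\<close> are the partial derivatives of \<open>F\<close>, and \<open>L\<close> is its Laplacian.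
\<close>

definition jet2 :: "(real^3) set \<Rightarrow> (real^3 \<Rightarrow> complex) \<Rightarrow> (3 \<Rightarrow> real^3 \<Rightarrow> complex) \<Rightarrow> (real^3 \<Rightarrow> complex) \<Rightarrow> bool" where
  "jet2 U F D L \<longleftrightarrow> (\<forall>y\<in>U. (F has_derivative grad_form (\<lambda>i. D i y)) (at y)) \<and>
     (\<exists>H. (\<forall>i. \<forall>y\<in>U. (D i has_derivative grad_form (\<lambda>j. H i j y)) (at y)) \<and> (\<forall>y\<in>U. L y = (\<Sum>i\<in>UNIV. H i i y)))"

lemma jet2_laplacian:
  assumes "open U" "jet2 U F D L" "y \<in> U"
  shows "laplacian F y = L y"
proof -
  obtain H where H: "\<And>i y. y \<in> U \<Longrightarrow> (D i has_derivative grad_form (\<lambda>j. H i j y)) (at y)" "L y = (\<Sum>i\<in>UNIV. H i i y)"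
    using assms(2,3) unfolding jet2_def by blast
  have F: "\<And>y. y \<in> U \<Longrightarrow> (F has_derivative grad_form (\<lambda>i. D i y)) (at y)" using assms by (auto simp: jet2_def)
  have "frechet_derivative (\<lambda>y. frechet_derivative F (at y) (axis i 1)) (at y) (axis i 1) = H i i y" for i
  proof -
    have "((\<lambda>y. frechet_derivative F (at y) (axis i 1)) has_derivative grad_form (\<lambda>j. H i j y)) (at y)"
      by (rule has_derivative_transform_within_open[OF H(1)[OF assms(3)] assms(1,3)])
        (use frechet_derivative_grad[OF F] grad_form_axis in simp)
    from frechet_derivative_grad[OF this] show ?thesis by (simp only: grad_form_axis)
  qed
  moreover have "laplacian F y = (\<Sum>i\<in>UNIV. frechet_derivative (\<lambda>y. frechet_derivative F (at y) (axis i 1)) (at y) (axis i (1::real)))"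
    unfolding laplacian_def Basis_real3
    by (subst sum.reindex) (auto simp: inj_on_def axis_eq_axis)
  ultimately show ?thesis using H(2) by simp
qed

lemma jet2_cong:
  assumes "jet2 U F D L" "open U" "\<And>y. y \<in> U \<Longrightarrow> F' y = F y"
    "\<And>i y. y \<in> U \<Longrightarrow> D' i y = D i y" "\<And>y. y \<in> U \<Longrightarrow> L' y = L y"
  shows "jet2 U F' D' L'"
proof -
  obtain H where H: "\<And>i y. y \<in> U \<Longrightarrow> (D i has_derivative grad_form (\<lambda>j. H i j y)) (at y)" "\<And>y. y \<in> U \<Longrightarrow> L y = (\<Sum>i\<in>UNIV. H i i y)"
    using assms(1) unfolding jet2_def by blast
  have "(F' has_derivative grad_form (\<lambda>i. D' i y)) (at y)" if y: "y \<in> U" for y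
  proof -
    have "(F has_derivative grad_form (\<lambda>i. D i y)) (at y)" using assms(1) y by (auto simp: jet2_def)
    from has_derivative_transform_within_open[OF this assms(2) y, of F'] assms(3)
    have "(F' has_derivative grad_form (\<lambda>i. D i y)) (at y)" by simp
    moreover have "grad_form (\<lambda>i. D i y) = grad_form (\<lambda>i. D' i y)" using assms(4) y by simp
    ultimately show ?thesis by simp
  qed
  moreover have "(D' i has_derivative grad_form (\<lambda>j. H i j y)) (at y)" if y: "y \<in> U" for i y
    using has_derivative_transform_within_open[OF H(1)[OF y] assms(2) y, of i "D' i"] assms(4) by simp
  ultimately show ?thesis using H(2) assms(5) unfolding jet2_def by (intro conjI exI[of _ H]) auto
qed

lemma jet2_const: "jet2 U (\<lambda>y. c) (\<lambda>i y. 0) (\<lambda>y. 0)"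
  unfolding jet2_def by (intro conjI exI[of _ "\<lambda>i j y. 0"]) auto

lemma jet2_coord: "jet2 U (\<lambda>y. of_real (y $ k)) (\<lambda>i y. if i = k then 1 else 0) (\<lambda>y. 0)"
  unfolding jet2_def
  by (intro conjI exI[of _ "\<lambda>i j y. 0"]) (use has_derivative_grad_coord in auto)

lemma jet2_add:
  assumes "jet2 U F D L" "jet2 U F' D' L'"
  shows "jet2 U (\<lambda>y. F y + F' y) (\<lambda>i y. D i y + D' i y) (\<lambda>y. L y + L' y)"
proof -
  obtain H H' where H: "\<forall>i. \<forall>y\<in>U. (D i has_derivative grad_form (\<lambda>j. H i j y)) (at y)" "\<forall>y\<in>U. L y = (\<Sum>i\<in>UNIV. H i i y)"
    "\<forall>i. \<forall>y\<in>U. (D' i has_derivative grad_form (\<lambda>j. H' i j y)) (at y)" "\<forall>y\<in>U. L' y = (\<Sum>i\<in>UNIV. H' i i y)"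
    using assms unfolding jet2_def by blast
  then show ?thesis using assms unfolding jet2_def
    by (intro conjI exI[of _ "\<lambda>i j y. H i j y + H' i j y"]) (auto intro!: has_derivative_grad_add simp: sum.distrib)
qed

lemma jet2_mult:
  assumes "jet2 U F D L" "jet2 U F' D' L'"
  shows "jet2 U (\<lambda>y. F y * F' y) (\<lambda>i y. D i y * F' y + F y * D' i y)
    (\<lambda>y. L y * F' y + 2 * (\<Sum>i\<in>UNIV. D i y * D' i y) + F y * L' y)"
proof -
  obtain H H' where H: "\<forall>i. \<forall>y\<in>U. (D i has_derivative grad_form (\<lambda>j. H i j y)) (at y)" "\<forall>y\<in>U. L y = (\<Sum>i\<in>UNIV. H i i y)"
    "\<forall>i. \<forall>y\<in>U. (D' i has_derivative grad_form (\<lambda>j. H' i j y)) (at y)" "\<forall>y\<in>U. L' y = (\<Sum>i\<in>UNIV. H' i i y)"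
    using assms unfolding jet2_def by blast
  have F: "\<forall>y\<in>U. (F has_derivative grad_form (\<lambda>i. D i y)) (at y)" "\<forall>y\<in>U. (F' has_derivative grad_form (\<lambda>i. D' i y)) (at y)"
    using assms by (auto simp: jet2_def)
  let ?H = "\<lambda>i j y. (H i j y * F' y + D i y * D' j y) + (D j y * D' i y + F y * H' i j y)"
  have "\<forall>i. \<forall>y\<in>U. ((\<lambda>y. D i y * F' y + F y * D' i y) has_derivative grad_form (\<lambda>j. ?H i j y)) (at y)"
    using F H by (intro allI ballI has_derivative_grad_add has_derivative_grad_mult) auto
  moreover have "\<forall>y\<in>U. L y * F' y + 2 * (\<Sum>i\<in>UNIV. D i y * D' i y) + F y * L' y = (\<Sum>i\<in>UNIV. ?H i i y)"
    using H by (auto simp: sum.distrib sum_distrib_left sum_distrib_right algebra_simps)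
  moreover have "\<forall>y\<in>U. ((\<lambda>y. F y * F' y) has_derivative grad_form (\<lambda>i. D i y * F' y + F y * D' i y)) (at y)"
    using F by (auto intro!: has_derivative_grad_mult)
  ultimately show ?thesis unfolding jet2_def by (intro conjI exI[of _ ?H])
qed

text \<open>The Newtonian potential is harmonic in three dimensions: the trace of its second
  derivatives is \<open>- 3 + 3\<close> times the cube of the inverse norm.\<close>

lemma jet2_inverse_norm:
  "jet2 (UNIV - {0}) (\<lambda>y. of_real (inverse (norm y)))
     (\<lambda>i y. - of_real (y $ i) * of_real (inverse (norm y)) ^ 3) (\<lambda>y. 0)"
proof -
  let ?r = "\<lambda>y :: real^3. complex_of_real (inverse (norm y))"
  let ?D = "\<lambda>i y. - of_real (y $ i) * ?r y ^ 3"
  let ?G = "\<lambda>i (y :: real^3). ?D i y"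
  let ?H = "\<lambda>i j y. (if j = i then - 1 else 0) * ?r y ^ 3 + (- of_real (y $ i)) *
      (?D j y * ?r y ^ 2 + ?r y * (?D j y * ?r y + ?r y * ?D j y))"
  have "(?D i has_derivative grad_form (\<lambda>j. ?H i j y)) (at y)" if y: "y \<noteq> 0" for i y
  proof -
    have r: "(?r has_derivative grad_form (\<lambda>i. ?D i y)) (at y)" by (rule has_derivative_grad_inverse_norm[OF y])
    have c: "((\<lambda>y. - complex_of_real (y $ i)) has_derivative grad_form (\<lambda>j. if j = i then -1 else 0)) (at y)"
      using has_derivative_grad_mult[OF has_derivative_grad_const[of "-1"] has_derivative_grad_coord[of i y]]
      by (simp add: if_distrib cong: if_cong)
    have r2: "((\<lambda>y. ?r y ^ 2) has_derivative grad_form (\<lambda>j. ?D j y * ?r y + ?r y * ?D j y)) (at y)"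
      unfolding power2_eq_square by (rule has_derivative_grad_mult[OF r r])
    have "((\<lambda>y. ?r y ^ 3) has_derivative grad_form (\<lambda>j. ?D j y * ?r y ^ 2 + ?r y * (?D j y * ?r y + ?r y * ?D j y))) (at y)"
      using has_derivative_grad_mult[OF r r2] by (simp only: power3_eq_cube power2_eq_square mult.assoc)
    from has_derivative_grad_mult[OF c this] show ?thesis .
  qed
  moreover have "0 = (\<Sum>i\<in>UNIV. ?H i i y)" if y: "y \<noteq> 0" for y
  proof -
    define r where "r = ?r y"
    define s where "s = (complex_of_real (y $ 1))\<^sup>2 + (of_real (y $ 2))\<^sup>2 + (of_real (y $ 3))\<^sup>2"
    have "s * r\<^sup>2 = of_real (((y $ 1)\<^sup>2 + (y $ 2)\<^sup>2 + (y $ 3)\<^sup>2) * (inverse (norm y))\<^sup>2)"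
      by (simp add: s_def r_def)
    also have "(y $ 1)\<^sup>2 + (y $ 2)\<^sup>2 + (y $ 3)\<^sup>2 = (norm y)\<^sup>2"
      by (simp add: norm_vec_def L2_set_def sum_3)
    also have "of_real ((norm y)\<^sup>2 * (inverse (norm y))\<^sup>2) = (1 :: complex)"
      using y by (simp add: power_mult_distrib[symmetric])
    finally have sr: "s * r\<^sup>2 = 1" .
    have "(\<Sum>i\<in>UNIV. ?H i i y) = - 3 * r ^ 3 + 3 * r ^ 3 * (s * r\<^sup>2)"
      unfolding sum_3 r_def[symmetric] s_def by (simp add: algebra_simps power2_eq_square power3_eq_cube)
    then show ?thesis using sr by simp
  qed
  ultimately show ?thesis
    unfolding jet2_def using has_derivative_grad_inverse_norm by (intro conjI exI[of _ ?H]) auto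
qed

text \<open>The exponents \<open>m - 1\<close> and \<open>m - 2\<close> are truncated only where
  their coefficients vanish.\<close>

lemma jet2_power:
  assumes "jet2 U F D L" "open U"
  shows "jet2 U (\<lambda>y. F y ^ m) (\<lambda>i y. of_nat m * F y ^ (m - 1) * D i y)
    (\<lambda>y. of_nat m * of_nat (m - 1) * F y ^ (m - 2) * (\<Sum>i\<in>UNIV. (D i y)\<^sup>2) + of_nat m * F y ^ (m - 1) * L y)"
proof (induction m)
  case 0
  show ?case using jet2_const[of U 1] by simp
next
  case (Suc m)
  consider "m = 0" | k where "m = Suc k" by (cases m) auto
  then show ?case
  proof cases
    case 1
    then show ?thesis using assms(1) by simp
  next
    case 2
    show ?thesis
    proof (rule jet2_cong[OF jet2_mult[OF assms(1) Suc] assms(2)])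
      fix y
      note [simp del] = sum_distrib_left
      have s: "(\<Sum>i\<in>UNIV. D i y * (of_nat m * F y ^ (m - 1) * D i y)) = of_nat m * F y ^ (m - 1) * (\<Sum>i\<in>UNIV. (D i y)\<^sup>2)"
        by (simp only: sum_distrib_left power2_eq_square mult_ac)
      show "of_nat (Suc m) * of_nat (Suc m - 1) * F y ^ (Suc m - 2) * (\<Sum>i\<in>UNIV. (D i y)\<^sup>2) + of_nat (Suc m) * F y ^ (Suc m - 1) * L y =
         L y * F y ^ m + 2 * (\<Sum>i\<in>UNIV. D i y * (of_nat m * F y ^ (m - 1) * D i y)) +
         F y * (of_nat m * of_nat (m - 1) * F y ^ (m - 2) * (\<Sum>i\<in>UNIV. (D i y)\<^sup>2) + of_nat m * F y ^ (m - 1) * L y)"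
        unfolding s unfolding 2 by (cases k) (simp_all add: algebra_simps)
    qed (simp_all add: 2 algebra_simps)
  qed
qed

lemma jet2_poly:
  fixes f :: "real^3 \<Rightarrow> real"
  assumes "jet2 U (\<lambda>y. of_real (f y)) D L" "open U"
  shows "jet2 U (\<lambda>y. of_real (poly q (f y))) (\<lambda>i y. of_real (poly (pderiv q) (f y)) * D i y)
    (\<lambda>y. of_real (poly (pderiv (pderiv q)) (f y)) * (\<Sum>i\<in>UNIV. (D i y)\<^sup>2) + of_real (poly (pderiv q) (f y)) * L y)"
proof (induction q)
  case 0
  show ?case using jet2_const[of U 0] by simp
next
  case (pCons c q)
  show ?case
  proof (rule jet2_cong[OF jet2_add[OF jet2_const[of U "of_real c"] jet2_mult[OF assms(1) pCons.IH]] assms(2)])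
    fix y
    have s: "(\<Sum>i\<in>UNIV. D i y * (of_real (poly (pderiv q) (f y)) * D i y)) = of_real (poly (pderiv q) (f y)) * (\<Sum>i\<in>UNIV. (D i y)\<^sup>2)"
      by (simp only: sum_distrib_left power2_eq_square mult_ac)
    show "of_real (poly (pderiv (pderiv (pCons c q))) (f y)) * (\<Sum>i\<in>UNIV. (D i y)\<^sup>2) + of_real (poly (pderiv (pCons c q)) (f y)) * L y
      = 0 + (L y * of_real (poly q (f y)) + 2 * (\<Sum>i\<in>UNIV. D i y * (of_real (poly (pderiv q) (f y)) * D i y)) +
          of_real (f y) * (of_real (poly (pderiv (pderiv q)) (f y)) * (\<Sum>i\<in>UNIV. (D i y)\<^sup>2) + of_real (poly (pderiv q) (f y)) * L y))"
      unfolding s by (simp add: pderiv_pCons pderiv_add algebra_simps)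
  qed (simp_all add: pderiv_pCons algebra_simps)
qed

abbreviation rinv :: "real^3 \<Rightarrow> complex" where "rinv y \<equiv> complex_of_real (inverse (norm y))"

lemma poly3_imp_rat_fun_radial: "poly3 \<psi> \<Longrightarrow> rat_fun (radial_extension \<psi>)"
proof (induction rule: poly3.induct)
  case (coord i)
  have "radial_extension (\<lambda>y. complex_of_real (y $ i)) = (\<lambda>y. rinv y * of_real (y $ i))"
    by (auto simp: radial_extension_def)
  then show ?case using rat_fun.mult[OF rat_fun.inverse_norm rat_fun.coord[of i]] by (simp only:)
next
  case (add F G)
  then show ?case using rat_fun.add by (simp add: radial_extension_def[abs_def])
next
  case (mult F G)
  then show ?case using rat_fun.mult by (simp add: radial_extension_def[abs_def])
qed (auto simp: radial_extension_def[abs_def] intro: rat_fun.const)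

lemma poly3_smooth_sphere: "poly3 \<psi> \<Longrightarrow> smooth_sphere \<psi>"
  unfolding smooth_sphere_def using rat_fun_Ck[OF poly3_imp_rat_fun_radial] by blast

lemma poly3_continuous: "poly3 F \<Longrightarrow> continuous_on A F"
  by (induction rule: poly3.induct) (auto intro!: continuous_intros)

lemma poly3_power: "poly3 F \<Longrightarrow> poly3 (\<lambda>y. F y ^ n)"
  by (induction n) (auto intro: poly3.const[of 1, simplified] poly3.mult)

lemma poly3_poly: "poly3 (\<lambda>y. complex_of_real (poly Q (y $ i)))"
proof (induction Q)
  case (pCons c Q)
  then show ?case using poly3.add[OF poly3.const[of "of_real c"] poly3.mult[OF poly3.coord[of i] pCons(2)]] by simp
qed (use poly3.const[of 0] in simp)

text \<open>
  For \<open>\<kappa> = \<i>\<close> or \<open>\<kappa> = -\<i>\<close> the first factor is \<open>(sin \<theta>) ^ m\<close> times a character of \<open>\<phi>\<close>.  These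
  functions span the polynomials on the sphere, and the Laplace--Beltrami operator acts on \<open>Q\<close> alone.
\<close>

definition axial :: "complex \<Rightarrow> nat \<Rightarrow> real poly \<Rightarrow> complex \<Rightarrow> real^3 \<Rightarrow> complex" where
  "axial \<kappa> m Q c x = c * (of_real (x $ 1) + \<kappa> * of_real (x $ 2)) ^ m * of_real (poly Q (x $ 3))"

lemma poly3_axial: "poly3 (axial \<kappa> m Q c)"
  unfolding axial_def[abs_def]
  by (intro poly3.mult poly3_power poly3.add poly3.const poly3.coord poly3_poly)

text \<open>The spherical Laplacian of an \<open>axial\<close> function keeps the first factor and
  acts on \<open>Q\<close> by this operator. For \<open>m = 0\<close> it is Legendre's operator, for
  larger \<open>m\<close> the associated one with the power of \<open>sin \<theta>\<close> divided
  out.\<close>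

definition legendre_op :: "nat \<Rightarrow> real poly \<Rightarrow> real poly" where
  "legendre_op m Q = [:1, 0, -1:] * pderiv (pderiv Q) - smult (2 * real m + 2) ([:0, 1:] * pderiv Q)
     - smult (real m * (real m + 1)) Q"

text \<open>The radial extension is \<open>c * z ^ m * Q f\<close> with \<open>z\<close> and
  \<open>f\<close> homogeneous of degree zero. On the sphere the product and chain rules need only
  the Laplacians \<open>Lz\<close>, \<open>Lf\<close> and the products of gradients
  \<open>zz\<close>, \<open>ff\<close>, \<open>zf\<close>, all of which are polynomials in
  \<open>z\<close> and \<open>f\<close>.\<close>

lemma axial_jet:
  assumes \<kappa>: "\<kappa>\<^sup>2 = -1"
  obtains D L where "jet2 (UNIV - {0}) (radial_extension (axial \<kappa> m Q c)) D L"
    "\<And>x. x \<in> S2 \<Longrightarrow> L x = axial \<kappa> m (legendre_op m Q) c x"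
proof -
  let ?U = "UNIV - {0 :: real^3}"
  have U: "open ?U" by auto
  let ?w = "\<lambda>y :: real^3. of_real (y $ 1) + \<kappa> * of_real (y $ 2)"
  let ?e = "\<lambda>i :: 3. (if i = 1 then 1 else 0) + \<kappa> * (if i = 2 then 1 else 0)"
  let ?r' = "\<lambda>i y. - of_real (y $ i) * rinv y ^ 3"
  have w: "jet2 ?U ?w (\<lambda>i y. ?e i) (\<lambda>y. 0)"
    by (rule jet2_cong[OF jet2_add[OF jet2_coord[of ?U 1] jet2_mult[OF jet2_const[of ?U \<kappa>] jet2_coord[of ?U 2]]] U]) auto
  define z where "z y = ?w y * rinv y" for y
  define Dz where "Dz i y = ?e i * rinv y + ?w y * ?r' i y" for i y
  define Lz where "Lz y = 0 * rinv y + 2 * (\<Sum>i\<in>UNIV. ?e i * ?r' i y) + ?w y * 0" for y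
  have z: "jet2 ?U z Dz Lz"
    unfolding z_def[abs_def] Dz_def[abs_def] Lz_def[abs_def] by (rule jet2_mult[OF w jet2_inverse_norm])
  define f where "f y = y $ 3 * inverse (norm y)" for y :: "real^3"
  define Df where "Df i y = (if i = 3 then 1 else 0) * rinv y + of_real (y $ 3) * ?r' i y" for i y
  define Lf where "Lf y = 0 * rinv y + 2 * (\<Sum>i\<in>UNIV. (if i = 3 then 1 else 0) * ?r' i y) + of_real (y $ 3) * 0" for y
  have f: "jet2 ?U (\<lambda>y. of_real (f y)) Df Lf"
    unfolding Df_def[abs_def] Lf_def[abs_def] f_def[abs_def] of_real_mult
    by (rule jet2_mult[OF jet2_coord jet2_inverse_norm])
  note zm = jet2_power[OF z U, of m]
  note fq = jet2_poly[OF f U, of Q]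
  note J = jet2_mult[OF jet2_const[of ?U c] jet2_mult[OF zm fq]]
  have ext: "radial_extension (axial \<kappa> m Q c) y = c * (z y ^ m * of_real (poly Q (f y)))" for y
    by (simp add: radial_extension_def axial_def z_def f_def algebra_simps)
  note J' = jet2_cong[OF J U ext refl refl]
  show thesis
  proof (rule that[OF J'])
    fix x assume x: "x \<in> S2"
    then have n: "norm x = 1" by simp
    define a b s where "a = complex_of_real (x $ 1)" and "b = complex_of_real (x $ 2)" and "s = complex_of_real (x $ 3)"
    have "(x $ 1)\<^sup>2 + (x $ 2)\<^sup>2 + (x $ 3)\<^sup>2 = 1" using x by (simp only: S2_iff)
    from arg_cong[OF this, of complex_of_real] have abs: "a * a + b * b + s * s = 1"
      by (simp add: a_def b_def s_def power2_eq_square)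
    have k2: "\<kappa> * \<kappa> = -1" using \<kappa> by (simp add: power2_eq_square)
    define Z where "Z = a + \<kappa> * b"
    have zx: "z x = Z" by (simp add: z_def n Z_def a_def b_def)
    have fx: "f x = x $ 3" by (simp add: f_def n)
    have Dz: "Dz 1 x = 1 - Z * a" "Dz 2 x = \<kappa> - Z * b" "Dz 3 x = - Z * s"
      by (simp_all add: Dz_def n Z_def a_def b_def s_def algebra_simps)
    have Df: "Df 1 x = - s * a" "Df 2 x = - s * b" "Df 3 x = 1 - s * s"
      by (simp_all add: Df_def n a_def b_def s_def)
    have Lz: "Lz x = - 2 * Z" by (simp add: Lz_def n sum_3 Z_def a_def b_def)
    have Lf: "Lf x = - 2 * s" by (simp add: Lf_def n sum_3 s_def)
    \<comment> \<open>As \<open>\<kappa>\<^sup>2 = -1\<close>, the direction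
      \<open>(1, \<kappa>, 0)\<close> is isotropic and the constant term drops out.\<close>
    have zz: "(\<Sum>i\<in>UNIV. (Dz i x)\<^sup>2) = - (Z * Z)"
    proof -
      have "(\<Sum>i\<in>UNIV. (Dz i x)\<^sup>2) = 1 + \<kappa> * \<kappa> - 2 * Z * (a + \<kappa> * b) + Z * Z * (a * a + b * b + s * s)"
        unfolding sum_3 Dz by (simp add: power2_eq_square algebra_simps)
      then show ?thesis unfolding abs k2 Z_def[symmetric] by simp
    qed
    have ff: "(\<Sum>i\<in>UNIV. (Df i x)\<^sup>2) = 1 - s * s"
    proof -
      have "(\<Sum>i\<in>UNIV. (Df i x)\<^sup>2) = 1 - 2 * (s * s) + s * s * (a * a + b * b + s * s)"
        unfolding sum_3 Df by (simp add: power2_eq_square algebra_simps)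
      then show ?thesis unfolding abs by simp
    qed
    have zf: "(\<Sum>i\<in>UNIV. Dz i x * Df i x) = - (Z * s)"
    proof -
      have "(\<Sum>i\<in>UNIV. Dz i x * Df i x) = - s * (a + \<kappa> * b) - Z * s + Z * s * (a * a + b * b + s * s)"
        unfolding sum_3 Dz Df by (simp add: algebra_simps)
      then show ?thesis unfolding abs Z_def[symmetric] by simp
    qed
    define q0 q1 q2 where "q0 = complex_of_real (poly Q (x $ 3))"
      and "q1 = complex_of_real (poly (pderiv Q) (x $ 3))"
      and "q2 = complex_of_real (poly (pderiv (pderiv Q)) (x $ 3))"
    have mixed: "(\<Sum>i\<in>UNIV. of_nat m * z x ^ (m - 1) * Dz i x * (of_real (poly (pderiv Q) (f x)) * Df i x)) =
        - of_nat m * Z ^ m * s * q1"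
    proof -
      have "(\<Sum>i\<in>UNIV. of_nat m * z x ^ (m - 1) * Dz i x * (of_real (poly (pderiv Q) (f x)) * Df i x)) =
        of_nat m * Z ^ (m - 1) * q1 * (\<Sum>i\<in>UNIV. Dz i x * Df i x)"
        by (simp only: sum_distrib_left zx fx q1_def mult_ac)
      also have "\<dots> = - of_nat m * Z ^ m * s * q1"
        unfolding zf by (cases m) (simp_all add: algebra_simps)
      finally show ?thesis .
    qed
    have Lzm: "of_nat m * of_nat (m - 1) * z x ^ (m - 2) * (\<Sum>i\<in>UNIV. (Dz i x)\<^sup>2) + of_nat m * z x ^ (m - 1) * Lz x =
        - of_nat m * (of_nat m + 1) * Z ^ m"
    proof -
      consider "m = 0" | "m = 1" | k where "m = Suc (Suc k)" by (metis One_nat_def not0_implies_Suc)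
      then show ?thesis unfolding zx zz Lz by cases (simp_all add: algebra_simps)
    qed
    have op: "complex_of_real (poly (legendre_op m Q) (x $ 3)) =
        (1 - s * s) * q2 - (2 * of_nat m + 2) * (s * q1) - of_nat m * (of_nat m + 1) * q0"
      by (simp add: legendre_op_def q0_def q1_def q2_def s_def algebra_simps)
    show "0 * (z x ^ m * of_real (poly Q (f x))) +
        2 * (\<Sum>i\<in>UNIV. 0 * (of_nat m * z x ^ (m - 1) * Dz i x * of_real (poly Q (f x)) +
             z x ^ m * (of_real (poly (pderiv Q) (f x)) * Df i x))) +
        c * ((of_nat m * of_nat (m - 1) * z x ^ (m - 2) * (\<Sum>i\<in>UNIV. (Dz i x)\<^sup>2) + of_nat m * z x ^ (m - 1) * Lz x) *
              of_real (poly Q (f x)) +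
             2 * (\<Sum>i\<in>UNIV. of_nat m * z x ^ (m - 1) * Dz i x * (of_real (poly (pderiv Q) (f x)) * Df i x)) +
             z x ^ m * (of_real (poly (pderiv (pderiv Q)) (f x)) * (\<Sum>i\<in>UNIV. (Df i x)\<^sup>2) +
               of_real (poly (pderiv Q) (f x)) * Lf x)) =
        axial \<kappa> m (legendre_op m Q) c x"
      unfolding mixed Lzm ff Lf axial_def op
      unfolding zx fx a_def[symmetric] b_def[symmetric] Z_def[symmetric] q0_def[symmetric] q1_def[symmetric] q2_def[symmetric]
      by (simp add: algebra_simps)
  qed
qed

lemma laplace_beltrami_jet:
  assumes "jet2 (UNIV - {0}) (radial_extension h) D L" "x \<in> S2"
  shows "laplace_beltrami h x = L x"
proof -
  have "x \<noteq> 0" using assms(2) by auto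
  then show ?thesis unfolding laplace_beltrami_def by (intro jet2_laplacian[OF _ assms(1)]) auto
qed

lemma laplace_beltrami_axial:
  assumes "\<kappa>\<^sup>2 = -1" "x \<in> S2"
  shows "laplace_beltrami (axial \<kappa> m Q c) x = axial \<kappa> m (legendre_op m Q) c x"
  using axial_jet[OF assms(1), of m Q c] laplace_beltrami_jet assms(2) by metis

text \<open>Closure under equality on the sphere is built in because the relation
  \<open>(x $ 1)\<^sup>2 + (x $ 2)\<^sup>2 = 1 - (x $ 3)\<^sup>2\<close>, which lowers the degree in
  the first two coordinates, holds only there.\<close>

inductive axial_span :: "(real^3 \<Rightarrow> complex) \<Rightarrow> bool" where
  axial: "\<kappa>\<^sup>2 = -1 \<Longrightarrow> axial_span (axial \<kappa> m Q c)"
| add: "axial_span F \<Longrightarrow> axial_span G \<Longrightarrow> axial_span (\<lambda>x. F x + G x)"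
| cong: "axial_span F \<Longrightarrow> (\<And>x. x \<in> S2 \<Longrightarrow> G x = F x) \<Longrightarrow> axial_span G"

lemma axial_span_scale: "axial_span F \<Longrightarrow> axial_span (\<lambda>x. F x * c)"
proof (induction rule: axial_span.induct)
  case (axial \<kappa> m Q d)
  show ?case
    by (rule axial_span.cong[OF axial_span.axial[OF axial, of m Q "c * d"]]) (simp add: axial_def)
next
  case (add F G)
  show ?case by (rule axial_span.cong[OF axial_span.add[OF add.IH]]) (simp add: algebra_simps)
next
  case (cong F G)
  show ?case by (rule axial_span.cong[OF cong.IH]) (simp add: cong.hyps)
qed

text \<open>Multiplication by \<open>x $ 1 + \<kappa> * x $ 2\<close> raises \<open>m\<close>,
  multiplication by \<open>x $ 1 - \<kappa> * x $ 2\<close> lowers it, and the first two coordinates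
  are combinations of these factors. For \<open>m = 0\<close> lowering means raising with the
  opposite sign of \<kappa>.\<close>

lemma axial_span_coord: "axial_span F \<Longrightarrow> axial_span (\<lambda>x. F x * of_real (x $ k))"
proof (induction rule: axial_span.induct)
  case (axial \<kappa> m Q c)
  have \<kappa>: "(- \<kappa>)\<^sup>2 = -1" "\<kappa> \<noteq> 0" using axial by auto
  let ?w = "\<lambda>\<kappa> x. complex_of_real (x $ 1) + \<kappa> * of_real (x $ 2)"
  have up: "axial_span (\<lambda>x. axial \<kappa> m Q c x * ?w \<kappa> x)"
    by (rule axial_span.cong[OF axial_span.axial[OF axial, of "Suc m" Q c]]) (simp add: axial_def)
  have down: "axial_span (\<lambda>x. axial \<kappa> m Q c x * ?w (- \<kappa>) x)"
  proof (cases m)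
    case 0
    show ?thesis
      by (rule axial_span.cong[OF axial_span.axial[OF \<kappa>(1), of 1 Q c]]) (simp add: axial_def 0)
  next
    case (Suc k)
    show ?thesis
    proof (rule axial_span.cong[OF axial_span.axial[OF axial, of k "[:1, 0, -1:] * Q" c]])
      fix x assume "x \<in> S2"
      then have "(x $ 1)\<^sup>2 + (x $ 2)\<^sup>2 = 1 - (x $ 3)\<^sup>2" unfolding S2_iff by simp
      from arg_cong[OF this, of complex_of_real]
      have "(of_real (x $ 1))\<^sup>2 + (of_real (x $ 2))\<^sup>2 = 1 - (complex_of_real (x $ 3))\<^sup>2" by simp
      moreover have "?w \<kappa> x * ?w (- \<kappa>) x = (of_real (x $ 1))\<^sup>2 - \<kappa>\<^sup>2 * (of_real (x $ 2))\<^sup>2"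
        by (simp add: algebra_simps power2_eq_square)
      ultimately have ww: "?w \<kappa> x * ?w (- \<kappa>) x = 1 - (complex_of_real (x $ 3))\<^sup>2"
        unfolding axial by simp
      have "axial \<kappa> m Q c x * ?w (- \<kappa>) x = c * ?w \<kappa> x ^ k * of_real (poly Q (x $ 3)) * (?w \<kappa> x * ?w (- \<kappa>) x)"
        by (simp only: axial_def Suc power_Suc mult_ac)
      also have "\<dots> = axial \<kappa> k ([:1, 0, -1:] * Q) c x"
        unfolding ww by (simp add: axial_def algebra_simps power2_eq_square)
      finally show "axial \<kappa> m Q c x * ?w (- \<kappa>) x = axial \<kappa> k ([:1, 0, -1:] * Q) c x" .
    qed
  qed
  consider "k = 1" | "k = 2" | "k = 3" using exhaust_3[of k] by blast
  then show ?case
  proof cases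
    case 1
    show ?thesis
      by (rule axial_span.cong[OF axial_span_scale[OF axial_span.add[OF up down], of "1/2"]])
        (simp add: 1 algebra_simps)
  next
    case 2
    show ?thesis
      by (rule axial_span.cong[OF axial_span_scale[OF axial_span.add[OF up axial_span_scale[OF down, of "-1"]], of "1/(2*\<kappa>)"]])
        (use \<kappa>(2) in \<open>simp add: 2 field_simps\<close>)
  next
    case 3
    show ?thesis
      by (rule axial_span.cong[OF axial_span.axial[OF axial, of m "pCons 0 Q" c]]) (simp add: axial_def 3)
  qed
next
  case (add F G)
  show ?case by (rule axial_span.cong[OF axial_span.add[OF add.IH]]) (simp add: algebra_simps)
next
  case (cong F G)
  show ?case by (rule axial_span.cong[OF cong.IH]) (simp add: cong.hyps)
qed

lemma axial_span_mult_poly3: "poly3 h \<Longrightarrow> axial_span F \<Longrightarrow> axial_span (\<lambda>x. F x * h x)"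
proof (induction arbitrary: F rule: poly3.induct)
  case (add h1 h2)
  show ?case
    by (rule axial_span.cong[OF axial_span.add[OF add.IH[OF add.prems]]]) (simp add: algebra_simps)
next
  case (mult h1 h2)
  show ?case
    by (rule axial_span.cong[OF mult.IH(2)[OF mult.IH(1)[OF mult.prems]]]) (simp add: algebra_simps)
qed (simp_all add: axial_span_scale axial_span_coord)

lemma poly3_axial_span:
  assumes "poly3 h"
  shows "axial_span h"
proof -
  have "axial_span (axial \<i> 0 1 1)" by (rule axial_span.axial) simp
  from axial_span_mult_poly3[OF assms this] show ?thesis by (simp add: axial_def)
qed

lemma axial_span_continuous: "axial_span F \<Longrightarrow> continuous_on S2 F"
proof (induction rule: axial_span.induct)
  case (cong F G)
  then show ?case using continuous_on_cong by metis
qed (auto intro!: continuous_intros poly3_continuous[OF poly3_axial])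

lemma polynomial_function_poly3:
  assumes "polynomial_function (h :: real^3 \<Rightarrow> complex)"
  shows "poly3 h"
proof -
  have real: "poly3 (\<lambda>x. complex_of_real (g x))" if "real_polynomial_function g" for g :: "real^3 \<Rightarrow> real"
    using that
  proof (induction rule: real_polynomial_function.induct)
    case (linear g)
    then interpret g: bounded_linear g .
    have "g x = (\<Sum>i\<in>UNIV. x $ i * g (axis i 1))" for x
    proof -
      have "g x = g (\<Sum>i\<in>UNIV. x $ i *\<^sub>R axis i 1)" by (simp add: basis_expansion scalar_mult_eq_scaleR[symmetric])
      then show ?thesis by (simp add: g.sum g.scaleR)
    qed
    note gx = this
    have "(\<lambda>x. complex_of_real (g x)) = (\<lambda>x. of_real (x $ 1) * of_real (g (axis 1 1)) +
        of_real (x $ 2) * of_real (g (axis 2 1)) + of_real (x $ 3) * of_real (g (axis 3 1)))"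
    proof
      fix x
      show "complex_of_real (g x) = of_real (x $ 1) * of_real (g (axis 1 1)) +
        of_real (x $ 2) * of_real (g (axis 2 1)) + of_real (x $ 3) * of_real (g (axis 3 1))"
        unfolding gx[of x] sum_3 by simp
    qed
    then show ?case by (simp only:) (intro poly3.add poly3.mult poly3.coord poly3.const)
  qed (auto intro: poly3.const poly3.add poly3.mult)
  have "poly3 (\<lambda>x. of_real (Re (h x)) + \<i> * of_real (Im (h x)))"
    using assms unfolding polynomial_function_def o_def
    by (intro poly3.add poly3.mult poly3.const real) (auto intro: bounded_linear_Re bounded_linear_Im)
  then show ?thesis by (simp add: complex_eq[symmetric])
qed

section \<open>Orthogonality and identification of the solution\<close>

text \<open>Differentiation multiplies \<open>cos \<phi> + \<kappa> * sin \<phi>\<close> by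
  \<kappa>. Its power is therefore its own antiderivative up to a factor, and it has period
  \<open>2 * pi\<close>.\<close>

lemma integral_cos_sin_power:
  assumes "\<kappa>\<^sup>2 = -1" "m \<ge> 1"
  shows "integral {0..2*pi} (\<lambda>\<phi>. (of_real (cos \<phi>) + \<kappa> * complex_of_real (sin \<phi>)) ^ m) = 0"
proof -
  obtain k where m: "m = Suc k" using assms(2) by (cases m) auto
  have k2: "\<kappa> * \<kappa> = -1" using assms(1) by (simp add: power2_eq_square)
  then have "\<kappa> \<noteq> 0" by auto
  let ?g = "\<lambda>w. (cos w + \<kappa> * sin w) ^ m / (of_nat m * \<kappa>)"
  have "((\<lambda>\<phi>. ?g (of_real \<phi>)) has_vector_derivative (of_real (cos \<phi>) + \<kappa> * complex_of_real (sin \<phi>)) ^ m) (at \<phi> within {0..2*pi})" for \<phi>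
  proof (rule has_vector_derivative_real_field)
    define w where "w = complex_of_real \<phi>"
    have "(?g has_field_derivative of_nat m * (cos w + \<kappa> * sin w) ^ (m - 1) * (- sin w + \<kappa> * cos w) / (of_nat m * \<kappa>)) (at w)"
    proof -
      have "((\<lambda>w. (cos w + \<kappa> * sin w) ^ m) has_field_derivative of_nat m * (cos w + \<kappa> * sin w) ^ (m - 1) * (- sin w + \<kappa> * cos w)) (at w)"
        by (auto intro!: derivative_eq_intros simp: algebra_simps)
      then show ?thesis by (rule DERIV_cdivide)
    qed
    also have "- sin w + \<kappa> * cos w = \<kappa> * (cos w + \<kappa> * sin w)"
      by (simp add: distrib_left mult.assoc[symmetric] k2)
    also have "of_nat m * (cos w + \<kappa> * sin w) ^ (m - 1) * (\<kappa> * (cos w + \<kappa> * sin w)) / (of_nat m * \<kappa>) = (cos w + \<kappa> * sin w) ^ m"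
      using \<open>\<kappa> \<noteq> 0\<close> unfolding m by (simp del: of_nat_Suc)
    finally show "(?g has_field_derivative (of_real (cos \<phi>) + \<kappa> * complex_of_real (sin \<phi>)) ^ m) (at (of_real \<phi>))"
      by (simp add: w_def cos_of_real sin_of_real)
  qed
  then have "((\<lambda>\<phi>. (of_real (cos \<phi>) + \<kappa> * complex_of_real (sin \<phi>)) ^ m) has_integral
      (?g (of_real (2 * pi)) - ?g (of_real 0))) {0..2*pi}"
    by (intro fundamental_theorem_of_calculus) auto
  moreover have "?g (of_real (2 * pi)) = ?g (of_real 0)"
    unfolding cos_of_real sin_of_real by simp
  ultimately show ?thesis by (simp add: integral_unique)
qed

definition zonal_fun :: "(real \<Rightarrow> complex) \<Rightarrow> real^3 \<Rightarrow> complex" where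
  "zonal_fun f x = f (arccos (x $ 3))"

lemma S2_nth3:
  assumes "x \<in> S2"
  shows "-1 \<le> x $ 3" "x $ 3 \<le> 1"
proof -
  have "(x $ 1)\<^sup>2 + (x $ 2)\<^sup>2 + (x $ 3)\<^sup>2 = 1" using assms by (simp only: S2_iff)
  then have "(x $ 3)\<^sup>2 \<le> 1"
    using zero_le_power2[of "x $ 1"] zero_le_power2[of "x $ 2"] by linarith
  then show "-1 \<le> x $ 3" "x $ 3 \<le> 1" by (simp_all add: abs_square_le_1 abs_le_iff)
qed

lemma zonal_fun_spherical_coords:
  "0 \<le> \<theta> \<Longrightarrow> \<theta> \<le> pi \<Longrightarrow> zonal_fun f (spherical_coords (\<theta>, \<phi>)) = f \<theta>"
  by (simp add: zonal_fun_def arccos_cos)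

lemma continuous_on_zonal_fun:
  assumes "continuous_on UNIV f"
  shows "continuous_on S2 (zonal_fun f)"
proof -
  have "continuous_on S2 (\<lambda>x :: real^3. arccos (x $ 3))"
    using S2_nth3 by (intro continuous_on_compose2[OF continuous_on_arccos' continuous_on_component]) auto
  from continuous_on_compose2[OF assms this] show ?thesis
    by (simp add: zonal_fun_def[abs_def])
qed

lemma integral_zonal_axial:
  assumes f: "continuous_on UNIV f" and \<kappa>: "\<kappa>\<^sup>2 = -1"
  shows "integral\<^sup>L sphere_measure (\<lambda>x. zonal_fun f x * axial \<kappa> m Q c x) =
    (if m = 0 then 2 * of_real pi * c * integral {0..pi} (\<lambda>\<theta>. of_real (sin \<theta>) * (f \<theta> * of_real (poly Q (cos \<theta>)))) else 0)"
proof -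
  let ?f = "\<lambda>\<theta>. c * of_real (sin \<theta>) ^ m * (f \<theta> * of_real (poly Q (cos \<theta>)))"
  let ?g = "\<lambda>\<phi>. (of_real (cos \<phi>) + \<kappa> * complex_of_real (sin \<phi>)) ^ m"
  have "integral\<^sup>L sphere_measure (\<lambda>x. zonal_fun f x * axial \<kappa> m Q c x) =
      integral {0..pi} (\<lambda>\<theta>. of_real (sin \<theta>) * ?f \<theta>) * integral {0..2*pi} ?g"
  proof (rule integral_sphere_product)
    show "(\<lambda>x. zonal_fun f x * axial \<kappa> m Q c x) \<in> borel_measurable sphere_measure"
      by (intro borel_measurable_sphere_continuous continuous_intros continuous_on_zonal_fun f poly3_continuous poly3_axial)
    show "continuous_on UNIV ?f" by (intro continuous_intros f)
    show "continuous_on UNIV ?g" by (intro continuous_intros)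
    fix \<theta> \<phi> :: real assume "0 \<le> \<theta>" "\<theta> \<le> pi"
    moreover have "of_real (sin \<theta> * cos \<phi>) + \<kappa> * of_real (sin \<theta> * sin \<phi>) =
       of_real (sin \<theta>) * (of_real (cos \<phi>) + \<kappa> * complex_of_real (sin \<phi>))"
      by (simp add: algebra_simps)
    ultimately show "zonal_fun f (spherical_coords (\<theta>, \<phi>)) * axial \<kappa> m Q c (spherical_coords (\<theta>, \<phi>)) = ?f \<theta> * ?g \<phi>"
      by (simp only: zonal_fun_spherical_coords axial_def spherical_coords_nth power_mult_distrib mult_ac)
  qed
  also have "\<dots> = (if m = 0 then 2 * of_real pi * c * integral {0..pi} (\<lambda>\<theta>. of_real (sin \<theta>) * (f \<theta> * of_real (poly Q (cos \<theta>)))) else 0)"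
  proof (cases "m = 0")
    case True
    have "integral {0..2*pi} ?g = 2 * of_real pi"
      using has_integral_const_real[of "1::complex" 0 "2*pi"] True
      by (simp add: integral_unique scaleR_conv_of_real)
    moreover have "integral {0..pi} (\<lambda>\<theta>. of_real (sin \<theta>) * ?f \<theta>) =
        integral {0..pi} (\<lambda>\<theta>. c * (of_real (sin \<theta>) * (f \<theta> * of_real (poly Q (cos \<theta>)))))"
      using True by (simp add: mult_ac)
    ultimately show ?thesis using True by (simp add: mult_ac)
  qed (use integral_cos_sin_power[OF \<kappa>, of m] in simp)
  finally show ?thesis .
qed

section \<open>Legendre polynomials as orthogonal eigenfunctions\<close>

lemma integral_sin_poly_pderiv:
  "((\<lambda>\<theta>. sin \<theta> * poly (pderiv R) (cos \<theta>)) has_integral (poly R 1 - poly R (-1))) {0..pi}"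
proof -
  have "((\<lambda>\<theta>. - poly R (cos \<theta>)) has_vector_derivative sin \<theta> * poly (pderiv R) (cos \<theta>)) (at \<theta> within {0..pi})" for \<theta>
    unfolding has_real_derivative_iff_has_vector_derivative[symmetric]
    by (rule derivative_eq_intros DERIV_chain2[OF poly_DERIV] refl)+ simp
  then have "((\<lambda>\<theta>. sin \<theta> * poly (pderiv R) (cos \<theta>)) has_integral (- poly R (cos pi) - (- poly R (cos 0)))) {0..pi}"
    by (intro fundamental_theorem_of_calculus) auto
  then show ?thesis by simp
qed

lemma legendre_op_leg: "poly (legendre_op 0 (legendre_poly n)) s = - real n * (real n + 1) * leg n s"
  using legendre_ode[of s n] by (simp add: legendre_op_def algebra_simps power2_eq_square)

text \<open>Lagrange's identity: \<open>R\<close> is \<open>[:1, 0, -1:]\<close> times the Wronskian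
  of the two polynomials and vanishes at both ends of the interval from -1 to 1.\<close>

lemma integral_legendre_op:
  "integral {0..pi} (\<lambda>\<theta>. sin \<theta> * (leg n (cos \<theta>) * poly (legendre_op 0 Q) (cos \<theta>))) =
     - real n * (real n + 1) * integral {0..pi} (\<lambda>\<theta>. sin \<theta> * (leg n (cos \<theta>) * poly Q (cos \<theta>)))"
proof -
  let ?P = "legendre_poly n"
  define R where "R = [:1, 0, -1:] * (?P * pderiv Q - Q * pderiv ?P)"
  have "poly (pderiv R) s = leg n s * poly (legendre_op 0 Q) s - poly Q s * poly (legendre_op 0 ?P) s" for s
    unfolding R_def pderiv_mult pderiv_diff
    by (simp add: pderiv_pCons pderiv_mult pderiv_diff legendre_op_def algebra_simps)
  then have eq: "poly (pderiv R) s = leg n s * poly (legendre_op 0 Q) s + real n * (real n + 1) * (leg n s * poly Q s)" for s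
    unfolding legendre_op_leg by (simp add: algebra_simps)
  have "((\<lambda>\<theta>. sin \<theta> * poly (pderiv R) (cos \<theta>)) has_integral 0) {0..pi}"
    using integral_sin_poly_pderiv[of R] by (simp add: R_def)
  moreover have "((\<lambda>\<theta>. sin \<theta> * (leg n (cos \<theta>) * poly (legendre_op 0 Q) (cos \<theta>)) +
        real n * (real n + 1) * (sin \<theta> * (leg n (cos \<theta>) * poly Q (cos \<theta>)))) has_integral
     integral {0..pi} (\<lambda>\<theta>. sin \<theta> * (leg n (cos \<theta>) * poly (legendre_op 0 Q) (cos \<theta>))) +
     real n * (real n + 1) * integral {0..pi} (\<lambda>\<theta>. sin \<theta> * (leg n (cos \<theta>) * poly Q (cos \<theta>)))) {0..pi}"
    by (intro has_integral_add has_integral_mult_right integrable_integral integrable_continuous_real continuous_intros)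
  moreover have "(\<lambda>\<theta>. sin \<theta> * poly (pderiv R) (cos \<theta>)) = (\<lambda>\<theta>. sin \<theta> * (leg n (cos \<theta>) * poly (legendre_op 0 Q) (cos \<theta>)) +
        real n * (real n + 1) * (sin \<theta> * (leg n (cos \<theta>) * poly Q (cos \<theta>))))"
    unfolding eq by (simp add: algebra_simps)
  ultimately have "0 = integral {0..pi} (\<lambda>\<theta>. sin \<theta> * (leg n (cos \<theta>) * poly (legendre_op 0 Q) (cos \<theta>))) +
     real n * (real n + 1) * integral {0..pi} (\<lambda>\<theta>. sin \<theta> * (leg n (cos \<theta>) * poly Q (cos \<theta>)))"
    using has_integral_unique by (metis (no_types, lifting))
  then show ?thesis by simp
qed

definition leg_inner :: "nat \<Rightarrow> nat \<Rightarrow> real" where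
  "leg_inner m n = integral {0..pi} (\<lambda>\<theta>. sin \<theta> * (leg m (cos \<theta>) * leg n (cos \<theta>)))"

text \<open>Self-adjointness with distinct eigenvalues; these differ by
  \<open>(m - n) * (m + n + 1)\<close>.\<close>

lemma leg_orthogonal:
  assumes "m \<noteq> n"
  shows "leg_inner m n = 0"
proof -
  have "integral {0..pi} (\<lambda>\<theta>. sin \<theta> * (leg m (cos \<theta>) * poly (legendre_op 0 (legendre_poly n)) (cos \<theta>))) =
      integral {0..pi} (\<lambda>\<theta>. (- real n * (real n + 1)) * (sin \<theta> * (leg m (cos \<theta>) * leg n (cos \<theta>))))"
    unfolding legendre_op_leg by (simp add: mult_ac)
  then have "- real m * (real m + 1) * leg_inner m n = - real n * (real n + 1) * leg_inner m n"
    using integral_legendre_op[of m "legendre_poly n"] by (simp add: leg_inner_def)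
  then have "(real m * (real m + 1) - real n * (real n + 1)) * leg_inner m n = 0"
    by (simp add: algebra_simps)
  moreover have "real m * (real m + 1) - real n * (real n + 1) = (real m - real n) * (real m + real n + 1)"
    by (simp add: algebra_simps)
  moreover have "real m - real n \<noteq> 0" using assms by simp
  moreover have "real m + real n + 1 \<noteq> 0" by linarith
  ultimately show ?thesis by simp
qed

lemma leg_inner_pos: "leg_inner n n \<ge> 0"
  unfolding leg_inner_def
proof (rule integral_nonneg)
  fix \<theta> assume "\<theta> \<in> {0..pi}"
  then show "0 \<le> sin \<theta> * (leg n (cos \<theta>) * leg n (cos \<theta>))"
    by (intro mult_nonneg_nonneg[OF sin_ge_zero zero_le_square]) auto
qed (intro integrable_continuous_real continuous_intros)

abbreviation leg_fun :: "nat \<Rightarrow> real^3 \<Rightarrow> complex" where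
  "leg_fun n \<equiv> axial \<i> 0 (legendre_poly n) 1"

lemma leg_fun_eq: "leg_fun n x = of_real (leg n (x $ 3))"
  by (simp add: axial_def)

lemma leg_fun_zonal: "x \<in> S2 \<Longrightarrow> zonal_fun (\<lambda>\<theta>. of_real (leg n (cos \<theta>))) x = leg_fun n x"
  using S2_nth3[of x] by (simp add: zonal_fun_def leg_fun_eq)

lemma integral_leg_fun_axial:
  assumes \<kappa>: "\<kappa>\<^sup>2 = -1"
  shows "integral\<^sup>L sphere_measure (\<lambda>x. leg_fun n x * axial \<kappa> m Q c x) =
    (if m = 0 then 2 * of_real pi * c * of_real (integral {0..pi} (\<lambda>\<theta>. sin \<theta> * (leg n (cos \<theta>) * poly Q (cos \<theta>)))) else 0)"
proof -
  have "integral\<^sup>L sphere_measure (\<lambda>x. leg_fun n x * axial \<kappa> m Q c x) =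
     integral\<^sup>L sphere_measure (\<lambda>x. zonal_fun (\<lambda>\<theta>. of_real (leg n (cos \<theta>))) x * axial \<kappa> m Q c x)"
    by (intro Bochner_Integration.integral_cong) (auto simp: leg_fun_zonal)
  also have "\<dots> = (if m = 0 then 2 * of_real pi * c * integral {0..pi} (\<lambda>\<theta>. of_real (sin \<theta>) * (of_real (leg n (cos \<theta>)) * of_real (poly Q (cos \<theta>)))) else 0)"
    by (intro integral_zonal_axial \<kappa> continuous_intros)
  also have "integral {0..pi} (\<lambda>\<theta>. of_real (sin \<theta>) * (of_real (leg n (cos \<theta>)) * of_real (poly Q (cos \<theta>)))) =
      complex_of_real (integral {0..pi} (\<lambda>\<theta>. sin \<theta> * (leg n (cos \<theta>) * poly Q (cos \<theta>))))"
  proof -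
    have "(\<lambda>\<theta>. sin \<theta> * (leg n (cos \<theta>) * poly Q (cos \<theta>))) integrable_on {0..pi}"
      by (intro integrable_continuous_real continuous_intros)
    from has_integral_of_real[OF integrable_integral[OF this]]
    have "((\<lambda>\<theta>. complex_of_real (sin \<theta> * (leg n (cos \<theta>) * poly Q (cos \<theta>)))) has_integral
       complex_of_real (integral {0..pi} (\<lambda>\<theta>. sin \<theta> * (leg n (cos \<theta>) * poly Q (cos \<theta>))))) {0..pi}" .
    then show ?thesis by (simp add: integral_unique)
  qed
  finally show ?thesis .
qed

lemma integral_leg_fun_leg_fun:
  "integral\<^sup>L sphere_measure (\<lambda>x. leg_fun m x * leg_fun n x) = of_real (2 * pi * leg_inner m n)"
  by (simp add: integral_leg_fun_axial leg_inner_def)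

text \<open>Linearity extends the identity from axial functions to their span. The Laplacian is
  carried along as the continuous function \<open>L\<close> of a jet, so that the integrals of sums
  can be split.\<close>

lemma axial_span_selfadjoint:
  assumes "axial_span h"
  shows "\<exists>D L. jet2 (UNIV - {0}) (radial_extension h) D L \<and> continuous_on S2 L \<and>
    integral\<^sup>L sphere_measure (\<lambda>x. leg_fun n x * L x) =
      - of_nat n * (of_nat n + 1) * integral\<^sup>L sphere_measure (\<lambda>x. leg_fun n x * h x)"
  using assms
proof induction
  case (axial \<kappa> m Q c)
  obtain D L where J: "jet2 (UNIV - {0}) (radial_extension (axial \<kappa> m Q c)) D L"
    "\<And>x. x \<in> S2 \<Longrightarrow> L x = axial \<kappa> m (legendre_op m Q) c x"
    using axial_jet[OF axial] by metis
  have cL: "continuous_on S2 L"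
    using J(2) poly3_continuous[OF poly3_axial] continuous_on_cong by metis
  have "integral\<^sup>L sphere_measure (\<lambda>x. leg_fun n x * L x) =
     integral\<^sup>L sphere_measure (\<lambda>x. leg_fun n x * axial \<kappa> m (legendre_op m Q) c x)"
    by (intro Bochner_Integration.integral_cong) (auto simp: J(2))
  also have "\<dots> = - of_nat n * (of_nat n + 1) * integral\<^sup>L sphere_measure (\<lambda>x. leg_fun n x * axial \<kappa> m Q c x)"
    unfolding integral_leg_fun_axial[OF axial] using integral_legendre_op[of n Q] by simp
  finally show ?case using J(1) cL by blast
next
  case (add F G)
  then obtain D L D' L' where J: "jet2 (UNIV - {0}) (radial_extension F) D L" "jet2 (UNIV - {0}) (radial_extension G) D' L'"
    and c: "continuous_on S2 L" "continuous_on S2 L'"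
    and I: "integral\<^sup>L sphere_measure (\<lambda>x. leg_fun n x * L x) =
      - of_nat n * (of_nat n + 1) * integral\<^sup>L sphere_measure (\<lambda>x. leg_fun n x * F x)"
      "integral\<^sup>L sphere_measure (\<lambda>x. leg_fun n x * L' x) =
      - of_nat n * (of_nat n + 1) * integral\<^sup>L sphere_measure (\<lambda>x. leg_fun n x * G x)"
    by blast
  have int: "integrable sphere_measure (\<lambda>x. leg_fun n x * H x)" if "continuous_on S2 H" for H
    by (intro integrable_sphere_continuous continuous_intros poly3_continuous poly3_axial that)
  have cFG: "continuous_on S2 F" "continuous_on S2 G" using add.hyps axial_span_continuous by auto
  have "jet2 (UNIV - {0}) (radial_extension (\<lambda>x. F x + G x)) (\<lambda>i y. D i y + D' i y) (\<lambda>y. L y + L' y)"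
    using jet2_add[OF J] by (simp add: radial_extension_def[abs_def])
  moreover have "continuous_on S2 (\<lambda>y. L y + L' y)" using c by (intro continuous_intros)
  moreover have "integral\<^sup>L sphere_measure (\<lambda>x. leg_fun n x * (L x + L' x)) =
      - of_nat n * (of_nat n + 1) * integral\<^sup>L sphere_measure (\<lambda>x. leg_fun n x * (F x + G x))"
    unfolding distrib_left Bochner_Integration.integral_add[OF int[OF c(1)] int[OF c(2)]]
      Bochner_Integration.integral_add[OF int[OF cFG(1)] int[OF cFG(2)]] I
    by (simp add: algebra_simps)
  ultimately show ?case by blast
next
  case (cong F G)
  then obtain D L where J: "jet2 (UNIV - {0}) (radial_extension F) D L" "continuous_on S2 L"
    "integral\<^sup>L sphere_measure (\<lambda>x. leg_fun n x * L x) =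
      - of_nat n * (of_nat n + 1) * integral\<^sup>L sphere_measure (\<lambda>x. leg_fun n x * F x)" by blast
  have "jet2 (UNIV - {0}) (radial_extension G) D L"
    by (rule jet2_cong[OF J(1)]) (auto simp: radial_extension_def cong.hyps)
  have "integral\<^sup>L sphere_measure (\<lambda>x. leg_fun n x * F x) = integral\<^sup>L sphere_measure (\<lambda>x. leg_fun n x * G x)"
    by (intro Bochner_Integration.integral_cong) (auto simp: cong.hyps)
  with J(3) have "integral\<^sup>L sphere_measure (\<lambda>x. leg_fun n x * L x) =
      - of_nat n * (of_nat n + 1) * integral\<^sup>L sphere_measure (\<lambda>x. leg_fun n x * G x)" by (simp only:)
  then show ?case using J(2) \<open>jet2 (UNIV - {0}) (radial_extension G) D L\<close> by blast
qed

section \<open>Spherical harmonics as eigenfunctions\<close>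

lemma jet2_subset: "jet2 U F D L \<Longrightarrow> V \<subseteq> U \<Longrightarrow> jet2 V F D L"
  unfolding jet2_def by blast

lemma poly3_jet2:
  assumes "poly3 h"
  shows "\<exists>D L. jet2 U h D L"
proof -
  obtain D where D: "\<And>i. poly3 (D i)" "\<And>y. (h has_derivative grad_form (\<lambda>i. D i y)) (at y)"
    using poly3_gradient[OF assms] by blast
  have "\<forall>i. \<exists>E. \<forall>y. (D i has_derivative grad_form (\<lambda>j. E j y)) (at y)"
    using poly3_gradient[OF D(1)] by blast
  then obtain H where "\<forall>i y. (D i has_derivative grad_form (\<lambda>j. H i j y)) (at y)"
    by metis
  then have "jet2 U h D (\<lambda>y. \<Sum>i\<in>UNIV. H i i y)"
    using D(2) unfolding jet2_def by blast
  then show ?thesis by blast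
qed

text \<open>The derivative of \<open>h (r *\<^sub>R x)\<close> with respect to \<open>r\<close> at
  \<open>r = 1\<close>, computed once by the chain rule and once from homogeneity.\<close>

lemma euler_homogeneous:
  assumes hom: "\<And>r x. h (r *\<^sub>R x) = r ^ n *\<^sub>R h x" and D: "(h has_derivative grad_form (\<lambda>i. D i x)) (at x)"
  shows "(\<Sum>i\<in>UNIV. of_real (x $ i) * D i x) = of_nat n * h x"
proof -
  have "(h has_derivative grad_form (\<lambda>i. D i x)) (at (1 *\<^sub>R x))" using D by simp
  moreover have "((\<lambda>r. r *\<^sub>R x) has_derivative (\<lambda>r. r *\<^sub>R x)) (at (1::real))"
    by (auto intro!: derivative_eq_intros)
  ultimately have "((\<lambda>r. h (r *\<^sub>R x)) has_derivative (\<lambda>r. grad_form (\<lambda>i. D i x) (r *\<^sub>R x))) (at (1::real))"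
    using has_derivative_compose[of "\<lambda>r. r *\<^sub>R x" "\<lambda>r. r *\<^sub>R x" 1 UNIV h "grad_form (\<lambda>i. D i x)"] by simp
  moreover have "((\<lambda>r. h (r *\<^sub>R x)) has_derivative (\<lambda>r. r *\<^sub>R (of_nat n * h x))) (at (1::real))"
  proof -
    have "((\<lambda>r. r ^ n) has_real_derivative real n) (at (1::real))"
      by (auto intro!: derivative_eq_intros)
    then have "((\<lambda>r. r ^ n) has_derivative (\<lambda>r. real n * r)) (at (1::real))"
      by (simp add: has_field_derivative_def)
    from has_derivative_scaleR_left[OF this, of "h x"] show ?thesis
      unfolding hom by (simp add: scaleR_conv_of_real mult_ac)
  qed
  ultimately have "(\<lambda>r. grad_form (\<lambda>i. D i x) (r *\<^sub>R x)) = (\<lambda>r. r *\<^sub>R (of_nat n * h x))"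
    by (rule has_derivative_unique)
  from fun_cong[OF this, of 1] show ?thesis by (simp add: grad_form_def)
qed

text \<open>The radial extension of \<open>h\<close> is \<open>rinv y ^ n * h y\<close>. On the
  sphere the Laplacian of the first factor contributes \<open>n * (n - 1)\<close>, the mixed term
  contributes \<open>- 2 * n\<^sup>2\<close> by Euler's relation, and \<open>h\<close> itself is
  harmonic.\<close>

lemma spherical_harmonic_jet:
  assumes h: "h \<in> spherical_harmonics n"
  shows "\<exists>D L. jet2 (UNIV - {0}) (radial_extension h) D L \<and>
    (\<forall>x\<in>S2. L x = - of_nat n * (of_nat n + 1) * h x)"
proof -
  have p: "poly3 h" and hom: "\<And>r x. h (r *\<^sub>R x) = r ^ n *\<^sub>R h x" and harm: "\<And>x. laplacian h x = 0"
    using h polynomial_function_poly3 by (auto simp: spherical_harmonics_def)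
  obtain D L where J0: "jet2 UNIV h D L" using poly3_jet2[OF p] by blast
  then have J: "jet2 (UNIV - {0}) h D L" by (rule jet2_subset) simp
  have L0: "L y = 0" for y using jet2_laplacian[OF _ J0, of y] harm by simp
  have euler: "(\<Sum>i\<in>UNIV. of_real (x $ i) * D i x) = of_nat n * h x" for x
    using J0 by (intro euler_homogeneous hom) (simp add: jet2_def)
  have U: "open (UNIV - {0 :: real^3})" by auto
  note R = jet2_power[OF jet2_inverse_norm U, of n]
  have ext: "radial_extension h y = rinv y ^ n * h y" for y
    unfolding radial_extension_def hom by (simp add: scaleR_conv_of_real)
  note J1 = jet2_cong[OF jet2_mult[OF R J] U ext refl refl]
  show ?thesis
  proof (intro exI conjI ballI, rule J1)
    fix x assume x: "x \<in> S2"
    then have nx: "norm x = 1" by simp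
    have "(x $ 1)\<^sup>2 + (x $ 2)\<^sup>2 + (x $ 3)\<^sup>2 = 1" using x by (simp only: S2_iff)
    from arg_cong[OF this, of complex_of_real]
    have s: "(\<Sum>i\<in>UNIV. (complex_of_real (x $ i))\<^sup>2) = 1" by (simp add: sum_3)
    have "(\<Sum>i\<in>UNIV. of_nat n * of_real (x $ i) * D i x) = of_nat n * (\<Sum>i\<in>UNIV. of_real (x $ i) * D i x)"
      by (simp add: sum_distrib_left mult.assoc)
    then have mixed: "(\<Sum>i\<in>UNIV. of_nat n * of_real (x $ i) * D i x) = of_nat n * (of_nat n * h x)"
      unfolding euler .
    show "(of_nat n * of_nat (n - 1) * rinv x ^ (n - 2) * (\<Sum>i\<in>UNIV. (- of_real (x $ i) * rinv x ^ 3)\<^sup>2) + of_nat n * rinv x ^ (n - 1) * 0) * h x +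
        2 * (\<Sum>i\<in>UNIV. of_nat n * rinv x ^ (n - 1) * (- of_real (x $ i) * rinv x ^ 3) * D i x) +
        rinv x ^ n * L x = - of_nat n * (of_nat n + 1) * h x"
      using s mixed by (simp add: nx L0 sum_negf) (cases n; simp add: algebra_simps)
  qed
qed

text \<open>Two jets of the same function are compared: one carries self-adjointness, the other the
  eigenvalue. Both compute \<open>laplace_beltrami h\<close> on the sphere, so they agree
  there.\<close>

lemma spherical_harmonic_orthogonal_leg_fun:
  assumes h: "h \<in> spherical_harmonics n" and "m \<noteq> n"
  shows "integral\<^sup>L sphere_measure (\<lambda>x. leg_fun m x * h x) = 0"
proof -
  have "poly3 h" using h polynomial_function_poly3 by (auto simp: spherical_harmonics_def)
  from axial_span_selfadjoint[OF poly3_axial_span[OF this], of m]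
  obtain D L where J: "jet2 (UNIV - {0}) (radial_extension h) D L"
    "integral\<^sup>L sphere_measure (\<lambda>x. leg_fun m x * L x) =
      - of_nat m * (of_nat m + 1) * integral\<^sup>L sphere_measure (\<lambda>x. leg_fun m x * h x)" by blast
  obtain D' L' where J': "jet2 (UNIV - {0}) (radial_extension h) D' L'"
    "\<And>x. x \<in> S2 \<Longrightarrow> L' x = - of_nat n * (of_nat n + 1) * h x"
    using spherical_harmonic_jet[OF h] by blast
  have "L x = - of_nat n * (of_nat n + 1) * h x" if "x \<in> S2" for x
    using laplace_beltrami_jet[OF J(1) that] laplace_beltrami_jet[OF J'(1) that] J'(2)[OF that] by simp
  then have "integral\<^sup>L sphere_measure (\<lambda>x. leg_fun m x * L x) =
      integral\<^sup>L sphere_measure (\<lambda>x. (- of_nat n * (of_nat n + 1)) * (leg_fun m x * h x))"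
    by (intro Bochner_Integration.integral_cong) auto
  then have "of_nat m * (of_nat m + 1) * integral\<^sup>L sphere_measure (\<lambda>x. leg_fun m x * h x) =
     of_nat n * (of_nat n + 1) * integral\<^sup>L sphere_measure (\<lambda>x. leg_fun m x * h x)"
    using J(2) by simp
  moreover have "of_nat m * (of_nat m + 1) \<noteq> (of_nat n * (of_nat n + 1) :: complex)"
  proof
    assume "of_nat m * (of_nat m + 1) = (of_nat n * (of_nat n + 1) :: complex)"
    then have "of_nat (m * (m + 1)) = (of_nat (n * (n + 1)) :: complex)" by (simp only: of_nat_mult of_nat_add of_nat_1)
    then have "m * (m + 1) = n * (n + 1)" by (simp only: of_nat_eq_iff)
    moreover have "m * (m + 1) < n * (n + 1)" if "m < n" for m n :: nat
      using that by (intro mult_strict_mono) auto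
    ultimately show False using assms(2) by (metis less_irrefl linorder_neqE_nat)
  qed
  ultimately show ?thesis by simp
qed

section \<open>Moments determine a square integrable function\<close>

lemma axial_scale: "axial \<kappa> m (smult r Q) c x = of_real r * axial \<kappa> m Q c x"
  and axial_plus: "axial \<kappa> m (Q + R) c x = axial \<kappa> m Q c x + axial \<kappa> m R c x"
  and axial_coeff: "axial \<kappa> m Q c x = c * axial \<kappa> m Q 1 x"
  by (simp_all add: axial_def algebra_simps)

lemma integrable_L2_axial:
  "w \<in> L2_sphere \<Longrightarrow> integrable sphere_measure (\<lambda>x. w x * axial \<kappa> m Q c x)"
  by (intro integrable_L2_mult_continuous poly3_continuous poly3_axial)

lemma axial_moments_zero_of_monomials:
  assumes w: "w \<in> L2_sphere"
    and z: "\<And>k. integral\<^sup>L sphere_measure (\<lambda>x. w x * axial \<kappa> m (monom 1 k) 1 x) = 0"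
  shows "integral\<^sup>L sphere_measure (\<lambda>x. w x * axial \<kappa> m Q c x) = 0"
proof -
  let ?I = "\<lambda>Q. integral\<^sup>L sphere_measure (\<lambda>x. w x * axial \<kappa> m Q 1 x)"
  have add: "?I (P + R) = ?I P + ?I R" for P R
    unfolding axial_plus distrib_left
    by (intro Bochner_Integration.integral_add integrable_L2_axial w)
  have scale: "?I (smult r P) = of_real r * ?I P" for r P
  proof -
    have "(\<lambda>x. w x * axial \<kappa> m (smult r P) 1 x) = (\<lambda>x. of_real r * (w x * axial \<kappa> m P 1 x))"
      by (simp add: axial_scale mult_ac)
    then show ?thesis by simp
  qed
  have mono: "?I (monom r k) = 0" for r k
    using scale[of r "monom 1 k"] z[of k] by (simp add: smult_monom)
  have zero: "?I 0 = 0" by (simp add: axial_def)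
  have sums: "finite A \<Longrightarrow> ?I (\<Sum>i\<in>A. monom (coeff Q i) i) = 0" for A
    by (induction A rule: finite_induct) (simp_all add: zero add mono)
  have "?I Q = 0"
    using sums[of "{..degree Q}"] by (simp add: poly_as_sum_of_monoms)
  moreover have "(\<lambda>x. w x * axial \<kappa> m Q c x) = (\<lambda>x. c * (w x * axial \<kappa> m Q 1 x))"
    by (subst axial_coeff) (simp add: mult_ac)
  ultimately show ?thesis by simp
qed

text \<open>Bonnet's recurrence expresses \<open>s * leg n s\<close> by the neighbouring degrees, so
  powers of \<open>s\<close> are removed one at a time, for all degrees simultaneously. Degree 0
  then gives the pure monomials.\<close>

lemma axial_moments_zero_of_legendre:
  assumes w: "w \<in> L2_sphere"
    and z: "\<And>n. integral\<^sup>L sphere_measure (\<lambda>x. w x * leg_fun n x) = 0"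
  shows "integral\<^sup>L sphere_measure (\<lambda>x. w x * axial \<kappa> 0 Q c x) = 0"
proof (rule axial_moments_zero_of_monomials[OF w])
  fix k
  let ?I = "\<lambda>k n. integral\<^sup>L sphere_measure (\<lambda>x. w x * axial \<i> 0 (monom 1 k * legendre_poly n) 1 x)"
  have "?I k n = 0" for n
  proof (induction k arbitrary: n)
    case 0
    then show ?case using z[of n] by (simp add: monom_0)
  next
    case (Suc k)
    show ?case
    proof (cases "n = 0")
      case True
      then show ?thesis using Suc[of 1] by (simp add: monom_Suc mult.commute)
    next
      case False
      then have n: "n \<ge> 1" by simp
      have eq: "axial \<i> 0 (monom 1 (Suc k) * legendre_poly n) 1 x =
         of_real (real (Suc n) / (2 * real n + 1)) * axial \<i> 0 (monom 1 k * legendre_poly (Suc n)) 1 x +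
         of_real (real n / (2 * real n + 1)) * axial \<i> 0 (monom 1 k * legendre_poly (n - 1)) 1 x" for x
      proof -
        define s where "s = x $ 3"
        have nz: "2 * real n + 1 \<noteq> 0" by linarith
        have "s * leg n s = (real (Suc n) * leg (Suc n) s + real n * leg (n - 1) s) / (2 * real n + 1)"
          using bonnet[OF n, of s] nz by (simp add: field_simps)
        then have "s ^ k * (s * leg n s) = real (Suc n) / (2 * real n + 1) * (s ^ k * leg (Suc n) s)
           + real n / (2 * real n + 1) * (s ^ k * leg (n - 1) s)"
          by (simp add: add_divide_distrib distrib_left mult_ac del: of_nat_Suc)
        from arg_cong[OF this, of complex_of_real] show ?thesis
          by (simp add: axial_def poly_monom s_def mult_ac del: of_nat_Suc)
      qed
      have int: "integrable sphere_measure (\<lambda>x. w x * axial \<i> 0 P 1 x)" for P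
        by (rule integrable_L2_axial[OF w])
      have "?I (Suc k) n = integral\<^sup>L sphere_measure (\<lambda>x. of_real (real (Suc n) / (2 * real n + 1)) * (w x * axial \<i> 0 (monom 1 k * legendre_poly (Suc n)) 1 x) +
         of_real (real n / (2 * real n + 1)) * (w x * axial \<i> 0 (monom 1 k * legendre_poly (n - 1)) 1 x))"
        unfolding eq by (intro Bochner_Integration.integral_cong refl) (simp add: algebra_simps)
      also have "\<dots> = of_real (real (Suc n) / (2 * real n + 1)) * ?I k (Suc n) + of_real (real n / (2 * real n + 1)) * ?I k (n - 1)"
        by (subst Bochner_Integration.integral_add) (auto intro!: integrable_mult_right int)
      finally show ?thesis using Suc by simp
    qed
  qed
  from this[of 0] show "integral\<^sup>L sphere_measure (\<lambda>x. w x * axial \<kappa> 0 (monom 1 k) 1 x) = 0"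
    by (simp add: axial_def)
qed

text \<open>Continuous functions built from the distance to the complement increase to the indicator
  of an open set, so the integral of \<open>w\<close> over every open set vanishes. A Dynkin
  argument passes to all Borel sets.\<close>

lemma L2_zero_of_continuous_moments:
  fixes w :: "real^3 \<Rightarrow> complex"
  assumes w: "integrable sphere_measure w"
    and z: "\<And>g :: real^3 \<Rightarrow> real. continuous_on UNIV g \<Longrightarrow> integral\<^sup>L sphere_measure (\<lambda>x. of_real (g x) * w x) = 0"
  shows "AE x in sphere_measure. w x = 0"
proof -
  have wm [measurable]: "w \<in> borel_measurable sphere_measure" using w by auto
  have ind: "(\<lambda>x. indicator B x :: real) \<in> borel_measurable sphere_measure" if "B \<in> sets borel" for B
    unfolding borel_measurable_sphere_cong using that by (intro measurable_restrict_space1) auto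
  have all: "integral\<^sup>L sphere_measure (\<lambda>x. indicator B x *\<^sub>R w x) = 0" if "B \<in> sets borel" for B
  proof -
    have B: "B \<in> sigma_sets UNIV {S. open S}" using that by (simp add: borel_def)
    have I: "integrable sphere_measure (\<lambda>x. indicator B x *\<^sub>R w x)" if "B \<in> sets borel" for B :: "(real^3) set"
      by (rule Bochner_Integration.integrable_bound[OF w]) (use ind[OF that] in \<open>auto simp: indicator_def\<close>)
    have UN: "integral\<^sup>L sphere_measure (\<lambda>x. indicator UNIV x *\<^sub>R w x) = 0"
      using z[of "\<lambda>_. 1"] by simp
    have "Int_stable {S :: (real^3) set. open S}" by (auto simp: Int_stable_def)
    from this _ B show ?thesis
    proof (rule sigma_sets_induct_disjoint)
      show "integral\<^sup>L sphere_measure (\<lambda>x. indicator {} x *\<^sub>R w x) = 0" by simp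
    next
      fix A :: "(real^3) set" assume "A \<in> {S. open S}"
      then have A: "open A" by simp
      show "integral\<^sup>L sphere_measure (\<lambda>x. indicator A x *\<^sub>R w x) = 0"
      proof (cases "A = UNIV")
        case False
        define g where "g k x = min 1 (real k * infdist x (- A))" for k x
        have ne: "- A \<noteq> {}" "closed (- A)" using False A by auto
        have lim: "(\<lambda>k. g k x) \<longlonglongrightarrow> indicator A x" for x
        proof (cases "x \<in> A")
          case True
          then have "infdist x (- A) > 0" using infdist_pos_not_in_closed[OF ne(2,1)] by simp
          then obtain k0 where k0: "1 / infdist x (- A) < real k0" using reals_Archimedean2 by blast
          have "eventually (\<lambda>k. g k x = 1) sequentially"
            using eventually_ge_at_top[of k0]
          proof eventually_elim
            case (elim k)
            have "1 / infdist x (- A) < real k" using k0 elim by simp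
            then have "1 < real k * infdist x (- A)" using \<open>infdist x (- A) > 0\<close> by (simp add: field_simps)
            then show ?case by (simp add: g_def)
          qed
          then show ?thesis using True by (simp add: tendsto_eventually)
        next
          case False
          then have "infdist x (- A) = 0" by simp
          then show ?thesis using False by (simp add: g_def)
        qed
        have cg: "continuous_on UNIV (g k)" for k
          unfolding g_def[abs_def] by (intro continuous_intros)
        have "(\<lambda>k. integral\<^sup>L sphere_measure (\<lambda>x. of_real (g k x) * w x)) \<longlonglongrightarrow>
            integral\<^sup>L sphere_measure (\<lambda>x. indicator A x *\<^sub>R w x)"
        proof (rule integral_dominated_convergence[where w = "\<lambda>x. norm (w x)"])
          show "(\<lambda>x. indicator A x *\<^sub>R w x) \<in> borel_measurable sphere_measure"
            using ind[of A] A by auto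
          show "(\<lambda>x. of_real (g k x) * w x) \<in> borel_measurable sphere_measure" for k
            by (intro borel_measurable_times borel_measurable_sphere_continuous wm continuous_intros
                continuous_on_subset[OF cg]) auto
          show "integrable sphere_measure (\<lambda>x. norm (w x))" using w by simp
          show "AE x in sphere_measure. (\<lambda>k. of_real (g k x) * w x) \<longlonglongrightarrow> indicator A x *\<^sub>R w x"
            using lim by (auto simp: scaleR_conv_of_real intro!: AE_I2 tendsto_mult tendsto_of_real)
          show "AE x in sphere_measure. norm (of_real (g k x) * w x) \<le> norm (w x)" for k
          proof (rule AE_I2)
            fix x
            have "\<bar>g k x\<bar> \<le> 1" using infdist_nonneg[of x "- A"] by (simp add: g_def abs_le_iff min_le_iff_disj)
            then show "norm (of_real (g k x) * w x) \<le> norm (w x)"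
              by (simp add: norm_mult mult_left_le_one_le)
          qed
        qed
        then have "(\<lambda>k. 0) \<longlonglongrightarrow> integral\<^sup>L sphere_measure (\<lambda>x. indicator A x *\<^sub>R w x)"
          unfolding z[OF cg] .
        then show ?thesis by (simp add: LIMSEQ_const_iff)
      qed (use UN in simp)
    next
      fix A :: "(real^3) set"
      assume A: "A \<in> sigma_sets UNIV {S. open S}" and z: "integral\<^sup>L sphere_measure (\<lambda>x. indicator A x *\<^sub>R w x) = 0"
      have Ab: "A \<in> sets borel" using A by (simp add: borel_def)
      have "integral\<^sup>L sphere_measure (\<lambda>x. indicator (UNIV - A) x *\<^sub>R w x) =
         integral\<^sup>L sphere_measure (\<lambda>x. indicator UNIV x *\<^sub>R w x - indicator A x *\<^sub>R w x)"
        by (intro Bochner_Integration.integral_cong) (auto simp: indicator_def)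
      also have "\<dots> = 0" using UN z by (subst Bochner_Integration.integral_diff[OF I I[OF Ab]]) auto
      finally show "integral\<^sup>L sphere_measure (\<lambda>x. indicator (UNIV - A) x *\<^sub>R w x) = 0" .
    next
      fix A :: "nat \<Rightarrow> (real^3) set"
      assume dis: "disjoint_family A" and A: "range A \<subseteq> sigma_sets UNIV {S. open S}"
        and z: "\<And>i. integral\<^sup>L sphere_measure (\<lambda>x. indicator (A i) x *\<^sub>R w x) = 0"
      have Ab: "A i \<in> sets borel" for i using A by (auto simp: borel_def)
      have S: "A i \<inter> S2 \<in> sets sphere_measure" for i
        unfolding sets_sphere_measure sets_restrict_space using Ab[of i] by auto
      have cut: "integral\<^sup>L sphere_measure (\<lambda>x. indicator B x *\<^sub>R w x) = (LINT x:B \<inter> S2|sphere_measure. w x)" for B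
        unfolding set_lebesgue_integral_def by (intro Bochner_Integration.integral_cong) (auto simp: indicator_def)
      have "(LINT x:(\<Union>i. A i \<inter> S2)|sphere_measure. w x) = (\<Sum>i. (LINT x:(A i \<inter> S2)|sphere_measure. w x))"
      proof (rule lebesgue_integral_countable_add[OF S])
        show "A i \<inter> S2 \<inter> (A j \<inter> S2) = {}" if "i \<noteq> j" for i j
          using dis that by (auto simp: disjoint_family_on_def)
        show "set_integrable sphere_measure (\<Union>i. A i \<inter> S2) w"
          unfolding set_integrable_def
          by (rule integrable_mult_indicator[OF _ w]) (rule sets.countable_UN, use S in blast)
      qed
      then show "integral\<^sup>L sphere_measure (\<lambda>x. indicator (\<Union>i. A i) x *\<^sub>R w x) = 0"
        unfolding cut using z unfolding cut by simp
    qed simp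
  qed
  show ?thesis
  proof (rule sphere.density_zero[OF w])
    fix A assume "A \<in> sets sphere_measure"
    then obtain B where B: "B \<in> sets borel" "A = S2 \<inter> B"
      unfolding sets_sphere_measure sets_restrict_space by auto
    have "set_lebesgue_integral sphere_measure A w = integral\<^sup>L sphere_measure (\<lambda>x. indicator B x *\<^sub>R w x)"
      unfolding set_lebesgue_integral_def B(2)
      by (intro Bochner_Integration.integral_cong) (auto simp: indicator_def)
    then show "set_lebesgue_integral sphere_measure A w = 0" using all[OF B(1)] by simp
  qed
qed

text \<open>The axial moments give the moments against all polynomials, which by Stone and
  Weierstrass are uniformly dense in the continuous functions on the sphere.\<close>

lemma L2_zero_of_axial_moments:
  assumes w: "w \<in> L2_sphere"
    and z: "\<And>\<kappa> m Q c. \<kappa>\<^sup>2 = -1 \<Longrightarrow> integral\<^sup>L sphere_measure (\<lambda>x. w x * axial \<kappa> m Q c x) = 0"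
  shows "AE x in sphere_measure. w x = 0"
proof -
  have span: "integral\<^sup>L sphere_measure (\<lambda>x. w x * h x) = 0" if "axial_span h" for h
    using that
  proof induction
    case (add F G)
    have "integrable sphere_measure (\<lambda>x. w x * F x)" "integrable sphere_measure (\<lambda>x. w x * G x)"
      using add.hyps axial_span_continuous by (auto intro!: integrable_L2_mult_continuous w)
    then show ?case using add.IH unfolding distrib_left by simp
  next
    case (cong F G)
    have "integral\<^sup>L sphere_measure (\<lambda>x. w x * G x) = integral\<^sup>L sphere_measure (\<lambda>x. w x * F x)"
      by (intro Bochner_Integration.integral_cong) (auto simp: cong.hyps)
    then show ?case using cong.IH by simp
  qed (use z in blast)
  have wi: "integrable sphere_measure w" by (rule integral_norm_le_L2_norm(1)[OF w])
  show ?thesis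
  proof (rule L2_zero_of_continuous_moments[OF wi])
    fix g :: "real^3 \<Rightarrow> real" assume "continuous_on UNIV g"
    then have cg: "continuous_on S2 (\<lambda>x. complex_of_real (g x))"
      by (intro continuous_intros) (rule continuous_on_subset, auto)
    define W where "W = integral\<^sup>L sphere_measure (\<lambda>x. norm (w x))"
    have W: "W \<ge> 0" by (simp add: W_def)
    have "norm (integral\<^sup>L sphere_measure (\<lambda>x. of_real (g x) * w x)) \<le> 0 + e" if e: "e > 0" for e
    proof -
      define d where "d = e / (W + 1)"
      have d: "d > 0" "d * W \<le> e" using e W by (auto simp: d_def field_simps)
      obtain h :: "real^3 \<Rightarrow> complex" where h: "polynomial_function h" "\<And>x. x \<in> S2 \<Longrightarrow> norm (of_real (g x) - h x) < d"
        using Stone_Weierstrass_polynomial_function[OF compact_sphere cg d(1)] by blast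
      have ph: "poly3 h" by (rule polynomial_function_poly3[OF h(1)])
      have hw: "integral\<^sup>L sphere_measure (\<lambda>x. w x * h x) = 0" by (rule span[OF poly3_axial_span[OF ph]])
      have i1: "integrable sphere_measure (\<lambda>x. w x * of_real (g x))" "integrable sphere_measure (\<lambda>x. w x * h x)"
        by (intro integrable_L2_mult_continuous w cg poly3_continuous ph)+
      have "integral\<^sup>L sphere_measure (\<lambda>x. of_real (g x) * w x) = integral\<^sup>L sphere_measure (\<lambda>x. w x * of_real (g x) - w x * h x)"
        using hw i1 by (simp add: mult.commute)
      also have "norm \<dots> \<le> integral\<^sup>L sphere_measure (\<lambda>x. norm (w x * of_real (g x) - w x * h x))"
        by (rule integral_norm_bound)
      also have "\<dots> \<le> integral\<^sup>L sphere_measure (\<lambda>x. d * norm (w x))"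
      proof (rule integral_mono)
        show "integrable sphere_measure (\<lambda>x. norm (w x * of_real (g x) - w x * h x))" using i1 by simp
        show "integrable sphere_measure (\<lambda>x. d * norm (w x))" using wi by simp
        fix x assume "x \<in> space sphere_measure"
        then have "norm (of_real (g x) - h x) \<le> d" using h(2)[of x] by simp
        then have "norm (w x) * norm (of_real (g x) - h x) \<le> norm (w x) * d" by (rule mult_left_mono) simp
        then show "norm (w x * of_real (g x) - w x * h x) \<le> d * norm (w x)"
          unfolding right_diff_distrib[symmetric] norm_mult by (simp only: mult.commute)
      qed
      also have "\<dots> = d * W" by (simp add: W_def)
      finally show ?thesis using d(2) by simp
    qed
    then have "norm (integral\<^sup>L sphere_measure (\<lambda>x. of_real (g x) * w x)) \<le> 0" by (rule field_le_epsilon)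
    then show "integral\<^sup>L sphere_measure (\<lambda>x. of_real (g x) * w x) = 0" by simp
  qed
qed

section \<open>Identification of the solution through its moments\<close>

lemma linear_ode_unique:
  fixes y :: "real \<Rightarrow> complex"
  assumes "\<And>t. (y has_vector_derivative c * y t) (at t)"
  shows "y t = exp (c * of_real t) * y 0"
proof -
  have "((\<lambda>t. exp (- (c * of_real t)) * y t) has_vector_derivative 0) (at t)" for t
  proof -
    have "((\<lambda>w. exp (- (c * w))) has_field_derivative - c * exp (- (c * of_real t))) (at (of_real t))"
      by (auto intro!: derivative_eq_intros)
    from has_vector_derivative_mult[OF has_vector_derivative_real_field[OF this] assms[of t]]
    show ?thesis by (simp add: algebra_simps)
  qed
  then have "\<exists>k. \<forall>t\<in>UNIV. exp (- (c * of_real t)) * y t = k"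
    by (intro has_derivative_zero_constant) (auto simp: has_vector_derivative_def)
  then obtain k where k: "\<And>t. exp (- (c * of_real t)) * y t = k" by auto
  have "exp (- (c * of_real t)) * y t = exp (- (c * of_real 0)) * y 0" by (simp only: k)
  then show ?thesis by (simp add: exp_minus field_simps)
qed

context zonal_time
begin

lemma partial_sum_T:
  "b 0 + (\<Sum>i<k. T i \<theta>) = (\<Sum>n<2^k. b n * schr_phase t n * of_real (leg n (cos \<theta>)))"
proof (induction k)
  case 0
  have "schr_phase t 0 = 1" by (simp add: schr_phase_def)
  then show ?case by simp
next
  case (Suc k)
  have "{..<2 ^ Suc k} = {..<2 ^ k} \<union> {2 ^ k..<2 * 2 ^ k :: nat}" by auto
  moreover have "(\<Sum>n\<in>{..<2 ^ k} \<union> {2 ^ k..<2 * 2 ^ k}. b n * schr_phase t n * of_real (leg n (cos \<theta>))) =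
     (\<Sum>n<2 ^ k. b n * schr_phase t n * of_real (leg n (cos \<theta>))) + T k \<theta>"
    unfolding T_def leg_block_def by (rule sum.union_disjoint) auto
  ultimately show ?case using Suc by (simp add: add.assoc)
qed

lemma G_integral_limit:
  assumes "continuous_on {0..pi} g"
  shows "(\<lambda>k. integral {0..pi} (\<lambda>\<theta>. (b 0 + (\<Sum>i<k. T i \<theta>)) * g \<theta>)) \<longlonglongrightarrow> integral {0..pi} (\<lambda>\<theta>. G \<theta> * g \<theta>)"
proof -
  have bg: "bounded (g ` {0..pi})"
    by (intro compact_imp_bounded compact_continuous_image assms compact_Icc)
  have bG: "bounded (G ` {0..pi})"
    by (intro compact_imp_bounded compact_continuous_image continuous_on_G compact_Icc)
  have "uniform_limit {0..pi} (\<lambda>k \<theta>. b 0 + (\<Sum>i<k. T i \<theta>)) G sequentially"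
    by (rule uniform_limit_on_subset[OF G_uniform_limit]) simp
  from uniform_lim_mult[OF this uniform_limit_const bG bg]
  have u: "uniform_limit {0..pi} (\<lambda>k \<theta>. (b 0 + (\<Sum>i<k. T i \<theta>)) * g \<theta>) (\<lambda>\<theta>. G \<theta> * g \<theta>) sequentially" .
  have c: "continuous_on {0..pi} (\<lambda>\<theta>. (b 0 + (\<Sum>i<k. T i \<theta>)) * g \<theta>)" for k
    by (intro continuous_intros continuous_on_T assms)
  obtain I J where I: "\<And>k. ((\<lambda>\<theta>. (b 0 + (\<Sum>i<k. T i \<theta>)) * g \<theta>) has_integral I k) {0..pi}"
    "((\<lambda>\<theta>. G \<theta> * g \<theta>) has_integral J) {0..pi}" "I \<longlonglongrightarrow> J"
    using uniform_limit_integral[OF u c] by auto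
  show ?thesis using I(3) by (simp only: integral_unique[OF I(1)] integral_unique[OF I(2)])
qed

text \<open>Uniform convergence permits integration term by term, and by orthogonality the integral
  is constant as soon as the partial sum contains degree \<open>n\<close>.\<close>

lemma G_coeff:
  "integral {0..pi} (\<lambda>\<theta>. G \<theta> * of_real (sin \<theta> * leg n (cos \<theta>))) = b n * schr_phase t n * of_real (leg_inner n n)"
proof -
  let ?g = "\<lambda>\<theta>. complex_of_real (sin \<theta> * leg n (cos \<theta>))"
  have "integral {0..pi} (\<lambda>\<theta>. (b 0 + (\<Sum>i<k. T i \<theta>)) * ?g \<theta>) = b n * schr_phase t n * of_real (leg_inner n n)"
    if k: "n < 2 ^ k" for k
  proof -
    have h: "((\<lambda>\<theta>. complex_of_real (sin \<theta> * (leg m (cos \<theta>) * leg n (cos \<theta>)))) has_integral of_real (leg_inner m n)) {0..pi}" for m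
      unfolding leg_inner_def
      by (intro has_integral_of_real integrable_integral integrable_continuous_real continuous_intros)
    have "((\<lambda>\<theta>. \<Sum>m<2^k. b m * schr_phase t m * complex_of_real (sin \<theta> * (leg m (cos \<theta>) * leg n (cos \<theta>)))) has_integral
       (\<Sum>m<2^k. b m * schr_phase t m * of_real (leg_inner m n))) {0..pi}"
      by (intro has_integral_sum has_integral_mult_right h) auto
    moreover have "(\<lambda>\<theta>. \<Sum>m<2^k. b m * schr_phase t m * complex_of_real (sin \<theta> * (leg m (cos \<theta>) * leg n (cos \<theta>)))) =
       (\<lambda>\<theta>. (b 0 + (\<Sum>i<k. T i \<theta>)) * ?g \<theta>)"
      unfolding partial_sum_T sum_distrib_right
      by (intro ext sum.cong refl) (simp add: mult_ac)
    moreover have "(\<Sum>m<2^k. b m * schr_phase t m * of_real (leg_inner m n)) =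
       (\<Sum>m<2^k. if m = n then b n * schr_phase t n * complex_of_real (leg_inner n n) else 0)"
      by (intro sum.cong refl) (auto simp: leg_orthogonal)
    ultimately show ?thesis using k by (simp add: integral_unique)
  qed
  moreover have "eventually (\<lambda>k. n < 2 ^ k) sequentially"
    using eventually_ge_at_top[of n]
  proof eventually_elim
    case (elim k)
    then show ?case using less_exp[of k] by linarith
  qed
  ultimately have "(\<lambda>k. integral {0..pi} (\<lambda>\<theta>. (b 0 + (\<Sum>i<k. T i \<theta>)) * ?g \<theta>)) \<longlonglongrightarrow>
     b n * schr_phase t n * of_real (leg_inner n n)"
    by (intro tendsto_eventually) (auto elim: eventually_mono)
  moreover have "(\<lambda>k. integral {0..pi} (\<lambda>\<theta>. (b 0 + (\<Sum>i<k. T i \<theta>)) * ?g \<theta>)) \<longlonglongrightarrow> integral {0..pi} (\<lambda>\<theta>. G \<theta> * ?g \<theta>)"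
    by (intro G_integral_limit continuous_intros)
  ultimately show ?thesis using LIMSEQ_unique by blast
qed

end

context zonal_coeffs
begin

lemma zonal_expansion_moment:
  assumes f: "zonal_expansion a f" and h: "continuous_on S2 h"
  shows "(\<lambda>N. \<Sum>n<N. b n * integral\<^sup>L sphere_measure (\<lambda>x. leg_fun n x * h x)) \<longlonglongrightarrow>
    integral\<^sup>L sphere_measure (\<lambda>x. f x * h x)"
proof -
  have zh: "a n * zonal_harmonic n x = b n * leg_fun n x" for n x
    by (simp add: zonal_harmonic_def b_def leg_fun_eq)
  have fL: "f \<in> L2_sphere" and lim: "(\<lambda>N. L2_norm (\<lambda>x. f x - (\<Sum>n<N. b n * leg_fun n x))) \<longlonglongrightarrow> 0"
    using f unfolding zonal_expansion_def zh by auto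
  have "(\<lambda>N. integral\<^sup>L sphere_measure (\<lambda>x. (\<Sum>n<N. b n * leg_fun n x) * h x)) \<longlonglongrightarrow> integral\<^sup>L sphere_measure (\<lambda>x. f x * h x)"
    by (rule L2_limit_integral[OF fL _ lim h]) (intro continuous_intros poly3_continuous poly3_axial)
  moreover have "integral\<^sup>L sphere_measure (\<lambda>x. (\<Sum>n<N. b n * leg_fun n x) * h x) =
     (\<Sum>n<N. b n * integral\<^sup>L sphere_measure (\<lambda>x. leg_fun n x * h x))" for N
  proof -
    have "integrable sphere_measure (\<lambda>x. leg_fun n x * h x)" for n
      by (intro integrable_sphere_continuous continuous_intros poly3_continuous poly3_axial h)
    then show ?thesis unfolding sum_distrib_right mult.assoc
      by (subst Bochner_Integration.integral_sum) auto
  qed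
  ultimately show ?thesis by simp
qed

lemma zonal_expansion_axial_moment:
  assumes f: "zonal_expansion a f" and \<kappa>: "\<kappa>\<^sup>2 = -1" and m: "m \<ge> 1"
  shows "integral\<^sup>L sphere_measure (\<lambda>x. f x * axial \<kappa> m Q c x) = 0"
proof -
  have "(\<lambda>N. \<Sum>n<N. b n * integral\<^sup>L sphere_measure (\<lambda>x. leg_fun n x * axial \<kappa> m Q c x)) \<longlonglongrightarrow>
    integral\<^sup>L sphere_measure (\<lambda>x. f x * axial \<kappa> m Q c x)"
    by (intro zonal_expansion_moment f poly3_continuous poly3_axial)
  then show ?thesis using m by (simp add: integral_leg_fun_axial[OF \<kappa>] LIMSEQ_const_iff)
qed

lemma zonal_expansion_coeff:
  assumes f: "zonal_expansion a f"
    and z: "\<And>m. m \<noteq> n \<Longrightarrow> integral\<^sup>L sphere_measure (\<lambda>x. leg_fun m x * h x) = 0" and h: "continuous_on S2 h"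
  shows "integral\<^sup>L sphere_measure (\<lambda>x. f x * h x) = b n * integral\<^sup>L sphere_measure (\<lambda>x. leg_fun n x * h x)"
proof -
  let ?I = "\<lambda>m. integral\<^sup>L sphere_measure (\<lambda>x. leg_fun m x * h x)"
  have "eventually (\<lambda>N. (\<Sum>m<N. b m * ?I m) = b n * ?I n) sequentially"
    using eventually_gt_at_top[of n]
  proof eventually_elim
    case (elim N)
    have "(\<Sum>m<N. b m * ?I m) = (\<Sum>m<N. if m = n then b n * ?I n else 0)"
      by (intro sum.cong refl) (auto simp: z)
    then show ?case using elim by simp
  qed
  then have "(\<lambda>N. \<Sum>m<N. b m * ?I m) \<longlonglongrightarrow> b n * ?I n" by (rule tendsto_eventually)
  then show ?thesis using zonal_expansion_moment[OF f h] LIMSEQ_unique by blast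
qed

end

context zonal_time
begin

text \<open>The moments against the monomials in \<open>x $ 3\<close> solve a triangular system:
  \<open>legendre_op\<close> maps \<open>monom 1 k\<close> to a combination of itself and
  \<open>monom 1 (k - 2)\<close>. By induction the lower moment vanishes, and a homogeneous linear
  equation with zero initial value remains.\<close>

lemma solution_axial_moment:
  assumes f: "zonal_expansion a f" and u: "schrodinger_solution f u" and \<kappa>: "\<kappa>\<^sup>2 = -1" and m: "m \<ge> 1"
  shows "integral\<^sup>L sphere_measure (\<lambda>x. u s x * axial \<kappa> m Q c x) = 0"
proof -
  have uL: "u s \<in> L2_sphere" for s using u by (simp add: schrodinger_solution_def)
  let ?y = "\<lambda>k s. integral\<^sup>L sphere_measure (\<lambda>x. u s x * axial \<kappa> m (monom 1 k) 1 x)"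
  have "?y k s = 0" for k s
  proof (induction k arbitrary: s rule: less_induct)
    case (less k)
    define l where "l = (real m + real k) * (real m + real k + 1)"
    have op: "legendre_op m (monom 1 k) = smult (real k * (real k - 1)) (monom 1 (k - 2)) + smult (- l) (monom 1 k)"
    proof -
      have "poly (legendre_op m (monom 1 k)) s = poly (smult (real k * (real k - 1)) (monom 1 (k - 2)) + smult (- l) (monom 1 k)) s" for s
      proof -
        consider "k = 0" | "k = 1" | j where "k = Suc (Suc j)" by (metis One_nat_def not0_implies_Suc)
        then show ?thesis
          by cases (simp_all add: legendre_op_def pderiv_monom poly_monom l_def algebra_simps)
      qed
      then show ?thesis by (simp add: poly_eq_poly_eq_iff[symmetric] ext)
    qed
    have "(?y k has_vector_derivative (- \<i> * of_real l) * ?y k s) (at s)" for s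
    proof -
      have "(?y k has_vector_derivative \<i> * integral\<^sup>L sphere_measure (\<lambda>x. u s x * laplace_beltrami (axial \<kappa> m (monom 1 k) 1) x)) (at s)"
        using u poly3_smooth_sphere[OF poly3_axial] unfolding schrodinger_solution_def by blast
      also have "integral\<^sup>L sphere_measure (\<lambda>x. u s x * laplace_beltrami (axial \<kappa> m (monom 1 k) 1) x) =
         integral\<^sup>L sphere_measure (\<lambda>x. of_real (real k * (real k - 1)) * (u s x * axial \<kappa> m (monom 1 (k - 2)) 1 x)
            + of_real (- l) * (u s x * axial \<kappa> m (monom 1 k) 1 x))"
        by (intro Bochner_Integration.integral_cong refl)
          (simp only: space_sphere_measure laplace_beltrami_axial[OF \<kappa>] op axial_plus axial_scale distrib_left mult.left_commute)
      also have "\<dots> = of_real (real k * (real k - 1)) * ?y (k - 2) s + of_real (- l) * ?y k s"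
        by (subst Bochner_Integration.integral_add) (auto intro!: integrable_mult_right integrable_L2_axial uL)
      \<comment> \<open>For \<open>k \<le> 1\<close> the coefficient vanishes, so the truncated
        index does no harm.\<close>
      also have "of_real (real k * (real k - 1)) * ?y (k - 2) s = 0"
        using less[of "k - 2" s] by (cases "k \<le> 1") (auto simp: le_Suc_eq)
      finally show ?thesis by (simp add: mult_ac)
    qed
    from linear_ode_unique[OF this, of s]
    have "?y k s = exp (- \<i> * of_real l * of_real s) * ?y k 0" .
    also have "?y k 0 = integral\<^sup>L sphere_measure (\<lambda>x. f x * axial \<kappa> m (monom 1 k) 1 x)"
    proof (rule integral_cong_AE)
      show "(\<lambda>x. u 0 x * axial \<kappa> m (monom 1 k) 1 x) \<in> borel_measurable sphere_measure"
        using integrable_L2_axial[OF uL] by (rule borel_measurable_integrable)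
      show "(\<lambda>x. f x * axial \<kappa> m (monom 1 k) 1 x) \<in> borel_measurable sphere_measure"
        using f by (intro borel_measurable_integrable integrable_L2_axial) (simp add: zonal_expansion_def)
      show "AE x in sphere_measure. u 0 x * axial \<kappa> m (monom 1 k) 1 x = f x * axial \<kappa> m (monom 1 k) 1 x"
        using u by (auto simp: schrodinger_solution_def)
    qed
    also have "\<dots> = 0" by (rule zonal_expansion_axial_moment[OF f \<kappa> m])
    finally show ?case by simp
  qed
  then show ?thesis by (rule axial_moments_zero_of_monomials[OF uL])
qed

text \<open>\<open>leg_fun n\<close> is an eigenfunction, so its moment satisfies a scalar linear
  equation with rate \<open>- \<i> * n * (n + 1)\<close>, whose exponential is
  \<open>schr_phase t n\<close>.\<close>

lemma solution_legendre_moment: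
  assumes f: "zonal_expansion a f" and u: "schrodinger_solution f u"
  shows "integral\<^sup>L sphere_measure (\<lambda>x. u t x * leg_fun n x) = b n * schr_phase t n * of_real (2 * pi * leg_inner n n)"
proof -
  have uL: "u s \<in> L2_sphere" for s using u by (simp add: schrodinger_solution_def)
  let ?y = "\<lambda>s. integral\<^sup>L sphere_measure (\<lambda>x. u s x * leg_fun n x)"
  define l where "l = real n * (real n + 1)"
  have "(?y has_vector_derivative (- \<i> * of_real l) * ?y s) (at s)" for s
  proof -
    have "(?y has_vector_derivative \<i> * integral\<^sup>L sphere_measure (\<lambda>x. u s x * laplace_beltrami (leg_fun n) x)) (at s)"
      using u poly3_smooth_sphere[OF poly3_axial] unfolding schrodinger_solution_def by blast
    also have "integral\<^sup>L sphere_measure (\<lambda>x. u s x * laplace_beltrami (leg_fun n) x) =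
       integral\<^sup>L sphere_measure (\<lambda>x. of_real (- l) * (u s x * leg_fun n x))"
    proof (intro Bochner_Integration.integral_cong refl)
      fix x assume "x \<in> space sphere_measure"
      then have "laplace_beltrami (leg_fun n) x = axial \<i> 0 (legendre_op 0 (legendre_poly n)) 1 x"
        by (intro laplace_beltrami_axial) auto
      then show "u s x * laplace_beltrami (leg_fun n) x = of_real (- l) * (u s x * leg_fun n x)"
        unfolding axial_def legendre_op_leg by (simp add: l_def)
    qed
    finally show ?thesis by (simp add: mult_ac)
  qed
  from linear_ode_unique[OF this, of t]
  have "?y t = exp (- \<i> * of_real l * of_real t) * ?y 0" .
  also have "?y 0 = integral\<^sup>L sphere_measure (\<lambda>x. f x * leg_fun n x)"
  proof (rule integral_cong_AE)
    show "(\<lambda>x. u 0 x * leg_fun n x) \<in> borel_measurable sphere_measure"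
      using integrable_L2_axial[OF uL] by (rule borel_measurable_integrable)
    show "(\<lambda>x. f x * leg_fun n x) \<in> borel_measurable sphere_measure"
      using f by (intro borel_measurable_integrable integrable_L2_axial) (simp add: zonal_expansion_def)
    show "AE x in sphere_measure. u 0 x * leg_fun n x = f x * leg_fun n x"
      using u by (auto simp: schrodinger_solution_def)
  qed
  also have "\<dots> = b n * integral\<^sup>L sphere_measure (\<lambda>x. leg_fun n x * leg_fun n x)"
    by (rule zonal_expansion_coeff[OF f]) (auto simp: integral_leg_fun_leg_fun leg_orthogonal intro: poly3_continuous poly3_axial)
  also have "exp (- \<i> * of_real l * of_real t) = schr_phase t n"
    by (simp add: schr_phase_def cis_conv_exp l_def mult_ac)
  finally show ?thesis by (simp add: integral_leg_fun_leg_fun mult_ac)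
qed

text \<open>All axial moments of the difference vanish: for \<open>m = 0\<close> by comparison of
  the Legendre moments, for \<open>m \<ge> 1\<close> because both functions have zero
  moments.\<close>

theorem solution_eq_zonal_fun_G:
  assumes f: "zonal_expansion a f" and u: "schrodinger_solution f u"
  shows "continuous_version (u t) (zonal_fun G)"
proof -
  have uL: "u t \<in> L2_sphere" using u by (simp add: schrodinger_solution_def)
  have cG: "continuous_on S2 (zonal_fun G)" by (intro continuous_on_zonal_fun continuous_on_G)
  have GL: "zonal_fun G \<in> L2_sphere" by (rule L2_sphere_continuous[OF cG])
  define w where "w x = u t x - zonal_fun G x" for x
  have wL: "w \<in> L2_sphere" unfolding w_def[abs_def] by (rule L2_sphere_diff[OF uL GL])
  have diff: "integral\<^sup>L sphere_measure (\<lambda>x. w x * axial \<kappa> m Q c x) =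
     integral\<^sup>L sphere_measure (\<lambda>x. u t x * axial \<kappa> m Q c x) - integral\<^sup>L sphere_measure (\<lambda>x. zonal_fun G x * axial \<kappa> m Q c x)" for \<kappa> m Q c
    unfolding w_def left_diff_distrib
    by (intro Bochner_Integration.integral_diff integrable_L2_axial uL GL)
  have leg: "integral\<^sup>L sphere_measure (\<lambda>x. w x * leg_fun n x) = 0" for n
  proof -
    have "integral\<^sup>L sphere_measure (\<lambda>x. zonal_fun G x * leg_fun n x) =
      2 * of_real pi * integral {0..pi} (\<lambda>\<theta>. G \<theta> * of_real (sin \<theta> * leg n (cos \<theta>)))"
      by (subst integral_zonal_axial[OF continuous_on_G]) (simp_all add: mult_ac)
    then show ?thesis unfolding diff solution_legendre_moment[OF f u] G_coeff by simp
  qed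
  have "integral\<^sup>L sphere_measure (\<lambda>x. w x * axial \<kappa> m Q c x) = 0" if \<kappa>: "\<kappa>\<^sup>2 = -1" for \<kappa> m Q c
  proof (cases "m = 0")
    case True
    then show ?thesis using axial_moments_zero_of_legendre[OF wL leg] by simp
  next
    case False
    then show ?thesis
      unfolding diff using solution_axial_moment[OF f u \<kappa>, of m t] integral_zonal_axial[OF continuous_on_G \<kappa>, of m] by simp
  qed
  then have "AE x in sphere_measure. w x = 0" by (intro L2_zero_of_axial_moments wL)
  then show ?thesis using cG by (simp add: continuous_version_def w_def)
qed

end

section \<open>Energy of dyadic blocks\<close>

text \<open>The solid harmonic that extends \<open>leg n (x $ 3)\<close> from the sphere. It is
  defined by Bonnet's recurrence with \<open>x \<bullet> x\<close> inserted for homogeneity, a form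
  from which it is visibly a polynomial.\<close>

fun solid_zonal :: "nat \<Rightarrow> real^3 \<Rightarrow> real" where
  "solid_zonal 0 x = 1"
| "solid_zonal (Suc 0) x = x $ 3"
| "solid_zonal (Suc (Suc n)) x =
     ((2 * real n + 3) * (x $ 3 * solid_zonal (Suc n) x) - (real n + 1) * ((x \<bullet> x) * solid_zonal n x)) / (real n + 2)"

lemma solid_zonal_polynomial: "real_polynomial_function (solid_zonal n)"
proof (induction n rule: induct_nat_012)
  case 0
  then show ?case by (simp add: real_polynomial_function.intros(2))
next
  case 1
  have "real_polynomial_function (\<lambda>x :: real^3. x $ 3)"
    by (intro real_polynomial_function.intros(1) bounded_linear_vec_nth)
  then show ?case by simp
next
  case (ge2 n)
  have c: "real_polynomial_function (\<lambda>x :: real^3. x $ i)" for i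
    by (intro real_polynomial_function.intros(1) bounded_linear_vec_nth)
  have q: "real_polynomial_function (\<lambda>x :: real^3. x \<bullet> x)"
    unfolding inner_vec_def sum_3 inner_real_def by (intro real_polynomial_function.intros(3) real_polynomial_function.intros(4) c)
  show ?case
    using ge2 unfolding solid_zonal.simps(3)[abs_def]
    by (intro real_polynomial_function_divide real_polynomial_function_diff real_polynomial_function.intros(4)
        real_polynomial_function.intros(2) c q)
qed

lemma solid_zonal_homogeneous: "solid_zonal n (r *\<^sub>R x) = r ^ n * solid_zonal n x"
proof (induction n rule: induct_nat_012)
  case (ge2 n)
  show ?case unfolding solid_zonal.simps ge2 by (simp add: algebra_simps power2_eq_square)
qed auto

lemma solid_zonal_on_sphere:
  assumes "x \<in> S2"
  shows "solid_zonal n x = leg n (x $ 3)"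
proof (induction n rule: induct_nat_012)
  case (ge2 n)
  have "x \<bullet> x = 1" using assms by (simp add: norm_eq_1)
  then have "(real n + 2) * solid_zonal (Suc (Suc n)) x = (2 * real n + 3) * (x $ 3) * leg (Suc n) (x $ 3) - (real n + 1) * leg n (x $ 3)"
    unfolding solid_zonal.simps ge2 by simp
  also have "\<dots> = (real n + 2) * leg (Suc (Suc n)) (x $ 3)"
    using bonnet[of "Suc n" "x $ 3"] by (simp add: algebra_simps)
  finally show ?case by simp
qed auto

text \<open>Harmonicity does not propagate through the recurrence alone: the Laplacian of
  \<open>x $ 3\<close> times a harmonic function is twice its third partial derivative. The formula
  for this derivative is therefore part of the induction.\<close>

lemma solid_zonal_jet:
  "\<exists>D L. jet2 UNIV (\<lambda>y. complex_of_real (solid_zonal n y)) D L \<and> (\<forall>y. L y = 0) \<and>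
     (\<forall>y. D 3 y = of_nat n * of_real (solid_zonal (n - 1) y))"
proof (induction n rule: induct_nat_012)
  case 0
  show ?case
    by (intro exI[of _ "\<lambda>i y. 0"] exI[of _ "\<lambda>y. 0"]) (auto simp: jet2_const)
next
  case 1
  show ?case
    by (intro exI[of _ "\<lambda>i y. if i = 3 then 1 else 0"] exI[of _ "\<lambda>y. 0"]) (auto simp: jet2_coord)
next
  case (ge2 n)
  let ?h = "\<lambda>n y. complex_of_real (solid_zonal n y)"
  obtain D L where 0: "jet2 UNIV (?h n) D L" "\<And>y. L y = 0" "\<And>y. D 3 y = of_nat n * ?h (n - 1) y"
    using ge2(1) by blast
  obtain D' L' where 1: "jet2 UNIV (?h (Suc n)) D' L'" "\<And>y. L' y = 0" "\<And>y. D' 3 y = of_nat (Suc n) * ?h n y"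
    using ge2(2) by auto
  let ?q = "\<lambda>y :: real^3. complex_of_real (y $ 1) * of_real (y $ 1) + (of_real (y $ 2) * of_real (y $ 2) + of_real (y $ 3) * of_real (y $ 3))"
  have q: "jet2 UNIV ?q (\<lambda>i y. 2 * of_real (y $ i)) (\<lambda>y. 6)"
  proof (rule jet2_cong[OF jet2_add[OF jet2_mult[OF jet2_coord[of UNIV 1] jet2_coord[of UNIV 1]]
      jet2_add[OF jet2_mult[OF jet2_coord[of UNIV 2] jet2_coord[of UNIV 2]] jet2_mult[OF jet2_coord[of UNIV 3] jet2_coord[of UNIV 3]]]]])
    show "2 * complex_of_real (y $ i) = (if i = 1 then 1 else 0) * of_real (y $ 1) + of_real (y $ 1) * (if i = 1 then 1 else 0) +
        ((if i = 2 then 1 else 0) * of_real (y $ 2) + of_real (y $ 2) * (if i = 2 then 1 else 0) +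
         ((if i = 3 then 1 else 0) * of_real (y $ 3) + of_real (y $ 3) * (if i = 3 then 1 else 0)))" for i :: 3 and y :: "real^3"
      using exhaust_3[of i] by auto
  qed (auto simp: sum_3)
  have euler: "(\<Sum>i\<in>UNIV. of_real (y $ i) * D i y) = of_nat n * ?h n y" for y
    using 0(1) by (intro euler_homogeneous) (simp_all add: jet2_def solid_zonal_homogeneous scaleR_conv_of_real[where 'a = complex])
  define \<alpha> where "\<alpha> = complex_of_real ((2 * real n + 3) / (real n + 2))"
  define \<beta> where "\<beta> = complex_of_real (- (real n + 1) / (real n + 2))"
  have n2: "of_nat n + (2 :: complex) \<noteq> 0"
    using of_nat_neq_0[of "Suc n", where 'a = complex] by (simp add: add.commute)
  have ab: "(of_nat n + 2) * \<alpha> = 2 * of_nat n + 3" "(of_nat n + 2) * \<beta> = - (of_nat n + 1)"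
    unfolding \<alpha>_def \<beta>_def using n2 by simp_all
  have rec: "?h (Suc (Suc n)) y = \<alpha> * (of_real (y $ 3) * ?h (Suc n) y) + \<beta> * (?q y * ?h n y)" for y
  proof -
    have yy: "y \<bullet> y = y $ 1 * y $ 1 + (y $ 2 * y $ 2 + y $ 3 * y $ 3)" by (simp add: inner_vec_def sum_3)
    have split: "(A * X - B * Y) / d = A / d * X + - B / d * Y" for A B X Y d :: real
      by (simp add: diff_divide_distrib)
    have "solid_zonal (Suc (Suc n)) y = (2 * real n + 3) / (real n + 2) * (y $ 3 * solid_zonal (Suc n) y) +
        - (real n + 1) / (real n + 2) * ((y $ 1 * y $ 1 + (y $ 2 * y $ 2 + y $ 3 * y $ 3)) * solid_zonal n y)"
      unfolding solid_zonal.simps yy by (rule split)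
    from arg_cong[OF this, of complex_of_real] show ?thesis
      unfolding \<alpha>_def \<beta>_def by (simp only: of_real_add of_real_mult)
  qed
  note J = jet2_add[OF jet2_mult[OF jet2_const[of UNIV \<alpha>] jet2_mult[OF jet2_coord[of UNIV 3] 1(1)]]
     jet2_mult[OF jet2_const[of UNIV \<beta>] jet2_mult[OF q 0(1)]]]
  note J' = jet2_cong[OF J open_UNIV rec refl refl]
  show ?case
  proof (intro exI conjI allI, rule J')
    fix y
    have d3: "(\<Sum>i\<in>UNIV. (if i = 3 then 1 else 0) * D' i y) = D' 3 y"
      by (simp add: sum_3)
    have de: "(\<Sum>i\<in>UNIV. 2 * of_real (y $ i) * D i y) = 2 * (of_nat n * ?h n y)"
      unfolding euler[symmetric] by (simp only: sum_distrib_left mult.assoc)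
    let ?X = "0 * (of_real (y $ 3) * ?h (Suc n) y) +
       2 * (\<Sum>i\<in>UNIV. 0 * ((if i = 3 then 1 else 0) * ?h (Suc n) y + of_real (y $ 3) * D' i y)) +
       \<alpha> * (0 * ?h (Suc n) y + 2 * (\<Sum>i\<in>UNIV. (if i = 3 then 1 else 0) * D' i y) + of_real (y $ 3) * L' y) +
       (0 * (?q y * ?h n y) + 2 * (\<Sum>i\<in>UNIV. 0 * (2 * of_real (y $ i) * ?h n y + ?q y * D i y)) +
       \<beta> * (6 * ?h n y + 2 * (\<Sum>i\<in>UNIV. 2 * of_real (y $ i) * D i y) + ?q y * L y))"
    \<comment> \<open>Besides the third derivative there is the Laplacian of
      \<open>x \<bullet> x\<close> times a harmonic function of degree \<open>n\<close>, which by
      Euler's relation multiplies that function by \<open>6 + 4 * n\<close>. The recurrence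
      coefficients make the two contributions cancel.\<close>
    have "?X = \<alpha> * (2 * (of_nat (Suc n) * ?h n y)) + \<beta> * (6 * ?h n y + 2 * (2 * (of_nat n * ?h n y)))"
      unfolding d3 de 0(2) 1(2) 1(3) by simp
    then have "(of_nat n + 2) * ?X = ((of_nat n + 2) * \<alpha>) * (2 * (of_nat (Suc n) * ?h n y)) +
        ((of_nat n + 2) * \<beta>) * (6 * ?h n y + 2 * (2 * (of_nat n * ?h n y)))"
      by (simp only: distrib_left mult.assoc)
    also have "\<dots> = 0" unfolding ab by (simp add: algebra_simps)
    finally show "?X = 0" using n2 by (simp only: mult_eq_0_iff simp_thms)
  next
    fix y
    let ?Y = "0 * (of_real (y $ 3) * ?h (Suc n) y) + \<alpha> * ((if (3::3) = 3 then 1 else 0) * ?h (Suc n) y + of_real (y $ 3) * D' 3 y) +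
       (0 * (?q y * ?h n y) + \<beta> * (2 * of_real (y $ 3) * ?h n y + ?q y * D 3 y))"
    define z where "z = complex_of_real (y $ 3)"
    define H where "H = ?h n y"
    define H1 where "H1 = ?h (Suc n) y"
    define W where "W = of_nat n * (?q y * ?h (n - 1) y)"
    \<comment> \<open>The same recurrence one degree lower, which serves to eliminate
      \<open>W\<close>.\<close>
    have r1: "(of_nat n + 1) * H1 = (2 * of_nat n + 1) * (z * H) - W"
    proof (cases n)
      case 0
      then show ?thesis by (simp add: H1_def H_def W_def z_def)
    next
      case (Suc k)
      have "y \<bullet> y = y $ 1 * y $ 1 + (y $ 2 * y $ 2 + y $ 3 * y $ 3)" by (simp add: inner_vec_def sum_3)
      then have "(real n + 1) * solid_zonal (Suc n) y = (2 * real n + 1) * (y $ 3 * solid_zonal n y) -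
          real n * ((y $ 1 * y $ 1 + (y $ 2 * y $ 2 + y $ 3 * y $ 3)) * solid_zonal (n - 1) y)"
        unfolding Suc solid_zonal.simps by (simp add: field_simps)
      from arg_cong[OF this, of complex_of_real] show ?thesis
        unfolding H1_def H_def W_def z_def by simp
    qed
    have "?Y = \<alpha> * (H1 + z * (of_nat (Suc n) * H)) + \<beta> * (2 * z * H + W)"
      unfolding 0(3) 1(3) H_def H1_def W_def z_def by (simp add: mult_ac)
    then have "(of_nat n + 2) * ?Y = ((of_nat n + 2) * \<alpha>) * (H1 + z * (of_nat (Suc n) * H)) + ((of_nat n + 2) * \<beta>) * (2 * z * H + W)"
      by (simp only: distrib_left mult.assoc)
    also have "\<dots> = (2 * of_nat n + 3) * H1 + (of_nat n + 1) * ((2 * of_nat n + 1) * (z * H) - W)"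
      unfolding ab by (simp add: algebra_simps)
    also have "\<dots> = (of_nat n + 2) * (of_nat (Suc (Suc n)) * H1)"
      unfolding r1[symmetric] by (simp add: algebra_simps)
    finally show "?Y = of_nat (Suc (Suc n)) * ?h (Suc (Suc n) - 1) y"
      using n2 by (simp only: mult_cancel_left simp_thms H1_def diff_Suc_1)
  qed
qed

lemma solid_zonal_spherical_harmonic: "(\<lambda>x. c * complex_of_real (solid_zonal n x)) \<in> spherical_harmonics n"
proof -
  obtain D L where J: "jet2 UNIV (\<lambda>y. complex_of_real (solid_zonal n y)) D L" "\<And>y. L y = 0"
    using solid_zonal_jet[of n] by blast
  note J' = jet2_mult[OF jet2_const[of UNIV c] J(1)]
  have "laplacian (\<lambda>x. c * complex_of_real (solid_zonal n x)) y = 0" for y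
    using jet2_laplacian[OF open_UNIV J', of y] by (simp add: J(2))
  moreover have "polynomial_function (\<lambda>x. c * complex_of_real (solid_zonal n x))"
    unfolding polynomial_function_def
  proof (intro allI impI)
    fix f :: "complex \<Rightarrow> real" assume "bounded_linear f"
    then interpret f: bounded_linear f .
    have "f \<circ> (\<lambda>x. c * complex_of_real (solid_zonal n x)) = (\<lambda>x. solid_zonal n x * f c)"
    proof
      fix x
      have "c * complex_of_real (solid_zonal n x) = solid_zonal n x *\<^sub>R c" by (simp add: scaleR_conv_of_real mult.commute)
      then show "(f \<circ> (\<lambda>x. c * complex_of_real (solid_zonal n x))) x = solid_zonal n x * f c" by (simp add: f.scaleR)
    qed
    then show "real_polynomial_function (f \<circ> (\<lambda>x. c * complex_of_real (solid_zonal n x)))"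
      using solid_zonal_polynomial[of n] by (simp add: real_polynomial_function.intros(4) real_polynomial_function.intros(2))
  qed
  ultimately show ?thesis
    unfolding spherical_harmonics_def
    by (simp add: solid_zonal_homogeneous scaleR_conv_of_real[where 'a = complex] mult_ac)
qed

lemma spherical_harmonics_continuous: "h \<in> spherical_harmonics n \<Longrightarrow> continuous_on A h"
  by (intro poly3_continuous polynomial_function_poly3) (simp add: spherical_harmonics_def)

section \<open>Large blocks from the lack of Sobolev regularity\<close>

context zonal_coeffs
begin

text \<open>The projection is an arbitrary witness of its defining property and is compared with the
  explicit witness \<open>g0\<close>: both have the same inner products with all harmonics of degree
  \<open>n\<close>, hence the same norm.\<close>

lemma L2_norm_harmonic_proj:
  assumes f: "zonal_expansion a f"
  shows "(L2_norm (harmonic_proj n f))\<^sup>2 = (norm (b n))\<^sup>2 * (2 * pi * leg_inner n n)"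
proof -
  have fL: "f \<in> L2_sphere" using f by (simp add: zonal_expansion_def)
  let ?I = "\<lambda>F. integral\<^sup>L sphere_measure F"
  define g0 where "g0 x = b n * complex_of_real (solid_zonal n x)" for x
  have g0: "g0 \<in> spherical_harmonics n" unfolding g0_def[abs_def] by (rule solid_zonal_spherical_harmonic)
  have g0S: "g0 x = b n * leg_fun n x" if "x \<in> S2" for x
    using that by (simp add: g0_def leg_fun_eq solid_zonal_on_sphere)
  let ?P = "\<lambda>g. g \<in> spherical_harmonics n \<and> (\<forall>h\<in>spherical_harmonics n. ?I (\<lambda>x. (f x - g x) * cnj (h x)) = 0)"
  have cnj_cont: "continuous_on S2 (\<lambda>x. cnj (h x))" if "h \<in> spherical_harmonics n" for h
    by (intro continuous_intros spherical_harmonics_continuous[OF that])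
  have fh: "?I (\<lambda>x. f x * cnj (h x)) = ?I (\<lambda>x. g0 x * cnj (h x))" if h: "h \<in> spherical_harmonics n" for h
  proof -
    have cn: "?I (\<lambda>x. leg_fun m x * cnj (h x)) = cnj (?I (\<lambda>x. leg_fun m x * h x))" for m
      by (subst Bochner_Integration.integral_cnj[symmetric]) (simp add: leg_fun_eq)
    have "?I (\<lambda>x. f x * cnj (h x)) = b n * ?I (\<lambda>x. leg_fun n x * cnj (h x))"
      by (rule zonal_expansion_coeff[OF f _ cnj_cont[OF h]])
        (simp add: cn spherical_harmonic_orthogonal_leg_fun[OF h])
    also have "\<dots> = ?I (\<lambda>x. b n * (leg_fun n x * cnj (h x)))" by simp
    also have "\<dots> = ?I (\<lambda>x. g0 x * cnj (h x))"
      by (intro Bochner_Integration.integral_cong) (auto simp: g0S)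
    finally show ?thesis .
  qed
  have cont: "continuous_on S2 h" if "h \<in> spherical_harmonics n" for h
    using that by (rule spherical_harmonics_continuous)
  have diff: "?I (\<lambda>x. (f x - g x) * cnj (h x)) = ?I (\<lambda>x. f x * cnj (h x)) - ?I (\<lambda>x. g x * cnj (h x))"
    if "g \<in> spherical_harmonics n" "h \<in> spherical_harmonics n" for g h
    unfolding left_diff_distrib
    by (intro Bochner_Integration.integral_diff integrable_L2_mult_continuous fL cnj_cont that
        L2_sphere_continuous cont)
  have P0: "?P g0" using g0 diff[OF g0] fh by simp
  have P: "?P (harmonic_proj n f)" unfolding harmonic_proj_def using someI[of ?P, OF P0] .
  define g where "g = harmonic_proj n f"
  have g: "g \<in> spherical_harmonics n" using P by (simp add: g_def)
  have gh: "?I (\<lambda>x. g x * cnj (h x)) = ?I (\<lambda>x. g0 x * cnj (h x))" if h: "h \<in> spherical_harmonics n" for h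
    using P diff[OF g h] fh[OF h] h unfolding g_def by simp
  have "?I (\<lambda>x. g x * cnj (g x)) = ?I (\<lambda>x. g0 x * cnj (g x))" by (rule gh[OF g])
  also have "\<dots> = cnj (?I (\<lambda>x. g x * cnj (g0 x)))"
    by (subst Bochner_Integration.integral_cnj[symmetric]) (simp add: mult.commute)
  also have "\<dots> = cnj (?I (\<lambda>x. g0 x * cnj (g0 x)))" by (simp only: gh[OF g0])
  finally have eq: "?I (\<lambda>x. g x * cnj (g x)) = cnj (?I (\<lambda>x. g0 x * cnj (g0 x)))" .
  have "?I (\<lambda>x. g0 x * cnj (g0 x)) = ?I (\<lambda>x. of_real ((norm (b n))\<^sup>2) * (leg_fun n x * leg_fun n x))"
  proof (intro Bochner_Integration.integral_cong refl)
    fix x assume "x \<in> space sphere_measure"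
    then have "g0 x = b n * leg_fun n x" by (simp add: g0S)
    then show "g0 x * cnj (g0 x) = of_real ((norm (b n))\<^sup>2) * (leg_fun n x * leg_fun n x)"
      by (simp only: complex_norm_square leg_fun_eq complex_cnj_mult complex_cnj_complex_of_real mult_ac)
  qed
  also have "\<dots> = of_real ((norm (b n))\<^sup>2 * (2 * pi * leg_inner n n))"
    by (simp add: integral_leg_fun_leg_fun)
  finally have v: "?I (\<lambda>x. g x * cnj (g x)) = of_real ((norm (b n))\<^sup>2 * (2 * pi * leg_inner n n))"
    unfolding eq by simp
  have "?I (\<lambda>x. g x * cnj (g x)) = ?I (\<lambda>x. complex_of_real ((norm (g x))\<^sup>2))"
    by (simp only: complex_norm_square)
  also have "\<dots> = of_real (integral\<^sup>L sphere_measure (\<lambda>x. (norm (g x))\<^sup>2))" by (rule integral_complex_of_real)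
  finally have "integral\<^sup>L sphere_measure (\<lambda>x. (norm (g x))\<^sup>2) = (norm (b n))\<^sup>2 * (2 * pi * leg_inner n n)"
    using v of_real_eq_iff by metis
  moreover have "(L2_norm g)\<^sup>2 = integral\<^sup>L sphere_measure (\<lambda>x. (norm (g x))\<^sup>2)"
    unfolding L2_norm_def by (intro real_sqrt_pow2) simp
  ultimately show ?thesis by (simp add: g_def)
qed

text \<open>
  This is the squared norm of the projection onto degree \<open>n\<close>, up to the factor \<open>2 * pi\<close>.
\<close>

definition energy :: "nat \<Rightarrow> real" where
  "energy n = (norm (b n))\<^sup>2 * leg_inner n n"

lemma energy_nonneg: "energy n \<ge> 0"
  using leg_inner_pos by (simp add: energy_def)

lemma energy_not_summable:
  assumes f: "zonal_expansion a f" and "f \<notin> sobolev_sphere r"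
  shows "\<not> summable (\<lambda>n. sqrt (1 + (real n)\<^sup>2) powr (2 * r) * energy n)"
proof
  assume "summable (\<lambda>n. sqrt (1 + (real n)\<^sup>2) powr (2 * r) * energy n)"
  from summable_mult[OF this, of "2 * pi"]
  have "summable (\<lambda>n. sqrt (1 + (real n)\<^sup>2) powr (2 * r) * (L2_norm (harmonic_proj n f))\<^sup>2)"
    unfolding L2_norm_harmonic_proj[OF f] energy_def by (simp add: mult_ac)
  then show False using assms by (simp add: sobolev_sphere_def zonal_expansion_def)
qed

text \<open>Otherwise all late blocks are small and the Sobolev sum of order
  \<open>p - 1/2 + \<eta> / 4\<close> converges: on the block at frequency \<open>N\<close> its
  weight is of size \<open>N powr (2 * p - 1 + \<eta> / 2)\<close>, which leaves
  \<open>N powr (- \<eta> / 2)\<close>.\<close>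

lemma large_dyadic_energy:
  assumes f: "zonal_expansion a f" and nf: "\<And>\<epsilon>. \<epsilon> > 0 \<Longrightarrow> f \<notin> sobolev_sphere (p - 1/2 + \<epsilon>)"
    and \<eta>: "\<eta> > 0"
  shows "\<exists>k\<ge>k0. (2 ^ k) powr (1 - 2 * p - \<eta>) \<le> (\<Sum>n\<in>{2^k..<2*2^k}. energy n)"
proof (rule ccontr)
  assume "\<not> ?thesis"
  then have small: "(\<Sum>n\<in>{2^k..<2*2^k}. energy n) \<le> (2 ^ k) powr (1 - 2 * p - \<eta>)" if "k \<ge> k0" for k
    using that by force
  define s where "s = 2 * (p - 1/2 + \<eta> / 4)"
  have s: "s > 0" using p1 \<eta> by (simp add: s_def)
  define w where "w n = sqrt (1 + (real n)\<^sup>2) powr s * energy n" for n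
  have w0: "w n \<ge> 0" for n using energy_nonneg by (simp add: w_def)
  have block: "(\<Sum>n\<in>{2^k..<2*2^k}. w n) \<le> 2 powr s * (2 ^ k) powr (- \<eta> / 2)" if k: "k \<ge> k0" for k
  proof -
    have "w n \<le> (2 * 2 ^ k) powr s * energy n" if n: "n \<in> {2^k..<2*2^k}" for n
      unfolding w_def
    proof (intro mult_right_mono powr_mono2 energy_nonneg)
      have "real n + 1 \<le> 2 * 2 ^ k" using n by (simp add: nat_less_real_le)
      moreover have "1 + (real n)\<^sup>2 \<le> (real n + 1)\<^sup>2" by (simp add: power2_sum)
      moreover have "(real n + 1)\<^sup>2 \<le> (2 * 2 ^ k)\<^sup>2" using calculation(1) by (intro power_mono) auto
      ultimately have "1 + (real n)\<^sup>2 \<le> (2 * 2 ^ k)\<^sup>2" by linarith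
      then show "sqrt (1 + (real n)\<^sup>2) \<le> 2 * 2 ^ k" by (intro real_le_lsqrt) auto
    qed (use s in auto)
    then have "(\<Sum>n\<in>{2^k..<2*2^k}. w n) \<le> (\<Sum>n\<in>{2^k..<2*2^k}. (2 * 2 ^ k) powr s * energy n)"
      by (rule sum_mono)
    also have "\<dots> \<le> (2 * 2 ^ k) powr s * (2 ^ k) powr (1 - 2 * p - \<eta>)"
      unfolding sum_distrib_left[symmetric] using small[OF k] by (intro mult_left_mono) auto
    also have "\<dots> = 2 powr s * ((2 ^ k) powr s * (2 ^ k) powr (1 - 2 * p - \<eta>))"
      by (simp add: powr_mult)
    also have "(2 ^ k) powr s * (2 ^ k) powr (1 - 2 * p - \<eta>) = (2 ^ k :: real) powr (- \<eta> / 2)"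
      by (subst powr_add[symmetric]) (simp add: s_def field_simps)
    finally show ?thesis .
  qed
  define S where "S = (\<Sum>k. (2 ^ k :: real) powr (- \<eta> / 2))"
  have sm: "summable (\<lambda>k. (2 ^ k :: real) powr (- \<eta> / 2))"
    using \<eta> by (intro summable_two_power_powr) auto
  have upto: "(\<Sum>n<2^k. w n) \<le> (\<Sum>n<2^k0. w n) + (\<Sum>i<k. 2 powr s * (2 ^ i) powr (- \<eta> / 2))" for k
  proof (induction k)
    case 0
    have "w 0 \<le> (\<Sum>n<2^k0. w n)" by (rule member_le_sum) (auto simp: w0)
    then show ?case by simp
  next
    case (Suc k)
    show ?case
    proof (cases "k < k0")
      case True
      have "(\<Sum>n<2^Suc k. w n) \<le> (\<Sum>n<2^k0. w n)"
      proof (intro sum_mono2)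
        have "(2::nat) ^ Suc k \<le> 2 ^ k0" using True by (intro power_increasing) auto
        then show "{..<2 ^ Suc k} \<subseteq> {..<2 ^ k0 :: nat}" by auto
      qed (auto simp: w0)
      moreover have "0 \<le> (\<Sum>i<Suc k. 2 powr s * (2 ^ i) powr (- \<eta> / 2))" by (intro sum_nonneg) auto
      ultimately show ?thesis by linarith
    next
      case False
      have "{..<2 ^ Suc k} = {..<2 ^ k} \<union> {2 ^ k..<2 * 2 ^ k :: nat}" by auto
      moreover have "(\<Sum>n\<in>{..<2 ^ k} \<union> {2 ^ k..<2 * 2 ^ k}. w n) = (\<Sum>n<2 ^ k. w n) + (\<Sum>n\<in>{2^k..<2*2^k}. w n)"
        by (rule sum.union_disjoint) auto
      ultimately show ?thesis using Suc block[of k] False by simp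
    qed
  qed
  have "(\<Sum>n<k. w n) \<le> (\<Sum>n<2^k0. w n) + 2 powr s * S" for k
  proof -
    have "(\<Sum>n<k. w n) \<le> (\<Sum>n<2^k. w n)"
      using w0 by (intro sum_mono2) (auto intro: less_trans[OF _ less_exp])
    also have "\<dots> \<le> (\<Sum>n<2^k0. w n) + 2 powr s * (\<Sum>i<k. (2 ^ i) powr (- \<eta> / 2))"
      using upto[of k] by (simp add: sum_distrib_left)
    also have "\<dots> \<le> (\<Sum>n<2^k0. w n) + 2 powr s * S"
      unfolding S_def by (intro add_left_mono mult_left_mono sum_le_suminf sm) auto
    finally show ?thesis .
  qed
  then have "summable w" by (intro summableI_nonneg_bounded w0)
  moreover have "\<not> summable w"
    using energy_not_summable[OF f nf[of "\<eta> / 4"]] \<eta> unfolding w_def s_def by simp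
  ultimately show False by simp
qed

end

section \<open>Box counting for graphs over the sphere\<close>

lemma box_number_le:
  assumes "finite K" "E \<subseteq> (\<Union>c\<in>K. cbox c (c + \<epsilon> *\<^sub>R One))"
  shows "box_number E \<epsilon> \<le> card K"
  unfolding box_number_def by (rule Least_le) (use assms in blast)

text \<open>Total boundedness, with each ball of radius \<open>\<epsilon> / 2\<close> placed in the
  box of side \<epsilon> about its centre.\<close>

lemma box_cover_exists:
  fixes E :: "'a::euclidean_space set"
  assumes "bounded E" "\<epsilon> > 0"
  shows "\<exists>K. finite K \<and> E \<subseteq> (\<Union>c\<in>K. cbox c (c + \<epsilon> *\<^sub>R One))"
proof -
  have "compact (closure E)" using assms(1) by (simp add: compact_closure)
  then obtain F where F: "finite F" "closure E \<subseteq> (\<Union>x\<in>F. ball x (\<epsilon> / 2))"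
    using assms(2) unfolding compact_eq_totally_bounded by (meson half_gt_zero)
  have box: "ball x (\<epsilon> / 2) \<subseteq> cbox (x - (\<epsilon> / 2) *\<^sub>R One) (x - (\<epsilon> / 2) *\<^sub>R One + \<epsilon> *\<^sub>R One)" for x :: 'a
  proof
    fix y assume y: "y \<in> ball x (\<epsilon> / 2)"
    have close: "\<bar>(x - y) \<bullet> b\<bar> \<le> \<epsilon> / 2" if "b \<in> Basis" for b
      using Basis_le_norm[OF that, of "x - y"] y by (simp add: dist_norm)
    show "y \<in> cbox (x - (\<epsilon> / 2) *\<^sub>R One) (x - (\<epsilon> / 2) *\<^sub>R One + \<epsilon> *\<^sub>R One)"
      unfolding mem_box
    proof (intro ballI)
      fix b :: 'a assume b: "b \<in> Basis"
      have "x \<bullet> b - y \<bullet> b \<le> \<epsilon> / 2" "y \<bullet> b - x \<bullet> b \<le> \<epsilon> / 2"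
        using abs_le_D1[OF close[OF b]] abs_le_D2[OF close[OF b]] by (simp_all only: inner_diff_left minus_diff_eq)
      then show "(x - (\<epsilon> / 2) *\<^sub>R One) \<bullet> b \<le> y \<bullet> b \<and> y \<bullet> b \<le> (x - (\<epsilon> / 2) *\<^sub>R One + \<epsilon> *\<^sub>R One) \<bullet> b"
        using b by (simp add: inner_diff_left inner_add_left)
    qed
  qed
  have "E \<subseteq> (\<Union>c\<in>(\<lambda>x. x - (\<epsilon> / 2) *\<^sub>R One) ` F. cbox c (c + \<epsilon> *\<^sub>R One))"
  proof
    fix z assume "z \<in> E"
    then have "z \<in> closure E" using closure_subset by (rule rev_subsetD)
    then obtain x where "x \<in> F" "z \<in> ball x (\<epsilon> / 2)" using F(2) by auto
    then show "z \<in> (\<Union>c\<in>(\<lambda>x. x - (\<epsilon> / 2) *\<^sub>R One) ` F. cbox c (c + \<epsilon> *\<^sub>R One))"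
      using subsetD[OF box] by (intro UN_I[OF imageI])
  qed
  moreover have "finite ((\<lambda>x. x - (\<epsilon> / 2) *\<^sub>R One) ` F)" using F(1) by (rule finite_imageI)
  ultimately show ?thesis by (intro exI conjI)
qed

lemma box_number_attained:
  fixes E :: "'a::euclidean_space set"
  assumes "bounded E" "\<epsilon> > 0"
  obtains K where "finite K" "card K = box_number E \<epsilon>" "E \<subseteq> (\<Union>c\<in>K. cbox c (c + \<epsilon> *\<^sub>R One))"
proof -
  let ?P = "\<lambda>k. \<exists>K. finite K \<and> card K = k \<and> E \<subseteq> (\<Union>c\<in>K. cbox c (c + \<epsilon> *\<^sub>R One))"
  have "\<exists>k. ?P k" using box_cover_exists[OF assms] by blast
  then have "?P (box_number E \<epsilon>)" unfolding box_number_def by (rule LeastI_ex)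
  then show thesis using that by blast
qed

text \<open>The constant \<open>C\<close> disappears in the limit: below the threshold
  \<open>e0\<close> its logarithm is at most \<open>\<eta> * ln (1 / \<epsilon>)\<close>.\<close>

lemma fractal_dim_le:
  assumes C: "C \<ge> 1" and le: "\<And>\<epsilon>. 0 < \<epsilon> \<Longrightarrow> \<epsilon> < 1 \<Longrightarrow> real (box_number E \<epsilon>) \<le> C * (1 / \<epsilon>) powr d" and d: "d \<ge> 0"
  shows "fractal_dim E \<le> ereal d"
proof (rule ereal_le_epsilon2)
  fix \<eta> :: real assume \<eta>: "\<eta> > 0"
  define e0 where "e0 = min 1 (exp (- ln C / \<eta>))"
  have e0: "e0 > 0" by (simp add: e0_def)
  have "eventually (\<lambda>\<epsilon>. ereal (ln (real (box_number E \<epsilon>)) / ln (1 / \<epsilon>)) \<le> ereal (d + \<eta>)) (at_right 0)"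
  proof -
    have "eventually (\<lambda>\<epsilon>. \<epsilon> < e0 \<and> 0 < \<epsilon>) (at_right (0::real))"
      using e0 unfolding eventually_at_right_field by auto
    then show ?thesis
    proof eventually_elim
      case (elim \<epsilon>)
      then have \<epsilon>: "0 < \<epsilon>" "\<epsilon> < 1" "\<epsilon> < exp (- ln C / \<eta>)" by (auto simp: e0_def)
      have L: "ln (1 / \<epsilon>) > 0" using \<epsilon> by (simp add: ln_div)
      have "ln \<epsilon> < - ln C / \<eta>" using \<epsilon> by (metis exp_ln exp_less_cancel_iff)
      then have lC: "ln C \<le> \<eta> * ln (1 / \<epsilon>)" using \<epsilon> \<eta> by (simp add: ln_div field_simps)
      have "ln (real (box_number E \<epsilon>)) \<le> ln C + d * ln (1 / \<epsilon>)"
      \<comment> \<open>If the box number is 0, its logarithm has the default value 0.\<close>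
      proof (cases "box_number E \<epsilon> = 0")
        case True
        then show ?thesis using C d L by simp
      next
        case False
        then have "ln (real (box_number E \<epsilon>)) \<le> ln (C * (1 / \<epsilon>) powr d)"
          using le[OF \<epsilon>(1,2)] C \<epsilon> by (subst ln_le_cancel_iff) auto
        also have "\<dots> = ln C + d * ln (1 / \<epsilon>)"
          using C \<epsilon> by (subst ln_mult) (auto simp: ln_powr)
        finally show ?thesis .
      qed
      also have "\<dots> \<le> (d + \<eta>) * ln (1 / \<epsilon>)" using lC by (simp add: algebra_simps)
      finally show ?case using L by (simp add: divide_le_eq)
    qed
  qed
  then have "fractal_dim E \<le> ereal (d + \<eta>)"
    unfolding fractal_dim_def by (rule Limsup_bounded)
  then show "fractal_dim E \<le> ereal d + ereal \<eta>" by simp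
qed

lemma fractal_dim_ge:
  assumes "\<And>\<epsilon>. 0 < \<epsilon> \<Longrightarrow> \<epsilon> < 1 \<Longrightarrow> (1 / \<epsilon>) powr d \<le> real (box_number E \<epsilon>)"
  shows "ereal d \<le> fractal_dim E"
  unfolding fractal_dim_def
proof (rule le_Limsup)
  have "eventually (\<lambda>\<epsilon>. \<epsilon> < 1 \<and> 0 < \<epsilon>) (at_right (0::real))"
    unfolding eventually_at_right_field by (auto intro: exI[of _ 1])
  then show "eventually (\<lambda>\<epsilon>. ereal d \<le> ereal (ln (real (box_number E \<epsilon>)) / ln (1 / \<epsilon>))) (at_right 0)"
  proof eventually_elim
    case (elim \<epsilon>)
    have L: "ln (1 / \<epsilon>) > 0" using elim by (simp add: ln_div)
    have "0 < (1 / \<epsilon>) powr d" using elim by simp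
    moreover have "(1 / \<epsilon>) powr d \<le> real (box_number E \<epsilon>)" using assms[of \<epsilon>] elim by simp
    ultimately have "ln ((1 / \<epsilon>) powr d) \<le> ln (real (box_number E \<epsilon>))"
      by (subst ln_le_cancel_iff) linarith+
    then show ?case using L elim by (simp add: ln_powr le_divide_eq)
  qed
qed simp

lemma fractal_dim_less_imp_box_number:
  assumes "fractal_dim E < ereal d"
  shows "eventually (\<lambda>\<epsilon>. real (box_number E \<epsilon>) \<le> (1 / \<epsilon>) powr d) (at_right 0)"
proof -
  have "eventually (\<lambda>\<epsilon>. ereal (ln (real (box_number E \<epsilon>)) / ln (1 / \<epsilon>)) < ereal d) (at_right 0)"
    using assms unfolding fractal_dim_def by (rule Limsup_lessD)
  moreover have "eventually (\<lambda>\<epsilon>. \<epsilon> < 1 \<and> 0 < \<epsilon>) (at_right (0::real))"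
    unfolding eventually_at_right_field by (auto intro: exI[of _ 1])
  ultimately show ?thesis
  proof eventually_elim
    case (elim \<epsilon>)
    have L: "ln (1 / \<epsilon>) > 0" using elim by (simp add: ln_div)
    show ?case
    proof (cases "box_number E \<epsilon> = 0")
      case False
      have "ln (real (box_number E \<epsilon>)) < d * ln (1 / \<epsilon>)" using elim(1) L by (simp add: divide_less_eq)
      also have "d * ln (1 / \<epsilon>) = ln ((1 / \<epsilon>) powr d)" using elim by (simp add: ln_powr)
      finally show ?thesis using False elim by (subst (asm) ln_less_cancel_iff) auto
    qed simp
  qed
qed

lemma mem_graph_box:
  fixes c :: "(real^3) \<times> real"
  shows "(x, y) \<in> cbox c (c + \<epsilon> *\<^sub>R One) \<longleftrightarrow>
    (\<forall>i. fst c $ i \<le> x $ i \<and> x $ i \<le> fst c $ i + \<epsilon>) \<and> snd c \<le> y \<and> y \<le> snd c + \<epsilon>"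
proof -
  have "(x, y) \<in> cbox c (c + \<epsilon> *\<^sub>R One) \<longleftrightarrow>
     (\<forall>b\<in>Basis. c \<bullet> (b, 0) \<le> (x, y) \<bullet> (b, 0) \<and> (x, y) \<bullet> (b, 0) \<le> (c + \<epsilon> *\<^sub>R One) \<bullet> (b, 0)) \<and>
     (c \<bullet> (0, 1) \<le> (x, y) \<bullet> (0, 1) \<and> (x, y) \<bullet> (0, 1) \<le> (c + \<epsilon> *\<^sub>R One) \<bullet> (0, 1))"
    unfolding mem_box Basis_prod_def by auto
  also have "\<dots> \<longleftrightarrow> (\<forall>b\<in>Basis. fst c \<bullet> b \<le> x \<bullet> b \<and> x \<bullet> b \<le> fst c \<bullet> b + \<epsilon>) \<and> snd c \<le> y \<and> y \<le> snd c + \<epsilon>"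
  proof -
    have "(c + \<epsilon> *\<^sub>R One) \<bullet> (b, 0) = fst c \<bullet> b + \<epsilon>" if "b \<in> Basis" for b
    proof -
      have "(b, 0::real) \<in> Basis" using that by (simp add: Basis_prod_def)
      then have "One \<bullet> (b, 0::real) = 1" by simp
      then show ?thesis by (simp add: inner_add_left inner_prod_def)
    qed
    moreover have "(c + \<epsilon> *\<^sub>R One) \<bullet> (0, 1) = snd c + \<epsilon>"
    proof -
      have "(0::real^3, 1::real) \<in> Basis" by (simp add: Basis_prod_def)
      then have "One \<bullet> (0::real^3, 1::real) = 1" by simp
      then show ?thesis by (simp add: inner_add_left inner_prod_def)
    qed
    ultimately show ?thesis by (auto simp: inner_prod_def)
  qed
  also have "(\<forall>b\<in>Basis. fst c \<bullet> b \<le> x \<bullet> b \<and> x \<bullet> b \<le> fst c \<bullet> b + \<epsilon>) \<longleftrightarrow>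
     (\<forall>i. fst c $ i \<le> x $ i \<and> x $ i \<le> fst c $ i + \<epsilon>)"
    by (auto simp: Basis_vec_def inner_axis)
  finally show ?thesis .
qed

lemma bounded_graph_S2:
  assumes "continuous_on S2 h"
  shows "bounded (graph_S2 h)"
  unfolding graph_S2_def
  by (intro compact_imp_bounded compact_continuous_image continuous_intros assms compact_sphere)

lemma measure_cbox_cover_le:
  fixes a b :: "'a::euclidean_space"
  assumes K: "finite K" and sub: "cbox a b \<subseteq> (\<Union>c\<in>K. cbox (l c) (u c))"
  shows "measure lborel (cbox a b) \<le> (\<Sum>c\<in>K. measure lborel (cbox (l c) (u c)))"
proof -
  have "measure lborel (cbox a b) \<le> measure lborel (\<Union>c\<in>K. cbox (l c) (u c))"
    using K by (intro measure_mono_fmeasurable[OF sub] fmeasurable.finite_UN fmeasurable_cbox) auto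
  also have "\<dots> \<le> (\<Sum>c\<in>K. measure lborel (cbox (l c) (u c)))"
    using K by (intro measure_UNION_le) auto
  finally show ?thesis .
qed

section \<open>Graphs of continuous and of Hoelder continuous functions\<close>

text \<open>The square of side 1 about the origin lies under the upper hemisphere. The boxes project
  to squares of area \<open>\<epsilon>\<^sup>2\<close> that cover it, so no constant is
  lost.\<close>

lemma box_number_graph_S2_ge:
  assumes "continuous_on S2 h" and \<epsilon>: "0 < \<epsilon>"
  shows "(1 / \<epsilon>) powr 2 \<le> real (box_number (graph_S2 h) \<epsilon>)"
proof -
  obtain K where K: "finite K" "card K = box_number (graph_S2 h) \<epsilon>" "graph_S2 h \<subseteq> (\<Union>c\<in>K. cbox c (c + \<epsilon> *\<^sub>R One))"
    by (rule box_number_attained[OF bounded_graph_S2[OF assms(1)] \<epsilon>])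
  let ?Q = "\<lambda>c :: (real^3) \<times> real. cbox (fst c $ 1, fst c $ 2) (fst c $ 1 + \<epsilon>, fst c $ 2 + \<epsilon>)"
  let ?S = "cbox (- (1/2), - (1/2)) (1/2, 1/2) :: (real \<times> real) set"
  have "?S \<subseteq> (\<Union>c\<in>K. ?Q c)"
  proof
    fix p assume p: "p \<in> ?S"
    obtain s t where st: "p = (s, t)" by (cases p)
    have "\<bar>s\<bar> \<le> 1/2" "\<bar>t\<bar> \<le> 1/2" using p st by (auto simp: cbox_Pair_eq abs_le_iff)
    then have "s\<^sup>2 \<le> (1/2)\<^sup>2" "t\<^sup>2 \<le> (1/2)\<^sup>2" by (metis abs_ge_zero power2_abs power_mono)+
    then have r: "1 - s\<^sup>2 - t\<^sup>2 \<ge> 0" by (simp add: power2_eq_square)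
    define x :: "real^3" where "x = vector [s, t, sqrt (1 - s\<^sup>2 - t\<^sup>2)]"
    have x: "x $ 1 = s" "x $ 2 = t" "x $ 3 = sqrt (1 - s\<^sup>2 - t\<^sup>2)" by (simp_all add: x_def vector_3)
    have "x \<in> S2" unfolding S2_iff x using r by simp
    then have "(x, h x) \<in> graph_S2 h" by (auto simp: graph_S2_def)
    then obtain c where c: "c \<in> K" "(x, h x) \<in> cbox c (c + \<epsilon> *\<^sub>R One)" using K(3) by blast
    then have "fst c $ 1 \<le> x $ 1 \<and> x $ 1 \<le> fst c $ 1 + \<epsilon>" "fst c $ 2 \<le> x $ 2 \<and> x $ 2 \<le> fst c $ 2 + \<epsilon>"
      unfolding mem_graph_box by blast+
    then have "p \<in> ?Q c" unfolding st x by (simp add: cbox_Pair_eq)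
    then show "p \<in> (\<Union>c\<in>K. ?Q c)" using c(1) by blast
  qed
  then have "measure lborel ?S \<le> (\<Sum>c\<in>K. measure lborel (?Q c))" by (rule measure_cbox_cover_le[OF K(1)])
  also have "\<dots> = (\<Sum>c\<in>K. \<epsilon> * \<epsilon>)"
    using \<epsilon> by (intro sum.cong refl) (simp add: content_Pair)
  also have "measure lborel ?S = 1" by (simp add: content_Pair)
  finally have "1 \<le> real (card K) * (\<epsilon> * \<epsilon>)" by simp
  then have "(1 / \<epsilon>)\<^sup>2 \<le> real (card K)" using \<epsilon> by (simp add: field_simps power2_eq_square)
  then show ?thesis using K(2) \<epsilon> by simp
qed

lemma spherical_coords_nth_diff:
  "\<bar>spherical_coords (\<theta>, \<phi>) $ i - spherical_coords (\<theta>', \<phi>') $ i\<bar> \<le> \<bar>\<theta> - \<theta>'\<bar> + \<bar>\<phi> - \<phi>'\<bar>"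
proof -
  have half: "\<bar>2 * (sin ((x - y) / 2) * z)\<bar> \<le> \<bar>x - y\<bar>" if "\<bar>z\<bar> \<le> 1" for x y z :: real
  proof -
    have "\<bar>sin ((x - y) / 2)\<bar> * \<bar>z\<bar> \<le> \<bar>(x - y) / 2\<bar> * 1"
      using that by (intro mult_mono abs_sin_x_le_abs_x) auto
    then show ?thesis by (simp add: abs_mult)
  qed
  have lip: "\<bar>sin x - sin y\<bar> \<le> \<bar>x - y\<bar>" "\<bar>cos x - cos y\<bar> \<le> \<bar>x - y\<bar>" for x y :: real
  proof -
    show "\<bar>sin x - sin y\<bar> \<le> \<bar>x - y\<bar>"
      using half[of "cos ((x + y) / 2)" x y] by (simp add: sin_diff_sin mult.assoc)
    show "\<bar>cos x - cos y\<bar> \<le> \<bar>x - y\<bar>"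
      using half[of "sin ((x + y) / 2)" y x] by (simp add: cos_diff_cos mult_ac abs_minus_commute)
  qed
  have prod: "\<bar>a * b - a' * b'\<bar> \<le> \<bar>a - a'\<bar> + \<bar>b - b'\<bar>" if "\<bar>b\<bar> \<le> 1" "\<bar>a'\<bar> \<le> 1" for a b a' b' :: real
  proof -
    have "a * b - a' * b' = (a - a') * b + a' * (b - b')" by (simp add: algebra_simps)
    also have "\<bar>\<dots>\<bar> \<le> \<bar>a - a'\<bar> * \<bar>b\<bar> + \<bar>a'\<bar> * \<bar>b - b'\<bar>"
      by (rule order_trans[OF abs_triangle_ineq]) (simp add: abs_mult)
    also have "\<dots> \<le> \<bar>a - a'\<bar> * 1 + 1 * \<bar>b - b'\<bar>"
      using that by (intro add_mono mult_left_mono mult_right_mono) auto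
    finally show ?thesis by simp
  qed
  consider "i = 1" | "i = 2" | "i = 3" using exhaust_3[of i] by blast
  then show ?thesis
  proof cases
    case 1
    then show ?thesis using prod[of "cos \<phi>" "sin \<theta>'" "sin \<theta>" "cos \<phi>'"] lip[of \<theta> \<theta>'] lip[of \<phi> \<phi>'] by simp
  next
    case 2
    then show ?thesis using prod[of "sin \<phi>" "sin \<theta>'" "sin \<theta>" "sin \<phi>'"] lip[of \<theta> \<theta>'] lip[of \<phi> \<phi>'] by simp
  next
    case 3
    then show ?thesis using lip[of \<theta> \<theta>'] by simp
  qed
qed

lemma floor_grid:
  fixes x \<delta> X :: real
  assumes "0 \<le> x" "x \<le> X" "\<delta> > 0"
  obtains i where "i \<le> nat \<lfloor>X / \<delta>\<rfloor>" "real i * \<delta> \<le> x" "x \<le> real i * \<delta> + \<delta>"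
proof
  let ?i = "nat \<lfloor>x / \<delta>\<rfloor>"
  have i: "real ?i = of_int \<lfloor>x / \<delta>\<rfloor>" using assms by simp
  show "?i \<le> nat \<lfloor>X / \<delta>\<rfloor>" using assms by (intro nat_mono floor_mono divide_right_mono) auto
  have "of_int \<lfloor>x / \<delta>\<rfloor> \<le> x / \<delta>" "x / \<delta> \<le> of_int \<lfloor>x / \<delta>\<rfloor> + 1" by linarith+
  then have "real_of_int \<lfloor>x / \<delta>\<rfloor> * \<delta> \<le> (x / \<delta>) * \<delta>" "(x / \<delta>) * \<delta> \<le> (real_of_int \<lfloor>x / \<delta>\<rfloor> + 1) * \<delta>"
    using assms(3) by (intro mult_right_mono; simp)+
  then show "real ?i * \<delta> \<le> x" "x \<le> real ?i * \<delta> + \<delta>"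
    unfolding i using assms(3) by (simp_all add: distrib_right)
qed

text \<open>The sphere is covered by boxes about a grid in the two angles, and over each of them
  boxes are stacked to a height of order \<open>\<epsilon> powr \<gamma>\<close>. The constant
  \<open>378 * (4 * M + 1)\<close> is a product over the three counts, with
  \<open>378 = 14 * 27\<close>.\<close>

lemma box_number_graph_holder:
  assumes M: "M \<ge> 0" and hol: "\<And>x y. x \<in> S2 \<Longrightarrow> y \<in> S2 \<Longrightarrow> \<bar>h x - h y\<bar> \<le> M * dist x y powr \<gamma>"
    and \<gamma>: "0 < \<gamma>" "\<gamma> \<le> 1" and \<epsilon>: "0 < \<epsilon>" "\<epsilon> < 1"
  shows "real (box_number (graph_S2 h) \<epsilon>) \<le> 378 * (4 * M + 1) * (1 / \<epsilon>) powr (3 - \<gamma>)"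
proof -
  \<comment> \<open>With mesh \<open>\<epsilon> / 4\<close> in both angles each coordinate moves by
    at most \<open>\<epsilon> / 2\<close>, so the box of side \<epsilon> centred at a grid point
    contains its cell. \<open>R\<close> bounds the variation of \<open>h\<close> from the grid
    point, whose distance is at most \<open>2 * \<epsilon>\<close>.\<close>
  define \<delta> where "\<delta> = \<epsilon> / 4"
  define R where "R = 2 * M * \<epsilon> powr \<gamma>"
  have \<delta>: "\<delta> > 0" using \<epsilon> by (simp add: \<delta>_def)
  have R: "R \<ge> 0" using M by (simp add: R_def)
  define I J L where "I = nat \<lfloor>pi / \<delta>\<rfloor>" and "J = nat \<lfloor>2 * pi / \<delta>\<rfloor>" and "L = nat \<lfloor>2 * R / \<epsilon>\<rfloor>"
  let ?x = "\<lambda>i j. spherical_coords (real i * \<delta>, real j * \<delta>)"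
  let ?c = "\<lambda>(i, j, k). (?x i j - (\<chi> _. \<epsilon> / 2), h (?x i j) - R + real k * \<epsilon>)"
  define K where "K = ?c ` ({..I} \<times> {..J} \<times> {..L})"
  have "graph_S2 h \<subseteq> (\<Union>c\<in>K. cbox c (c + \<epsilon> *\<^sub>R One))"
  proof
    fix z assume "z \<in> graph_S2 h"
    then obtain x where x: "x \<in> S2" "z = (x, h x)" by (auto simp: graph_S2_def)
    obtain \<phi> where \<phi>: "0 \<le> \<phi>" "\<phi> < 2 * pi" "x = spherical_coords (arccos (x $ 3), \<phi>)"
      using spherical_coords_exists[OF x(1)] by blast
    have "(x $ 1)\<^sup>2 + (x $ 2)\<^sup>2 + (x $ 3)\<^sup>2 = 1" using x(1) by (simp only: S2_iff)
    then have "(x $ 3)\<^sup>2 \<le> 1" using zero_le_power2[of "x $ 1"] zero_le_power2[of "x $ 2"] by linarith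
    then have "-1 \<le> x $ 3" "x $ 3 \<le> 1" by (simp_all add: abs_square_le_1 abs_le_iff)
    then have \<theta>: "0 \<le> arccos (x $ 3)" "arccos (x $ 3) \<le> pi" by (auto intro: arccos_lbound arccos_ubound)
    define \<theta> where "\<theta> = arccos (x $ 3)"
    obtain i where i: "i \<le> I" "real i * \<delta> \<le> \<theta>" "\<theta> \<le> real i * \<delta> + \<delta>"
      using floor_grid[of \<theta> pi \<delta>] \<theta> \<delta> unfolding I_def \<theta>_def by blast
    obtain j where j: "j \<le> J" "real j * \<delta> \<le> \<phi>" "\<phi> \<le> real j * \<delta> + \<delta>"
      using floor_grid[of \<phi> "2 * pi" \<delta>] \<phi> \<delta> unfolding J_def by force
    have xs: "x = spherical_coords (\<theta>, \<phi>)" using \<phi>(3) unfolding \<theta>_def .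
    have near: "\<bar>x $ l - ?x i j $ l\<bar> \<le> \<epsilon> / 2" for l
    proof -
      have "\<bar>x $ l - ?x i j $ l\<bar> \<le> \<bar>\<theta> - real i * \<delta>\<bar> + \<bar>\<phi> - real j * \<delta>\<bar>"
        unfolding xs by (rule spherical_coords_nth_diff)
      then show ?thesis using i j unfolding \<delta>_def by linarith
    qed
    have "dist x (?x i j) \<le> (\<Sum>l\<in>UNIV. \<bar>(x - ?x i j) $ l\<bar>)" unfolding dist_norm by (rule norm_le_l1_cart)
    also have "\<dots> \<le> 2 * \<epsilon>" using near[of 1] near[of 2] near[of 3] \<epsilon> by (simp add: sum_3)
    finally have d: "dist x (?x i j) \<le> 2 * \<epsilon>" .
    have "\<bar>h x - h (?x i j)\<bar> \<le> M * dist x (?x i j) powr \<gamma>" by (rule hol[OF x(1) spherical_coords_in_S2])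
    also have "\<dots> \<le> M * (2 * \<epsilon>) powr \<gamma>" using M d \<gamma> by (intro mult_left_mono powr_mono2) auto
    also have "\<dots> \<le> M * (2 powr 1 * \<epsilon> powr \<gamma>)"
    proof -
      have "(2::real) powr \<gamma> \<le> 2 powr 1" using \<gamma> by (intro powr_mono) auto
      then show ?thesis using M \<epsilon> unfolding powr_mult by (intro mult_left_mono mult_right_mono) auto
    qed
    also have "\<dots> = R" by (simp add: R_def)
    finally have hR: "\<bar>h x - h (?x i j)\<bar> \<le> R" .
    obtain k where k: "k \<le> L" "real k * \<epsilon> \<le> h x - h (?x i j) + R" "h x - h (?x i j) + R \<le> real k * \<epsilon> + \<epsilon>"
      using floor_grid[of "h x - h (?x i j) + R" "2 * R" \<epsilon>] hR \<epsilon>(1) unfolding L_def by (auto simp: abs_le_iff)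
    have "z \<in> cbox (?c (i, j, k)) (?c (i, j, k) + \<epsilon> *\<^sub>R One)"
      unfolding x(2) mem_graph_box
    proof (intro conjI allI)
      fix l
      show "fst (?c (i, j, k)) $ l \<le> x $ l" "x $ l \<le> fst (?c (i, j, k)) $ l + \<epsilon>"
        using abs_le_D1[OF near[of l]] abs_le_D2[OF near[of l]] by simp_all
    next
      show "snd (?c (i, j, k)) \<le> h x" "h x \<le> snd (?c (i, j, k)) + \<epsilon>" using k(2,3) by simp_all
    qed
    moreover have "?c (i, j, k) \<in> K" unfolding K_def using i(1) j(1) k(1) by (intro imageI) auto
    ultimately show "z \<in> (\<Union>c\<in>K. cbox c (c + \<epsilon> *\<^sub>R One))" by blast
  qed
  then have "box_number (graph_S2 h) \<epsilon> \<le> card K"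
    by (intro box_number_le) (auto simp: K_def)
  also have "card K \<le> card ({..I} \<times> {..J} \<times> {..L})"
    unfolding K_def by (rule card_image_le) auto
  also have "\<dots> = (I + 1) * ((J + 1) * (L + 1))" by (simp add: card_cartesian_product)
  finally have "real (box_number (graph_S2 h) \<epsilon>) \<le> real ((I + 1) * ((J + 1) * (L + 1)))"
    by (simp only: of_nat_le_iff)
  also have "\<dots> = (real I + 1) * ((real J + 1) * (real L + 1))" by (simp only: of_nat_mult of_nat_add of_nat_1)
  also have "\<dots> \<le> (14 / \<epsilon>) * ((27 / \<epsilon>) * ((4 * M + 1) * \<epsilon> powr (\<gamma> - 1)))"
  proof (intro mult_mono)
    have pi: "pi < 3.2" using pi_approx by simp
    have "real I \<le> pi / \<delta>" unfolding I_def using \<delta> by simp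
    also have "\<dots> \<le> 13 / \<epsilon>" using pi \<epsilon> by (simp add: \<delta>_def divide_right_mono)
    finally show "real I + 1 \<le> 14 / \<epsilon>" using \<epsilon> by (simp add: field_simps)
    have "real J \<le> 2 * pi / \<delta>" unfolding J_def using \<delta> by simp
    also have "\<dots> \<le> 26 / \<epsilon>" using pi \<epsilon> by (simp add: \<delta>_def divide_right_mono)
    finally show "real J + 1 \<le> 27 / \<epsilon>" using \<epsilon> by (simp add: field_simps)
    have "real L \<le> 2 * R / \<epsilon>" unfolding L_def using R \<epsilon> by simp
    also have "\<dots> = 4 * M * \<epsilon> powr (\<gamma> - 1)" using \<epsilon> by (simp add: R_def powr_diff)
    finally have "real L \<le> 4 * M * \<epsilon> powr (\<gamma> - 1)" .
    moreover have "1 \<le> \<epsilon> powr (\<gamma> - 1)"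
      using powr_mono'[of "\<gamma> - 1" 0 \<epsilon>] \<epsilon> \<gamma> by simp
    ultimately show "real L + 1 \<le> (4 * M + 1) * \<epsilon> powr (\<gamma> - 1)" by (simp add: algebra_simps)
  qed (use \<epsilon> in auto)
  also have "\<dots> = 378 * (4 * M + 1) * ((1 / \<epsilon>) powr 2 * (1 / \<epsilon>) powr (1 - \<gamma>))"
  proof -
    have "(1 / \<epsilon>) powr (1 - \<gamma>) = \<epsilon> powr (\<gamma> - 1)"
      using \<epsilon> by (simp add: powr_divide powr_minus_divide[symmetric])
    moreover have "(1 / \<epsilon>) powr 2 = (1 / \<epsilon>) * (1 / \<epsilon>)" using \<epsilon> by (simp add: power2_eq_square)
    ultimately show ?thesis by simp
  qed
  also have "(1 / \<epsilon>) powr 2 * (1 / \<epsilon>) powr (1 - \<gamma>) = (1 / \<epsilon>) powr (3 - \<gamma>)"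
    by (subst powr_add[symmetric]) simp
  finally show ?thesis .
qed

section \<open>Counting boxes along the meridians of a zonal function\<close>

lemma real_interval_cover_le:
  fixes w :: "'c \<Rightarrow> real"
  assumes "finite K" "\<epsilon> \<ge> 0" and cov: "\<And>y. m \<le> y \<Longrightarrow> y \<le> M \<Longrightarrow> \<exists>c\<in>K. w c \<le> y \<and> y \<le> w c + \<epsilon>"
  shows "M - m \<le> \<epsilon> * real (card K)"
proof (cases "m \<le> M")
  case True
  have "cbox m M \<subseteq> (\<Union>c\<in>K. cbox (w c) (w c + \<epsilon>))" using cov by fastforce
  from measure_cbox_cover_le[OF assms(1) this]
  have "M - m \<le> (\<Sum>c\<in>K. measure lborel (cbox (w c) (w c + \<epsilon>)))" using True by simp
  also have "\<dots> = \<epsilon> * real (card K)" using assms(2) by simp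
  finally show ?thesis .
next
  case False
  then have "M - m \<le> 0" by simp
  also have "0 \<le> \<epsilon> * real (card K)" using assms(2) by simp
  finally show ?thesis .
qed

text \<open>By connectedness all values between \<open>g s\<close> and \<open>g t\<close> are
  attained, so the intervals of length \<epsilon> cover that whole range and their total length
  bounds it.\<close>

lemma oscillation_cover_le:
  fixes g :: "real \<Rightarrow> real" and w :: "'c \<Rightarrow> real"
  assumes K: "finite K" "\<epsilon> \<ge> 0" and g: "continuous_on {\<alpha>..\<beta>} g"
    and cov: "\<And>x. x \<in> {\<alpha>..\<beta>} \<Longrightarrow> \<exists>c\<in>K. w c \<le> g x \<and> g x \<le> w c + \<epsilon>"
    and s: "s \<in> {\<alpha>..\<beta>}" and t: "t \<in> {\<alpha>..\<beta>}"
  shows "\<bar>g s - g t\<bar> \<le> \<epsilon> * real (card K)"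
proof -
  have conn: "connected (g ` {\<alpha>..\<beta>})" by (rule connected_continuous_image[OF g]) simp
  have "g y - g x \<le> \<epsilon> * real (card K)" if "x \<in> {\<alpha>..\<beta>}" "y \<in> {\<alpha>..\<beta>}" for x y
  proof (rule real_interval_cover_le[OF K, where w = w])
    fix v assume "g x \<le> v" "v \<le> g y"
    then have "v \<in> g ` {\<alpha>..\<beta>}"
      using connected_contains_Icc[OF conn imageI[OF that(1)] imageI[OF that(2)]] by auto
    then show "\<exists>c\<in>K. w c \<le> v \<and> v \<le> w c + \<epsilon>" using cov by auto
  qed
  from this[OF s t] this[OF t s] show ?thesis by linarith
qed

text \<open>For given polar angles the chord is shortest when the longitudes agree, where it equals
  \<open>2 * sin (\<bar>\<theta> - \<theta>'\<bar> / 2)\<close>; Jordan's inequality bounds this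
  from below.\<close>

lemma angle_le_chord:
  assumes "\<theta> \<in> {0..pi}" "\<theta>' \<in> {0..pi}"
  shows "\<bar>\<theta> - \<theta>'\<bar> \<le> pi / 2 * dist (spherical_coords (\<theta>, \<phi>)) (spherical_coords (\<theta>', \<phi>'))"
proof -
  let ?d = "dist (spherical_coords (\<theta>, \<phi>)) (spherical_coords (\<theta>', \<phi>'))"
  define z where "z = \<bar>\<theta> - \<theta>'\<bar> / 2"
  have z: "0 \<le> z" "z \<le> pi / 2" using assms by (auto simp: z_def)
  have eq: "(s * c - s' * c')\<^sup>2 + (s * e - s' * e')\<^sup>2 + (u - u')\<^sup>2
      = s\<^sup>2 * (c\<^sup>2 + e\<^sup>2) + s'\<^sup>2 * (c'\<^sup>2 + e'\<^sup>2) + u\<^sup>2 + u'\<^sup>2 - 2 * (s * s' * (c * c' + e * e') + u * u')"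
    for s c s' c' e e' u u' :: real by (simp add: power2_eq_square algebra_simps)
  have sc: "(sin x)\<^sup>2 = 1 - (cos x)\<^sup>2" for x :: real using sin_cos_squared_add[of x] by linarith
  have "?d\<^sup>2 = (sin \<theta> * cos \<phi> - sin \<theta>' * cos \<phi>')\<^sup>2 + (sin \<theta> * sin \<phi> - sin \<theta>' * sin \<phi>')\<^sup>2 + (cos \<theta> - cos \<theta>')\<^sup>2"
    unfolding dist_norm norm_vec3 by (subst real_sqrt_pow2) simp_all
  also have "\<dots> = 2 - 2 * (sin \<theta> * sin \<theta>' * cos (\<phi> - \<phi>') + cos \<theta> * cos \<theta>')"
    unfolding eq by (simp add: sc cos_diff algebra_simps)
  finally have "?d\<^sup>2 = 2 - 2 * (sin \<theta> * sin \<theta>' * cos (\<phi> - \<phi>') + cos \<theta> * cos \<theta>')" .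
  moreover have "sin \<theta> * sin \<theta>' * cos (\<phi> - \<phi>') \<le> sin \<theta> * sin \<theta>' * 1"
    using assms by (intro mult_left_mono mult_nonneg_nonneg sin_ge_zero) auto
  moreover have "cos (\<theta> - \<theta>') = 1 - 2 * (sin z)\<^sup>2"
  proof -
    have "cos (2 * z) = 1 - 2 * (sin z)\<^sup>2" by (rule cos_double_sin)
    moreover have "cos (2 * z) = cos (\<theta> - \<theta>')" unfolding z_def by (simp add: abs_if) (metis cos_minus minus_diff_eq)
    ultimately show ?thesis by simp
  qed
  ultimately have "(2 * sin z)\<^sup>2 \<le> ?d\<^sup>2" by (simp add: cos_diff power_mult_distrib)
  then have "2 * sin z \<le> ?d" using power2_le_imp_le zero_le_dist by blast
  moreover have "2 / pi * z \<le> sin z" using z by (intro jordan_sin) auto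
  ultimately have "2 * (2 / pi * z) \<le> ?d" by linarith
  then have "pi / 2 * (2 * (2 / pi * z)) \<le> pi / 2 * ?d" by (intro mult_left_mono) auto
  then show ?thesis by (simp add: z_def)
qed

lemma norm_vec3_le:
  assumes "\<And>i. \<bar>(x :: real^3) $ i\<bar> \<le> e"
  shows "norm x \<le> 2 * e"
proof -
  have e: "e \<ge> 0" using assms[of 1] by linarith
  have "(x $ i)\<^sup>2 \<le> e\<^sup>2" for i using assms[of i] e by (metis abs_ge_zero power2_abs power_mono)
  from this[of 1] this[of 2] this[of 3]
  have "(x $ 1)\<^sup>2 + (x $ 2)\<^sup>2 + (x $ 3)\<^sup>2 \<le> 3 * e\<^sup>2" by linarith
  also have "\<dots> \<le> (2 * e)\<^sup>2" by (simp add: power_mult_distrib)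
  finally show ?thesis unfolding norm_vec3 using e by (intro real_le_lsqrt) auto
qed

text \<open>The distance of the first point from the vertical plane through the second meridian is
  \<open>sin \<theta> * \<bar>sin (\<phi>' - \<phi>)\<bar>\<close>, at most
  \<open>2 * \<epsilon>\<close>. By Jordan's inequality a longitude difference of
  \<open>4 * \<epsilon> / \<delta>\<close> or more would give \<open>8 \<le> 2 * pi\<close>.\<close>

lemma close_points_meridian:
  assumes close: "\<And>i. \<bar>spherical_coords (\<theta>, \<phi>) $ i - spherical_coords (\<theta>', \<phi>') $ i\<bar> \<le> \<epsilon>"
    and \<phi>: "\<phi> \<in> {0..pi/2}" "\<phi>' \<in> {0..pi/2}" and \<delta>: "0 < \<delta>" "\<delta> \<le> sin \<theta>" and \<epsilon>: "\<epsilon> > 0"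
  shows "\<bar>\<phi> - \<phi>'\<bar> < 4 * \<epsilon> / \<delta>"
proof (rule ccontr)
  assume far: "\<not> ?thesis"
  let ?x = "spherical_coords (\<theta>, \<phi>)" and ?x' = "spherical_coords (\<theta>', \<phi>')"
  have "sin \<theta> * sin (\<phi>' - \<phi>) = (?x $ 1 - ?x' $ 1) * sin \<phi>' - (?x $ 2 - ?x' $ 2) * cos \<phi>'"
    by (simp add: sin_diff algebra_simps)
  also have "\<bar>\<dots>\<bar> \<le> \<bar>?x $ 1 - ?x' $ 1\<bar> * \<bar>sin \<phi>'\<bar> + \<bar>?x $ 2 - ?x' $ 2\<bar> * \<bar>cos \<phi>'\<bar>"
    by (rule order_trans[OF abs_triangle_ineq4]) (simp only: abs_mult order_refl)
  also have "\<dots> \<le> \<epsilon> * 1 + \<epsilon> * 1"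
    using \<epsilon> by (intro add_mono mult_mono close abs_sin_le_one abs_cos_le_one) auto
  finally have up: "sin \<theta> * \<bar>sin (\<phi>' - \<phi>)\<bar> \<le> 2 * \<epsilon>" using \<delta> by (simp add: abs_mult)
  define z where "z = \<bar>\<phi>' - \<phi>\<bar>"
  have z: "0 \<le> z" "z \<le> pi / 2" using \<phi> by (auto simp: z_def abs_if)
  have "2 / pi * z \<le> sin z" using z by (intro jordan_sin)
  also have "sin z \<le> \<bar>sin (\<phi>' - \<phi>)\<bar>" unfolding z_def using sin_minus[of "\<phi>' - \<phi>"] by (auto simp: abs_if)
  finally have "\<delta> * (2 / pi * z) \<le> sin \<theta> * \<bar>sin (\<phi>' - \<phi>)\<bar>"
    using \<delta> z by (intro mult_mono) auto
  with up have "\<delta> * (2 / pi * z) \<le> 2 * \<epsilon>" by linarith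
  moreover have "4 * \<epsilon> \<le> \<delta> * z" using far \<delta> by (simp add: z_def abs_minus_commute field_simps)
  then have "2 / pi * (4 * \<epsilon>) \<le> 2 / pi * (\<delta> * z)" by (intro mult_left_mono) auto
  ultimately have "2 / pi * (4 * \<epsilon>) \<le> 2 * \<epsilon>" by (simp add: mult_ac)
  then have "8 \<le> 2 * pi" using \<epsilon> by (simp add: field_simps)
  then show False using pi_less_4 by simp
qed

text \<open>
  A box of side \<open>\<epsilon>\<close> meets at most one of the \<open>m\<close> meridians at angular distance \<open>4 * \<epsilon> / \<delta>\<close> and, on
  it, at most nine rings of width \<open>\<epsilon>\<close>; over each piece of a meridian the boxes cover the range of \<open>g\<close>.
\<close>

lemma meridian_count:
  fixes g :: "real \<Rightarrow> real" and J :: "nat set"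
  assumes K: "finite K" "graph_S2 h \<subseteq> (\<Union>c\<in>K. cbox c (c + \<epsilon> *\<^sub>R One))"
    and h: "\<And>\<theta> \<phi>. \<theta> \<in> {0..pi} \<Longrightarrow> h (spherical_coords (\<theta>, \<phi>)) = g \<theta>"
    and g: "continuous_on {0..pi} g" and \<epsilon>: "\<epsilon> > 0" and \<delta>: "\<delta> > 0" and J: "finite J"
    and ring: "\<And>j. j \<in> J \<Longrightarrow> real (Suc j) * \<epsilon> \<le> pi"
      "\<And>j \<theta>. j \<in> J \<Longrightarrow> real j * \<epsilon> \<le> \<theta> \<Longrightarrow> \<theta> \<le> real (Suc j) * \<epsilon> \<Longrightarrow> \<delta> \<le> sin \<theta>"
      "\<And>j. j \<in> J \<Longrightarrow> s j \<in> {real j * \<epsilon>..real (Suc j) * \<epsilon>}" "\<And>j. j \<in> J \<Longrightarrow> s' j \<in> {real j * \<epsilon>..real (Suc j) * \<epsilon>}"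
    and m: "real m * (4 * \<epsilon> / \<delta>) \<le> pi / 2"
  shows "real m * (\<Sum>j\<in>J. \<bar>g (s j) - g (s' j)\<bar>) \<le> 9 * \<epsilon> * real (card K)"
proof -
  define \<kappa> where "\<kappa> = 4 * \<epsilon> / \<delta>"
  have \<kappa>: "\<kappa> > 0" using \<epsilon> \<delta> by (simp add: \<kappa>_def)
  \<comment> \<open>Incidence: the box \<open>c\<close> meets the graph over the piece of meridian
    number \<open>fst q\<close> that lies in ring number \<open>snd q\<close>.\<close>
  define R where "R q c \<longleftrightarrow> (\<exists>\<theta>\<in>{real (snd q) * \<epsilon>..real (Suc (snd q)) * \<epsilon>}.
    (spherical_coords (\<theta>, real (fst q) * \<kappa>), g \<theta>) \<in> cbox c (c + \<epsilon> *\<^sub>R One))" for q :: "nat \<times> nat" and c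
  have Ij: "{real j * \<epsilon>..real (Suc j) * \<epsilon>} \<subseteq> {0..pi}" if "j \<in> J" for j
  proof
    fix x assume "x \<in> {real j * \<epsilon>..real (Suc j) * \<epsilon>}"
    moreover have "0 \<le> real j * \<epsilon>" using \<epsilon> by simp
    ultimately show "x \<in> {0..pi}" using ring(1)[OF that] by (meson atLeastAtMost_iff order_trans)
  qed
  have osc: "\<bar>g (s j) - g (s' j)\<bar> \<le> \<epsilon> * real (card {c\<in>K. R (i, j) c})" if j: "j \<in> J" for i j
  proof (rule oscillation_cover_le[where w = snd, OF _ _ _ _ ring(3,4)[OF j]])
    show "continuous_on {real j * \<epsilon>..real (Suc j) * \<epsilon>} g" by (rule continuous_on_subset[OF g Ij[OF j]])
    fix x assume x: "x \<in> {real j * \<epsilon>..real (Suc j) * \<epsilon>}"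
    let ?p = "spherical_coords (x, real i * \<kappa>)"
    have "(?p, h ?p) \<in> graph_S2 h" unfolding graph_S2_def by (intro imageI spherical_coords_in_S2)
    then obtain c where c: "c \<in> K" "(?p, h ?p) \<in> cbox c (c + \<epsilon> *\<^sub>R One)" using K(2) by auto
    have "h ?p = g x" using x Ij[OF j] by (intro h) auto
    then have c': "(?p, g x) \<in> cbox c (c + \<epsilon> *\<^sub>R One)" using c(2) by simp
    then have "R (i, j) c" unfolding R_def using x by auto
    moreover have "snd c \<le> g x \<and> g x \<le> snd c + \<epsilon>" using c' unfolding mem_graph_box by blast
    ultimately show "\<exists>c\<in>{c\<in>K. R (i, j) c}. snd c \<le> g x \<and> g x \<le> snd c + \<epsilon>" using c(1) by blast
  qed (use K(1) \<epsilon> in auto)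
  have mult: "card {q\<in>{..<m} \<times> J. R q c} \<le> 9" for c
  proof (cases "{q\<in>{..<m} \<times> J. R q c} = {}")
    case True
    show ?thesis unfolding True by simp
  next
    case False
    then obtain i0 j0 where 0: "i0 < m" "j0 \<in> J" "R (i0, j0) c" by auto
    have "q \<in> {i0} \<times> {j0 - 4..j0 + 4}" if q: "q \<in> {..<m} \<times> J" "R q c" for q
    proof -
      obtain i j where ij: "q = (i, j)" "i < m" "j \<in> J" using q(1) by auto
      obtain \<theta>0 where \<theta>0: "\<theta>0 \<in> {real j0 * \<epsilon>..real (Suc j0) * \<epsilon>}"
        "(spherical_coords (\<theta>0, real i0 * \<kappa>), g \<theta>0) \<in> cbox c (c + \<epsilon> *\<^sub>R One)"
        using 0(3) unfolding R_def by auto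
      obtain \<theta>1 where \<theta>1: "\<theta>1 \<in> {real j * \<epsilon>..real (Suc j) * \<epsilon>}"
        "(spherical_coords (\<theta>1, real i * \<kappa>), g \<theta>1) \<in> cbox c (c + \<epsilon> *\<^sub>R One)"
        using q(2) unfolding R_def ij by auto
      have close: "\<bar>spherical_coords (\<theta>0, real i0 * \<kappa>) $ l - spherical_coords (\<theta>1, real i * \<kappa>) $ l\<bar> \<le> \<epsilon>" for l
      proof -
        have "fst c $ l \<le> spherical_coords (\<theta>0, real i0 * \<kappa>) $ l \<and> spherical_coords (\<theta>0, real i0 * \<kappa>) $ l \<le> fst c $ l + \<epsilon>"
          using \<theta>0(2) unfolding mem_graph_box by blast
        moreover have "fst c $ l \<le> spherical_coords (\<theta>1, real i * \<kappa>) $ l \<and> spherical_coords (\<theta>1, real i * \<kappa>) $ l \<le> fst c $ l + \<epsilon>"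
          using \<theta>1(2) unfolding mem_graph_box by blast
        ultimately show ?thesis by (intro abs_leI) linarith+
      qed
      have mer: "real n * \<kappa> \<in> {0..pi/2}" if "n < m" for n
      proof -
        have "real n * \<kappa> \<le> real m * \<kappa>" using that \<kappa> by (intro mult_right_mono) auto
        from order_trans[OF this m[folded \<kappa>_def]] show ?thesis using \<kappa> by simp
      qed
      have "\<bar>real i0 * \<kappa> - real i * \<kappa>\<bar> < \<kappa>"
        unfolding \<kappa>_def
        by (rule close_points_meridian[OF close[unfolded \<kappa>_def] mer[OF 0(1), unfolded \<kappa>_def] mer[OF ij(2), unfolded \<kappa>_def] \<delta> _ \<epsilon>])
          (use ring(2)[OF 0(2), of \<theta>0] \<theta>0(1) in simp)
      then have "\<bar>real i0 - real i\<bar> * \<kappa> < 1 * \<kappa>" using \<kappa> by (simp add: left_diff_distrib[symmetric] abs_mult)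
      then have "\<bar>real i0 - real i\<bar> < 1" using \<kappa> by (rule mult_right_less_imp_less[OF _ less_imp_le])
      then have i: "i = i0" by linarith
      have "\<bar>\<theta>0 - \<theta>1\<bar> \<le> pi / 2 * dist (spherical_coords (\<theta>0, real i0 * \<kappa>)) (spherical_coords (\<theta>1, real i * \<kappa>))"
        using \<theta>0(1) \<theta>1(1) Ij[OF 0(2)] Ij[OF ij(3)] by (intro angle_le_chord) auto
      also have "\<dots> \<le> pi / 2 * (2 * \<epsilon>)"
        unfolding dist_norm using close by (intro mult_left_mono norm_vec3_le) auto
      also have "\<dots> < 4 * \<epsilon>" using \<epsilon> pi_less_4 by simp
      finally have d: "\<theta>0 < \<theta>1 + 4 * \<epsilon>" "\<theta>1 < \<theta>0 + 4 * \<epsilon>" by linarith+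
      \<comment> \<open>Polar angles less than \<open>4 * \<epsilon>\<close> apart lie in rings
        whose indices differ by at most 4; hence the count of nine.\<close>
      have "real j * \<epsilon> < real (j0 + 5) * \<epsilon>" "real j0 * \<epsilon> < real (j + 5) * \<epsilon>"
        using d \<theta>0(1) \<theta>1(1) by (simp_all add: distrib_right)
      then have "real j < real (j0 + 5)" "real j0 < real (j + 5)"
        using \<epsilon> by (simp_all only: mult_less_cancel_right_pos)
      then show ?thesis unfolding ij(1) i by auto
    qed
    then have "{q\<in>{..<m} \<times> J. R q c} \<subseteq> {i0} \<times> {j0 - 4..j0 + 4}" by blast
    then have "card {q\<in>{..<m} \<times> J. R q c} \<le> card ({i0} \<times> {j0 - 4..j0 + 4})" by (intro card_mono) auto
    also have "\<dots> \<le> 9" by (simp add: card_cartesian_product)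
    finally show ?thesis .
  qed
  have card_filter: "card {x\<in>A. P x} = (\<Sum>x\<in>A. if P x then 1 else 0)" if "finite A" for A :: "'z set" and P
    using that by (simp add: sum.inter_filter[symmetric])
  have "real m * (\<Sum>j\<in>J. \<bar>g (s j) - g (s' j)\<bar>) = (\<Sum>i<m. \<Sum>j\<in>J. \<bar>g (s j) - g (s' j)\<bar>)" by simp
  also have "\<dots> \<le> (\<Sum>i<m. \<Sum>j\<in>J. \<epsilon> * real (card {c\<in>K. R (i, j) c}))"
    by (intro sum_mono osc)
  also have "\<dots> = \<epsilon> * real (\<Sum>q\<in>{..<m} \<times> J. card {c\<in>K. R q c})"
    by (simp add: sum.cartesian_product sum_distrib_left)
  \<comment> \<open>Double counting: the incidences are now summed box by box.\<close>
  also have "(\<Sum>q\<in>{..<m} \<times> J. card {c\<in>K. R q c}) = (\<Sum>q\<in>{..<m} \<times> J. \<Sum>c\<in>K. if R q c then 1 else 0)"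
    by (intro sum.cong refl card_filter K(1))
  also have "\<dots> = (\<Sum>c\<in>K. \<Sum>q\<in>{..<m} \<times> J. if R q c then 1 else 0)" by (rule sum.swap)
  also have "\<dots> = (\<Sum>c\<in>K. card {q\<in>{..<m} \<times> J. R q c})"
    using J by (intro sum.cong refl card_filter[symmetric]) auto
  also have "\<epsilon> * real (\<Sum>c\<in>K. card {q\<in>{..<m} \<times> J. R q c}) \<le> \<epsilon> * real (\<Sum>c\<in>K. 9)"
    using \<epsilon> by (intro mult_left_mono of_nat_mono sum_mono mult) auto
  finally show ?thesis by simp
qed

text \<open>The number of meridians is as large as a quarter turn allows,
  \<open>pi * \<delta> / (8 * \<epsilon>)\<close> rounded down. The quantity
  \<open>w = \<delta> / (6 * \<epsilon>)\<close> is a lower bound that survives the rounding because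
  \<open>\<epsilon> \<le> \<delta> / 5\<close>; the constant is \<open>54 = 6 * 9\<close>.\<close>

lemma meridian_sum_le:
  fixes g :: "real \<Rightarrow> real" and J :: "nat set"
  assumes hc: "continuous_on S2 h"
    and h: "\<And>\<theta> \<phi>. \<theta> \<in> {0..pi} \<Longrightarrow> h (spherical_coords (\<theta>, \<phi>)) = g \<theta>"
    and g: "continuous_on {0..pi} g" and \<epsilon>: "\<epsilon> > 0" "\<epsilon> \<le> \<delta> / 5" and J: "finite J"
    and ring: "\<And>j. j \<in> J \<Longrightarrow> real (Suc j) * \<epsilon> \<le> pi"
      "\<And>j \<theta>. j \<in> J \<Longrightarrow> real j * \<epsilon> \<le> \<theta> \<Longrightarrow> \<theta> \<le> real (Suc j) * \<epsilon> \<Longrightarrow> \<delta> \<le> sin \<theta>"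
      "\<And>j. j \<in> J \<Longrightarrow> s j \<in> {real j * \<epsilon>..real (Suc j) * \<epsilon>}" "\<And>j. j \<in> J \<Longrightarrow> s' j \<in> {real j * \<epsilon>..real (Suc j) * \<epsilon>}"
  shows "\<delta> * (\<Sum>j\<in>J. \<bar>g (s j) - g (s' j)\<bar>) \<le> 54 * \<epsilon>\<^sup>2 * real (box_number (graph_S2 h) \<epsilon>)"
proof -
  obtain K where K: "finite K" "card K = box_number (graph_S2 h) \<epsilon>" "graph_S2 h \<subseteq> (\<Union>c\<in>K. cbox c (c + \<epsilon> *\<^sub>R One))"
    by (rule box_number_attained[OF bounded_graph_S2[OF hc] \<epsilon>(1)])
  have \<delta>: "\<delta> > 0" using \<epsilon> by simp
  define S where "S = (\<Sum>j\<in>J. \<bar>g (s j) - g (s' j)\<bar>)"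
  have S: "S \<ge> 0" by (simp add: S_def sum_nonneg)
  define w where "w = \<delta> / (6 * \<epsilon>)"
  have w: "w \<ge> 5 / 6" using \<epsilon> by (simp add: w_def field_simps)
  define y where "y = pi * \<delta> / (8 * \<epsilon>)"
  have "9 / 4 * w = 3 * \<delta> / (8 * \<epsilon>)" by (simp add: w_def)
  also have "\<dots> \<le> y" unfolding y_def using \<epsilon> \<delta> pi_gt3 by (intro divide_right_mono mult_right_mono) auto
  finally have wy: "9 / 4 * w \<le> y" .
  define m where "m = nat \<lfloor>y\<rfloor>"
  have y: "y \<ge> 0" using w wy by linarith
  have m: "real m \<le> y" "y - 1 \<le> real m" unfolding m_def using y by linarith+
  have "real m * (4 * \<epsilon> / \<delta>) \<le> y * (4 * \<epsilon> / \<delta>)" using m \<epsilon> \<delta> by (intro mult_right_mono) auto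
  also have "\<dots> = pi / 2" using \<epsilon> \<delta> by (simp add: y_def)
  finally have m': "real m * (4 * \<epsilon> / \<delta>) \<le> pi / 2" .
  have "w * S \<le> real m * S" using S w wy m by (intro mult_right_mono) linarith+
  also have "\<dots> \<le> 9 * \<epsilon> * real (card K)"
    unfolding S_def by (rule meridian_count[OF K(1,3) h g \<epsilon>(1) \<delta> J ring m'])
  finally have "6 * \<epsilon> * (w * S) \<le> 6 * \<epsilon> * (9 * \<epsilon> * real (card K))" using \<epsilon> by (intro mult_left_mono) auto
  moreover have "6 * \<epsilon> * (w * S) = \<delta> * S" using \<epsilon> by (simp add: w_def)
  ultimately show ?thesis unfolding S_def K(2) by (simp add: power2_eq_square)
qed

section \<open>Oscillation against dyadic blocks\<close>

lemma integral_times_derivative_le: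
  fixes G H H' :: "real \<Rightarrow> complex"
  assumes G: "continuous_on UNIV G" and H': "continuous_on UNIV H'"
    and H: "\<And>x. (H has_vector_derivative H' x) (at x)" and \<Delta>: "\<Delta> \<ge> 0"
    and osc: "\<And>j x. j < n \<Longrightarrow> real j * \<Delta> \<le> x \<Longrightarrow> x \<le> real (Suc j) * \<Delta> \<Longrightarrow> norm (G x - G (real j * \<Delta>)) \<le> \<omega> j"
    and B: "\<And>j x. j < n \<Longrightarrow> real j * \<Delta> \<le> x \<Longrightarrow> x \<le> real (Suc j) * \<Delta> \<Longrightarrow> norm (H' x) \<le> B j"
  shows "norm (integral {0..real n * \<Delta>} (\<lambda>x. G x * H' x) - (G (real n * \<Delta>) * H (real n * \<Delta>) - G 0 * H 0))
    \<le> (\<Sum>j<n. \<omega> j * (norm (H (real (Suc j) * \<Delta>)) + \<Delta> * B j))"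
  using osc B
proof (induction n)
  case 0
  then show ?case by simp
next
  case (Suc n)
  define u v where "u = real n * \<Delta>" and "v = real (Suc n) * \<Delta>"
  have uv: "0 \<le> u" "u \<le> v" "v - u = \<Delta>" using \<Delta> by (auto simp: u_def v_def distrib_right)
  have c: "continuous_on S G" "continuous_on S H'" for S
    using G H' continuous_on_subset by blast+
  have ftc: "(H' has_integral (H v - H u)) {u..v}"
    using uv H by (intro fundamental_theorem_of_calculus) (auto intro: has_vector_derivative_at_within)
  have osc: "norm (G x - G u) \<le> \<omega> n" and B: "norm (H' x) \<le> B n" if "x \<in> {u..v}" for x
    using that Suc.prems(1,2)[of n x] by (auto simp: u_def v_def)
  have \<omega>0: "\<omega> n \<ge> 0" using osc[of u] uv by simp
  have B0: "B n \<ge> 0" using B[of u] norm_ge_zero[of "H' u"] uv by (meson atLeastAtMost_iff order_refl order_trans)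
  define R where "R = integral {u..v} (\<lambda>x. (G x - G u) * H' x)"
  have R: "norm R \<le> (\<omega> n * B n) * (v - u)"
    unfolding R_def
  proof (rule integral_bound[OF uv(2)])
    show "norm ((G x - G u) * H' x) \<le> \<omega> n * B n" if "x \<in> {u..v}" for x
      unfolding norm_mult using osc[OF that] B[OF that] \<omega>0 by (intro mult_mono) auto
  qed (intro continuous_intros c)
  have "((\<lambda>x. (G x - G u) * H' x + G u * H' x) has_integral (R + G u * (H v - H u))) {u..v}"
    unfolding R_def
    by (intro has_integral_add has_integral_mult_right ftc integrable_integral
        integrable_continuous_interval continuous_intros c)
  then have piece: "integral {u..v} (\<lambda>x. G x * H' x) = R + G u * (H v - H u)"
    by (intro integral_unique) (simp add: algebra_simps)
  have "integral {0..v} (\<lambda>x. G x * H' x) = integral {0..u} (\<lambda>x. G x * H' x) + integral {u..v} (\<lambda>x. G x * H' x)"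
    by (intro Henstock_Kurzweil_Integration.integral_combine[symmetric] uv integrable_continuous_interval continuous_intros c)
  then have "integral {0..v} (\<lambda>x. G x * H' x) - (G v * H v - G 0 * H 0)
    = (integral {0..u} (\<lambda>x. G x * H' x) - (G u * H u - G 0 * H 0)) + R - (G v - G u) * H v"
    unfolding piece by (simp add: algebra_simps)
  also have "norm \<dots> \<le> norm (integral {0..u} (\<lambda>x. G x * H' x) - (G u * H u - G 0 * H 0)) + norm R + norm ((G v - G u) * H v)"
    by (rule order_trans[OF norm_triangle_ineq4 add_right_mono[OF norm_triangle_ineq]])
  also have "\<dots> \<le> (\<Sum>j<n. \<omega> j * (norm (H (real (Suc j) * \<Delta>)) + \<Delta> * B j)) + \<omega> n * B n * \<Delta> + \<omega> n * norm (H v)"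
  proof (intro add_mono)
    show "norm (integral {0..u} (\<lambda>x. G x * H' x) - (G u * H u - G 0 * H 0))
        \<le> (\<Sum>j<n. \<omega> j * (norm (H (real (Suc j) * \<Delta>)) + \<Delta> * B j))"
      unfolding u_def by (rule Suc.IH) (use Suc.prems in auto)
    show "norm R \<le> \<omega> n * B n * \<Delta>" using R uv by simp
    show "norm ((G v - G u) * H v) \<le> \<omega> n * norm (H v)"
      unfolding norm_mult using osc[of v] uv by (intro mult_right_mono) auto
  qed
  also have "\<dots> = (\<Sum>j<Suc n. \<omega> j * (norm (H (real (Suc j) * \<Delta>)) + \<Delta> * B j))"
    by (simp add: v_def algebra_simps)
  finally show ?case unfolding v_def .
qed

lemma sin_between:
  assumes "0 \<le> u" "u \<le> x" "x \<le> v" "v \<le> pi"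
  shows "min (sin u) (sin v) \<le> sin x" "sin x \<le> min (sin u) (sin v) + (v - u)"
proof -
  show "min (sin u) (sin v) \<le> sin x"
  proof (cases "x \<le> pi / 2")
    case True
    then have "sin u \<le> sin x" using assms by (intro sin_monotone_2pi_le) auto
    then show ?thesis by simp
  next
    case False
    then have "sin (pi - v) \<le> sin (pi - x)" using assms by (intro sin_monotone_2pi_le) auto
    then show ?thesis by simp
  qed
  have "\<bar>sin x - sin y\<bar> \<le> \<bar>x - y\<bar>" for y
    using spherical_coords_nth_diff[of x 0 1 y 0] by simp
  from this[of u] this[of v] show "sin x \<le> min (sin u) (sin v) + (v - u)" using assms by (auto simp: min_def abs_le_iff)
qed

context zonal_time
begin

text \<open>
  By Legendre's equation, \<open>sin \<theta>\<close> times a dyadic block is the derivative of a function that is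
  smaller by a factor \<open>2 ^ i\<close>.
\<close>

definition H :: "nat \<Rightarrow> real \<Rightarrow> complex" where
  "H i \<theta> = - (of_real (sin \<theta>) *
     cnj (leg_block_deriv t (\<lambda>n. b n * of_real (1 / (real n * (real n + 1)))) (2 ^ i) \<theta>))"

definition H' :: "nat \<Rightarrow> real \<Rightarrow> complex" where "H' i \<theta> = of_real (sin \<theta>) * cnj (T i \<theta>)"

text \<open>Legendre's equation in the angle: the derivative of
  \<open>(sin \<theta>)\<^sup>2 * dleg n (cos \<theta>)\<close> is
  \<open>n * (n + 1) * sin \<theta> * leg n (cos \<theta>)\<close>. The eigenvalue cancels the
  divisor in \<open>H\<close>; degree 0 does not occur in a block.\<close>

lemma H_deriv: "(H i has_vector_derivative H' i \<theta>) (at \<theta>)"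
proof -
  let ?w = "\<lambda>n. cnj (b n * of_real (1 / (real n * (real n + 1))) * schr_phase t n)"
  have HS: "H i = (\<lambda>\<theta>. \<Sum>n\<in>{2^i..<2*2^i}. ?w n * of_real (sin \<theta> * (sin \<theta> * dleg n (cos \<theta>))))"
    unfolding H_def leg_block_deriv_def
    by (rule ext) (simp add: sum_distrib_left sum_negf[symmetric] mult_ac)
  have D: "((\<lambda>\<theta>. sin \<theta> * (sin \<theta> * dleg n (cos \<theta>))) has_real_derivative sin \<theta> * (real n * (real n + 1) * leg n (cos \<theta>))) (at \<theta>)" for n
  proof -
    have "((\<lambda>\<theta>. sin \<theta> * (sin \<theta> * dleg n (cos \<theta>))) has_real_derivative
       cos \<theta> * (sin \<theta> * dleg n (cos \<theta>)) +
       sin \<theta> * (cos \<theta> * dleg n (cos \<theta>) + sin \<theta> * (poly (pderiv (pderiv (legendre_poly n))) (cos \<theta>) * - sin \<theta>))) (at \<theta>)"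
      by (rule derivative_eq_intros DERIV_chain2[OF poly_DERIV] refl)+ (simp add: algebra_simps)
    moreover have "cos \<theta> * (sin \<theta> * dleg n (cos \<theta>)) +
       sin \<theta> * (cos \<theta> * dleg n (cos \<theta>) + sin \<theta> * (poly (pderiv (pderiv (legendre_poly n))) (cos \<theta>) * - sin \<theta>))
       = - (sin \<theta> * ((1 - (cos \<theta>)\<^sup>2) * poly (pderiv (pderiv (legendre_poly n))) (cos \<theta>) - 2 * cos \<theta> * dleg n (cos \<theta>)))"
      unfolding sin_squared_eq[symmetric] by (simp add: power2_eq_square algebra_simps)
    ultimately show ?thesis by (simp add: legendre_ode)
  qed
  have "(H i has_vector_derivative (\<Sum>n\<in>{2^i..<2*2^i}. ?w n * of_real (sin \<theta> * (real n * (real n + 1) * leg n (cos \<theta>))))) (at \<theta>)"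
    unfolding HS
    by (intro has_vector_derivative_sum has_vector_derivative_mult_right has_vector_derivative_of_real)
      (use D in \<open>simp add: has_real_derivative_iff_has_vector_derivative\<close>)
  moreover have "(\<Sum>n\<in>{2^i..<2*2^i}. ?w n * of_real (sin \<theta> * (real n * (real n + 1) * leg n (cos \<theta>)))) = H' i \<theta>"
    unfolding H'_def T_def leg_block_def cnj_sum sum_distrib_left
  proof (intro sum.cong refl)
    fix n :: nat assume "n \<in> {2^i..<2*2^i}"
    then have "n \<noteq> 0" by (metis atLeastLessThan_iff le_zero_eq power_not_zero zero_neq_numeral)
    then have "complex_of_real (1 / (real n * (real n + 1))) * of_real (real n * (real n + 1)) = 1"
      unfolding of_real_mult[symmetric] by simp
    moreover have "?w n * of_real (sin \<theta> * (real n * (real n + 1) * leg n (cos \<theta>)))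
       = complex_of_real (1 / (real n * (real n + 1))) * of_real (real n * (real n + 1)) *
         (of_real (sin \<theta>) * cnj (b n * schr_phase t n * of_real (leg n (cos \<theta>))))"
      by (simp only: complex_cnj_mult complex_cnj_complex_of_real of_real_mult mult_ac)
    ultimately show "?w n * of_real (sin \<theta> * (real n * (real n + 1) * leg n (cos \<theta>)))
       = of_real (sin \<theta>) * cnj (b n * schr_phase t n * of_real (leg n (cos \<theta>)))"
      by (simp only: mult_1)
  qed
  ultimately show ?thesis by simp
qed

lemma continuous_on_H': "continuous_on S (H' i)"
  unfolding H'_def[abs_def] by (intro continuous_intros continuous_on_T)

text \<open>Parseval on one block: by \<open>G_coeff\<close> each coefficient of \<open>G\<close>
  meets its own conjugate.\<close>

lemma integral_G_H': "integral {0..pi} (\<lambda>\<theta>. G \<theta> * H' i \<theta>) = of_real (\<Sum>n\<in>{2^i..<2*2^i}. energy n)"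
proof -
  let ?w = "\<lambda>n. cnj (b n * schr_phase t n)"
  have "(\<lambda>\<theta>. G \<theta> * H' i \<theta>) = (\<lambda>\<theta>. \<Sum>n\<in>{2^i..<2*2^i}. ?w n * (G \<theta> * of_real (sin \<theta> * leg n (cos \<theta>))))"
    unfolding H'_def T_def leg_block_def cnj_sum sum_distrib_left
    by (intro ext sum.cong refl) (simp add: mult_ac)
  then have "integral {0..pi} (\<lambda>\<theta>. G \<theta> * H' i \<theta>) =
     (\<Sum>n\<in>{2^i..<2*2^i}. integral {0..pi} (\<lambda>\<theta>. ?w n * (G \<theta> * of_real (sin \<theta> * leg n (cos \<theta>)))))"
    by (simp only:) (intro Henstock_Kurzweil_Integration.integral_sum finite_atLeastLessThan
        integrable_continuous_interval continuous_intros continuous_on_G)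
  also have "\<dots> = (\<Sum>n\<in>{2^i..<2*2^i}. of_real (energy n))"
  proof (intro sum.cong refl)
    fix n
    have "integral {0..pi} (\<lambda>\<theta>. ?w n * (G \<theta> * of_real (sin \<theta> * leg n (cos \<theta>))))
        = ?w n * (b n * schr_phase t n * of_real (leg_inner n n))"
      unfolding G_coeff[symmetric] by (rule Henstock_Kurzweil_Integration.integral_mult_right)
    also have "\<dots> = ((b n * schr_phase t n) * ?w n) * of_real (leg_inner n n)"
      by (simp only: mult_ac)
    also have "(b n * schr_phase t n) * ?w n = of_real ((norm (b n * schr_phase t n))\<^sup>2)"
      by (simp only: complex_norm_square)
    finally show "integral {0..pi} (\<lambda>\<theta>. ?w n * (G \<theta> * of_real (sin \<theta> * leg n (cos \<theta>)))) = of_real (energy n)"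
      by (simp add: energy_def norm_mult)
  qed
  finally show ?thesis by simp
qed

text \<open>The factor \<open>sin \<theta>\<close> in both functions absorbs the weight
  \<open>1 / sqrt (sin \<theta>)\<close> of the block bounds and leaves
  \<open>sqrt (sin \<theta>)\<close>. At the poles, where those bounds are not stated, both
  functions vanish.\<close>

lemma H_bounds:
  assumes e: "e > 0"
  obtains D where "D \<ge> 0"
    "\<And>i \<theta>. \<theta> \<in> {0..pi} \<Longrightarrow> norm (H i \<theta>) \<le> D * (2 ^ i) powr (- 1/2 - p + e) * sqrt (sin \<theta>)"
    "\<And>i \<theta>. \<theta> \<in> {0..pi} \<Longrightarrow> norm (H' i \<theta>) \<le> D * (2 ^ i) powr (1/2 - p + e) * sqrt (sin \<theta>)"
proof -
  obtain K where K: "weyl_bounded t e K" using weyl[OF e] by blast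
  obtain D where D: "D \<ge> 0"
    "\<And>i \<theta>. 0 < \<theta> \<Longrightarrow> \<theta> < pi \<Longrightarrow> norm (T i \<theta>) * sqrt (sin \<theta>) \<le> D * (2 ^ i) powr (1/2 - p + e)"
    using T_bounds[OF e] by metis
  define D1 where "D1 = 38 * 24 * C * K"
  have D1: "D1 \<ge> 0" using C_nonneg weyl_bounded_ge_1[OF K] by (simp add: D1_def)
  have sq: "sin \<theta> * x = x * sqrt (sin \<theta>) * sqrt (sin \<theta>)" if "\<theta> \<in> {0..pi}" for x \<theta>
    using sin_ge_zero[of \<theta>] that by simp
  have up: "sin \<theta> * x \<le> (D1 + D) * y * sqrt (sin \<theta>)"
    if "\<theta> \<in> {0..pi}" "0 < \<theta> \<Longrightarrow> \<theta> < pi \<Longrightarrow> x * sqrt (sin \<theta>) \<le> D' * y" "D' \<le> D1 + D" "0 \<le> y" for \<theta> x y D'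
  proof (cases "\<theta> = 0 \<or> \<theta> = pi")
    case True
    then show ?thesis by auto
  next
    case False
    then have "x * sqrt (sin \<theta>) \<le> D' * y" using that(1,2) by auto
    also have "\<dots> \<le> (D1 + D) * y" using that(3,4) by (rule mult_right_mono)
    finally show ?thesis unfolding sq[OF that(1)] using sin_ge_zero[of \<theta>] that(1) by (intro mult_right_mono) auto
  qed
  show thesis
  proof (rule that[of "D1 + D"])
    show "D1 + D \<ge> 0" using D1 D by simp
    fix i and \<theta> :: real assume \<theta>: "\<theta> \<in> {0..pi}"
    have sn: "norm (of_real (sin \<theta>) * z) = sin \<theta> * norm z" for z :: complex
      using sin_ge_zero[of \<theta>] \<theta> by (simp add: norm_mult)
    show "norm (H' i \<theta>) \<le> (D1 + D) * (2 ^ i) powr (1/2 - p + e) * sqrt (sin \<theta>)"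
      unfolding H'_def sn complex_mod_cnj using \<theta> D D1 by (intro up[where D' = D]) auto
    let ?V = "leg_block_deriv t (\<lambda>n. b n * of_real (1 / (real n * (real n + 1)))) (2 ^ i)"
    have "norm (?V \<theta>) * sqrt (sin \<theta>) \<le> D1 * (2 ^ i) powr (- 1/2 - p + e)" if "0 < \<theta>" "\<theta> < pi"
    proof -
      have "norm (?V \<theta>) * sqrt (sin \<theta>) \<le> 38 * (24 * C * real (2 ^ i) powr (- 3/2 - p)) * K * real (2 ^ i) powr (1 + e)"
        by (rule norm_leg_block_deriv_sqrt_le[OF slowly_varying_b_over_eigenvalue K e _ that]) simp_all
      also have "\<dots> = D1 * (real (2 ^ i) powr (- 3/2 - p) * real (2 ^ i) powr (1 + e))" by (simp add: D1_def)
      also have "real (2 ^ i) powr (- 3/2 - p) * real (2 ^ i) powr (1 + e) = (2 ^ i) powr (- 1/2 - p + e)"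
        by (subst powr_add[symmetric]) (simp add: algebra_simps)
      finally show ?thesis .
    qed
    then show "norm (H i \<theta>) \<le> (D1 + D) * (2 ^ i) powr (- 1/2 - p + e) * sqrt (sin \<theta>)"
      unfolding H_def norm_minus_cancel sn complex_mod_cnj using \<theta> D D1 by (intro up[where D' = D1]) auto
  qed
qed

end

lemma eventually_two_power_powr_less:
  assumes "e < e0"
  shows "eventually (\<lambda>k. c * (2 ^ k) powr e < (2 ^ k :: real) powr e0) sequentially"
proof -
  have gt1: "(1::real) < 2 powr (e0 - e)" using assms by simp
  then obtain n where n: "c < (2 powr (e0 - e)) ^ n" using real_arch_pow by blast
  have "c * (2 ^ k) powr e < (2 ^ k :: real) powr e0" if "k \<ge> n" for k
  proof -
    have "(2 powr (e0 - e)) ^ n \<le> (2 powr (e0 - e)) ^ k"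
      using that gt1 by (intro power_increasing) auto
    then have "c < (2 ^ k) powr (e0 - e)" using n by (simp add: two_power_powr)
    then have "c * (2 ^ k) powr e < (2 ^ k) powr (e0 - e) * (2 ^ k) powr e"
      by (intro mult_strict_right_mono) auto
    also have "\<dots> = (2 ^ k) powr e0" by (subst powr_add[symmetric]) simp
    finally show ?thesis .
  qed
  then show ?thesis unfolding eventually_sequentially by blast
qed

section \<open>Rings between the poles\<close>

text \<open>The oscillation on each ring is realised at a point, because
  \<open>meridian_sum_le\<close> compares two values of the function per ring.\<close>

lemma max_oscillation:
  fixes g :: "real \<Rightarrow> real"
  assumes g: "continuous_on UNIV g" and \<Delta>: "\<Delta> \<ge> 0"
  obtains s :: "nat \<Rightarrow> real" where "\<forall>j. s j \<in> {real j * \<Delta>..real (Suc j) * \<Delta>}"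
    "\<forall>j. \<forall>x\<in>{real j * \<Delta>..real (Suc j) * \<Delta>}. \<bar>g x - g (real j * \<Delta>)\<bar> \<le> \<bar>g (s j) - g (real j * \<Delta>)\<bar>"
proof -
  have "\<forall>j::nat. \<exists>s. s \<in> {real j * \<Delta>..real (Suc j) * \<Delta>} \<and>
    (\<forall>x\<in>{real j * \<Delta>..real (Suc j) * \<Delta>}. \<bar>g x - g (real j * \<Delta>)\<bar> \<le> \<bar>g s - g (real j * \<Delta>)\<bar>)"
  proof
    fix j
    have ne: "{real j * \<Delta>..real (Suc j) * \<Delta>} \<noteq> {}" using \<Delta> by (simp add: distrib_right)
    have c: "continuous_on {real j * \<Delta>..real (Suc j) * \<Delta>} (\<lambda>x. \<bar>g x - g (real j * \<Delta>)\<bar>)"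
      by (intro continuous_intros continuous_on_subset[OF g]) auto
    from continuous_attains_sup[OF compact_Icc ne c]
    show "\<exists>s. s \<in> {real j * \<Delta>..real (Suc j) * \<Delta>} \<and>
      (\<forall>x\<in>{real j * \<Delta>..real (Suc j) * \<Delta>}. \<bar>g x - g (real j * \<Delta>)\<bar> \<le> \<bar>g s - g (real j * \<Delta>)\<bar>)" by blast
  qed
  from choice[OF this] obtain s where s: "\<forall>j. s j \<in> {real j * \<Delta>..real (Suc j) * \<Delta>} \<and>
    (\<forall>x\<in>{real j * \<Delta>..real (Suc j) * \<Delta>}. \<bar>g x - g (real j * \<Delta>)\<bar> \<le> \<bar>g (s j) - g (real j * \<Delta>)\<bar>)" ..
  show thesis by (rule that[of s]) (use s in blast)+
qed

text \<open>The sine is unimodal on \<open>{0..pi}\<close>, so the smaller of the two end values is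
  its minimum over the ring. The two polar rings have the value 0.\<close>

definition ring_sin :: "nat \<Rightarrow> nat \<Rightarrow> real" where
  "ring_sin N j = min (sin (real j * (pi / real N))) (sin (real (Suc j) * (pi / real N)))"

lemma ring_in_0_pi:
  assumes "j < N" "real j * (pi / real N) \<le> x" "x \<le> real (Suc j) * (pi / real N)"
  shows "0 \<le> x" "x \<le> pi" "0 \<le> real j * (pi / real N)" "real (Suc j) * (pi / real N) \<le> pi"
proof -
  show 0: "0 \<le> real j * (pi / real N)" by simp
  have "real (Suc j) * (pi / real N) \<le> real N * (pi / real N)"
    using assms(1) by (intro mult_right_mono) auto
  also have "\<dots> = pi" using assms(1) by simp
  finally show 1: "real (Suc j) * (pi / real N) \<le> pi" .
  show "0 \<le> x" "x \<le> pi" using 0 1 assms(2,3) by linarith+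
qed

lemma ring_sin_between:
  assumes "j < N" "real j * (pi / real N) \<le> x" "x \<le> real (Suc j) * (pi / real N)"
  shows "ring_sin N j \<le> sin x" "sin x \<le> ring_sin N j + pi / real N"
proof -
  have "real (Suc j) * (pi / real N) - real j * (pi / real N) = pi / real N"
    unfolding left_diff_distrib[symmetric] by simp
  then show "ring_sin N j \<le> sin x" "sin x \<le> ring_sin N j + pi / real N"
    using sin_between[OF ring_in_0_pi(3)[OF assms] assms(2,3) ring_in_0_pi(4)[OF assms]]
    unfolding ring_sin_def by simp_all
qed

text \<open>Jordan's inequality, measured from the nearer pole; \<open>j\<close> and
  \<open>N - 1 - j\<close> count the rings on either side.\<close>

lemma ring_sin_ge:
  assumes "j < N"
  shows "2 / real N * min (real j) (real (N - 1 - j)) \<le> ring_sin N j"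
proof -
  have sin_ge: "2 / real N * min (real i) (real (N - i)) \<le> sin (real i * (pi / real N))" if i: "i \<le> N" for i
  proof -
    define x where "x = real i * (pi / real N)"
    have N: "real N > 0" using assms by simp
    have x: "2 / pi * x = 2 / real N * real i" by (simp add: x_def)
    have x': "2 / pi * (pi - x) = 2 / real N * real (N - i)"
      using N i by (simp add: x_def of_nat_diff field_simps)
    have "pi * real i \<le> pi * real N" using i by simp
    then have "0 \<le> x" "x \<le> pi" using N by (simp_all add: x_def field_simps)
    then consider "0 \<le> x \<and> x \<le> pi / 2" | "0 \<le> pi - x \<and> pi - x \<le> pi / 2" by linarith
    then show ?thesis
    proof cases
      case 1
      then have "2 / pi * x \<le> sin x" by (intro jordan_sin) auto
      moreover have "2 / real N * min (real i) (real (N - i)) \<le> 2 / real N * real i"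
        by (intro mult_left_mono) auto
      ultimately show ?thesis unfolding x unfolding x_def by linarith
    next
      case 2
      then have "2 / pi * (pi - x) \<le> sin (pi - x)" by (intro jordan_sin) auto
      moreover have "2 / real N * min (real i) (real (N - i)) \<le> 2 / real N * real (N - i)"
        by (intro mult_left_mono) auto
      ultimately show ?thesis unfolding x' unfolding x_def by simp
    qed
  qed
  have "2 / real N * min (real j) (real (N - 1 - j)) \<le> 2 / real N * min (real i) (real (N - i))"
    if "i = j \<or> i = Suc j" for i
    using that assms by (intro mult_left_mono min.mono) auto
  from order_trans[OF this[of j] sin_ge[of j]] order_trans[OF this[of "Suc j"] sin_ge[of "Suc j"]]
  show ?thesis
    using assms unfolding ring_sin_def by (intro min.boundedI) (simp_all only: less_imp_le Suc_leI simp_thms)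
qed

lemma ring_sin_nonneg:
  assumes "j < N"
  shows "0 \<le> ring_sin N j"
  by (rule order_trans[OF _ ring_sin_ge[OF assms]]) simp

lemma card_ring_sin_zero: "card {j. j < N \<and> ring_sin N j = 0} \<le> 2"
proof -
  have "j \<in> {0, N - 1}" if j: "j < N" "ring_sin N j = 0" for j
  proof -
    have "2 / real N * min (real j) (real (N - 1 - j)) \<le> 0" using ring_sin_ge[OF j(1)] j(2) by simp
    then have "min (real j) (real (N - 1 - j)) \<le> 0" using j(1) by (simp add: mult_le_0_iff divide_le_0_iff)
    then show ?thesis using j(1) by (auto simp: min_def split: if_splits)
  qed
  then have "card {j. j < N \<and> ring_sin N j = 0} \<le> card {0, N - 1}" by (intro card_mono) auto
  also have "\<dots> \<le> 2" by (simp add: card_insert_if)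
  finally show ?thesis .
qed

text \<open>Such rings lie in a cap at each pole with at most \<open>N * \<delta> / 2 + 1\<close>
  rings, and \<open>N * \<delta> \<ge> 2\<close> absorbs the extra ring.\<close>

lemma card_ring_sin_less:
  assumes "real N * \<delta> \<ge> 2" "\<delta> \<ge> 0"
  shows "real (card {j. j < N \<and> ring_sin N j < \<delta>}) \<le> 2 * (real N * \<delta>)"
proof -
  define m where "m = nat \<lceil>real N * \<delta> / 2\<rceil>"
  have m: "real m \<le> real N * \<delta> / 2 + 1" using assms unfolding m_def by linarith
  have "j \<in> {..<m} \<union> (\<lambda>i. N - 1 - i) ` {..<m}" if j: "j < N" "ring_sin N j < \<delta>" for j
  proof -
    have "2 / real N * min (real j) (real (N - 1 - j)) < \<delta>" using ring_sin_ge[OF j(1)] j(2) by simp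
    then have "min (real j) (real (N - 1 - j)) < real N * \<delta> / 2" using j(1) by (simp add: field_simps)
    then have "j < m \<or> N - 1 - j < m" unfolding m_def min_def by (auto split: if_splits) linarith+
    moreover have "j = N - 1 - (N - 1 - j)" using j(1) by simp
    ultimately show ?thesis by blast
  qed
  then have "card {j. j < N \<and> ring_sin N j < \<delta>} \<le> card ({..<m} \<union> (\<lambda>i. N - 1 - i) ` {..<m})"
    by (intro card_mono) auto
  also have "\<dots> \<le> card {..<m} + card ((\<lambda>i. N - 1 - i) ` {..<m})" by (rule card_Un_le)
  also have "\<dots> \<le> m + m" using card_image_le[of "{..<m}" "\<lambda>i. N - 1 - i"] by simp
  finally have "real (card {j. j < N \<and> ring_sin N j < \<delta>}) \<le> real m + real m" by linarith
  then show ?thesis using m assms by linarith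
qed

text \<open>This is \<open>meridian_sum_le\<close> at the scale \<open>pi / N\<close>: the square of
  the scale gives \<open>N powr (-2)\<close>, and \<open>864 = 54 * 16\<close> with
  \<open>pi\<^sup>2 \<le> 16\<close>.\<close>

lemma far_oscillation_sum_le:
  fixes g :: "real \<Rightarrow> real"
  assumes hc: "continuous_on S2 h"
    and h: "\<And>\<theta> \<phi>. \<theta> \<in> {0..pi} \<Longrightarrow> h (spherical_coords (\<theta>, \<phi>)) = g \<theta>"
    and g: "continuous_on {0..pi} g" and N: "N \<ge> 1" and \<delta>: "pi / real N \<le> \<delta> / 5"
    and s: "\<And>j. s j \<in> {real j * (pi / real N)..real (Suc j) * (pi / real N)}"
    and box: "real (box_number (graph_S2 h) (pi / real N)) \<le> real N powr d"
  shows "(\<Sum>j\<in>{j. j < N \<and> \<delta> \<le> ring_sin N j}. \<bar>g (s j) - g (real j * (pi / real N))\<bar>) \<le> 864 * (real N powr (d - 2) / \<delta>)"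
    (is "?S \<le> _")
proof -
  have N0: "real N > 0" using N by simp
  have \<epsilon>: "pi / real N > 0" using N0 by simp
  then have \<delta>0: "\<delta> > 0" using \<delta> by linarith
  have "\<delta> * ?S \<le> 54 * (pi / real N)\<^sup>2 * real (box_number (graph_S2 h) (pi / real N))"
  proof (rule meridian_sum_le[OF hc h g \<epsilon> \<delta>])
    show "finite {j. j < N \<and> \<delta> \<le> ring_sin N j}" by simp
    fix j assume j: "j \<in> {j. j < N \<and> \<delta> \<le> ring_sin N j}"
    have "real j * (pi / real N) \<le> real (Suc j) * (pi / real N)" using \<epsilon> by (intro mult_right_mono) auto
    then show "real (Suc j) * (pi / real N) \<le> pi" "real j * (pi / real N) \<in> {real j * (pi / real N)..real (Suc j) * (pi / real N)}"
      using ring_in_0_pi(4)[of j N] j by auto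
    show "s j \<in> {real j * (pi / real N)..real (Suc j) * (pi / real N)}" by (rule s)
    fix \<theta> assume "real j * (pi / real N) \<le> \<theta>" "\<theta> \<le> real (Suc j) * (pi / real N)"
    then show "\<delta> \<le> sin \<theta>" using ring_sin_between(1)[of j N \<theta>] j by auto
  qed
  also have "\<dots> \<le> 54 * (16 / (real N)\<^sup>2) * real N powr d"
  proof (intro mult_mono mult_left_mono)
    have "pi * pi \<le> 4 * 4" using pi_less_4 by (intro mult_mono) auto
    then show "(pi / real N)\<^sup>2 \<le> 16 / (real N)\<^sup>2"
      unfolding power_divide using N0 by (intro divide_right_mono) (auto simp: power2_eq_square)
  qed (use box in auto)
  also have "\<dots> = 864 * real N powr (d - 2)" using N0 by (simp add: powr_diff)
  finally show ?thesis using \<delta>0 by (simp add: field_simps)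
qed

context zonal_time
begin

text \<open>
  The rings away from the poles are controlled by the box numbers, those with
  \<open>0 < ring_sin N j < (2 ^ i) powr (-5 * \<eta>)\<close> by the weighted modulus of continuity, and the two
  polar rings by the supremum of \<open>G\<close>.
\<close>

lemma energy_block_le:
  assumes D: "D \<ge> 0"
    "\<And>i \<theta>. \<theta> \<in> {0..pi} \<Longrightarrow> norm (H i \<theta>) \<le> D * (2 ^ i) powr (- 1/2 - p + \<eta>) * sqrt (sin \<theta>)"
    "\<And>i \<theta>. \<theta> \<in> {0..pi} \<Longrightarrow> norm (H' i \<theta>) \<le> D * (2 ^ i) powr (1/2 - p + \<eta>) * sqrt (sin \<theta>)"
    and M: "M \<ge> 0" "\<And>\<theta> \<theta>' s. s > 0 \<Longrightarrow>
     (\<And>x. min \<theta> \<theta>' \<le> x \<Longrightarrow> x \<le> max \<theta> \<theta>' \<Longrightarrow> 0 < x \<and> x < pi \<and> sin x \<ge> s) \<Longrightarrow>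
     norm (G \<theta> - G \<theta>') \<le> M / sqrt s * \<bar>\<theta> - \<theta>'\<bar> powr (p - 1/2 - \<eta>)"
    and Q: "\<And>\<theta>. \<theta> \<in> {0..pi} \<Longrightarrow> norm (G \<theta>) \<le> Q"
    and \<eta>: "p - 1/2 - \<eta> \<ge> 0" "p - 1/2 - \<eta> \<le> 1"
    and small: "pi / 2 ^ i \<le> (2 ^ i) powr (- 5 * \<eta>) / 5" "\<eta> \<ge> 0"
    and box: "real (box_number (graph_S2 (\<lambda>x. Re (zonal_fun G x))) (pi / 2 ^ i)) \<le> (2 ^ i) powr d"
      "real (box_number (graph_S2 (\<lambda>x. Im (zonal_fun G x))) (pi / 2 ^ i)) \<le> (2 ^ i) powr d"
  shows "(\<Sum>n\<in>{2^i..<2*2^i}. energy n) \<le> 17280 * D * (2 ^ i) powr (d - 5/2 - p + 6 * \<eta>)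
    + 160 * D * M * (2 ^ i) powr (1 - 2 * p - 3 * \<eta>) + 80 * D * Q * (2 ^ i) powr (- 1 - p + \<eta>)"
proof -
  define N :: nat where "N = 2 ^ i"
  have rN: "real N = 2 ^ i" by (simp add: N_def)
  have N1: "N \<ge> 1" and N0: "real N > 0" by (simp_all add: N_def)
  define \<Delta> where "\<Delta> = pi / real N"
  have \<Delta>: "\<Delta> > 0" using N0 by (simp add: \<Delta>_def)
  have \<Delta>_powr: "\<Delta> powr q = pi powr q * real N powr (- q)" for q
    unfolding \<Delta>_def using N0 by (simp add: powr_divide powr_minus_divide)
  have N\<Delta>: "real N * \<Delta> = pi" using N0 by (simp add: \<Delta>_def)
  define \<delta> where "\<delta> = real N powr (- 5 * \<eta>)"
  have \<delta>: "\<Delta> \<le> \<delta> / 5" using small(1) by (simp add: \<Delta>_def \<delta>_def rN)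
  have \<delta>1: "\<delta> \<le> 1" unfolding \<delta>_def using powr_mono[of "- 5 * \<eta>" 0 "real N"] N1 small(2) by simp
  have \<delta>0: "\<delta> > 0" using \<delta> \<Delta> by linarith
  have N\<delta>: "real N * \<delta> \<ge> 2"
  proof -
    have "real N * \<Delta> \<le> real N * (\<delta> / 5)" using \<delta> by (intro mult_left_mono) auto
    then show ?thesis unfolding N\<Delta> using pi_gt3 by simp
  qed
  have cG: "continuous_on UNIV G" by (rule continuous_on_G)
  obtain sR where sR': "\<forall>j. sR j \<in> {real j * \<Delta>..real (Suc j) * \<Delta>}"
    "\<forall>j. \<forall>x\<in>{real j * \<Delta>..real (Suc j) * \<Delta>}. \<bar>Re (G x) - Re (G (real j * \<Delta>))\<bar> \<le> \<bar>Re (G (sR j)) - Re (G (real j * \<Delta>))\<bar>"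
    by (rule max_oscillation[OF continuous_on_Re[OF cG] less_imp_le[OF \<Delta>]])
  have sR: "\<And>j. sR j \<in> {real j * \<Delta>..real (Suc j) * \<Delta>}"
    "\<And>j x. x \<in> {real j * \<Delta>..real (Suc j) * \<Delta>} \<Longrightarrow> \<bar>Re (G x) - Re (G (real j * \<Delta>))\<bar> \<le> \<bar>Re (G (sR j)) - Re (G (real j * \<Delta>))\<bar>"
    using sR' by blast+
  obtain sI where sI': "\<forall>j. sI j \<in> {real j * \<Delta>..real (Suc j) * \<Delta>}"
    "\<forall>j. \<forall>x\<in>{real j * \<Delta>..real (Suc j) * \<Delta>}. \<bar>Im (G x) - Im (G (real j * \<Delta>))\<bar> \<le> \<bar>Im (G (sI j)) - Im (G (real j * \<Delta>))\<bar>"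
    by (rule max_oscillation[OF continuous_on_Im[OF cG] less_imp_le[OF \<Delta>]])
  have sI: "\<And>j. sI j \<in> {real j * \<Delta>..real (Suc j) * \<Delta>}"
    "\<And>j x. x \<in> {real j * \<Delta>..real (Suc j) * \<Delta>} \<Longrightarrow> \<bar>Im (G x) - Im (G (real j * \<Delta>))\<bar> \<le> \<bar>Im (G (sI j)) - Im (G (real j * \<Delta>))\<bar>"
    using sI' by blast+
  \<comment> \<open>The two graphs are covered separately, so the real and imaginary oscillations
    are measured apart and then added.\<close>
  define \<omega>R where "\<omega>R j = \<bar>Re (G (sR j)) - Re (G (real j * \<Delta>))\<bar>" for j
  define \<omega>I where "\<omega>I j = \<bar>Im (G (sI j)) - Im (G (real j * \<Delta>))\<bar>" for j
  define \<omega> where "\<omega> j = \<omega>R j + \<omega>I j" for j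
  have \<omega>0: "\<omega> j \<ge> 0" for j by (simp add: \<omega>_def \<omega>R_def \<omega>I_def)
  have osc: "norm (G x - G (real j * \<Delta>)) \<le> \<omega> j" if "real j * \<Delta> \<le> x" "x \<le> real (Suc j) * \<Delta>" for j x
    using cmod_le[of "G x - G (real j * \<Delta>)"] sR(2)[of x j] sI(2)[of x j] that
    unfolding \<omega>_def \<omega>R_def \<omega>I_def by simp
  have \<omega>_le: "\<omega> j \<le> 2 * r" if "\<And>x. x \<in> {real j * \<Delta>..real (Suc j) * \<Delta>} \<Longrightarrow> norm (G x - G (real j * \<Delta>)) \<le> r" for j r
    using abs_Re_le_cmod[of "G (sR j) - G (real j * \<Delta>)"] abs_Im_le_cmod[of "G (sI j) - G (real j * \<Delta>)"]
      that[OF sR(1)] that[OF sI(1)]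
    unfolding \<omega>_def \<omega>R_def \<omega>I_def by simp
  define \<sigma> where "\<sigma> j = ring_sin N j" for j
  have \<sigma>0: "0 \<le> \<sigma> j" if "j < N" for j using ring_sin_nonneg[OF that] by (simp add: \<sigma>_def)
  \<comment> \<open>\<open>B\<close> exceeds the bound for \<open>H\<close> by one factor
    \<open>N\<close>, and \<open>N * \<Delta> = pi \<le> 4\<close>. So \<open>H\<close> and
    \<open>\<Delta> * B j\<close> are of the same order, with total constant
    \<open>1 + 4\<close>.\<close>
  define A where "A = 5 * D * real N powr (- 1/2 - p + \<eta>)"
  have A: "A \<ge> 0" using D(1) by (simp add: A_def)
  have sub: "x \<in> {0..pi}" and sqrt_le: "sqrt (sin x) \<le> sqrt (\<sigma> j + \<Delta>)"
    if "j < N" "real j * \<Delta> \<le> x" "x \<le> real (Suc j) * \<Delta>" for j x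
    using ring_in_0_pi(1,2)[of j N x] ring_sin_between(2)[of j N x] that unfolding \<Delta>_def \<sigma>_def by simp_all
  define B where "B j = D * real N powr (1/2 - p + \<eta>) * sqrt (\<sigma> j + \<Delta>)" for j
  have B: "norm (H' i x) \<le> B j" if "j < N" "real j * \<Delta> \<le> x" "x \<le> real (Suc j) * \<Delta>" for j x
  proof -
    have "norm (H' i x) \<le> D * real N powr (1/2 - p + \<eta>) * sqrt (sin x)"
      using D(3)[OF sub[OF that]] by (simp add: rN)
    also have "\<dots> \<le> B j" unfolding B_def using D(1) sqrt_le[OF that] by (intro mult_left_mono) auto
    finally show ?thesis .
  qed
  have W: "norm (H i (real (Suc j) * \<Delta>)) + \<Delta> * B j \<le> A * sqrt (\<sigma> j + \<Delta>)" if j: "j < N" for j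
  proof -
    let ?v = "real (Suc j) * \<Delta>"
    have v: "real j * \<Delta> \<le> ?v" "?v \<le> real (Suc j) * \<Delta>" using \<Delta> by (simp_all add: distrib_right)
    have "norm (H i ?v) \<le> D * real N powr (- 1/2 - p + \<eta>) * sqrt (sin ?v)"
      using D(2)[OF sub[OF j v]] by (simp add: rN)
    also have "\<dots> \<le> D * real N powr (- 1/2 - p + \<eta>) * sqrt (\<sigma> j + \<Delta>)"
      using D(1) sqrt_le[OF j v] by (intro mult_left_mono) auto
    finally have 1: "norm (H i ?v) \<le> D * real N powr (- 1/2 - p + \<eta>) * sqrt (\<sigma> j + \<Delta>)" .
    have "real N powr (1/2 - p + \<eta>) = real N powr (- 1/2 - p + \<eta>) * real N"
      using powr_add[of "real N" "- 1/2 - p + \<eta>" 1] N0 by (simp add: algebra_simps)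
    then have "\<Delta> * B j = (real N * \<Delta>) * (D * real N powr (- 1/2 - p + \<eta>) * sqrt (\<sigma> j + \<Delta>))"
      by (simp add: B_def)
    also have "\<dots> \<le> 4 * (D * real N powr (- 1/2 - p + \<eta>) * sqrt (\<sigma> j + \<Delta>))"
      unfolding N\<Delta> using D(1) pi_less_4 \<sigma>0[OF j] \<Delta> by (intro mult_right_mono) auto
    finally show ?thesis using 1 unfolding A_def by linarith
  qed
  define T2 where "T2 = 16 * A * M * real N powr (- (p - 1/2 - \<eta>))"
  define T3 where "T3 = 8 * A * Q * real N powr (- 1/2)"
  have Q0: "Q \<ge> 0" using Q[of 0] norm_ge_zero[of "G 0"] by (simp add: order_trans[OF norm_ge_zero])
  have T: "T2 \<ge> 0" "T3 \<ge> 0" using A M(1) Q0 by (simp_all add: T2_def T3_def)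
  have summand: "\<omega> j * (norm (H i (real (Suc j) * \<Delta>)) + \<Delta> * B j)
      \<le> (if \<delta> \<le> \<sigma> j then 2 * A * \<omega> j else 0) + (if \<sigma> j < \<delta> then T2 else 0) + (if \<sigma> j = 0 then T3 else 0)"
    if j: "j < N" for j
  proof -
    let ?W = "norm (H i (real (Suc j) * \<Delta>)) + \<Delta> * B j"
    have W1: "\<omega> j * ?W \<le> \<omega> j * (A * sqrt (\<sigma> j + \<Delta>))" using W[OF j] \<omega>0 by (intro mult_left_mono) auto
    consider "\<delta> \<le> \<sigma> j" | "0 < \<sigma> j" "\<sigma> j < \<delta>" | "\<sigma> j = 0" using \<sigma>0[OF j] by linarith
    then show ?thesis
    proof cases
      case 1
      have "\<sigma> j \<le> 1" unfolding \<sigma>_def ring_sin_def by (simp add: min_le_iff_disj)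
      then have "\<sigma> j + \<Delta> \<le> 4" using \<delta> \<delta>1 by simp
      then have "sqrt (\<sigma> j + \<Delta>) \<le> 2" by (intro real_le_lsqrt) (use \<sigma>0[OF j] \<Delta> in auto)
      then have "\<omega> j * (A * sqrt (\<sigma> j + \<Delta>)) \<le> \<omega> j * (A * 2)" using \<omega>0 A by (intro mult_left_mono) auto
      then show ?thesis using W1 1 T by (simp add: mult_ac)
    next
      case 2
      \<comment> \<open>A ring with positive \<open>\<sigma> j\<close> does not touch a pole, hence
        \<open>\<sigma> j \<ge> 2 / N\<close> and the width \<Delta> is absorbed into
        \<open>\<sigma> j\<close>. The factors \<open>1 / sqrt (\<sigma> j)\<close> and
        \<open>sqrt (\<sigma> j)\<close> then cancel, and every such ring has the same bound
        \<open>T2\<close>.\<close>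
      have "min (real j) (real (N - 1 - j)) \<ge> 1"
      proof (rule ccontr)
        assume "\<not> ?thesis"
        then have "j = 0 \<or> Suc j = N" using j by (auto simp: min_def split: if_splits)
        then have "ring_sin N j = 0 \<or> ring_sin N j < 0"
        proof
          assume "j = 0"
          then show ?thesis unfolding ring_sin_def by (auto simp: min_def)
        next
          assume "Suc j = N"
          then have "sin (real (Suc j) * (pi / real N)) = 0" using N0 by simp
          then show ?thesis unfolding ring_sin_def min_def by auto
        qed
        then show False using 2 \<sigma>_def by auto
      qed
      then have "2 / real N * 1 \<le> 2 / real N * min (real j) (real (N - 1 - j))" by (intro mult_left_mono) auto
      also have "\<dots> \<le> \<sigma> j" unfolding \<sigma>_def by (rule ring_sin_ge[OF j])
      finally have "2 / real N \<le> \<sigma> j" by simp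
      moreover have "\<Delta> \<le> 4 / real N" unfolding \<Delta>_def using pi_less_4 by (intro divide_right_mono) auto
      then have "\<Delta> \<le> 2 * (2 / real N)" by simp
      ultimately have "\<sigma> j + \<Delta> \<le> 4 * \<sigma> j" using \<sigma>0[OF j] by linarith
      then have sq: "sqrt (\<sigma> j + \<Delta>) \<le> 2 * sqrt (\<sigma> j)"
        using real_sqrt_le_mono[of "\<sigma> j + \<Delta>" "4 * \<sigma> j"] by (simp add: real_sqrt_mult)
      have "norm (G x - G (real j * \<Delta>)) \<le> M / sqrt (\<sigma> j) * (4 * real N powr (- (p - 1/2 - \<eta>)))"
        if x: "x \<in> {real j * \<Delta>..real (Suc j) * \<Delta>}" for x
      proof -
        have "norm (G x - G (real j * \<Delta>)) \<le> M / sqrt (\<sigma> j) * \<bar>x - real j * \<Delta>\<bar> powr (p - 1/2 - \<eta>)"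
        proof (rule M(2)[OF 2(1)])
          fix y assume "min x (real j * \<Delta>) \<le> y" "y \<le> max x (real j * \<Delta>)"
          then have y: "real j * \<Delta> \<le> y" "y \<le> real (Suc j) * \<Delta>" using x by auto
          have "\<sigma> j \<le> sin y" using ring_sin_between(1)[of j N y] j y unfolding \<sigma>_def \<Delta>_def by simp
          moreover have "y \<in> {0..pi}" by (rule sub[OF j y])
          moreover have "y \<noteq> 0" "y \<noteq> pi" using \<open>\<sigma> j \<le> sin y\<close> 2(1) by auto
          ultimately show "0 < y \<and> y < pi \<and> \<sigma> j \<le> sin y" by auto
        qed
        also have "\<dots> \<le> M / sqrt (\<sigma> j) * (4 * real N powr (- (p - 1/2 - \<eta>)))"
        proof (intro mult_left_mono)
          have "\<bar>x - real j * \<Delta>\<bar> \<le> \<Delta>" using x by (auto simp: distrib_right)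
          then have "\<bar>x - real j * \<Delta>\<bar> powr (p - 1/2 - \<eta>) \<le> \<Delta> powr (p - 1/2 - \<eta>)"
            using \<eta>(1) by (intro powr_mono2) auto
          also have "\<dots> = pi powr (p - 1/2 - \<eta>) * real N powr (- (p - 1/2 - \<eta>))"
            by (rule \<Delta>_powr)
          also have "\<dots> \<le> 4 * real N powr (- (p - 1/2 - \<eta>))"
          proof (intro mult_right_mono)
            have "pi powr (p - 1/2 - \<eta>) \<le> pi powr 1" using \<eta>(2) pi_gt3 by (intro powr_mono) auto
            then show "pi powr (p - 1/2 - \<eta>) \<le> 4" using pi_less_4 by simp
          qed simp
          finally show "\<bar>x - real j * \<Delta>\<bar> powr (p - 1/2 - \<eta>) \<le> 4 * real N powr (- (p - 1/2 - \<eta>))" .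
        qed (use M(1) 2(1) in auto)
        finally show ?thesis .
      qed
      then have "\<omega> j \<le> 2 * (M / sqrt (\<sigma> j) * (4 * real N powr (- (p - 1/2 - \<eta>))))" by (rule \<omega>_le)
      then have "\<omega> j * (A * sqrt (\<sigma> j + \<Delta>)) \<le>
          2 * (M / sqrt (\<sigma> j) * (4 * real N powr (- (p - 1/2 - \<eta>)))) * (A * (2 * sqrt (\<sigma> j)))"
        using sq A \<omega>0 2(1) \<Delta> M(1) by (intro mult_mono mult_left_mono mult_nonneg_nonneg) (auto intro: order_trans[OF \<omega>0])
      also have "\<dots> = T2" using 2(1) by (simp add: T2_def)
      finally show ?thesis using W1 2 T by simp
    next
      case 3
      have "norm (G x - G (real j * \<Delta>)) \<le> 2 * Q" if x: "x \<in> {real j * \<Delta>..real (Suc j) * \<Delta>}" for x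
      proof -
        have "norm (G x - G (real j * \<Delta>)) \<le> norm (G x) + norm (G (real j * \<Delta>))" by (rule norm_triangle_ineq4)
        also have "\<dots> \<le> Q + Q" using x sub[OF j, of x] sub[OF j, of "real j * \<Delta>"] by (intro add_mono Q) auto
        finally show ?thesis by simp
      qed
      then have \<omega>j: "\<omega> j \<le> 2 * (2 * Q)" by (rule \<omega>_le)
      have "sqrt \<Delta> \<le> 2 * real N powr (- 1/2)"
      proof -
        have "sqrt \<Delta> \<le> sqrt (4 / real N)" unfolding \<Delta>_def using pi_less_4 by (intro real_sqrt_le_mono divide_right_mono) auto
        also have "\<dots> = 2 * real N powr (- 1/2)"
          using N0 by (simp add: real_sqrt_divide powr_minus_divide powr_half_sqrt)
        finally show ?thesis .
      qed
      then have "\<omega> j * (A * sqrt (\<sigma> j + \<Delta>)) \<le> 2 * (2 * Q) * (A * (2 * real N powr (- 1/2)))"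
        using \<omega>j A \<omega>0 \<Delta> Q0 3 by (intro mult_mono mult_left_mono) auto
      also have "\<dots> = T3" by (simp add: T3_def)
      finally show ?thesis using W1 3 T \<delta>0 by simp
    qed
  qed
  have far: "(\<Sum>j\<in>{j. j < N \<and> \<delta> \<le> ring_sin N j}. \<omega> j) \<le> 1728 * (real N powr (d - 2) / \<delta>)"
  proof -
    have "(\<Sum>j\<in>{j. j < N \<and> \<delta> \<le> ring_sin N j}. \<omega>R j) \<le> 864 * (real N powr (d - 2) / \<delta>)"
      unfolding \<omega>R_def \<Delta>_def
    proof (rule far_oscillation_sum_le[where h = "\<lambda>x. Re (zonal_fun G x)"])
      show "continuous_on S2 (\<lambda>x. Re (zonal_fun G x))"
        by (intro continuous_on_Re continuous_on_zonal_fun continuous_on_G)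
      show "continuous_on {0..pi} (\<lambda>x. Re (G x))" by (intro continuous_on_Re continuous_on_G)
    qed (use N1 \<delta> sR(1) box(1) in \<open>simp_all add: zonal_fun_spherical_coords \<Delta>_def rN\<close>)
    moreover have "(\<Sum>j\<in>{j. j < N \<and> \<delta> \<le> ring_sin N j}. \<omega>I j) \<le> 864 * (real N powr (d - 2) / \<delta>)"
      unfolding \<omega>I_def \<Delta>_def
    proof (rule far_oscillation_sum_le[where h = "\<lambda>x. Im (zonal_fun G x)"])
      show "continuous_on S2 (\<lambda>x. Im (zonal_fun G x))"
        by (intro continuous_on_Im continuous_on_zonal_fun continuous_on_G)
      show "continuous_on {0..pi} (\<lambda>x. Im (G x))" by (intro continuous_on_Im continuous_on_G)
    qed (use N1 \<delta> sI(1) box(2) in \<open>simp_all add: zonal_fun_spherical_coords \<Delta>_def rN\<close>)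
    ultimately show ?thesis unfolding \<omega>_def sum.distrib by linarith
  qed
  have filter: "(\<Sum>j<N. if P j then f j else 0) = (\<Sum>j\<in>{j. j < N \<and> P j}. f j)" for P and f :: "nat \<Rightarrow> real"
    by (subst sum.inter_filter[symmetric]) auto
  have ends: "H i 0 = 0" "H i pi = 0" by (simp_all add: H_def)
  have energy0: "(\<Sum>n\<in>{2^i..<2*2^i}. energy n) \<ge> 0" by (intro sum_nonneg energy_nonneg)
  have "norm (integral {0..real N * \<Delta>} (\<lambda>x. G x * H' i x) - (G (real N * \<Delta>) * H i (real N * \<Delta>) - G 0 * H i 0))
      \<le> (\<Sum>j<N. \<omega> j * (norm (H i (real (Suc j) * \<Delta>)) + \<Delta> * B j))"
  proof (rule integral_times_derivative_le[OF cG continuous_on_H' H_deriv less_imp_le[OF \<Delta>]])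
    fix j x assume "j < N" "real j * \<Delta> \<le> x" "x \<le> real (Suc j) * \<Delta>"
    then show "norm (G x - G (real j * \<Delta>)) \<le> \<omega> j" "norm (H' i x) \<le> B j" using osc B by blast+
  qed
  then have "norm (integral {0..pi} (\<lambda>\<theta>. G \<theta> * H' i \<theta>)) \<le> (\<Sum>j<N. \<omega> j * (norm (H i (real (Suc j) * \<Delta>)) + \<Delta> * B j))"
    unfolding N\<Delta> ends by (simp only: mult_zero_right diff_self diff_zero)
  then have "(\<Sum>n\<in>{2^i..<2*2^i}. energy n) \<le> (\<Sum>j<N. \<omega> j * (norm (H i (real (Suc j) * \<Delta>)) + \<Delta> * B j))"
    unfolding integral_G_H' norm_of_real using energy0 by simp
  also have "\<dots> \<le> (\<Sum>j<N. (if \<delta> \<le> \<sigma> j then 2 * A * \<omega> j else 0) + (if \<sigma> j < \<delta> then T2 else 0) + (if \<sigma> j = 0 then T3 else 0))"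
    by (intro sum_mono summand) simp
  also have "\<dots> = 2 * A * (\<Sum>j\<in>{j. j < N \<and> \<delta> \<le> ring_sin N j}. \<omega> j)
      + real (card {j. j < N \<and> ring_sin N j < \<delta>}) * T2 + real (card {j. j < N \<and> ring_sin N j = 0}) * T3"
    unfolding sum.distrib filter \<sigma>_def by (simp add: sum_distrib_left)
  also have "\<dots> \<le> 2 * A * (1728 * (real N powr (d - 2) / \<delta>)) + 2 * (real N * \<delta>) * T2 + 2 * T3"
    using far A T card_ring_sin_less[OF N\<delta> less_imp_le[OF \<delta>0]] card_ring_sin_zero[of N]
    by (intro add_mono mult_left_mono mult_right_mono) auto
  also have "2 * A * (1728 * (real N powr (d - 2) / \<delta>)) = 17280 * D * (2 ^ i) powr (d - 5/2 - p + 6 * \<eta>)"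
  proof -
    have "real N powr (d - 2) / \<delta> = real N powr (d - 2 + 5 * \<eta>)"
      by (simp add: \<delta>_def powr_minus divide_inverse powr_add)
    moreover have "real N powr (- 1/2 - p + \<eta>) * real N powr (d - 2 + 5 * \<eta>) = real N powr (d - 5/2 - p + 6 * \<eta>)"
      by (subst powr_add[symmetric]) (simp add: algebra_simps)
    ultimately show ?thesis by (simp add: A_def rN)
  qed
  \<comment> \<open>The losses in \<open>H\<close> and in the modulus of continuity cost \<eta>
    each, and the proportion \<delta> of rings in this range gains \<open>5 * \<eta>\<close>; a gain
    of \<open>3 * \<eta>\<close> remains.\<close>
  also have "2 * (real N * \<delta>) * T2 = 160 * D * M * (2 ^ i) powr (1 - 2 * p - 3 * \<eta>)"
  proof -
    have "real N * real N powr (- 5 * \<eta>) * (real N powr (- 1/2 - p + \<eta>) * real N powr (- (p - 1/2 - \<eta>)))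
        = real N powr 1 * real N powr (- 5 * \<eta>) * (real N powr (- 1/2 - p + \<eta>) * real N powr (- (p - 1/2 - \<eta>)))"
      using N0 by simp
    also have "\<dots> = real N powr (1 - 2 * p - 3 * \<eta>)"
      unfolding powr_add[symmetric] by (simp add: algebra_simps)
    finally show ?thesis by (simp add: T2_def A_def \<delta>_def rN mult_ac)
  qed
  also have "2 * T3 = 80 * D * Q * (2 ^ i) powr (- 1 - p + \<eta>)"
  proof -
    have "real N powr (- 1/2 - p + \<eta>) * real N powr (- 1/2) = real N powr (- 1 - p + \<eta>)"
      unfolding powr_add[symmetric] by (simp add: algebra_simps)
    then show ?thesis by (simp add: T3_def A_def rN mult_ac)
  qed
  finally show ?thesis .
qed

end

section \<open>Dimension of the graph\<close>

context zonal_time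
begin

lemma zonal_fun_G_holder:
  assumes \<gamma>: "0 < \<gamma>" "\<gamma> < p - 1"
  obtains M where "M \<ge> 0"
    "\<And>x y. x \<in> S2 \<Longrightarrow> y \<in> S2 \<Longrightarrow> norm (zonal_fun G x - zonal_fun G y) \<le> M * dist x y powr \<gamma>"
proof -
  obtain M where M: "M \<ge> 0" "\<And>\<theta> \<theta>'. norm (G \<theta> - G \<theta>') \<le> M * \<bar>\<theta> - \<theta>'\<bar> powr \<gamma>"
    using G_holder[OF \<gamma>] by metis
  show thesis
  proof (rule that[of "M * 2 powr \<gamma>"])
    show "M * 2 powr \<gamma> \<ge> 0" using M by simp
    fix x y :: "real^3" assume x: "x \<in> S2" and y: "y \<in> S2"
    obtain \<phi> where \<phi>: "x = spherical_coords (arccos (x $ 3), \<phi>)" using spherical_coords_exists[OF x] by blast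
    obtain \<phi>' where \<phi>': "y = spherical_coords (arccos (y $ 3), \<phi>')" using spherical_coords_exists[OF y] by blast
    have "\<bar>arccos (x $ 3) - arccos (y $ 3)\<bar> \<le>
        pi / 2 * dist (spherical_coords (arccos (x $ 3), \<phi>)) (spherical_coords (arccos (y $ 3), \<phi>'))"
      using S2_nth3[OF x] S2_nth3[OF y] by (intro angle_le_chord) (auto intro: arccos_lbound arccos_ubound)
    also have "\<dots> \<le> 2 * dist (spherical_coords (arccos (x $ 3), \<phi>)) (spherical_coords (arccos (y $ 3), \<phi>'))"
      using pi_less_4 by (intro mult_right_mono) auto
    also have "\<dots> = 2 * dist x y" by (simp only: \<phi>[symmetric] \<phi>'[symmetric])
    finally have d: "\<bar>arccos (x $ 3) - arccos (y $ 3)\<bar> \<le> 2 * dist x y" .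
    have "norm (zonal_fun G x - zonal_fun G y) \<le> M * \<bar>arccos (x $ 3) - arccos (y $ 3)\<bar> powr \<gamma>"
      unfolding zonal_fun_def by (rule M(2))
    also have "\<dots> \<le> M * (2 * dist x y) powr \<gamma>"
      using M(1) \<gamma> d by (intro mult_left_mono powr_mono2) auto
    also have "\<dots> = M * 2 powr \<gamma> * dist x y powr \<gamma>" by (simp add: powr_mult)
    finally show "norm (zonal_fun G x - zonal_fun G y) \<le> M * 2 powr \<gamma> * dist x y powr \<gamma>" .
  qed
qed

lemma zonal_fun_G_in_holder_sphere:
  assumes "0 < \<gamma>" "\<gamma> < p - 1"
  shows "zonal_fun G \<in> holder_sphere \<gamma>"
proof (rule zonal_fun_G_holder[OF assms])
  fix M
  assume "\<And>x y. x \<in> S2 \<Longrightarrow> y \<in> S2 \<Longrightarrow> norm (zonal_fun G x - zonal_fun G y) \<le> M * dist x y powr \<gamma>"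
  then have "\<forall>x\<in>S2. \<forall>y\<in>S2. norm (zonal_fun G x - zonal_fun G y) \<le> M * dist x y powr \<gamma>"
    by (intro ballI)
  then show ?thesis unfolding holder_sphere_def mem_Collect_eq by (rule exI)
qed

text \<open>The functional \<open>r\<close> treats the real and the imaginary part at once.\<close>

lemma fractal_dim_zonal_fun_G_le:
  assumes r: "\<And>z. \<bar>r z\<bar> \<le> norm (z :: complex)" "\<And>z w. r (z - w) = r z - r w"
  shows "fractal_dim (graph_S2 (\<lambda>x. r (zonal_fun G x))) \<le> ereal (4 - p)"
proof (rule ereal_le_epsilon2)
  fix \<eta> :: real assume \<eta>: "\<eta> > 0"
  \<comment> \<open>The minimum keeps \<gamma> positive when \<eta> is large.\<close>
  define \<gamma> where "\<gamma> = p - 1 - min \<eta> ((p - 1) / 2)"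
  have \<gamma>: "0 < \<gamma>" "\<gamma> < p - 1" "\<gamma> \<le> 1" "3 - \<gamma> \<le> 4 - p + \<eta>"
    using p1 p2 \<eta> by (auto simp: \<gamma>_def min_def field_simps)
  have "fractal_dim (graph_S2 (\<lambda>x. r (zonal_fun G x))) \<le> ereal (3 - \<gamma>)"
  proof (rule zonal_fun_G_holder[OF \<gamma>(1,2)], rule fractal_dim_le)
    fix M
    assume M: "M \<ge> 0"
      "\<And>x y. x \<in> S2 \<Longrightarrow> y \<in> S2 \<Longrightarrow> norm (zonal_fun G x - zonal_fun G y) \<le> M * dist x y powr \<gamma>"
    have hol: "\<bar>r (zonal_fun G x) - r (zonal_fun G y)\<bar> \<le> M * dist x y powr \<gamma>" if "x \<in> S2" "y \<in> S2" for x y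
      unfolding r(2)[symmetric] by (rule order_trans[OF r(1) M(2)[OF that]])
    show "378 * (4 * M + 1) \<ge> 1" using M(1) by simp
    show "3 - \<gamma> \<ge> 0" using \<gamma> by simp
    show "real (box_number (graph_S2 (\<lambda>x. r (zonal_fun G x))) \<epsilon>) \<le> 378 * (4 * M + 1) * (1 / \<epsilon>) powr (3 - \<gamma>)"
      if "0 < \<epsilon>" "\<epsilon> < 1" for \<epsilon>
      by (rule box_number_graph_holder[OF M(1) hol \<gamma>(1,3) that])
  qed
  also have "\<dots> \<le> ereal (4 - p) + ereal \<eta>" using \<gamma>(4) by simp
  finally show "fractal_dim (graph_S2 (\<lambda>x. r (zonal_fun G x))) \<le> ereal (4 - p) + ereal \<eta>" .
qed

lemma graph_dim_zonal_fun_G_le: "graph_dim (zonal_fun G) \<le> ereal (4 - p)"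
  unfolding graph_dim_def
  by (intro max.boundedI fractal_dim_zonal_fun_G_le abs_Re_le_cmod abs_Im_le_cmod) simp_all

lemma graph_dim_zonal_fun_G_ge_2: "ereal 2 \<le> graph_dim (zonal_fun G)"
proof -
  have "continuous_on S2 (\<lambda>x. Re (zonal_fun G x))"
    by (intro continuous_on_Re continuous_on_zonal_fun continuous_on_G)
  then have "ereal 2 \<le> fractal_dim (graph_S2 (\<lambda>x. Re (zonal_fun G x)))"
    by (intro fractal_dim_ge box_number_graph_S2_ge)
  then show ?thesis unfolding graph_dim_def by (rule max.coboundedI1)
qed

text \<open>The sides \<open>pi / 2 ^ k\<close> tend to 0 through positive values, and their
  reciprocals are below \<open>2 ^ k\<close>, so the factor \<open>pi\<close> costs nothing.\<close>

lemma eventually_box_number_le: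
  assumes "fractal_dim E < ereal d" "d \<ge> 0"
  shows "eventually (\<lambda>k. real (box_number E (pi / 2 ^ k)) \<le> (2 ^ k) powr d) sequentially"
proof -
  have "filterlim (\<lambda>k. pi / 2 ^ k) (at_right 0) sequentially"
  proof (rule tendsto_imp_filterlim_at_right)
    have "(\<lambda>k. pi * (1 / 2) ^ k) \<longlonglongrightarrow> pi * 0"
      by (intro tendsto_mult tendsto_const LIMSEQ_realpow_zero) auto
    then show "(\<lambda>k. pi / 2 ^ k) \<longlonglongrightarrow> 0" by (simp add: power_divide)
  qed auto
  from eventually_compose_filterlim[OF fractal_dim_less_imp_box_number[OF assms(1)] this]
  show ?thesis
  proof eventually_elim
    case (elim k)
    have "(1 / (pi / 2 ^ k)) powr d \<le> (2 ^ k) powr d"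
      using assms(2) pi_gt3 by (intro powr_mono2) (auto simp: field_simps)
    with elim show ?case by simp
  qed
qed

text \<open>If both dimensions were below some \<open>d < 7/2 - p\<close>, each of the three terms
  in \<open>energy_block_le\<close> would eventually fall below a third of
  \<open>N powr (1 - 2 * p - \<eta>)\<close>, contrary to the blocks found by
  \<open>large_dyadic_energy\<close>.\<close>

lemma graph_dim_zonal_fun_G_ge:
  assumes f: "zonal_expansion a f" and nf: "\<And>\<epsilon>. \<epsilon> > 0 \<Longrightarrow> f \<notin> sobolev_sphere (p - 1/2 + \<epsilon>)" and p: "p < 3/2"
  shows "ereal (7/2 - p) \<le> graph_dim (zonal_fun G)"
proof (rule ccontr)
  assume "\<not> ?thesis"
  then have "graph_dim (zonal_fun G) < ereal (7/2 - p)" by simp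
  then obtain d0 where d0: "graph_dim (zonal_fun G) < ereal d0" "ereal d0 < ereal (7/2 - p)"
    using ereal_dense2 by blast
  \<comment> \<open>There is room for this since \<open>7/2 - p > 2\<close> for
    \<open>p < 3/2\<close>; it makes \<open>d\<close> nonnegative, as the comparison of box numbers
    requires.\<close>
  define d where "d = max d0 2"
  have d: "2 \<le> d" "d < 7/2 - p" using d0(2) p by (auto simp: d_def)
  have "ereal d0 \<le> ereal d" by (simp add: d_def)
  then have dim: "fractal_dim (graph_S2 (\<lambda>x. Re (zonal_fun G x))) < ereal d"
    "fractal_dim (graph_S2 (\<lambda>x. Im (zonal_fun G x))) < ereal d"
    using less_le_trans[OF d0(1)] unfolding graph_dim_def by simp_all
  \<comment> \<open>The term of the far rings requires \<open>7 * \<eta> < 7/2 - p - d\<close>. The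
    bound \<open>1/8\<close> serves the polar term, which requires
    \<open>2 * \<eta> < 2 - p\<close>, and the smallness condition, which requires
    \<open>5 * \<eta> < 1\<close>.\<close>
  define \<eta> where "\<eta> = min ((7/2 - p - d) / 8) (1/8)"
  have \<eta>: "\<eta> > 0" "8 * \<eta> \<le> 7/2 - p - d" "\<eta> \<le> 1/8" using d by (auto simp: \<eta>_def min_def field_simps)
  have \<gamma>: "0 \<le> p - 1/2 - \<eta>" "p - 1/2 - \<eta> < p - 1/2" "p - 1/2 - \<eta> \<le> 1" using p1 p \<eta> by auto
  show False
  proof (rule H_bounds[OF \<eta>(1)], rule G_weighted_modulus[OF \<gamma>])
    fix D M :: real
    assume D: "D \<ge> 0"
      "\<And>i \<theta>. \<theta> \<in> {0..pi} \<Longrightarrow> norm (H i \<theta>) \<le> D * (2 ^ i) powr (- 1/2 - p + \<eta>) * sqrt (sin \<theta>)"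
      "\<And>i \<theta>. \<theta> \<in> {0..pi} \<Longrightarrow> norm (H' i \<theta>) \<le> D * (2 ^ i) powr (1/2 - p + \<eta>) * sqrt (sin \<theta>)"
    assume M: "M \<ge> 0" "\<And>\<theta> \<theta>' s. s > 0 \<Longrightarrow>
       (\<And>x. min \<theta> \<theta>' \<le> x \<Longrightarrow> x \<le> max \<theta> \<theta>' \<Longrightarrow> 0 < x \<and> x < pi \<and> sin x \<ge> s) \<Longrightarrow>
       norm (G \<theta> - G \<theta>') \<le> M / sqrt s * \<bar>\<theta> - \<theta>'\<bar> powr (p - 1/2 - \<eta>)"
    have "bounded (G ` {0..pi})"
      by (intro compact_imp_bounded compact_continuous_image continuous_on_G compact_Icc)
    then obtain Q where "\<forall>x\<in>G ` {0..pi}. norm x \<le> Q" unfolding bounded_iff ..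
    then have Q: "\<And>\<theta>. \<theta> \<in> {0..pi} \<Longrightarrow> norm (G \<theta>) \<le> Q" by blast
    define e where "e = 1 - 2 * p - \<eta>"
    have "eventually (\<lambda>k. (3 * (17280 * D)) * (2 ^ k) powr (d - 5/2 - p + 6 * \<eta>) < (2 ^ k :: real) powr e) sequentially"
      "eventually (\<lambda>k. (3 * (160 * D * M)) * (2 ^ k) powr (1 - 2 * p - 3 * \<eta>) < (2 ^ k :: real) powr e) sequentially"
      "eventually (\<lambda>k. (3 * (80 * D * Q)) * (2 ^ k) powr (- 1 - p + \<eta>) < (2 ^ k :: real) powr e) sequentially"
      "eventually (\<lambda>k. (5 * pi) * (2 ^ k) powr (- 1) < (2 ^ k :: real) powr (- 5 * \<eta>)) sequentially"
      unfolding e_def using \<eta> p by (intro eventually_two_power_powr_less; simp)+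
    moreover have "eventually (\<lambda>k. real (box_number (graph_S2 (\<lambda>x. Re (zonal_fun G x))) (pi / 2 ^ k)) \<le> (2 ^ k) powr d) sequentially"
      "eventually (\<lambda>k. real (box_number (graph_S2 (\<lambda>x. Im (zonal_fun G x))) (pi / 2 ^ k)) \<le> (2 ^ k) powr d) sequentially"
      using dim d by (intro eventually_box_number_le; simp)+
    ultimately have "eventually (\<lambda>k. (\<Sum>n\<in>{2^k..<2*2^k}. energy n) < (2 ^ k) powr e) sequentially"
    proof eventually_elim
      case (elim k)
      have small: "pi / 2 ^ k \<le> (2 ^ k) powr (- 5 * \<eta>) / 5"
        using elim(4) by (simp add: powr_minus_divide)
      have "(\<Sum>n\<in>{2^k..<2*2^k}. energy n) \<le> 17280 * D * (2 ^ k) powr (d - 5/2 - p + 6 * \<eta>)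
          + 160 * D * M * (2 ^ k) powr (1 - 2 * p - 3 * \<eta>) + 80 * D * Q * (2 ^ k) powr (- 1 - p + \<eta>)"
        by (rule energy_block_le)
          (fact D(1) D(2) D(3) M(1) M(2) Q \<gamma>(1) \<gamma>(3) small less_imp_le[OF \<eta>(1)] elim(5) elim(6))+
      with elim(1-3) show ?case by linarith
    qed
    then obtain k0 where k0: "\<And>k. k \<ge> k0 \<Longrightarrow> (\<Sum>n\<in>{2^k..<2*2^k}. energy n) < (2 ^ k) powr e"
      unfolding eventually_sequentially by blast
    obtain k where "k \<ge> k0" "(2 ^ k) powr e \<le> (\<Sum>n\<in>{2^k..<2*2^k}. energy n)"
      using large_dyadic_energy[OF f nf \<eta>(1), of k0] unfolding e_def by blast
    with k0[of k] show False by simp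
  qed
qed

end

theorem theorem1p3:
  fixes a :: "nat \<Rightarrow> complex" and p C :: real
    and f :: "real^3 \<Rightarrow> complex" and u :: "real \<Rightarrow> real^3 \<Rightarrow> complex"
  assumes "1 < p" and "p < 2"
    and "\<forall>n\<ge>1. norm (a n) \<le> C / real n powr p"
    and "\<forall>n\<ge>1. norm (a n - a (n - 1)) \<le> C / real n powr (p + 1)"
    and "zonal_expansion a f"
    and "schrodinger_solution f u"
  shows "(AE t in lborel. \<exists>g. continuous_version (u t) g \<and>
            (\<forall>\<gamma>. 0 < \<gamma> \<and> \<gamma> < p - 1 \<longrightarrow> g \<in> holder_sphere \<gamma>) \<and>
            graph_dim g \<le> ereal (4 - p)) \<and>
         ((\<forall>\<epsilon>>0. f \<notin> sobolev_sphere (p - 1/2 + \<epsilon>)) \<longrightarrow>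
            (AE t in lborel. \<exists>g. continuous_version (u t) g \<and>
               graph_dim g \<ge> ereal (max (7/2 - p) 2)))"
proof (intro conjI impI)
  have zonal_time: "zonal_time a p C t" if "\<forall>e>0. \<exists>K. weyl_bounded t e K" for t
    by unfold_locales (use assms that in auto)
  show "AE t in lborel. \<exists>g. continuous_version (u t) g \<and>
      (\<forall>\<gamma>. 0 < \<gamma> \<and> \<gamma> < p - 1 \<longrightarrow> g \<in> holder_sphere \<gamma>) \<and> graph_dim g \<le> ereal (4 - p)"
    using AE_weyl_bounded
  proof eventually_elim
    case (elim t)
    interpret zonal_time a p C t by (rule zonal_time[OF elim])
    show ?case
      using solution_eq_zonal_fun_G[OF assms(5,6)] zonal_fun_G_in_holder_sphere graph_dim_zonal_fun_G_le
      by (intro exI[of _ "zonal_fun G"]) simp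
  qed
  assume nf: "\<forall>\<epsilon>>0. f \<notin> sobolev_sphere (p - 1/2 + \<epsilon>)"
  show "AE t in lborel. \<exists>g. continuous_version (u t) g \<and> graph_dim g \<ge> ereal (max (7/2 - p) 2)"
    using AE_weyl_bounded
  proof eventually_elim
    case (elim t)
    interpret zonal_time a p C t by (rule zonal_time[OF elim])
    have "ereal (max (7/2 - p) 2) \<le> graph_dim (zonal_fun G)"
    \<comment> \<open>For \<open>p \<ge> 3/2\<close> the maximum is 2 and the bound for continuous
      functions is enough.\<close>
    proof (cases "p < 3/2")
      case True
      have "ereal (7/2 - p) \<le> graph_dim (zonal_fun G)"
        by (rule graph_dim_zonal_fun_G_ge[OF assms(5) _ True]) (use nf in blast)
      then show ?thesis using graph_dim_zonal_fun_G_ge_2 by (simp add: max_def)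
    next
      case False
      then show ?thesis using graph_dim_zonal_fun_G_ge_2 by (simp add: max_def)
    qed
    then show ?case using solution_eq_zonal_fun_G[OF assms(5,6)] by blast
  qed
qed

end
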